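(* Suppose the induced MDP is semicontinuous, $\mathbf V=\mathbf X$, and the following hold. Slater condition: there exists $\mu\in\mathcal D$ such that $\int_{\mathbf V\times\mathbf B}\bar C_j(x,b)\mu(dx\times db)<d_j$ for all $j=1,\dots,J$. Cost conditions: there is $\delta>0$ with $C^I_0(x,a)\ge\delta$ for all $x\in\mathbf X$, $a\in\mathbf A$; and $\max_{0\le j\le J}\sup_{x\in\mathbf X}C^g_j(x)+\max_{0\le j\le J}\sup_{(x,a)\in\mathbf X\times\mathbf A}C^I_j(x,a)<\infty$. Let $\bar g^*\in\mathbb R_+^J$ be any maximizer of the dual functional $h$ over $\mathbb R_+^J$, and let $\mathbf F$ be the associated set of deterministic stationary strategies. Then there exists a mixture $\pi^*\in\Pi$ of $J+1$ (not necessarily distinct) deterministic stationary strategies $f^1,\dots,f^{J+1}\in\mathbf F$ with coefficients $\{\gamma_l\}_{l=1}^{J+1}\subseteq(0,1]$, such that $\pi^*$ is optimal in the original impulse control problem $(P)$ and $\mu^{\pi^*}|_{\mathbf V\times\mathbf B}$ solves the primal convex program $(C)$ and the relaxed problem $(R)$.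
   Context: Impulse control model. $\mathbf X$ and $\mathbf A$ are nonempty Borel subsets of complete separable metric spaces; measurability means Borel measurability. $\phi:\mathbf X\times[0,\infty)\to\mathbf X$ is measurable with $\phi(x,0)=x$, $\lim_{t\downarrow0}\phi(\phi(x,s),t)=\phi(x,s)$ and $\phi(x,s+t)=\phi(\phi(x,s),t)$ for all $x\in\mathbf X$, $s,t\ge0$. $l:\mathbf X\times\mathbf A\to\mathbf X$ is measurable; $\alpha\in(0,\infty)$; $J\ge0$ is an integer; for $j=0,\dots,J$, $C^g_j:\mathbf X\to[0,\infty]$ and $C^I_j:\mathbf X\times\mathbf A\to[0,\infty]$ are measurable; $d_1,\dots,d_J\in[0,\infty)$ are constants. Measures are $[0,\infty]$-valued; $\mathbb R_+^J=[0,\infty)^J$. Induced MDP. State space $\mathbf X_\Delta=\mathbf X\cup\{\Delta\}$ with $\Delta\notin\mathbf X$ an isolated point; action space $\mathbf B=[0,\infty]\times\mathbf A$, where $[0,\infty]$ is the one-point compactification of $[0,\infty)$; transition kernel $Q(dy|x,(\theta,a))=e^{-\alpha\theta}\delta_{l(\phi(x,\theta),a)}(dy)+(1-e^{-\alpha\theta})\delta_\Delta(dy)$ if $x\ne\Delta$, $\theta\neq\infty$, and $\delta_\Delta(dy)$ otherwise; costs $\bar C_j(x,(\theta,a))=\int_0^\theta e^{-\alpha t}C^g_j(\phi(x,t))\,dt+e^{-\alpha\theta}C^I_j(\phi(x,\theta),a)$ for $x\in\mathbf X$ (the last term being $0$ if $\theta=\infty$), and $\bar C_j(\Delta,\cdot)=0$.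 Strategies. A strategy $\pi=\{\pi_i\}_{i\ge1}$ is a sequence of stochastic kernels $\pi_i(db|h_{i-1})$ on $\mathbf B$ given histories $h_{i-1}=(x_0,b_1,x_1,\dots,b_{i-1},x_{i-1})$. It is deterministic stationary, identified with a measurable $f:\mathbf X_\Delta\to\mathbf B$, if $\pi_i(db|h_{i-1})=\delta_{f(x_{i-1})}(db)$ for all $i$. $\mathsf P^\pi_x$, $\mathsf E^\pi_x$ denote the probability and expectation on $(\mathbf X_\Delta\times\mathbf B)^\infty$, with coordinates $X_0,B_1,X_1,B_2,\dots$, under which $X_0=x$, $B_i$ has conditional law $\pi_i(\cdot|H_{i-1})$ given the history $H_{i-1}=(X_0,B_1,\dots,X_{i-1})$, and $X_i$ has conditional law $Q(\cdot|X_{i-1},B_i)$ given $(H_{i-1},B_i)$. For a cost $\bar C$, $\mathcal V(x,\pi,\bar C)=\mathsf E^\pi_x[\sum_{i=1}^\infty\bar C(X_{i-1},B_i)]$. Problem $(P)$: for a fixed initial state $x_0$, minimize $\mathcal V(x_0,\pi,\bar C_0)$ over strategies $\pi$ subject to $\mathcal V(x_0,\pi,\bar C_j)\le d_j$, $j=1,\dots,J$. A strategy satisfying the constraints is feasible; it is feasible with a finite value if also $\mathcal V(x_0,\pi,\bar C_0)<\infty$. It is optimal if it is feasible and attains the infimum over feasible strategies. The induced MDP is semicontinuous if $\mathbf B$ is compact, $(x,b)\mapsto\int_{\mathbf X_\Delta}u(y)Q(dy|x,b)$ is continuous for every bounded continuous $u$ on $\mathbf X_\Delta$, and each $\bar C_j$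 is lower semicontinuous on $\mathbf X_\Delta\times\mathbf B$. Let $\mathbf V=\{x\in\mathbf X_\Delta:\inf_\pi\mathcal V(x,\pi,\sum_{j=0}^J\bar C_j)>0\}$ and $\mathbf V^c=\mathbf X_\Delta\setminus\mathbf V$. Standing assumption: $x_0\in\mathbf V$. When the induced MDP is semicontinuous, a deterministic stationary strategy $f^*$ is fixed which attains $\inf_\pi\mathcal V(x,\pi,\sum_j\bar C_j)$ for all $x\in\mathbf X_\Delta$ and attains the infimum in the corresponding Bellman equation; in particular $\bar C_j(x,f^*(x))=Q(\mathbf V|x,f^*(x))=0$ for all $x\in\mathbf V^c$ and all $j$. $\Pi$ is the set of feasible strategies with a finite value such that $\pi_i(db|h_{i-1})=\delta_{f^*(x_{i-1})}(db)$ for all $i\ge1$ whenever $x_{i-1}\in\mathbf V^c$. The occupation measure of $\pi$ is $\mu^\pi(\Gamma)=\mathsf E^\pi_{x_0}[\sum_{i=0}^\infty\mathbb I\{(X_i,B_{i+1})\in\Gamma\}]$, $\Gamma\in\mathcal B(\mathbf X_\Delta\times\mathbf B)$; $\mu|_{\mathbf V\times\mathbf B}$ denotes restriction. Mixture: a strategy $\pi^*$ is a mixture of deterministic stationary strategies $f^1,\dots,f^{J+1}$ with coefficients $\gamma_l\in(0,1]$, $\sum_{l=1}^{J+1}\gamma_l=1$, if $\mu^{\pi^*}|_{\mathbf V\times\mathbf B}=\sum_{l=1}^{J+1}\gamma_l\,\mu^{f^l}|_{\mathbf V\times\mathbf B}$. Relaxed problem $(R)$: minimize $\int_{\mathbf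 V\times\mathbf B}\bar C_0\,d\mu$ over measures $\mu$ on $\mathbf V\times\mathbf B$ with $\sigma$-finite marginal $\mu(dx\times\mathbf B)$ on $\mathbf V$, subject to $\mu(\Gamma\times\mathbf B)=\delta_{x_0}(\Gamma)+\int_{\mathbf V\times\mathbf B}Q(\Gamma|y,b)\mu(dy\times db)$ for all $\Gamma\in\mathcal B(\mathbf V)$, and $\int_{\mathbf V\times\mathbf B}\bar C_j\,d\mu\le d_j$, $j=1,\dots,J$. $\mathcal D$ is the set of measures $\mu$ on $\mathbf V\times\mathbf B$ such that the marginal $\mu(dx\times\mathbf B)$ is $\sigma$-finite on $\mathbf V$; $\mu(\Gamma\times\mathbf B)=\delta_{x_0}(\Gamma)+\int_{\mathbf V\times\mathbf B}Q(\Gamma|y,b)\mu(dy\times db)$ for all $\Gamma\in\mathcal B(\mathbf V)$; and $\int_{\mathbf V\times\mathbf B}\sum_{j=0}^J\bar C_j\,d\mu<\infty$. Primal convex program $(C)$: minimize $\int_{\mathbf V\times\mathbf B}\bar C_0\,d\mu$ over $\mu\in\mathcal D$ subject to $\int_{\mathbf V\times\mathbf B}\bar C_j\,d\mu-d_j\le0$, $j=1,\dots,J$. Dual functional: $h(\bar g)=\inf_{\mu\in\mathcal D}L_1(\mu,\bar g)$, where $L_1(\mu,\bar g)=\int_{\mathbf V\times\mathbf B}\bar C_0\,d\mu+\sum_{j=1}^Jg_j(\int_{\mathbf V\times\mathbf B}\bar C_j\,d\mu-d_j)$, $\bar g\in\mathbb R_+^J$. (A maximizer of $h$ over $\mathbb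 R_+^J$ exists under the hypotheses of the statement.) Bellman function: $W^*_{\bar g}(x)=\inf_\pi\{\mathcal V(x,\pi,\bar C_0)+\sum_{j=1}^Jg_j\mathcal V(x,\pi,\bar C_j)\}$, $x\in\mathbf V$. For a maximizer $\bar g^*$ of $h$, $\mathbf F$ is the set of deterministic stationary strategies $f$ with $f(x)=f^*(x)$ for $x\in\mathbf V^c$ and, for all $x\in\mathbf V$, $$W^*_{\bar g^*}(x)=\inf_{b\in\mathbf B}\Big\{\bar C_0(x,b)+\sum_{j=1}^Jg^*_j\bar C_j(x,b)+\int_{\mathbf V}W^*_{\bar g^*}(y)Q(dy|x,b)\Big\}=\bar C_0(x,f(x))+\sum_{j=1}^Jg^*_j\bar C_j(x,f(x))+\int_{\mathbf V}W^*_{\bar g^*}(y)Q(dy|x,f(x)).$$ *)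

theory Defs
  imports "HOL-Probability.Probability"
begin

section \<open>The one-point extension by an isolated point\<close>

text \<open>The extended state space \<open>X \<union> {\<Delta>}\<close> is modelled inside \<^typ>\<open>'x option\<close>: \<^term>\<open>Some x\<close> is the
  state \<open>x\<close> and \<^term>\<open>None\<close> is \<open>\<Delta>\<close>. The topology is the disjoint sum topology, so that \<^term>\<open>None\<close>
  is isolated.\<close>

instantiation option :: (topological_space) topological_space
begin

definition open_option :: "'a option set \<Rightarrow> bool" where
  "open_option U \<longleftrightarrow> open (Some -` U)"

instance
proof
  show "open (UNIV :: 'a option set)"
    by (simp add: open_option_def)
  show "open (S \<inter> T)" if "open S" "open T" for S T :: "'a option set"
    using that by (simp add: open_option_def open_Int)
  show "open (\<Union> K)" if "\<forall>S\<in>K. open S" for K :: "'a option set set"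
    using that by (auto simp: open_option_def vimage_Union)
qed

end

lemma open_None: "open {None :: 'a :: topological_space option}"
  by (simp add: open_option_def vimage_def)

lemma open_Some_image_iff: "open (Some ` U) \<longleftrightarrow> open U"
  by (simp add: open_option_def inj_vimage_image_eq)

instance option :: (second_countable_topology) second_countable_topology
proof
  obtain B :: "'a set set" where B: "countable B" "topological_basis B"
    using ex_countable_basis by blast
  define C where "C = insert {None} ((`) Some ` B)"
  have "countable C"
    using B(1) by (simp add: C_def)
  moreover have "topological_basis C"
  proof (rule topological_basisI)
    show "open U" if "U \<in> C" for U
      using that topological_basis_open[OF B(2)]
      by (auto simp: C_def open_None open_Some_image_iff)
    fix U :: "'a option set" and z
    assume U: "open U" "z \<in> U"
    show "\<exists>U'\<in>C. z \<in> U' \<and> U' \<subseteq> U"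
    proof (cases z)
      case None
      then show ?thesis using U by (auto simp: C_def)
    next
      case (Some x)
      then obtain V where "V \<in> B" "x \<in> V" "V \<subseteq> Some -` U"
        using topological_basisE[OF B(2), of "Some -` U" x] U
        by (auto simp: open_option_def)
      then show ?thesis
        using Some by (intro bexI[of _ "Some ` V"]) (auto simp: C_def)
    qed
  qed
  ultimately show "\<exists>C :: 'a option set set. countable C \<and> open = generate_topology C"
    using topological_basis_imp_subbasis by blast
qed

section \<open>The impulse control model\<close>

text \<open>Time lives in \<open>[0,\<infinity>)\<close>; values of \<open>flow\<close> at negative times and all values outside \<open>states\<close>
  and \<open>acts\<close> are irrelevant. Costs are indexed by \<open>0..ncons\<close>, constraint constants by \<open>1..ncons\<close>.\<close>

record ('x, 'a) impulse_model =
  states :: "'x set"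
  acts :: "'a set"
  flow :: "'x \<Rightarrow> real \<Rightarrow> 'x"
  jump :: "'x \<Rightarrow> 'a \<Rightarrow> 'x"
  disc :: real
  ncons :: nat
  gcost :: "nat \<Rightarrow> 'x \<Rightarrow> ennreal"
  icost :: "nat \<Rightarrow> 'x \<Rightarrow> 'a \<Rightarrow> ennreal"
  bound :: "nat \<Rightarrow> real"

definition impulse_control_model :: "('x :: polish_space, 'a :: polish_space) impulse_model \<Rightarrow> bool" where
  "impulse_control_model m \<longleftrightarrow>
     states m \<in> sets borel \<and> states m \<noteq> {} \<and> acts m \<in> sets borel \<and> acts m \<noteq> {} \<and>
     (\<lambda>(x, t). flow m x t) \<in>
       restrict_space borel (states m) \<Otimes>\<^sub>M restrict_space borel {0..} \<rightarrow>\<^sub>M restrict_space borel (states m) \<and>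
     (\<forall>x\<in>states m. flow m x 0 = x) \<and>
     (\<forall>x\<in>states m. \<forall>s\<ge>0. ((\<lambda>t. flow m (flow m x s) t) \<longlongrightarrow> flow m x s) (at_right 0)) \<and>
     (\<forall>x\<in>states m. \<forall>s\<ge>0. \<forall>t\<ge>0. flow m x (s + t) = flow m (flow m x s) t) \<and>
     (\<lambda>(x, a). jump m x a) \<in>
       restrict_space borel (states m) \<Otimes>\<^sub>M restrict_space borel (acts m) \<rightarrow>\<^sub>M restrict_space borel (states m) \<and>
     0 < disc m \<and>
     (\<forall>j\<le>ncons m. gcost m j \<in> borel_measurable (restrict_space borel (states m))) \<and>
     (\<forall>j\<le>ncons m. (\<lambda>(x, a). icost m j x a) \<in>
       borel_measurable (restrict_space borel (states m) \<Otimes>\<^sub>M restrict_space borel (acts m))) \<and>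
     (\<forall>j\<in>{1..ncons m}. 0 \<le> bound m j)"

section \<open>The induced Markov decision process\<close>

definition XD :: "('x, 'a) impulse_model \<Rightarrow> 'x option set" where
  "XD m = insert None (Some ` states m)"

text \<open>The order topology of \<^typ>\<open>ennreal\<close> is the one-point compactification of \<open>[0,\<infinity>)\<close>.\<close>

definition BA :: "('x, 'a) impulse_model \<Rightarrow> (ennreal \<times> 'a) set" where
  "BA m = UNIV \<times> acts m"

definition SM :: "('x :: polish_space, 'a :: polish_space) impulse_model \<Rightarrow> 'x option measure" where
  "SM m = restrict_space borel (XD m)"

definition BM :: "('x :: polish_space, 'a :: polish_space) impulse_model \<Rightarrow> (ennreal \<times> 'a) measure" where
  "BM m = restrict_space borel (BA m)"

definition SBM :: "('x :: polish_space, 'a :: polish_space) impulse_model \<Rightarrow>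
    ('x option \<times> (ennreal \<times> 'a)) measure" where
  "SBM m = SM m \<Otimes>\<^sub>M BM m"

lemma space_SM [simp]: "space (SM m) = XD m"
  by (simp add: SM_def space_restrict_space)

lemma space_BM [simp]: "space (BM m) = BA m"
  by (simp add: BM_def space_restrict_space)

lemma space_SBM [simp]: "space (SBM m) = XD m \<times> BA m"
  by (simp add: SBM_def space_pair_measure)

lemma sets_SBM_eq_borel: "sets (SBM m) = sets (restrict_space borel (XD m \<times> BA m))"
proof
  let ?R = "restrict_space (borel \<Otimes>\<^sub>M borel) (XD m \<times> BA m)"
  have "(\<lambda>z. z) \<in> SBM m \<rightarrow>\<^sub>M ?R"
  proof (rule measurable_restrict_space2)
    have "fst \<in> SBM m \<rightarrow>\<^sub>M borel" "snd \<in> SBM m \<rightarrow>\<^sub>M borel"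
      unfolding SBM_def SM_def BM_def
      by (auto intro!: measurable_compose[OF measurable_fst] measurable_compose[OF measurable_snd]
               measurable_restrict_space1)
    then show "(\<lambda>z. z) \<in> SBM m \<rightarrow>\<^sub>M borel \<Otimes>\<^sub>M borel"
      by (simp add: measurable_pair_iff comp_def)
  qed simp
  note 1 = measurable_sets[OF this]
  show "sets (restrict_space borel (XD m \<times> BA m)) \<subseteq> sets (SBM m)"
  proof
    fix S assume S: "S \<in> sets (restrict_space borel (XD m \<times> BA m))"
    then have "S \<subseteq> XD m \<times> BA m"
      by (auto simp: sets_restrict_space)
    with 1[of S] S show "S \<in> sets (SBM m)"
      by (simp add: borel_prod vimage_ident Int_absorb2)
  qed
  have "fst \<in> ?R \<rightarrow>\<^sub>M SM m" "snd \<in> ?R \<rightarrow>\<^sub>M BM m"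
    unfolding SM_def BM_def
    by (intro measurable_restrict_space2 measurable_restrict_space1;
        auto simp: space_restrict_space)+
  then have "(\<lambda>z. z) \<in> ?R \<rightarrow>\<^sub>M SBM m"
    by (simp add: SBM_def measurable_pair_iff comp_def)
  note 2 = measurable_sets[OF this]
  show "sets (SBM m) \<subseteq> sets (restrict_space borel (XD m \<times> BA m))"
  proof
    fix S assume S: "S \<in> sets (SBM m)"
    then have "S \<subseteq> XD m \<times> BA m"
      using sets.sets_into_space[OF S] by simp
    with 2[OF S] show "S \<in> sets (restrict_space borel (XD m \<times> BA m))"
      by (simp add: borel_prod space_restrict_space vimage_ident Int_absorb2)
  qed
qed

fun Qtr :: "('x :: polish_space, 'a :: polish_space) impulse_model \<Rightarrow>
    'x option \<times> (ennreal \<times> 'a) \<Rightarrow> 'x option measure" where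
  "Qtr m (None, (\<theta>, a)) = return (SM m) None"
| "Qtr m (Some x, (\<theta>, a)) =
     (if \<theta> = \<infinity> then return (SM m) None
      else measure_of (XD m) (sets (SM m)) (\<lambda>\<Gamma>.
        ennreal (exp (- disc m * enn2real \<theta>)) *
          emeasure (return (SM m) (Some (jump m (flow m x (enn2real \<theta>)) a))) \<Gamma> +
        ennreal (1 - exp (- disc m * enn2real \<theta>)) * emeasure (return (SM m) None) \<Gamma>))"

fun Cbar :: "('x, 'a) impulse_model \<Rightarrow> nat \<Rightarrow> 'x option \<times> (ennreal \<times> 'a) \<Rightarrow> ennreal" where
  "Cbar m j (None, (\<theta>, a)) = 0"
| "Cbar m j (Some x, (\<theta>, a)) =
     (\<integral>\<^sup>+t\<in>{t. 0 \<le> t \<and> ennreal t \<le> \<theta>}. ennreal (exp (- disc m * t)) * gcost m j (flow m x t) \<partial>lborel) +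
     (if \<theta> = \<infinity> then 0
      else ennreal (exp (- disc m * enn2real \<theta>)) * icost m j (flow m x (enn2real \<theta>)) a)"

definition Ctot :: "('x, 'a) impulse_model \<Rightarrow> 'x option \<times> (ennreal \<times> 'a) \<Rightarrow> ennreal" where
  "Ctot m z = (\<Sum>j\<le>ncons m. Cbar m j z)"

section \<open>Strategies\<close>

text \<open>A trajectory is a sequence \<open>\<omega>\<close> with \<open>\<omega> i = (X\<^sub>i, B\<^bsub>i+1\<^esub>)\<close>. The history
  \<open>(x\<^sub>0, b\<^sub>1, x\<^sub>1, \<dots>, b\<^sub>n, x\<^sub>n)\<close> is encoded as the pair of \<open>(x\<^sub>i, b\<^bsub>i+1\<^esub>)\<^bsub>i<n\<^esub>\<close> and \<open>x\<^sub>n\<close>, and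
  \<open>\<pi> n\<close> is the kernel that selects the action \<open>b\<^bsub>n+1\<^esub>\<close>.\<close>

type_synonym ('x, 'a) strategy =
  "nat \<Rightarrow> (nat \<Rightarrow> 'x option \<times> (ennreal \<times> 'a)) \<times> 'x option \<Rightarrow> (ennreal \<times> 'a) measure"

definition HM :: "('x :: polish_space, 'a :: polish_space) impulse_model \<Rightarrow> nat \<Rightarrow>
    ((nat \<Rightarrow> 'x option \<times> (ennreal \<times> 'a)) \<times> 'x option) measure" where
  "HM m n = (\<Pi>\<^sub>M i\<in>{0..<n}. SBM m) \<Otimes>\<^sub>M SM m"

definition strategies :: "('x :: polish_space, 'a :: polish_space) impulse_model \<Rightarrow> ('x, 'a) strategy set" where
  "strategies m = {\<pi>. \<forall>n. \<pi> n \<in> HM m n \<rightarrow>\<^sub>M prob_algebra (BM m)}"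

definition det_stationary :: "('x :: polish_space, 'a :: polish_space) impulse_model \<Rightarrow>
    ('x option \<Rightarrow> ennreal \<times> 'a) set" where
  "det_stationary m = SM m \<rightarrow>\<^sub>M BM m"

definition stat :: "('x :: polish_space, 'a :: polish_space) impulse_model \<Rightarrow>
    ('x option \<Rightarrow> ennreal \<times> 'a) \<Rightarrow> ('x, 'a) strategy" where
  "stat m f = (\<lambda>n (\<omega>, x). return (BM m) (f x))"

text \<open>\<open>step m \<pi> x n \<omega>\<close> is the conditional law of \<open>(X\<^sub>n, B\<^bsub>n+1\<^esub>)\<close> given the past
  \<open>\<omega> = (X\<^sub>i, B\<^bsub>i+1\<^esub>)\<^bsub>i<n\<^esub>\<close>; \<open>law m \<pi> x\<close> is the measure \<open>P\<^sup>\<pi>\<^sub>x\<close>, obtained from these kernels by the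
  Ionescu-Tulcea theorem (see \<open>Ionescu_Tulcea_step\<close> below).\<close>

definition step :: "('x :: polish_space, 'a :: polish_space) impulse_model \<Rightarrow> ('x, 'a) strategy \<Rightarrow>
    'x option \<Rightarrow> nat \<Rightarrow> (nat \<Rightarrow> 'x option \<times> (ennreal \<times> 'a)) \<Rightarrow> ('x option \<times> (ennreal \<times> 'a)) measure" where
  "step m \<pi> x n \<omega> =
     (if n = 0 then return (SM m) x else Qtr m (\<omega> (n - 1))) \<bind>
       (\<lambda>y. \<pi> n (\<omega>, y) \<bind> (\<lambda>b. return (SBM m) (y, b)))"

definition law :: "('x :: polish_space, 'a :: polish_space) impulse_model \<Rightarrow> ('x, 'a) strategy \<Rightarrow>
    'x option \<Rightarrow> (nat \<Rightarrow> 'x option \<times> (ennreal \<times> 'a)) measure" where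
  "law m \<pi> x = projective_family.lim UNIV (Ionescu_Tulcea.CI (step m \<pi> x) (\<lambda>_. SBM m)) (\<lambda>_. SBM m)"

definition val :: "('x :: polish_space, 'a :: polish_space) impulse_model \<Rightarrow> 'x option \<Rightarrow>
    ('x, 'a) strategy \<Rightarrow> ('x option \<times> (ennreal \<times> 'a) \<Rightarrow> ennreal) \<Rightarrow> ennreal" where
  "val m x \<pi> C = (\<integral>\<^sup>+\<omega>. (\<Sum>i. C (\<omega> i)) \<partial>law m \<pi> x)"

section \<open>The constrained problem\<close>

definition feasible :: "('x :: polish_space, 'a :: polish_space) impulse_model \<Rightarrow> 'x option \<Rightarrow>
    ('x, 'a) strategy set" where
  "feasible m x0 = {\<pi> \<in> strategies m. \<forall>j\<in>{1..ncons m}. val m x0 \<pi> (Cbar m j) \<le> ennreal (bound m j)}"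

definition optimal :: "('x :: polish_space, 'a :: polish_space) impulse_model \<Rightarrow> 'x option \<Rightarrow>
    ('x, 'a) strategy \<Rightarrow> bool" where
  "optimal m x0 \<pi> \<longleftrightarrow> \<pi> \<in> feasible m x0 \<and>
     val m x0 \<pi> (Cbar m 0) = (INF \<sigma>\<in>feasible m x0. val m x0 \<sigma> (Cbar m 0))"

definition lsc_on :: "'b :: topological_space set \<Rightarrow> ('b \<Rightarrow> ennreal) \<Rightarrow> bool" where
  "lsc_on S f \<longleftrightarrow> (\<forall>x\<in>S. f x \<le> Liminf (at x within S) f)"

definition semicontinuous_mdp :: "('x :: polish_space, 'a :: polish_space) impulse_model \<Rightarrow> bool" where
  "semicontinuous_mdp m \<longleftrightarrow>
     compact (BA m) \<and>
     (\<forall>u :: 'x option \<Rightarrow> real. continuous_on (XD m) u \<longrightarrow> bounded (u ` XD m) \<longrightarrow>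
        continuous_on (XD m \<times> BA m) (\<lambda>z. \<integral>y. u y \<partial>Qtr m z)) \<and>
     (\<forall>j\<le>ncons m. lsc_on (XD m \<times> BA m) (Cbar m j))"

definition Wtot :: "('x :: polish_space, 'a :: polish_space) impulse_model \<Rightarrow> 'x option \<Rightarrow> ennreal" where
  "Wtot m x = (INF \<pi>\<in>strategies m. val m x \<pi> (Ctot m))"

definition VV :: "('x :: polish_space, 'a :: polish_space) impulse_model \<Rightarrow> 'x option set" where
  "VV m = {x \<in> XD m. Wtot m x > 0}"

text \<open>The property by which the strategy \<open>f\<^sup>*\<close> is chosen: it attains \<^const>\<open>Wtot\<close> at every state and the
  infimum in the Bellman equation for \<^const>\<open>Wtot\<close>.\<close>

definition uniformly_optimal_total :: "('x :: polish_space, 'a :: polish_space) impulse_model \<Rightarrow>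
    ('x option \<Rightarrow> ennreal \<times> 'a) \<Rightarrow> bool" where
  "uniformly_optimal_total m f \<longleftrightarrow> f \<in> det_stationary m \<and>
     (\<forall>x\<in>XD m. val m x (stat m f) (Ctot m) = Wtot m x \<and>
        Wtot m x = (INF b\<in>BA m. Ctot m (x, b) + (\<integral>\<^sup>+y. Wtot m y \<partial>Qtr m (x, b))) \<and>
        Wtot m x = Ctot m (x, f x) + (\<integral>\<^sup>+y. Wtot m y \<partial>Qtr m (x, f x)))"

definition PiF :: "('x :: polish_space, 'a :: polish_space) impulse_model \<Rightarrow> 'x option \<Rightarrow>
    ('x option \<Rightarrow> ennreal \<times> 'a) \<Rightarrow> ('x, 'a) strategy set" where
  "PiF m x0 fs = {\<pi> \<in> feasible m x0. val m x0 \<pi> (Cbar m 0) < \<infinity> \<and>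
     (\<forall>n. \<forall>(\<omega>, x)\<in>space (HM m n). x \<notin> VV m \<longrightarrow> \<pi> n (\<omega>, x) = return (BM m) (fs x))}"

section \<open>Occupation measures and convex programs\<close>

definition occ :: "('x :: polish_space, 'a :: polish_space) impulse_model \<Rightarrow> 'x option \<Rightarrow>
    ('x, 'a) strategy \<Rightarrow> ('x option \<times> (ennreal \<times> 'a)) measure" where
  "occ m x0 \<pi> = measure_of (XD m \<times> BA m) (sets (SBM m))
     (\<lambda>\<Gamma>. \<integral>\<^sup>+\<omega>. (\<Sum>i. indicator \<Gamma> (\<omega> i)) \<partial>law m \<pi> x0)"

definition occV :: "('x :: polish_space, 'a :: polish_space) impulse_model \<Rightarrow> 'x option \<Rightarrow>
    ('x, 'a) strategy \<Rightarrow> ('x option \<times> (ennreal \<times> 'a)) measure" where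
  "occV m x0 \<pi> = restrict_space (occ m x0 \<pi>) (VV m \<times> BA m)"

definition VBM :: "('x :: polish_space, 'a :: polish_space) impulse_model \<Rightarrow>
    ('x option \<times> (ennreal \<times> 'a)) measure" where
  "VBM m = restrict_space (SBM m) (VV m \<times> BA m)"

definition mixture_of :: "('x :: polish_space, 'a :: polish_space) impulse_model \<Rightarrow> 'x option \<Rightarrow>
    ('x, 'a) strategy \<Rightarrow> (nat \<Rightarrow> 'x option \<Rightarrow> ennreal \<times> 'a) \<Rightarrow> (nat \<Rightarrow> real) \<Rightarrow> bool" where
  "mixture_of m x0 \<pi> f \<gamma> \<longleftrightarrow> \<pi> \<in> strategies m \<and>
     (\<forall>l\<in>{1..ncons m + 1}. f l \<in> det_stationary m \<and> 0 < \<gamma> l \<and> \<gamma> l \<le> 1) \<and>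
     (\<Sum>l=1..ncons m + 1. \<gamma> l) = 1 \<and>
     (\<forall>\<Gamma>\<in>sets (VBM m). emeasure (occV m x0 \<pi>) \<Gamma> =
        (\<Sum>l=1..ncons m + 1. ennreal (\<gamma> l) * emeasure (occV m x0 (stat m (f l))) \<Gamma>))"

definition sigma_finite_marginal :: "('x :: polish_space, 'a :: polish_space) impulse_model \<Rightarrow>
    ('x option \<times> (ennreal \<times> 'a)) measure \<Rightarrow> bool" where
  "sigma_finite_marginal m \<mu> \<longleftrightarrow> sigma_finite_measure (distr \<mu> (restrict_space (SM m) (VV m)) fst)"

definition balance :: "('x :: polish_space, 'a :: polish_space) impulse_model \<Rightarrow> 'x option \<Rightarrow>
    ('x option \<times> (ennreal \<times> 'a)) measure \<Rightarrow> bool" where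
  "balance m x0 \<mu> \<longleftrightarrow> (\<forall>\<Gamma>\<in>sets (restrict_space (SM m) (VV m)).
     emeasure \<mu> (\<Gamma> \<times> BA m) = indicator \<Gamma> x0 + (\<integral>\<^sup>+z. emeasure (Qtr m z) \<Gamma> \<partial>\<mu>))"

definition feasible_R :: "('x :: polish_space, 'a :: polish_space) impulse_model \<Rightarrow> 'x option \<Rightarrow>
    ('x option \<times> (ennreal \<times> 'a)) measure set" where
  "feasible_R m x0 = {\<mu>. sets \<mu> = sets (VBM m) \<and> sigma_finite_marginal m \<mu> \<and> balance m x0 \<mu> \<and>
     (\<forall>j\<in>{1..ncons m}. (\<integral>\<^sup>+z. Cbar m j z \<partial>\<mu>) \<le> ennreal (bound m j))}"

definition DD :: "('x :: polish_space, 'a :: polish_space) impulse_model \<Rightarrow> 'x option \<Rightarrow>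
    ('x option \<times> (ennreal \<times> 'a)) measure set" where
  "DD m x0 = {\<mu>. sets \<mu> = sets (VBM m) \<and> sigma_finite_marginal m \<mu> \<and> balance m x0 \<mu> \<and>
     (\<integral>\<^sup>+z. Ctot m z \<partial>\<mu>) < \<infinity>}"

definition feasible_C :: "('x :: polish_space, 'a :: polish_space) impulse_model \<Rightarrow> 'x option \<Rightarrow>
    ('x option \<times> (ennreal \<times> 'a)) measure set" where
  "feasible_C m x0 = {\<mu> \<in> DD m x0. \<forall>j\<in>{1..ncons m}.
     enn2ereal (\<integral>\<^sup>+z. Cbar m j z \<partial>\<mu>) - ereal (bound m j) \<le> 0}"

definition solves_R :: "('x :: polish_space, 'a :: polish_space) impulse_model \<Rightarrow> 'x option \<Rightarrow>
    ('x option \<times> (ennreal \<times> 'a)) measure \<Rightarrow> bool" where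
  "solves_R m x0 \<mu> \<longleftrightarrow> \<mu> \<in> feasible_R m x0 \<and>
     (\<integral>\<^sup>+z. Cbar m 0 z \<partial>\<mu>) = (INF \<nu>\<in>feasible_R m x0. \<integral>\<^sup>+z. Cbar m 0 z \<partial>\<nu>)"

definition solves_C :: "('x :: polish_space, 'a :: polish_space) impulse_model \<Rightarrow> 'x option \<Rightarrow>
    ('x option \<times> (ennreal \<times> 'a)) measure \<Rightarrow> bool" where
  "solves_C m x0 \<mu> \<longleftrightarrow> \<mu> \<in> feasible_C m x0 \<and>
     (\<integral>\<^sup>+z. Cbar m 0 z \<partial>\<mu>) = (INF \<nu>\<in>feasible_C m x0. \<integral>\<^sup>+z. Cbar m 0 z \<partial>\<nu>)"

section \<open>Duality\<close>

text \<open>Elements of \<open>\<real>\<^sub>+\<^sup>J\<close> are functions on \<^typ>\<open>nat\<close> of which only the values at \<open>1..J\<close> matter.\<close>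

definition nonneg_orthant :: "('x, 'a) impulse_model \<Rightarrow> (nat \<Rightarrow> real) set" where
  "nonneg_orthant m = {g. \<forall>j\<in>{1..ncons m}. 0 \<le> g j}"

definition L1 :: "('x :: polish_space, 'a :: polish_space) impulse_model \<Rightarrow>
    ('x option \<times> (ennreal \<times> 'a)) measure \<Rightarrow> (nat \<Rightarrow> real) \<Rightarrow> ereal" where
  "L1 m \<mu> g = enn2ereal (\<integral>\<^sup>+z. Cbar m 0 z \<partial>\<mu>) +
     (\<Sum>j=1..ncons m. ereal (g j) * (enn2ereal (\<integral>\<^sup>+z. Cbar m j z \<partial>\<mu>) - ereal (bound m j)))"

definition hdual :: "('x :: polish_space, 'a :: polish_space) impulse_model \<Rightarrow> 'x option \<Rightarrow>
    (nat \<Rightarrow> real) \<Rightarrow> ereal" where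
  "hdual m x0 g = (INF \<mu>\<in>DD m x0. L1 m \<mu> g)"

definition dual_maximizer :: "('x :: polish_space, 'a :: polish_space) impulse_model \<Rightarrow> 'x option \<Rightarrow>
    (nat \<Rightarrow> real) \<Rightarrow> bool" where
  "dual_maximizer m x0 g \<longleftrightarrow> g \<in> nonneg_orthant m \<and> (\<forall>g'\<in>nonneg_orthant m. hdual m x0 g' \<le> hdual m x0 g)"

definition Wg :: "('x :: polish_space, 'a :: polish_space) impulse_model \<Rightarrow> (nat \<Rightarrow> real) \<Rightarrow>
    'x option \<Rightarrow> ennreal" where
  "Wg m g x = (INF \<pi>\<in>strategies m. val m x \<pi> (Cbar m 0) +
     (\<Sum>j=1..ncons m. ennreal (g j) * val m x \<pi> (Cbar m j)))"

definition bellman_rhs :: "('x :: polish_space, 'a :: polish_space) impulse_model \<Rightarrow> (nat \<Rightarrow> real) \<Rightarrow>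
    'x option \<Rightarrow> ennreal \<times> 'a \<Rightarrow> ennreal" where
  "bellman_rhs m g x b = Cbar m 0 (x, b) + (\<Sum>j=1..ncons m. ennreal (g j) * Cbar m j (x, b)) +
     (\<integral>\<^sup>+y\<in>VV m. Wg m g y \<partial>Qtr m (x, b))"

definition FF :: "('x :: polish_space, 'a :: polish_space) impulse_model \<Rightarrow>
    ('x option \<Rightarrow> ennreal \<times> 'a) \<Rightarrow> (nat \<Rightarrow> real) \<Rightarrow> ('x option \<Rightarrow> ennreal \<times> 'a) set" where
  "FF m fs g = {f \<in> det_stationary m. (\<forall>x\<in>XD m - VV m. f x = fs x) \<and>
     (\<forall>x\<in>VV m. Wg m g x = (INF b\<in>BA m. bellman_rhs m g x b) \<and> Wg m g x = bellman_rhs m g x (f x))}"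

section \<open>The kernels, trajectory laws and occupation measures are well defined\<close>

lemma emeasure_Qtr:
  assumes "\<theta> \<noteq> \<infinity>" "\<Gamma> \<in> sets (SM m)"
  shows "emeasure (Qtr m (Some x, (\<theta>, a))) \<Gamma> =
    ennreal (exp (- disc m * enn2real \<theta>)) * indicator \<Gamma> (Some (jump m (flow m x (enn2real \<theta>)) a)) +
    ennreal (1 - exp (- disc m * enn2real \<theta>)) * indicator \<Gamma> None"
proof -
  let ?p = "ennreal (exp (- disc m * enn2real \<theta>))"
  let ?q = "ennreal (1 - exp (- disc m * enn2real \<theta>))"
  let ?R = "return (SM m) (Some (jump m (flow m x (enn2real \<theta>)) a))"
  let ?N = "return (SM m) None"
  let ?\<mu> = "\<lambda>\<Gamma>. ?p * emeasure ?R \<Gamma> + ?q * emeasure ?N \<Gamma>"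
  have "emeasure (measure_of (XD m) (sets (SM m)) ?\<mu>) \<Gamma> = ?\<mu> \<Gamma>"
  proof (rule emeasure_measure_of_sigma)
    show "sigma_algebra (XD m) (sets (SM m))"
      using sets.sigma_algebra_axioms[of "SM m"] by simp
    show "positive (sets (SM m)) ?\<mu>"
      by (simp add: positive_def)
    show "countably_additive (sets (SM m)) ?\<mu>"
    proof (rule countably_additiveI)
      fix A :: "nat \<Rightarrow> _" assume A: "range A \<subseteq> sets (SM m)" "disjoint_family A"
      have "(\<Sum>i. emeasure ?R (A i)) = emeasure ?R (\<Union>i. A i)"
           "(\<Sum>i. emeasure ?N (A i)) = emeasure ?N (\<Union>i. A i)"
        using A by (intro suminf_emeasure; simp)+
      then show "(\<Sum>i. ?\<mu> (A i)) = ?\<mu> (\<Union>i. A i)"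
        by (simp add: suminf_add[symmetric] ennreal_suminf_cmult)
    qed
  qed (use assms in auto)
  then show ?thesis
    using assms by simp
qed

lemma sets_Qtr [simp]: "sets (Qtr m z) = sets (SM m)"
proof -
  have "sigma_sets (XD m) (sets (SM m)) = sets (SM m)"
    using sets.sigma_sets_eq[of "SM m"] by simp
  moreover have "sets (SM m) \<subseteq> Pow (XD m)"
    using sets.space_closed[of "SM m"] by simp
  ultimately show ?thesis
    by (cases "(m, z)" rule: Qtr.cases) auto
qed

lemma space_Qtr [simp]: "space (Qtr m z) = XD m"
  using sets_eq_imp_space_eq[OF sets_Qtr] by simp

lemma None_in_XD [simp]: "None \<in> XD m"
  by (simp add: XD_def)

lemma continuous_on_Some: "continuous_on S Some"
  by (rule continuous_on_subset[OF _ subset_UNIV])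
     (simp add: continuous_on_open_vimage open_option_def)

lemma continuous_on_the: "continuous_on S the"
  by (rule continuous_on_subset[OF _ subset_UNIV])
     (simp add: continuous_on_open_vimage open_option_def vimage_def)

lemma borel_measurable_Some [measurable]: "Some \<in> borel_measurable borel"
  by (rule borel_measurable_continuous_onI) (rule continuous_on_Some)

lemma borel_measurable_the [measurable]: "the \<in> borel_measurable borel"
  by (rule borel_measurable_continuous_onI) (rule continuous_on_the)

lemma sets_borel_None [measurable]: "{None :: 'a :: topological_space option} \<in> sets borel"
  by (rule borel_open) (rule open_None)

lemma measurable_Qtr:
  assumes m: "impulse_control_model m"
  shows "Qtr m \<in> SBM m \<rightarrow>\<^sub>M prob_algebra (SM m)"
proof -
  let ?X = "restrict_space borel (states m)" and ?A = "restrict_space borel (acts m)"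
  have flow [measurable]: "(\<lambda>(x, t). flow m x t) \<in> ?X \<Otimes>\<^sub>M restrict_space borel {0..} \<rightarrow>\<^sub>M ?X"
    and jump [measurable]: "(\<lambda>(x, a). jump m x a) \<in> ?X \<Otimes>\<^sub>M ?A \<rightarrow>\<^sub>M ?X"
    and disc: "0 < disc m"
    using m by (auto simp: impulse_control_model_def)
  define t where "t z = enn2real (fst (snd z))" for z :: "'a option \<times> (ennreal \<times> 'b)"
  define g where "g z = Some (jump m (flow m (the (fst z)) (t z)) (snd (snd z)))" for z
  define E where "E = {z \<in> space (SBM m). fst z \<noteq> None \<and> fst (snd z) \<noteq> \<infinity>}"
  have st [measurable]: "fst \<in> SBM m \<rightarrow>\<^sub>M borel" "snd \<in> SBM m \<rightarrow>\<^sub>M borel"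
    unfolding SBM_def SM_def BM_def
    by (auto intro!: measurable_compose[OF measurable_fst] measurable_compose[OF measurable_snd]
             measurable_restrict_space1)
  have [measurable]: "(\<lambda>z. fst (snd z)) \<in> SBM m \<rightarrow>\<^sub>M borel" "(\<lambda>z. snd (snd z)) \<in> SBM m \<rightarrow>\<^sub>M borel"
    using measurable_compose[OF st(2), of fst borel] measurable_compose[OF st(2), of snd borel]
    by (auto simp: borel_prod[symmetric])
  have t_meas [measurable]: "t \<in> borel_measurable (SBM m)"
    unfolding t_def by measurable
  have "{z \<in> space (SBM m). fst z \<notin> {None} \<and> fst (snd z) \<noteq> \<infinity>} \<in> sets (SBM m)"
    by measurable
  then have E [measurable]: "E \<in> sets (SBM m)"
    by (simp add: E_def)
  have E': "{z \<in> space (SBM m). z \<in> E} \<in> sets (SBM m)"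
    by measurable
  let ?E = "restrict_space (SBM m) E"
  have E_D: "the (fst z) \<in> states m" "fst z = Some (the (fst z))" "0 \<le> t z" "snd (snd z) \<in> acts m"
    if "z \<in> space ?E" for z
    using that by (auto simp: E_def space_restrict_space XD_def BA_def t_def)
  have "(\<lambda>z. flow m (the (fst z)) (t z)) \<in> ?E \<rightarrow>\<^sub>M ?X"
  proof -
    have "(\<lambda>z. (the (fst z), t z)) \<in> ?E \<rightarrow>\<^sub>M ?X \<Otimes>\<^sub>M restrict_space borel {0..}"
      using E_D
      by (intro measurable_Pair measurable_restrict_space2 measurable_restrict_space1)
         (auto simp: measurable_compose[OF st(1) borel_measurable_the] t_meas)
    from measurable_compose[OF this flow] show ?thesis
      by simp
  qed
  moreover have "(\<lambda>z. snd (snd z)) \<in> ?E \<rightarrow>\<^sub>M ?A"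
    using E_D by (intro measurable_restrict_space2 measurable_restrict_space1) auto
  ultimately have "(\<lambda>z. (flow m (the (fst z)) (t z), snd (snd z))) \<in> ?E \<rightarrow>\<^sub>M ?X \<Otimes>\<^sub>M ?A"
    by (rule measurable_Pair)
  from measurable_compose[OF this jump]
  have j: "(\<lambda>z. jump m (flow m (the (fst z)) (t z)) (snd (snd z))) \<in> ?E \<rightarrow>\<^sub>M ?X"
    by simp
  have g [measurable]: "g \<in> ?E \<rightarrow>\<^sub>M SM m"
    unfolding SM_def
  proof (rule measurable_restrict_space2)
    show "g \<in> space ?E \<rightarrow> XD m"
      using measurable_space[OF j] by (auto simp: g_def XD_def space_restrict_space)
    have "(\<lambda>z. jump m (flow m (the (fst z)) (t z)) (snd (snd z))) \<in> ?E \<rightarrow>\<^sub>M borel"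
      using j by (simp add: measurable_restrict_space2_iff)
    from measurable_compose[OF this borel_measurable_Some] show "g \<in> ?E \<rightarrow>\<^sub>M borel"
      by (simp add: g_def[abs_def])
  qed
  have em: "emeasure (Qtr m z) \<Gamma> =
     (if z \<in> E then ennreal (exp (- disc m * t z)) * indicator \<Gamma> (g z) +
         ennreal (1 - exp (- disc m * t z)) * indicator \<Gamma> None
      else indicator \<Gamma> None)" if "\<Gamma> \<in> sets (SM m)" "z \<in> space (SBM m)" for z \<Gamma>
  proof (cases "(m, z)" rule: Qtr.cases)
    case (1 m' \<theta> a)
    then show ?thesis using that by (auto simp: E_def)
  next
    case (2 m' x \<theta> a)
    then show ?thesis
      using that emeasure_Qtr[of \<theta> \<Gamma> m x a] by (auto simp: E_def g_def t_def simp del: Qtr.simps(2)) auto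
  qed
  show ?thesis
  proof (rule measurable_prob_algebraI)
    show prob: "prob_space (Qtr m z)" if z: "z \<in> space (SBM m)" for z
    proof
      have "z \<in> E \<Longrightarrow> g z \<in> XD m"
        using measurable_space[OF g, of z] z by (simp add: space_restrict_space)
      moreover have "XD m \<in> sets (SM m)"
        using sets.top[of "SM m"] by simp
      ultimately show "emeasure (Qtr m z) (space (Qtr m z)) = 1"
        using z disc
        by (auto simp: em ennreal_plus[symmetric] t_def simp del: ennreal_plus)
    qed
    show "Qtr m \<in> SBM m \<rightarrow>\<^sub>M subprob_algebra (SM m)"
    proof (rule measurable_subprob_algebra)
      show "subprob_space (Qtr m z)" if "z \<in> space (SBM m)" for z
        using prob[OF that] by (rule prob_space_imp_subprob_space)
      fix \<Gamma> assume \<Gamma> [measurable]: "\<Gamma> \<in> sets (SM m)"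
      have [measurable]: "t \<in> borel_measurable ?E"
        using t_meas by (rule measurable_restrict_space1)
      have "(\<lambda>z. ennreal (exp (- disc m * t z)) * indicator \<Gamma> (g z) +
          ennreal (1 - exp (- disc m * t z)) * indicator \<Gamma> None) \<in> borel_measurable ?E"
        by measurable
      then have "(\<lambda>z. if z \<in> E then ennreal (exp (- disc m * t z)) * indicator \<Gamma> (g z) +
         ennreal (1 - exp (- disc m * t z)) * indicator \<Gamma> None
         else indicator \<Gamma> None :: ennreal) \<in> borel_measurable (SBM m)"
        by (subst measurable_If_restrict_space_iff[OF E']) simp_all
      then show "(\<lambda>z. emeasure (Qtr m z) \<Gamma>) \<in> borel_measurable (SBM m)"
        by (subst measurable_cong[OF em[OF \<Gamma>]])
    qed simp
  qed
qed

lemma measurable_step: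
  assumes "impulse_control_model m" "\<pi> \<in> strategies m" "x \<in> XD m"
  shows "step m \<pi> x n \<in> (\<Pi>\<^sub>M i\<in>{0..<n}. SBM m) \<rightarrow>\<^sub>M prob_algebra (SBM m)"
proof -
  let ?H = "\<Pi>\<^sub>M i\<in>{0..<n}. SBM m"
  have Q[measurable]: "Qtr m \<in> SBM m \<rightarrow>\<^sub>M prob_algebra (SM m)"
    by (rule measurable_Qtr) fact
  have pi[measurable]: "\<pi> n \<in> ?H \<Otimes>\<^sub>M SM m \<rightarrow>\<^sub>M prob_algebra (BM m)"
    using assms(2) by (simp add: strategies_def HM_def)
  have first: "(\<lambda>\<omega>. if n = 0 then return (SM m) x else Qtr m (\<omega> (n - 1))) \<in> ?H \<rightarrow>\<^sub>M prob_algebra (SM m)"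
  proof (cases "n = 0")
    case True
    then show ?thesis
      using assms(3) by (auto simp: space_prob_algebra intro!: prob_space_return)
  next
    case False
    then have "(\<lambda>\<omega>. \<omega> (n - 1)) \<in> ?H \<rightarrow>\<^sub>M SBM m"
      by (intro measurable_component_singleton) auto
    from measurable_compose[OF this Q] False show ?thesis
      by simp
  qed
  show ?thesis
    unfolding step_def
  proof (rule measurable_bind_prob_space2[where N = "SM m"])
    have "(\<lambda>p. \<pi> n p \<bind> (\<lambda>b. return (SBM m) (snd p, b))) \<in> ?H \<Otimes>\<^sub>M SM m \<rightarrow>\<^sub>M prob_algebra (SBM m)"
      unfolding SBM_def[of m] using pi[unfolded SBM_def[of m]]
      by measurable
    then show "(\<lambda>(\<omega>, y). \<pi> n (\<omega>, y) \<bind> (\<lambda>b. return (SBM m) (y, b)))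
        \<in> ?H \<Otimes>\<^sub>M SM m \<rightarrow>\<^sub>M prob_algebra (SBM m)"
      by (simp add: case_prod_unfold)
  qed (fact first)
qed

lemma Ionescu_Tulcea_step:
  assumes "impulse_control_model m" "\<pi> \<in> strategies m" "x \<in> XD m"
  shows "Ionescu_Tulcea (step m \<pi> x) (\<lambda>_. SBM m)"
proof (rule Ionescu_Tulcea.intro)
  show "step m \<pi> x n \<in> (\<Pi>\<^sub>M i\<in>{0..<n}. SBM m) \<rightarrow>\<^sub>M subprob_algebra (SBM m)" for n
    using measurable_step[OF assms] by (rule measurable_prob_algebraD)
  show "prob_space (step m \<pi> x n \<omega>)" if "\<omega> \<in> space (\<Pi>\<^sub>M i\<in>{0..<n}. SBM m)" for n \<omega>
    using measurable_space[OF measurable_step[OF assms] that] by (simp add: space_prob_algebra)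
qed

lemma stat_in_strategies: "f \<in> det_stationary m \<Longrightarrow> stat m f \<in> strategies m"
  unfolding det_stationary_def strategies_def stat_def HM_def
  by (auto simp: case_prod_unfold
      intro!: measurable_compose[OF measurable_snd measurable_compose[OF _ measurable_return_prob_space]])

lemma suminf_swap_ennreal:
  fixes f :: "nat \<Rightarrow> nat \<Rightarrow> ennreal"
  shows "(\<Sum>j. \<Sum>i. f j i) = (\<Sum>i. \<Sum>j. f j i)"
  using nn_integral_suminf[of "\<lambda>i j. f j i" "count_space UNIV"]
  by (simp add: nn_integral_count_space_nat)

lemma emeasure_occ:
  assumes "impulse_control_model m" "\<pi> \<in> strategies m" "x \<in> XD m" "\<Gamma> \<in> sets (SBM m)"
  shows "emeasure (occ m x \<pi>) \<Gamma> = (\<integral>\<^sup>+\<omega>. (\<Sum>i. indicator \<Gamma> (\<omega> i)) \<partial>law m \<pi> x)"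
proof -
  interpret Ionescu_Tulcea "step m \<pi> x" "\<lambda>_. SBM m"
    by (rule Ionescu_Tulcea_step) fact+
  let ?\<mu> = "\<lambda>\<Gamma>. \<integral>\<^sup>+\<omega>. (\<Sum>i. indicator \<Gamma> (\<omega> i)) \<partial>law m \<pi> x"
  have sets_law [measurable_cong]: "sets (law m \<pi> x) = sets (\<Pi>\<^sub>M i\<in>UNIV. SBM m)"
    unfolding law_def by simp
  show ?thesis
    unfolding occ_def
  proof (rule emeasure_measure_of_sigma)
    show "sigma_algebra (XD m \<times> BA m) (sets (SBM m))"
      using sets.sigma_algebra_axioms[of "SBM m"] by simp
    show "positive (sets (SBM m)) ?\<mu>"
      by (simp add: positive_def)
    show "countably_additive (sets (SBM m)) ?\<mu>"
    proof (rule countably_additiveI)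
      fix A :: "nat \<Rightarrow> _" assume A: "range A \<subseteq> sets (SBM m)" "disjoint_family A"
      have [measurable]: "A i \<in> sets (SBM m)" for i
        using A by auto
      have "(\<Sum>j. ?\<mu> (A j)) = (\<integral>\<^sup>+\<omega>. (\<Sum>j. \<Sum>i. indicator (A j) (\<omega> i)) \<partial>law m \<pi> x)"
        by (subst nn_integral_suminf) auto
      also have "\<dots> = (\<integral>\<^sup>+\<omega>. (\<Sum>i. \<Sum>j. indicator (A j) (\<omega> i)) \<partial>law m \<pi> x)"
        by (intro nn_integral_cong suminf_swap_ennreal)
      also have "\<dots> = ?\<mu> (\<Union>j. A j)"
        by (simp add: suminf_indicator[OF A(2)])
      finally show "(\<Sum>j. ?\<mu> (A j)) = ?\<mu> (\<Union>j. A j)" .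
    qed
  qed fact
qed

end

theory Submission
  imports Defs
begin

text \<open>The only randomness in the dynamics is the killing: as long as the process is alive, its state is a
function of the initial state and of the actions taken so far. It therefore suffices to study
open-loop plans, that is, sequences of actions. They form a compact space, and the cost vector of a
plan is a series of running costs weighted with the probabilities of being alive, which makes each
cost lower semicontinuous in the plan (\<open>plan_cost_seq_lsc\<close>). Every impulse made while alive costs at
least \<open>\<delta>\<close>, so that a finite cost bounds the expected number of impulses; as all running costs are
bounded, one finite cost makes the others finite and makes the measures of the convex program
finite.

Strategies and measures lead to the same Lagrangian value as plans. On the one hand a measurable
selection of minimisers in the Bellman equation is a stationary strategy whose path is an optimal
plan. On the other hand, integrating the Bellman inequality against a finite measure that satisfies
the balance equation bounds its cost from below by the value of plans (\<open>plan_value_le_integral\<close>).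
Hence \<open>W\<^sup>*\<close> is the minimal weighted cost of a plan (\<open>Wg_eq\<close>), and \<open>h(g)\<close> is that minimum at \<open>x\<^sub>0\<close>
minus \<open>\<Sum> g\<^sub>j d\<^sub>j\<close> (\<open>hdual_eq\<close>).

Let \<open>g\<^sup>*\<close> maximise \<open>h\<close> and put \<open>d\<^sub>0 = h(g\<^sup>*)\<close>. If no finite mixture of plans had its costs below
\<open>(d\<^sub>0, d\<^sub>1, \<dots>, d\<^sub>J)\<close>, then a closest mixture would yield a separating direction \<open>v \<ge> 0\<close>, and moving
from \<open>g\<^sup>*\<close> along \<open>v\<close>, or replacing \<open>g\<^sup>*\<close> by the normalised \<open>v\<close>, would increase \<open>h\<close>
(\<open>dual_maximizer_imp_no_separation\<close>). So such mixtures exist, and by weak duality they are optimal and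
all their atoms minimise the Lagrangian. The latter makes the cost vectors of the atoms lie in a
hyperplane, and Caratheodory's reduction leaves \<open>J + 1\<close> of them.

It remains to pass from plans to stationary strategies. Among the mixtures with \<open>J + 1\<close> atoms, one
that minimises a strictly concave increasing function of the costs has extreme atoms: their cost
vectors are not proper convex combinations of cost vectors of two other plans (\<open>extreme_mixture\<close>). If
an optimal plan comes back alive to a state, its cost vector is such a combination of the costs of the plan
that repeats the loop for ever and of the plan that skips the loop. For an extreme plan both have
the same costs, and repeating for ever from the first return on is what a stationary strategy does
(\<open>stationary_of_extreme_plan\<close>). Finally, the mixture of the stationary strategies is realised by a
Markov strategy that selects \<open>f\<^sup>l\<close> with the conditional probability of \<open>l\<close> given the present state
(\<open>exists_mixing_strategy\<close>).\<close>


section \<open>Lower semicontinuity along sequences\<close>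

text \<open>The sequential form of lower semicontinuity suffices for compactness arguments in first countable
spaces, and with it sums, series and products of costs reduce to superadditivity properties of
\<open>liminf\<close>.\<close>

definition seq_lsc :: "'b :: topological_space set \<Rightarrow> ('b \<Rightarrow> ennreal) \<Rightarrow> bool" where
  "seq_lsc S f \<longleftrightarrow> (\<forall>s x. (\<forall>n. s n \<in> S) \<longrightarrow> x \<in> S \<longrightarrow> s \<longlonglongrightarrow> x \<longrightarrow> f x \<le> liminf (\<lambda>n. f (s n)))"

lemma seq_lscI:
  assumes "\<And>s x. (\<And>n. s n \<in> S) \<Longrightarrow> x \<in> S \<Longrightarrow> s \<longlonglongrightarrow> x \<Longrightarrow> f x \<le> liminf (\<lambda>n. f (s n))"
  shows "seq_lsc S f"
  using assms by (auto simp: seq_lsc_def)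

lemma seq_lscD:
  assumes "seq_lsc S f" "\<And>n. s n \<in> S" "x \<in> S" "s \<longlonglongrightarrow> x"
  shows "f x \<le> liminf (\<lambda>n. f (s n))"
  using assms by (auto simp: seq_lsc_def)

lemma lsc_on_imp_seq_lsc:
  fixes f :: "'b :: topological_space \<Rightarrow> ennreal"
  assumes "lsc_on S f"
  shows "seq_lsc S f"
proof (rule seq_lscI)
  fix s x assume s: "\<And>n. s n \<in> S" "x \<in> S" "s \<longlonglongrightarrow> x"
  show "f x \<le> liminf (\<lambda>n. f (s n))"
  proof (rule le_Liminf_iff[THEN iffD2], intro allI impI)
    fix y assume y: "y < f x"
    have "f x \<le> Liminf (at x within S) f"
      using assms s(2) by (simp add: lsc_on_def)
    then have "eventually (\<lambda>z. y < f z) (at x within S)"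
      using y le_Liminf_iff[THEN iffD1] by blast
    then obtain U where U: "open U" "x \<in> U" "\<And>z. z \<in> U \<Longrightarrow> z \<noteq> x \<Longrightarrow> z \<in> S \<Longrightarrow> y < f z"
      unfolding eventually_at_topological by auto
    have "eventually (\<lambda>n. s n \<in> U) sequentially"
      using s(3) U(1,2) by (rule topological_tendstoD)
    then show "eventually (\<lambda>n. y < f (s n)) sequentially"
    proof eventually_elim
      case (elim n)
      then show "y < f (s n)"
        using U(3)[of "s n"] s(1)[of n] y by (cases "s n = x") auto
    qed
  qed
qed

text \<open>This is Fatou's lemma for counting measure, and so is the version for series.\<close>

lemma liminf_sum_ennreal:
  fixes f :: "'i \<Rightarrow> nat \<Rightarrow> ennreal"
  assumes "finite I"
  shows "(\<Sum>i\<in>I. liminf (f i)) \<le> liminf (\<lambda>n. \<Sum>i\<in>I. f i n)"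
  using nn_integral_liminf[of "\<lambda>n i. f i n" "count_space I"] assms
  by (simp add: nn_integral_count_space_finite)

lemma liminf_suminf_ennreal:
  fixes f :: "nat \<Rightarrow> nat \<Rightarrow> ennreal"
  shows "(\<Sum>i. liminf (f i)) \<le> liminf (\<lambda>n. \<Sum>i. f i n)"
  using nn_integral_liminf[of "\<lambda>n i. f i n" "count_space UNIV"]
  by (simp add: nn_integral_count_space_nat)

text \<open>Multiplication by a constant commutes with suprema of extended nonnegative numbers, even for the
product of \<open>0\<close> and \<open>\<infinity>\<close>; a double supremum of products of tail infima is therefore a product.\<close>

lemma liminf_mult_ennreal:
  fixes f g :: "nat \<Rightarrow> ennreal"
  shows "liminf f * liminf g \<le> liminf (\<lambda>n. f n * g n)"
proof -
  have "liminf f * liminf g = (SUP k. SUP l. (INF i\<in>{k..}. f i) * (INF i\<in>{l..}. g i))"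
    unfolding liminf_SUP_INF SUP_mult_right_ennreal unfolding SUP_mult_left_ennreal ..
  also have "\<dots> \<le> liminf (\<lambda>n. f n * g n)"
  proof (intro SUP_least)
    fix k l :: nat
    have "(INF i\<in>{k..}. f i) * (INF i\<in>{l..}. g i) \<le> (INF i\<in>{max k l..}. f i * g i)"
      by (intro INF_greatest mult_mono INF_lower) auto
    also have "\<dots> \<le> liminf (\<lambda>n. f n * g n)"
      unfolding liminf_SUP_INF by (rule SUP_upper) simp
    finally show "(INF i\<in>{k..}. f i) * (INF i\<in>{l..}. g i) \<le> liminf (\<lambda>n. f n * g n)" .
  qed
  finally show ?thesis .
qed

lemma seq_lsc_const: "seq_lsc S (\<lambda>x. c)"
  by (auto intro!: seq_lscI simp: Liminf_const)

lemma seq_lsc_sum: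
  assumes "finite I" "\<And>i. i \<in> I \<Longrightarrow> seq_lsc S (f i)"
  shows "seq_lsc S (\<lambda>x. \<Sum>i\<in>I. f i x)"
proof (rule seq_lscI)
  fix s x assume s: "\<And>n. s n \<in> S" "x \<in> S" "s \<longlonglongrightarrow> x"
  have "(\<Sum>i\<in>I. f i x) \<le> (\<Sum>i\<in>I. liminf (\<lambda>n. f i (s n)))"
    by (intro sum_mono seq_lscD[OF assms(2) s])
  also have "\<dots> \<le> liminf (\<lambda>n. \<Sum>i\<in>I. f i (s n))"
    by (rule liminf_sum_ennreal[OF assms(1)])
  finally show "(\<Sum>i\<in>I. f i x) \<le> liminf (\<lambda>n. \<Sum>i\<in>I. f i (s n))" .
qed

lemma seq_lsc_add:
  assumes "seq_lsc S f" "seq_lsc S g"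
  shows "seq_lsc S (\<lambda>x. f x + g x)"
  using seq_lsc_sum[of "UNIV :: bool set" S "\<lambda>b. if b then f else g"] assms
  by (simp add: UNIV_bool add.commute)

lemma seq_lsc_suminf:
  fixes f :: "nat \<Rightarrow> 'b :: topological_space \<Rightarrow> ennreal"
  assumes "\<And>i. seq_lsc S (f i)"
  shows "seq_lsc S (\<lambda>x. \<Sum>i. f i x)"
proof (rule seq_lscI)
  fix s x assume s: "\<And>n. s n \<in> S" "x \<in> S" "s \<longlonglongrightarrow> x"
  have "(\<Sum>i. f i x) \<le> (\<Sum>i. liminf (\<lambda>n. f i (s n)))"
    by (intro suminf_le seq_lscD[OF assms(1) s] summableI)
  also have "\<dots> \<le> liminf (\<lambda>n. \<Sum>i. f i (s n))"
    by (rule liminf_suminf_ennreal)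
  finally show "(\<Sum>i. f i x) \<le> liminf (\<lambda>n. \<Sum>i. f i (s n))" .
qed

lemma seq_lsc_mult:
  assumes "seq_lsc S f" "seq_lsc S g"
  shows "seq_lsc S (\<lambda>x. f x * g x)"
proof (rule seq_lscI)
  fix s x assume s: "\<And>n. s n \<in> S" "x \<in> S" "s \<longlonglongrightarrow> x"
  have "f x * g x \<le> liminf (\<lambda>n. f (s n)) * liminf (\<lambda>n. g (s n))"
    by (intro mult_mono seq_lscD[OF assms(1) s] seq_lscD[OF assms(2) s]) auto
  also have "\<dots> \<le> liminf (\<lambda>n. f (s n) * g (s n))"
    by (rule liminf_mult_ennreal)
  finally show "f x * g x \<le> liminf (\<lambda>n. f (s n) * g (s n))" .
qed

lemma seq_lsc_mono_compose:
  fixes h :: "ennreal \<Rightarrow> ennreal"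
  assumes "seq_lsc S f" "continuous_on UNIV h" "mono h"
  shows "seq_lsc S (\<lambda>x. h (f x))"
proof (rule seq_lscI)
  fix s x assume s: "\<And>n. s n \<in> S" "x \<in> S" "s \<longlonglongrightarrow> x"
  have "h (f x) \<le> h (liminf (\<lambda>n. f (s n)))"
    by (intro monoD[OF assms(3)] seq_lscD[OF assms(1) s])
  also have "\<dots> = liminf (\<lambda>n. h (f (s n)))"
    by (intro Liminf_compose_continuous_mono[symmetric] assms(2,3)) auto
  finally show "h (f x) \<le> liminf (\<lambda>n. h (f (s n)))" .
qed

lemma seq_lsc_compose:
  assumes "seq_lsc T f" "continuous_on S h" "h ` S \<subseteq> T"
  shows "seq_lsc S (\<lambda>x. f (h x))"
proof (rule seq_lscI)
  fix s x assume s: "\<And>n. s n \<in> S" "x \<in> S" "s \<longlonglongrightarrow> x"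
  have "(\<lambda>n. h (s n)) \<longlonglongrightarrow> h x"
    using assms(2) s by (auto intro: continuous_on_tendsto_compose)
  then show "f (h x) \<le> liminf (\<lambda>n. f (h (s n)))"
    using s assms(3) by (intro seq_lscD[OF assms(1)]) auto
qed

lemma seq_lsc_subset: "seq_lsc T f \<Longrightarrow> S \<subseteq> T \<Longrightarrow> seq_lsc S f"
  by (auto simp: seq_lsc_def)

lemma seq_lsc_tendsto:
  assumes "\<And>s x. (\<And>n. s n \<in> S) \<Longrightarrow> x \<in> S \<Longrightarrow> s \<longlonglongrightarrow> x \<Longrightarrow> (\<lambda>n. f (s n)) \<longlonglongrightarrow> f x"
  shows "seq_lsc S f"
proof (rule seq_lscI)
  fix s x assume s: "\<And>n. s n \<in> S" "x \<in> S" "s \<longlonglongrightarrow> x"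
  show "f x \<le> liminf (\<lambda>n. f (s n))"
    using lim_imp_Liminf[OF _ assms[OF s]] by simp
qed

lemma seq_lsc_limit_le:
  assumes "seq_lsc S f" "\<And>n. s n \<in> S" "x \<in> S" "s \<longlonglongrightarrow> x" "\<And>n. f (s n) \<le> r n" "r \<longlonglongrightarrow> r'"
  shows "f x \<le> (r' :: ennreal)"
proof -
  have "f x \<le> liminf (\<lambda>n. f (s n))"
    by (rule seq_lscD) fact+
  also have "\<dots> \<le> liminf r"
    using assms(5) by (intro Liminf_mono) auto
  also have "\<dots> = r'"
    using lim_imp_Liminf[OF _ assms(6)] by simp
  finally show ?thesis .
qed

lemma seq_lsc_attains_min:
  fixes f :: "'b :: topological_space \<Rightarrow> ennreal"
  assumes S: "seq_compact S" "S \<noteq> {}" and f: "seq_lsc S f"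
  shows "\<exists>x\<in>S. \<forall>y\<in>S. f x \<le> f y"
proof -
  obtain r where r: "decseq r" "range r \<subseteq> f ` S" "(INF x\<in>S. f x) = (INF i. r i)"
    using ennreal_Inf_countable_INF[of "f ` S"] S(2) by auto
  have lim: "r \<longlonglongrightarrow> (INF x\<in>S. f x)"
    unfolding r(3) using r(1) by (rule LIMSEQ_INF)
  have "\<forall>n. \<exists>x. x \<in> S \<and> f x = r n"
  proof
    fix n
    have "r n \<in> f ` S"
      using r(2) by blast
    then show "\<exists>x. x \<in> S \<and> f x = r n"
      by auto
  qed
  then obtain s where s: "\<And>n. s n \<in> S" "\<And>n. f (s n) = r n"
    by metis
  obtain x \<sigma> where x: "x \<in> S" "strict_mono \<sigma>" "(s \<circ> \<sigma>) \<longlonglongrightarrow> x"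
    using seq_compactE[OF S(1), of s] s(1) by blast
  have "f x \<le> (INF x\<in>S. f x)"
    using LIMSEQ_subseq_LIMSEQ[OF lim x(2)] s
    by (intro seq_lsc_limit_le[OF f _ x(1) x(3), of "r \<circ> \<sigma>"]) auto
  then show ?thesis
    using x(1) by (auto simp: le_INF_iff)
qed

text \<open>A sequence of minimisers along which the infimum stays below the claimed bound has a limit point by
compactness, and the value at the limit point is at most the bound.\<close>

lemma seq_lsc_INF_compact:
  fixes f :: "'b :: topological_space \<times> 'c :: first_countable_topology \<Rightarrow> ennreal"
  assumes K: "compact K" "K \<noteq> {}" and f: "seq_lsc (S \<times> K) f"
  shows "seq_lsc S (\<lambda>x. INF y\<in>K. f (x, y))"
proof (rule seq_lscI)
  fix s x assume s: "\<And>n. s n \<in> S" "x \<in> S" "s \<longlonglongrightarrow> x"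
  have sc: "seq_compact K"
    using K(1) by (rule compact_imp_seq_compact)
  have min: "\<exists>y\<in>K. f (z, y) = (INF y\<in>K. f (z, y))" if "z \<in> S" for z
  proof -
    have "seq_lsc K (\<lambda>y. f (z, y))"
      using that by (intro seq_lsc_compose[OF f]) (auto intro!: continuous_intros)
    from seq_lsc_attains_min[OF sc K(2) this] obtain y where "y \<in> K" "\<forall>y'\<in>K. f (z, y) \<le> f (z, y')"
      by auto
    then have "f (z, y) \<le> (INF y\<in>K. f (z, y))"
      by (intro INF_greatest) simp
    moreover have "(INF y\<in>K. f (z, y)) \<le> f (z, y)"
      using \<open>y \<in> K\<close> by (rule INF_lower)
    ultimately show ?thesis
      using \<open>y \<in> K\<close> by (intro bexI[of _ y] antisym)
  qed
  define y where "y n = (SOME b. b \<in> K \<and> f (s n, b) = (INF y\<in>K. f (s n, y)))" for n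
  have "y n \<in> K \<and> f (s n, y n) = (INF y\<in>K. f (s n, y))" for n
    unfolding y_def by (rule someI_ex) (use min[OF s(1)[of n]] in blast)
  then have y: "y n \<in> K" "f (s n, y n) = (INF y\<in>K. f (s n, y))" for n
    by blast+
  show "(INF y\<in>K. f (x, y)) \<le> liminf (\<lambda>n. INF y\<in>K. f (s n, y))"
  proof (rule le_Liminf_iff[THEN iffD2], intro allI impI)
    fix r assume r: "r < (INF y\<in>K. f (x, y))"
    show "eventually (\<lambda>n. r < (INF y\<in>K. f (s n, y))) sequentially"
    proof (rule ccontr)
      assume "\<not> ?thesis"
      then have "\<exists>\<^sub>F n in sequentially. f (s n, y n) \<le> r"
        unfolding not_eventually not_less y(2) .
      then have "infinite {n. f (s n, y n) \<le> r}"
        unfolding infinite_nat_iff_unbounded_le frequently_sequentially by simp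
      from infinite_enumerate[OF this] obtain \<sigma> :: "nat \<Rightarrow> nat"
        where \<sigma>: "strict_mono \<sigma>" "\<forall>n. \<sigma> n \<in> {n. f (s n, y n) \<le> r}"
        by (elim exE conjE)
      have "\<forall>n. (y \<circ> \<sigma>) n \<in> K"
        using y(1) by simp
      from seq_compactE[OF sc this]
      obtain b \<tau> where b: "b \<in> K" "strict_mono \<tau>" "((y \<circ> \<sigma>) \<circ> \<tau>) \<longlonglongrightarrow> b"
        by blast
      have "((s \<circ> \<sigma>) \<circ> \<tau>) \<longlonglongrightarrow> x"
        by (intro LIMSEQ_subseq_LIMSEQ s(3) \<sigma>(1) b(2))
      then have lim: "(\<lambda>n. (s (\<sigma> (\<tau> n)), y (\<sigma> (\<tau> n)))) \<longlonglongrightarrow> (x, b)"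
        using b(3) by (auto intro!: tendsto_Pair simp: o_def)
      have "f (x, b) \<le> r"
      proof (rule seq_lsc_limit_le[OF f _ _ lim _ tendsto_const])
        show "(s (\<sigma> (\<tau> n)), y (\<sigma> (\<tau> n))) \<in> S \<times> K" for n
          using s(1) y(1) by simp
        show "f (s (\<sigma> (\<tau> n)), y (\<sigma> (\<tau> n))) \<le> r" for n
          using \<sigma>(2) by simp
      qed (use s(2) b(1) in simp)
      moreover have "(INF y\<in>K. f (x, y)) \<le> f (x, b)"
        using b(1) by (rule INF_lower)
      ultimately show False
        using r by auto
    qed
  qed
qed

text \<open>Relative closedness of sublevel sets gives Borel measurability, and compactness of the set of
minimisers.\<close>

lemma seq_lsc_sublevel:
  fixes f :: "'b :: first_countable_topology \<Rightarrow> ennreal"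
  assumes f: "seq_lsc S f"
  shows "{x \<in> S. f x \<le> r} = S \<inter> closure {x \<in> S. f x \<le> r}"
proof -
  let ?A = "{x \<in> S. f x \<le> r}"
  have "S \<inter> closure ?A \<subseteq> ?A"
  proof
    fix x assume x: "x \<in> S \<inter> closure ?A"
    then have "\<exists>s. (\<forall>n. s n \<in> ?A) \<and> s \<longlonglongrightarrow> x"
      using closure_sequential[of x ?A] by simp
    then obtain s where s: "\<And>n. s n \<in> ?A" "s \<longlonglongrightarrow> x"
      by blast
    have "f x \<le> r"
      by (rule seq_lsc_limit_le[OF f _ _ s(2) _ tendsto_const]) (use s(1) x in auto)
    with x show "x \<in> ?A"
      by simp
  qed
  then show ?thesis
    using closure_subset[of ?A] by blast
qed

lemma seq_lsc_measurable:
  fixes f :: "'b :: first_countable_topology \<Rightarrow> ennreal"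
  assumes f: "seq_lsc S f"
  shows "f \<in> borel_measurable (restrict_space borel S)"
proof (rule borel_measurableI_le)
  fix r
  have "S \<inter> closure {x \<in> S. f x \<le> r} \<in> sets (restrict_space borel S)"
    unfolding sets_restrict_space by (intro imageI borel_closed closed_closure)
  with seq_lsc_sublevel[OF f, of r] show "{x \<in> space (restrict_space borel S). f x \<le> r} \<in> sets (restrict_space borel S)"
    by (simp only: space_restrict_space space_borel Int_UNIV_right)
qed

section \<open>Reduction of mixtures in variable dimension\<close>

text \<open>The number of constraints is a number and not a type, so that the cost vectors do not live in a type of
class \<open>euclidean_space\<close>. The little linear algebra that is needed is one step of Gaussian
elimination, used in an induction on the number of equations.\<close>

lemma homogeneous_system_nontrivial_solution:
  fixes a :: "nat \<Rightarrow> 'i \<Rightarrow> real"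
  assumes "finite I" "n < card I"
  shows "\<exists>z. (\<exists>i\<in>I. z i \<noteq> 0) \<and> (\<forall>k<n. (\<Sum>i\<in>I. z i * a k i) = 0)"
  using assms
proof (induction n arbitrary: I a)
  case 0
  then have "I \<noteq> {}" by auto
  then show ?case by (intro exI[of _ "\<lambda>_. 1"]) auto
next
  case (Suc n)
  show ?case
  proof (cases "\<forall>i\<in>I. a n i = 0")
    case True
    obtain z where "\<exists>i\<in>I. z i \<noteq> 0" "\<forall>k<n. (\<Sum>i\<in>I. z i * a k i) = 0"
      using Suc.IH[of I a] Suc.prems by auto
    with True show ?thesis
      by (intro exI[of _ z]) (auto simp: less_Suc_eq)
  next
    case False
    then obtain p where p: "p \<in> I" "a n p \<noteq> 0" by auto
    define b where "b k i = a k i - a k p * a n i / a n p" for k i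
    have "n < card (I - {p})"
      using Suc.prems p by (simp add: card_Diff_singleton)
    then obtain z where z: "\<exists>i\<in>I - {p}. z i \<noteq> 0" "\<And>k. k < n \<Longrightarrow> (\<Sum>i\<in>I - {p}. z i * b k i) = 0"
      using Suc.IH[of "I - {p}" b] Suc.prems by auto
    define y where "y = z(p := - (\<Sum>i\<in>I - {p}. z i * a n i) / a n p)"
    have sum_y: "(\<Sum>i\<in>I. y i * a k i) = y p * a k p + (\<Sum>i\<in>I - {p}. z i * a k i)" for k
    proof -
      have "(\<Sum>i\<in>I. y i * a k i) = y p * a k p + (\<Sum>i\<in>I - {p}. y i * a k i)"
        using Suc.prems(1) p(1) by (rule sum.remove)
      also have "(\<Sum>i\<in>I - {p}. y i * a k i) = (\<Sum>i\<in>I - {p}. z i * a k i)"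
        by (intro sum.cong) (auto simp: y_def)
      finally show ?thesis .
    qed
    have "(\<Sum>i\<in>I. y i * a n i) = 0"
      unfolding sum_y using p(2) by (simp add: y_def)
    moreover have "(\<Sum>i\<in>I. y i * a k i) = 0" if "k < n" for k
    proof -
      have "0 = (\<Sum>i\<in>I - {p}. z i * a k i) - (\<Sum>i\<in>I - {p}. z i * a n i) * (a k p / a n p)"
        using z(2)[OF that]
        by (simp add: b_def algebra_simps sum_subtractf sum_distrib_left)
      then show ?thesis
        unfolding sum_y by (simp add: y_def)
    qed
    moreover have "\<exists>i\<in>I. y i \<noteq> 0"
      using z(1) by (auto simp: y_def)
    ultimately show ?thesis
      by (intro exI[of _ y]) (auto simp: less_Suc_eq)
  qed
qed

text \<open>Caratheodory's argument: move the weights along a linear relation until one of them vanishes. The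
sign of the relation is free and is chosen such that the additional linear objective \<open>\<phi>\<close> does
not increase.\<close>

lemma caratheodory_weights:
  fixes \<gamma> :: "nat \<Rightarrow> real" and a :: "nat \<Rightarrow> nat \<Rightarrow> real" and \<phi> :: "nat \<Rightarrow> real"
  assumes nonneg: "\<And>l. l < n + 2 \<Longrightarrow> 0 \<le> \<gamma> l"
  shows "\<exists>\<delta>. (\<forall>l<n + 2. 0 \<le> \<delta> l \<and> (\<gamma> l = 0 \<longrightarrow> \<delta> l = 0)) \<and> (\<exists>i<n + 2. \<delta> i = 0) \<and>
    (\<Sum>l<n + 2. \<delta> l) = (\<Sum>l<n + 2. \<gamma> l) \<and>
    (\<forall>k<n. (\<Sum>l<n + 2. \<delta> l * a k l) = (\<Sum>l<n + 2. \<gamma> l * a k l)) \<and>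
    (\<Sum>l<n + 2. \<delta> l * \<phi> l) \<le> (\<Sum>l<n + 2. \<gamma> l * \<phi> l)"
proof (cases "\<exists>i<n + 2. \<gamma> i = 0")
  case True
  then show ?thesis
    using nonneg by (intro exI[of _ \<gamma>]) auto
next
  case False
  then have pos: "0 < \<gamma> l" if "l < n + 2" for l
    using nonneg that by (metis order_le_less)
  define a' where "a' k l = (if k = n then 1 else a k l)" for k l
  obtain z where z: "\<exists>l\<in>{..<n + 2}. z l \<noteq> 0" "\<forall>k<n + 1. (\<Sum>l<n + 2. z l * a' k l) = 0"
    using homogeneous_system_nontrivial_solution[of "{..<n + 2}" "n + 1" a'] by auto
  define s :: real where "s = (if (\<Sum>l<n + 2. z l * \<phi> l) \<le> 0 then 1 else - 1)"
  define \<mu> where "\<mu> l = s * z l" for l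
  have sum_\<mu>: "(\<Sum>l<n + 2. \<mu> l * h l) = s * (\<Sum>l<n + 2. z l * h l)" for h
    unfolding \<mu>_def sum_distrib_left by (simp only: mult.assoc)
  have \<mu>: "\<exists>l<n + 2. \<mu> l \<noteq> 0" "(\<Sum>l<n + 2. \<mu> l) = 0" "(\<Sum>l<n + 2. \<mu> l * \<phi> l) \<le> 0"
    "\<And>k. k < n \<Longrightarrow> (\<Sum>l<n + 2. \<mu> l * a k l) = 0"
  proof -
    show "\<exists>l<n + 2. \<mu> l \<noteq> 0"
      using z(1) by (auto simp: \<mu>_def s_def)
    have "(\<Sum>l<n + 2. z l * 1) = 0"
      using z(2)[rule_format, of n] by (simp add: a'_def del: sum.lessThan_Suc)
    then show "(\<Sum>l<n + 2. \<mu> l) = 0"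
      using sum_\<mu>[of "\<lambda>_. 1"] by simp
    show "(\<Sum>l<n + 2. \<mu> l * \<phi> l) \<le> 0"
      unfolding sum_\<mu> by (simp add: s_def)
    show "(\<Sum>l<n + 2. \<mu> l * a k l) = 0" if "k < n" for k
      using z(2)[rule_format, of k] that unfolding sum_\<mu> by (simp add: a'_def)
  qed
  \<comment> \<open>\<open>\<mu>\<close> sums to \<open>0\<close> and does not vanish, so some weights decrease along it; the first to reach \<open>0\<close> decides.\<close>
  define N where "N = {l. l < n + 2 \<and> \<mu> l < 0}"
  have "N \<noteq> {}"
  proof
    assume "N = {}"
    then have "0 \<le> \<mu> l" if "l \<in> {..<n + 2}" for l
      using that by (force simp: N_def)
    from sum_nonneg_eq_0_iff[of "{..<n + 2}" \<mu>, OF _ this] \<mu>(2) have "\<forall>l\<in>{..<n + 2}. \<mu> l = 0"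
      by blast
    with \<mu>(1) show False by blast
  qed
  have N: "finite N" by (simp add: N_def)
  define t where "t = Min ((\<lambda>l. \<gamma> l / (- \<mu> l)) ` N)"
  have "t \<in> (\<lambda>l. \<gamma> l / (- \<mu> l)) ` N"
    unfolding t_def using N \<open>N \<noteq> {}\<close> by (intro Min_in) auto
  then obtain i where i: "i \<in> N" "t = \<gamma> i / (- \<mu> i)" by auto
  have t: "t \<le> \<gamma> l / (- \<mu> l)" if "l \<in> N" for l
    unfolding t_def using N that by (intro Min_le) auto
  have t0: "0 \<le> t"
    unfolding i(2) using i(1) pos[of i] by (intro divide_nonneg_pos) (auto simp: N_def)
  define \<delta> where "\<delta> l = \<gamma> l + t * \<mu> l" for l
  have lin: "(\<Sum>l<n + 2. \<delta> l * h l) = (\<Sum>l<n + 2. \<gamma> l * h l) + t * (\<Sum>l<n + 2. \<mu> l * h l)" for h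
    by (simp add: \<delta>_def algebra_simps sum.distrib sum_distrib_left del: sum.lessThan_Suc)
  show ?thesis
  proof (intro exI[of _ \<delta>] conjI allI impI)
    show "0 \<le> \<delta> l" if "l < n + 2" for l
    proof (cases "\<mu> l < 0")
      case True
      then have "l \<in> N"
        using that by (simp add: N_def)
      from t[OF this] True have "t * (- \<mu> l) \<le> \<gamma> l"
        by (subst (asm) pos_le_divide_eq) auto
      then show ?thesis by (simp add: \<delta>_def)
    next
      case False
      then show ?thesis
        using pos[OF that] t0 by (simp add: \<delta>_def)
    qed
    show "\<delta> l = 0" if "l < n + 2" "\<gamma> l = 0" for l
      using pos[OF that(1)] that(2) by simp
    show "\<exists>i<n + 2. \<delta> i = 0"
      using i by (intro exI[of _ i]) (auto simp: N_def \<delta>_def)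
    show "(\<Sum>l<n + 2. \<delta> l) = (\<Sum>l<n + 2. \<gamma> l)"
      using lin[of "\<lambda>_. 1"] \<mu>(2) by simp
    show "(\<Sum>l<n + 2. \<delta> l * a k l) = (\<Sum>l<n + 2. \<gamma> l * a k l)" if "k < n" for k
      using lin[of "a k"] \<mu>(4)[OF that] by simp
    show "(\<Sum>l<n + 2. \<delta> l * \<phi> l) \<le> (\<Sum>l<n + 2. \<gamma> l * \<phi> l)"
      using lin[of \<phi>] \<mu>(3) t0 by (simp add: mult_nonneg_nonpos del: sum.lessThan_Suc)
  qed
qed

text \<open>The atom of weight \<open>0\<close> is overwritten by the last one, which keeps the atoms indexed by an initial
segment.\<close>

lemma drop_atom:
  fixes \<gamma> :: "nat \<Rightarrow> real" and \<beta> :: "nat \<Rightarrow> 'b" and a :: "nat \<Rightarrow> 'b \<Rightarrow> real" and \<phi> :: "'b \<Rightarrow> real"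
  assumes nonneg: "\<And>l. l < n + 2 \<Longrightarrow> 0 \<le> \<gamma> l"
  shows "\<exists>\<gamma>' \<beta>'. (\<forall>l<n + 1. 0 \<le> \<gamma>' l \<and> (\<exists>i<n + 2. \<beta>' l = \<beta> i \<and> (0 < \<gamma>' l \<longrightarrow> 0 < \<gamma> i))) \<and>
    (\<Sum>l<n + 1. \<gamma>' l) = (\<Sum>l<n + 2. \<gamma> l) \<and>
    (\<forall>k<n. (\<Sum>l<n + 1. \<gamma>' l * a k (\<beta>' l)) = (\<Sum>l<n + 2. \<gamma> l * a k (\<beta> l))) \<and>
    (\<Sum>l<n + 1. \<gamma>' l * \<phi> (\<beta>' l)) \<le> (\<Sum>l<n + 2. \<gamma> l * \<phi> (\<beta> l))"
proof -
  obtain \<delta> i where \<delta>: "\<And>l. l < n + 2 \<Longrightarrow> 0 \<le> \<delta> l" "\<And>l. l < n + 2 \<Longrightarrow> \<gamma> l = 0 \<Longrightarrow> \<delta> l = 0"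
    "i < n + 2" "\<delta> i = 0" "(\<Sum>l<n + 2. \<delta> l) = (\<Sum>l<n + 2. \<gamma> l)"
    "\<And>k. k < n \<Longrightarrow> (\<Sum>l<n + 2. \<delta> l * a k (\<beta> l)) = (\<Sum>l<n + 2. \<gamma> l * a k (\<beta> l))"
    "(\<Sum>l<n + 2. \<delta> l * \<phi> (\<beta> l)) \<le> (\<Sum>l<n + 2. \<gamma> l * \<phi> (\<beta> l))"
    using caratheodory_weights[of n \<gamma> "\<lambda>k l. a k (\<beta> l)" "\<lambda>l. \<phi> (\<beta> l)", OF nonneg] by blast
  define p where "p l = (if l = i then n + 1 else l)" for l
  have p: "bij_betw p {..<n + 1} ({..<n + 2} - {i})"
  proof (rule bij_betw_imageI)
    show "inj_on p {..<n + 1}"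
      by (auto simp: inj_on_def p_def split: if_splits)
    show "p ` {..<n + 1} = {..<n + 2} - {i}"
    proof
      show "p ` {..<n + 1} \<subseteq> {..<n + 2} - {i}"
        by (auto simp: p_def split: if_splits)
      show "{..<n + 2} - {i} \<subseteq> p ` {..<n + 1}"
      proof
        fix l assume l: "l \<in> {..<n + 2} - {i}"
        show "l \<in> p ` {..<n + 1}"
        proof (cases "l = n + 1")
          case True
          with l \<delta>(3) show ?thesis by (intro image_eqI[of _ _ i]) (auto simp: p_def)
        next
          case False
          with l show ?thesis by (intro image_eqI[of _ _ l]) (auto simp: p_def)
        qed
      qed
    qed
  qed
  have p_less: "p l < n + 2" if "l < n + 1" for l
    using that by (simp add: p_def)
  have sum_p: "(\<Sum>l<n + 1. \<delta> (p l) * h (p l)) = (\<Sum>l<n + 2. \<delta> l * h l)" for h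
  proof -
    have "(\<Sum>l<n + 1. \<delta> (p l) * h (p l)) = (\<Sum>l\<in>{..<n + 2} - {i}. \<delta> l * h l)"
      by (rule sum.reindex_bij_betw[OF p])
    also have "\<dots> = (\<Sum>l<n + 2. \<delta> l * h l)"
      using \<delta>(3,4) by (simp add: sum_diff1)
    finally show ?thesis .
  qed
  show ?thesis
  proof (intro exI[of _ "\<lambda>l. \<delta> (p l)"] exI[of _ "\<lambda>l. \<beta> (p l)"] conjI allI impI)
    show "0 \<le> \<delta> (p l)" if "l < n + 1" for l
      using \<delta>(1)[OF p_less[OF that]] .
    show "\<exists>i<n + 2. \<beta> (p l) = \<beta> i \<and> (0 < \<delta> (p l) \<longrightarrow> 0 < \<gamma> i)" if "l < n + 1" for l
    proof (intro exI[of _ "p l"] conjI impI)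
      show "0 < \<gamma> (p l)" if "0 < \<delta> (p l)"
        using that \<delta>(2)[OF p_less[OF \<open>l < n + 1\<close>]] nonneg[OF p_less[OF \<open>l < n + 1\<close>]]
        by (cases "\<gamma> (p l) = 0") auto
    qed (use p_less[OF that] in auto)
    show "(\<Sum>l<n + 1. \<delta> (p l)) = (\<Sum>l<n + 2. \<gamma> l)"
      using sum_p[of "\<lambda>_. 1"] \<delta>(5) by simp
    show "(\<Sum>l<n + 1. \<delta> (p l) * a k (\<beta> (p l))) = (\<Sum>l<n + 2. \<gamma> l * a k (\<beta> l))" if "k < n" for k
      using sum_p[of "\<lambda>l. a k (\<beta> l)"] \<delta>(6)[OF that] by simp
    show "(\<Sum>l<n + 1. \<delta> (p l) * \<phi> (\<beta> (p l))) \<le> (\<Sum>l<n + 2. \<gamma> l * \<phi> (\<beta> l))"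
      using sum_p[of "\<lambda>l. \<phi> (\<beta> l)"] \<delta>(7) by simp
  qed
qed

section \<open>Mixtures with a fixed number of atoms\<close>

text \<open>Weights and atoms are indexed by all natural numbers, although only the first \<open>N\<close> count. The set is
then a closed subset of a product space, and compact by Tychonoff's theorem.\<close>

definition mixtures :: "nat \<Rightarrow> 'b set \<Rightarrow> ((nat \<Rightarrow> real) \<times> (nat \<Rightarrow> 'b)) set" where
  "mixtures N S = {(\<gamma>, \<beta>). (\<forall>l. \<gamma> l \<in> {0..1}) \<and> (\<forall>l. \<beta> l \<in> S) \<and> (\<Sum>l<N. \<gamma> l) = 1}"

lemma compact_functions:
  fixes T :: "'i \<Rightarrow> 'b :: topological_space set"
  assumes "\<And>i. compact (T i)"
  shows "compact {f. \<forall>i. f i \<in> T i}"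
proof -
  have "compactin (product_topology (\<lambda>i. euclidean) UNIV) (PiE UNIV T)"
    using assms by (auto simp: compactin_PiE)
  then show ?thesis
    unfolding euclidean_product_topology by (simp add: PiE_UNIV_domain Pi_def)
qed

lemma seq_compact_mixtures:
  fixes S :: "'b :: first_countable_topology set"
  assumes "compact S"
  shows "seq_compact (mixtures N S)"
proof (rule compact_imp_seq_compact)
  have 1: "compact ({\<gamma> :: nat \<Rightarrow> real. \<forall>l. \<gamma> l \<in> {0..1}} \<times> {\<beta>. \<forall>l. \<beta> l \<in> S})"
    by (intro compact_Times compact_functions assms) auto
  have "continuous_on UNIV (\<lambda>p :: (nat \<Rightarrow> real) \<times> (nat \<Rightarrow> 'b). \<Sum>l<N. fst p l)"
    by (intro continuous_on_sum continuous_on_product_then_coordinatewise[OF continuous_on_fst[OF continuous_on_id]])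
  then have 2: "closed {p :: (nat \<Rightarrow> real) \<times> (nat \<Rightarrow> 'b). (\<Sum>l<N. fst p l) = 1}"
    by (intro closed_Collect_eq) auto
  have "mixtures N S = ({\<gamma>. \<forall>l. \<gamma> l \<in> {0..1}} \<times> {\<beta>. \<forall>l. \<beta> l \<in> S}) \<inter> {p. (\<Sum>l<N. fst p l) = 1}"
    by (auto simp: mixtures_def)
  then show "compact (mixtures N S)"
    using compact_Int_closed[OF 1 2] by simp
qed

lemma seq_lsc_average:
  fixes S :: "'b :: first_countable_topology set"
  assumes "seq_lsc S c"
  shows "seq_lsc (mixtures N S) (\<lambda>p. \<Sum>l<N. ennreal (fst p l) * c (snd p l))"
proof (intro seq_lsc_sum seq_lsc_mult finite_lessThan)
  fix l assume "l \<in> {..<N}"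
  show "seq_lsc (mixtures N S) (\<lambda>p. ennreal (fst p l))"
  proof (rule seq_lsc_tendsto)
    fix s and x :: "(nat \<Rightarrow> real) \<times> (nat \<Rightarrow> 'b)" assume s: "s \<longlonglongrightarrow> x"
    have "continuous_on UNIV (\<lambda>p :: (nat \<Rightarrow> real) \<times> (nat \<Rightarrow> 'b). fst p l)"
      by (rule continuous_on_product_then_coordinatewise[OF continuous_on_fst[OF continuous_on_id]])
    from continuous_on_tendsto_compose[OF this s] show "(\<lambda>n. ennreal (fst (s n) l)) \<longlonglongrightarrow> ennreal (fst x l)"
      by (intro tendsto_ennrealI) auto
  qed
  show "seq_lsc (mixtures N S) (\<lambda>p. c (snd p l))"
  proof (rule seq_lsc_compose[OF assms])
    show "continuous_on (mixtures N S) (\<lambda>p. snd p l)"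
      by (rule continuous_on_product_then_coordinatewise[OF continuous_on_snd[OF continuous_on_id]])
    show "(\<lambda>p. snd p l) ` mixtures N S \<subseteq> S"
      by (auto simp: mixtures_def)
  qed
qed

lemma seq_lsc_diff_const:
  assumes "seq_lsc S f"
  shows "seq_lsc S (\<lambda>x. f x - ennreal d)"
proof (rule seq_lscI)
  fix s x assume s: "\<And>n. s n \<in> S" "x \<in> S" "s \<longlonglongrightarrow> x"
  have "f x \<le> liminf (\<lambda>n. f (s n))"
    by (rule seq_lscD[OF assms s])
  also have "\<dots> \<le> liminf (\<lambda>n. ennreal d + (f (s n) - ennreal d))"
    proof (intro Liminf_mono always_eventually allI)
    show "f (s n) \<le> ennreal d + (f (s n) - ennreal d)" for n
      using ennreal_minus_le_iff[of "f (s n)" "ennreal d" "f (s n) - ennreal d"] by simp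
  qed
  also have "\<dots> = ennreal d + liminf (\<lambda>n. f (s n) - ennreal d)"
    by (rule Liminf_const_add) auto
  finally show "f x - ennreal d \<le> liminf (\<lambda>n. f (s n) - ennreal d)"
    by (simp add: ennreal_minus_le_iff)
qed

lemma average_finite:
  fixes \<gamma> :: "nat \<Rightarrow> real"
  assumes "\<And>l. l < N \<Longrightarrow> 0 \<le> \<gamma> l"
  shows "(\<Sum>l<N. ennreal (\<gamma> l) * c (\<beta> l)) < \<infinity> \<longleftrightarrow> (\<forall>l<N. 0 < \<gamma> l \<longrightarrow> c (\<beta> l) < \<infinity>)"
  using assms by (auto simp: ennreal_mult_eq_top_iff less_top[symmetric] ennreal_eq_0_iff not_le not_less)

text \<open>An atom of weight \<open>0\<close> may have infinite cost; it contributes \<open>0\<close> on both sides.\<close>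

lemma average_eq_real:
  fixes \<gamma> :: "nat \<Rightarrow> real"
  assumes "\<And>l. l < N \<Longrightarrow> 0 \<le> \<gamma> l" "\<And>l. l < N \<Longrightarrow> 0 < \<gamma> l \<Longrightarrow> c (\<beta> l) < \<infinity>"
  shows "(\<Sum>l<N. ennreal (\<gamma> l) * c (\<beta> l)) = ennreal (\<Sum>l<N. \<gamma> l * enn2real (c (\<beta> l)))"
proof -
  have "(\<Sum>l<N. ennreal (\<gamma> l) * c (\<beta> l)) = (\<Sum>l<N. ennreal (\<gamma> l * enn2real (c (\<beta> l))))"
  proof (intro sum.cong refl)
    fix l assume l: "l \<in> {..<N}"
    show "ennreal (\<gamma> l) * c (\<beta> l) = ennreal (\<gamma> l * enn2real (c (\<beta> l)))"
    proof (cases "\<gamma> l = 0")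
      case False
      then have "c (\<beta> l) < \<infinity>"
        using assms l by (simp add: less_le)
      then have "c (\<beta> l) = ennreal (enn2real (c (\<beta> l)))"
        by simp
      then show ?thesis
        using assms(1) l by (metis ennreal_mult enn2real_nonneg lessThan_iff)
    qed simp
  qed
  also have "\<dots> = ennreal (\<Sum>l<N. \<gamma> l * enn2real (c (\<beta> l)))"
    using assms(1) by (intro sum_ennreal) simp
  finally show ?thesis .
qed

section \<open>Mixtures with extreme atoms\<close>

definition finite_mixture :: "nat \<Rightarrow> 'b set \<Rightarrow> ('b \<Rightarrow> bool) \<Rightarrow> (nat \<Rightarrow> real) \<Rightarrow> (nat \<Rightarrow> 'b) \<Rightarrow> bool" where
  "finite_mixture N S fin \<gamma> \<beta> \<longleftrightarrow>
     (\<forall>l<N. 0 \<le> \<gamma> l \<and> \<beta> l \<in> S \<and> (0 < \<gamma> l \<longrightarrow> fin (\<beta> l))) \<and> (\<Sum>l<N. \<gamma> l) = 1"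

lemma finite_mixture_extend:
  assumes "finite_mixture N S fin \<gamma> \<beta>"
  obtains \<gamma>' \<beta>' where "(\<gamma>', \<beta>') \<in> mixtures N S" "\<And>l. l < N \<Longrightarrow> \<gamma>' l = \<gamma> l" "\<And>l. l < N \<Longrightarrow> \<beta>' l = \<beta> l"
proof
  have N: "0 < N"
    using assms by (cases N) (auto simp: finite_mixture_def)
  define \<gamma>' where "\<gamma>' l = (if l < N then \<gamma> l else 0)" for l
  define \<beta>' where "\<beta>' l = (if l < N then \<beta> l else \<beta> 0)" for l
  show "\<gamma>' l = \<gamma> l" "\<beta>' l = \<beta> l" if "l < N" for l
    using that by (auto simp: \<gamma>'_def \<beta>'_def)
  have "\<gamma> l \<le> 1" if "l < N" for l
  proof -
    have "\<gamma> l \<le> (\<Sum>l<N. \<gamma> l)"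
      using assms that by (intro member_le_sum) (auto simp: finite_mixture_def)
    then show ?thesis
      using assms by (simp add: finite_mixture_def)
  qed
  then show "(\<gamma>', \<beta>') \<in> mixtures N S"
    using assms N by (auto simp: mixtures_def finite_mixture_def \<gamma>'_def \<beta>'_def)
qed

lemma finite_mixture_if_mixtures:
  assumes "(\<gamma>, \<beta>) \<in> mixtures N S" "\<And>l. l < N \<Longrightarrow> 0 < \<gamma> l \<Longrightarrow> fin (\<beta> l)"
  shows "finite_mixture N S fin \<gamma> \<beta>"
  using assms by (auto simp: mixtures_def finite_mixture_def)

text \<open>The squared distance from the orthant below \<open>d\<close> has gradient \<open>v = max 0 (y - d)\<close> at \<open>y\<close>, up to a
factor. If \<open>y\<close> minimises it on the segment to \<open>z\<close>, then \<open>v\<close> has a nonnegative product with \<open>z - y\<close>.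
But \<open>z\<close> lies on the other side of the hyperplane orthogonal to \<open>v\<close> through \<open>d\<close>, which forces \<open>v = 0\<close>.\<close>

lemma convex_combination_close_to_minimum:
  fixes y z d :: "nat \<Rightarrow> real"
  assumes min: "\<And>t. 0 < t \<Longrightarrow> t < 1 \<Longrightarrow>
      (\<Sum>j\<le>J. (max 0 (y j - d j))\<^sup>2) \<le> (\<Sum>j\<le>J. (max 0 ((1 - t) * y j + t * z j - d j))\<^sup>2)"
    and z: "(\<Sum>j\<le>J. max 0 (y j - d j) * z j) \<le> (\<Sum>j\<le>J. max 0 (y j - d j) * d j)"
    and j: "j \<le> J"
  shows "y j \<le> d j"
proof -
  define v where "v j = max 0 (y j - d j)" for j
  define h where "h j = z j - y j" for j
  have sq: "(max 0 ((1 - t) * y j + t * z j - d j))\<^sup>2 \<le> (v j + t * h j)\<^sup>2" for t j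
  proof -
    have *: "(1 - t) * y j + t * z j - d j = (y j - d j) + t * h j"
      by (simp add: h_def algebra_simps)
    show ?thesis
    proof (cases "0 \<le> y j - d j + t * h j")
      case True
      moreover have "y j - d j + t * h j \<le> v j + t * h j"
        by (simp add: v_def)
      ultimately show ?thesis
        unfolding * by (simp add: power_mono)
    qed (simp add: *)
  qed
  have expand: "(\<Sum>j\<le>J. (v j + t * h j)\<^sup>2) = (\<Sum>j\<le>J. (v j)\<^sup>2) + 2 * t * (\<Sum>j\<le>J. v j * h j) + t\<^sup>2 * (\<Sum>j\<le>J. (h j)\<^sup>2)" for t
    by (simp add: power2_eq_square algebra_simps sum.distrib sum_distrib_left)
  have "0 \<le> 2 * (\<Sum>j\<le>J. v j * h j) + t * (\<Sum>j\<le>J. (h j)\<^sup>2)" if "0 < t" "t < 1" for t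
  proof -
    have "(\<Sum>j\<le>J. (v j)\<^sup>2) \<le> (\<Sum>j\<le>J. (v j + t * h j)\<^sup>2)"
    proof -
      have "(\<Sum>j\<le>J. (v j)\<^sup>2) \<le> (\<Sum>j\<le>J. (max 0 ((1 - t) * y j + t * z j - d j))\<^sup>2)"
        unfolding v_def by (rule min[OF that])
      also have "\<dots> \<le> (\<Sum>j\<le>J. (v j + t * h j)\<^sup>2)"
        by (intro sum_mono sq)
      finally show ?thesis .
    qed
    then have "0 \<le> t * (2 * (\<Sum>j\<le>J. v j * h j) + t * (\<Sum>j\<le>J. (h j)\<^sup>2))"
      unfolding expand by (simp add: power2_eq_square algebra_simps)
    then show ?thesis
      using that by (simp add: zero_le_mult_iff)
  qed
  then have "eventually (\<lambda>t. 0 \<le> 2 * (\<Sum>j\<le>J. v j * h j) + t * (\<Sum>j\<le>J. (h j)\<^sup>2)) (at_right 0)"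
    using eventually_at_right_less[of "0::real"] eventually_at_right[of 0 "1::real"]
    by (auto simp: eventually_at_right intro!: exI[of _ 1])
  moreover have "((\<lambda>t. 2 * (\<Sum>j\<le>J. v j * h j) + t * (\<Sum>j\<le>J. (h j)\<^sup>2)) \<longlongrightarrow> 2 * (\<Sum>j\<le>J. v j * h j) + 0 * (\<Sum>j\<le>J. (h j)\<^sup>2)) (at_right 0)"
    by (intro tendsto_intros)
  ultimately have "0 \<le> 2 * (\<Sum>j\<le>J. v j * h j) + 0 * (\<Sum>j\<le>J. (h j)\<^sup>2)"
    by (intro tendsto_lowerbound) auto
  then have "0 \<le> (\<Sum>j\<le>J. v j * h j)"
    by simp
  also have "(\<Sum>j\<le>J. v j * h j) = (\<Sum>j\<le>J. v j * z j) - (\<Sum>j\<le>J. v j * d j) - (\<Sum>j\<le>J. (v j)\<^sup>2)"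
  proof -
    have "v j * h j = v j * z j - v j * d j - (v j)\<^sup>2" for j
      by (auto simp: v_def h_def max_def power2_eq_square algebra_simps)
    then show ?thesis
      by (simp add: sum_subtractf)
  qed
  finally have "(\<Sum>j\<le>J. (v j)\<^sup>2) \<le> 0"
    using z by (simp add: v_def)
  moreover have "(v j)\<^sup>2 \<le> (\<Sum>j\<le>J. (v j)\<^sup>2)"
    using j by (intro member_le_sum) auto
  ultimately have "(v j)\<^sup>2 \<le> 0"
    by linarith
  then show ?thesis
    by (auto simp: v_def max_def split: if_splits)
qed

text \<open>A theorem of the alternative: the averages that can be attained meet the orthant below \<open>d\<close> unless
some direction \<open>v \<ge> 0\<close> separates them from it. The atoms of a mixture that is closest to the orthant
have finite costs, as the distance is finite somewhere. The number of atoms, \<open>J + 2\<close>, is what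
Caratheodory's theorem allows in dimension \<open>J + 1\<close>, so that a segment from the closest mixture to
another point can be followed without using more atoms.\<close>

lemma dominated_mixture:
  fixes S :: "'b :: first_countable_topology set" and c :: "nat \<Rightarrow> 'b \<Rightarrow> ennreal" and d :: "nat \<Rightarrow> real"
  assumes S: "compact S"
    and lsc: "\<And>j. j \<le> J \<Longrightarrow> seq_lsc S (c j)"
    and d: "\<And>j. j \<le> J \<Longrightarrow> 0 \<le> d j"
    and H: "\<And>v. (\<And>j. j \<le> J \<Longrightarrow> 0 \<le> v j) \<Longrightarrow> \<exists>\<beta>\<in>S. (\<forall>j\<le>J. c j \<beta> < \<infinity>) \<and>
        (\<Sum>j\<le>J. v j * enn2real (c j \<beta>)) \<le> (\<Sum>j\<le>J. v j * d j)"
  shows "\<exists>\<gamma> \<beta>. finite_mixture (J + 2) S (\<lambda>\<beta>. \<forall>j\<le>J. c j \<beta> < \<infinity>) \<gamma> \<beta> \<and>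
    (\<forall>j\<le>J. (\<Sum>l<J + 2. \<gamma> l * enn2real (c j (\<beta> l))) \<le> d j)"
proof -
  let ?N = "J + 2"
  define fin where "fin \<beta> \<longleftrightarrow> (\<forall>j\<le>J. c j \<beta> < \<infinity>)" for \<beta>
  define avg where "avg j p = (\<Sum>l<?N. ennreal (fst p l) * c j (snd p l))" for j p
  define F where "F p = (\<Sum>j\<le>J. (avg j p - ennreal (d j)) * (avg j p - ennreal (d j)))" for p
  have F_lsc: "seq_lsc (mixtures ?N S) F"
    unfolding F_def avg_def
    by (intro seq_lsc_sum seq_lsc_mult seq_lsc_diff_const seq_lsc_average lsc) auto
  have avg_real: "avg j (\<gamma>, \<beta>) = ennreal (\<Sum>l<?N. \<gamma> l * enn2real (c j (\<beta> l)))"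
    if "finite_mixture ?N S fin \<gamma> \<beta>" "j \<le> J" for \<gamma> \<beta> j
    unfolding avg_def fst_conv snd_conv
    using that by (intro average_eq_real) (auto simp: finite_mixture_def fin_def)
  have F_real: "F (\<gamma>, \<beta>) = ennreal (\<Sum>j\<le>J. (max 0 ((\<Sum>l<?N. \<gamma> l * enn2real (c j (\<beta> l))) - d j))\<^sup>2)"
    if *: "finite_mixture ?N S fin \<gamma> \<beta>" for \<gamma> \<beta>
  proof -
    have "F (\<gamma>, \<beta>) = (\<Sum>j\<le>J. ennreal ((max 0 ((\<Sum>l<?N. \<gamma> l * enn2real (c j (\<beta> l))) - d j))\<^sup>2))"
      unfolding F_def
    proof (intro sum.cong refl)
      fix j assume j: "j \<in> {..J}"
      let ?y = "\<Sum>l<?N. \<gamma> l * enn2real (c j (\<beta> l))"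
      have "avg j (\<gamma>, \<beta>) - ennreal (d j) = ennreal (?y - d j)"
        using j d[of j] avg_real[OF *, of j] by (simp add: ennreal_minus)
      also have "\<dots> = ennreal (max 0 (?y - d j))"
        by (simp add: max_def ennreal_neg)
      finally show "(avg j (\<gamma>, \<beta>) - ennreal (d j)) * (avg j (\<gamma>, \<beta>) - ennreal (d j)) = ennreal ((max 0 (?y - d j))\<^sup>2)"
        by (simp add: power2_eq_square ennreal_mult)
    qed
    also have "\<dots> = ennreal (\<Sum>j\<le>J. (max 0 ((\<Sum>l<?N. \<gamma> l * enn2real (c j (\<beta> l))) - d j))\<^sup>2)"
      by (rule sum_ennreal) simp
    finally show ?thesis .
  qed
  obtain \<beta>0 where \<beta>0: "\<beta>0 \<in> S" "fin \<beta>0"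
    using H[of "\<lambda>_. 0"] by (auto simp: fin_def)
  have tw0: "finite_mixture ?N S fin (\<lambda>l. if l = 0 then 1 else 0) (\<lambda>_. \<beta>0)"
    using \<beta>0 by (auto simp: finite_mixture_def sum.delta)
  obtain \<gamma>0' \<beta>0' where p0: "(\<gamma>0', \<beta>0') \<in> mixtures ?N S"
    "\<And>l. l < ?N \<Longrightarrow> \<gamma>0' l = (if l = 0 then 1 else 0)" "\<And>l. l < ?N \<Longrightarrow> \<beta>0' l = \<beta>0"
    using finite_mixture_extend[OF tw0] by blast
  have "mixtures ?N S \<noteq> {}"
    using p0 by auto
  with seq_lsc_attains_min[OF seq_compact_mixtures[OF S] _ F_lsc]
  obtain p where p: "p \<in> mixtures ?N S" "\<And>q. q \<in> mixtures ?N S \<Longrightarrow> F p \<le> F q"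
    by blast
  obtain \<gamma> \<beta> where p_eq: "p = (\<gamma>, \<beta>)"
    by (cases p)
  have "finite_mixture ?N S fin \<gamma>0' \<beta>0'"
    using p0(1) by (rule finite_mixture_if_mixtures) (simp add: p0(3) \<beta>0)
  from F_real[OF this] p(2)[OF p0(1)] have "F p < \<infinity>"
    by (auto simp: le_less_trans)
  have tw: "finite_mixture ?N S fin \<gamma> \<beta>"
  proof (rule finite_mixture_if_mixtures)
    show "(\<gamma>, \<beta>) \<in> mixtures ?N S"
      using p(1) p_eq by simp
    then have nonneg: "0 \<le> \<gamma> l" for l
      by (auto simp: mixtures_def)
    fix l assume l: "l < ?N" "0 < \<gamma> l"
    have "c j (\<beta> l) < \<infinity>" if j: "j \<le> J" for j
    proof -
      have "(avg j p - ennreal (d j)) * (avg j p - ennreal (d j)) \<le> F p"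
        unfolding F_def using j by (intro member_le_sum) auto
      with \<open>F p < \<infinity>\<close> have "(avg j p - ennreal (d j)) * (avg j p - ennreal (d j)) < \<infinity>"
        by (rule le_less_trans[rotated])
      then have "avg j p < \<infinity>"
        by (auto simp: less_top[symmetric] ennreal_mult_eq_top_iff)
      then show ?thesis
        using average_finite[of ?N \<gamma> "c j" \<beta>] nonneg l by (simp add: avg_def p_eq del: sum.lessThan_Suc add_2_eq_Suc')
    qed
    then show "fin (\<beta> l)"
      by (simp add: fin_def)
  qed
  define y where "y j = (\<Sum>l<?N. \<gamma> l * enn2real (c j (\<beta> l)))" for j
  obtain \<beta>1 where \<beta>1: "\<beta>1 \<in> S" "fin \<beta>1"
    "(\<Sum>j\<le>J. max 0 (y j - d j) * enn2real (c j \<beta>1)) \<le> (\<Sum>j\<le>J. max 0 (y j - d j) * d j)"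
    using H[of "\<lambda>j. max 0 (y j - d j)"] by (auto simp: fin_def)
  have "y j \<le> d j" if "j \<le> J" for j
  proof (rule convex_combination_close_to_minimum[OF _ \<beta>1(3) that])
    fix t :: real assume t: "0 < t" "t < 1"
    define \<delta> where "\<delta> l = (if l < ?N then (1 - t) * \<gamma> l else t)" for l
    define \<eta> where "\<eta> l = (if l < ?N then \<beta> l else \<beta>1)" for l
    have sum_split: "(\<Sum>l<J + 1 + 2. \<delta> l * h (\<eta> l)) = (1 - t) * (\<Sum>l<?N. \<gamma> l * h (\<beta> l)) + t * h \<beta>1" for h :: "'b \<Rightarrow> real"
    proof -
      have "(\<Sum>l<J + 1 + 2. \<delta> l * h (\<eta> l)) = (\<Sum>l<?N. \<delta> l * h (\<eta> l)) + \<delta> ?N * h (\<eta> ?N)"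
        by (simp add: numeral_2_eq_2)
      also have "(\<Sum>l<?N. \<delta> l * h (\<eta> l)) = (\<Sum>l<?N. (1 - t) * (\<gamma> l * h (\<beta> l)))"
        by (intro sum.cong) (auto simp: \<delta>_def \<eta>_def)
      finally show ?thesis
        by (simp add: \<delta>_def \<eta>_def sum_distrib_left del: sum.lessThan_Suc)
    qed
    have sum1: "(\<Sum>l<J + 1 + 2. \<delta> l) = 1"
      using sum_split[of "\<lambda>_. 1"] tw by (simp add: finite_mixture_def del: sum.lessThan_Suc)
    have \<delta>0: "0 \<le> \<delta> l" if "l < J + 1 + 2" for l
      using tw t by (auto simp: \<delta>_def finite_mixture_def)
    have \<eta>: "\<eta> l \<in> S" "0 < \<delta> l \<Longrightarrow> fin (\<eta> l)" if "l < J + 1 + 2" for l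
      using tw \<beta>1 t by (auto simp: \<eta>_def \<delta>_def finite_mixture_def zero_less_mult_iff)
    obtain \<gamma>' \<beta>' where gb: "\<And>l. l < J + 1 + 1 \<Longrightarrow> 0 \<le> \<gamma>' l"
      "\<And>l. l < J + 1 + 1 \<Longrightarrow> \<exists>i<J + 1 + 2. \<beta>' l = \<eta> i \<and> (0 < \<gamma>' l \<longrightarrow> 0 < \<delta> i)"
      "(\<Sum>l<J + 1 + 1. \<gamma>' l) = (\<Sum>l<J + 1 + 2. \<delta> l)"
      "\<And>k. k < J + 1 \<Longrightarrow> (\<Sum>l<J + 1 + 1. \<gamma>' l * enn2real (c k (\<beta>' l))) = (\<Sum>l<J + 1 + 2. \<delta> l * enn2real (c k (\<eta> l)))"
      using drop_atom[of "J + 1" \<delta> \<eta> "\<lambda>k b. enn2real (c k b)" "\<lambda>_. 0", OF \<delta>0] by blast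
    have N_eq: "J + 1 + 1 = ?N" by simp
    have tw': "finite_mixture ?N S fin \<gamma>' \<beta>'"
      unfolding finite_mixture_def
    proof (intro conjI allI impI)
      show "(\<Sum>l<?N. \<gamma>' l) = 1"
        using gb(3) sum1 unfolding N_eq by simp
      fix l assume l: "l < ?N"
      show "0 \<le> \<gamma>' l"
        using gb(1) l unfolding N_eq by blast
      obtain i where i: "i < J + 1 + 2" "\<beta>' l = \<eta> i" "0 < \<gamma>' l \<longrightarrow> 0 < \<delta> i"
        using gb(2)[of l] l unfolding N_eq by blast
      show "fin (\<beta>' l)" if "0 < \<gamma>' l"
        using \<eta>[OF i(1)] i that by auto
      show "\<beta>' l \<in> S"
        using \<eta>(1)[OF i(1)] i(2) by simp
    qed
    obtain \<gamma>'' \<beta>'' where q: "(\<gamma>'', \<beta>'') \<in> mixtures ?N S" "\<And>l. l < ?N \<Longrightarrow> \<gamma>'' l = \<gamma>' l" "\<And>l. l < ?N \<Longrightarrow> \<beta>'' l = \<beta>' l"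
      using finite_mixture_extend[OF tw'] by blast
    have tw'': "finite_mixture ?N S fin \<gamma>'' \<beta>''"
      using q(1) by (rule finite_mixture_if_mixtures) (use tw' q(2,3) in \<open>auto simp: finite_mixture_def\<close>)
    have avg'': "(\<Sum>l<?N. \<gamma>'' l * enn2real (c j (\<beta>'' l))) = (1 - t) * y j + t * enn2real (c j \<beta>1)" if "j \<le> J" for j
    proof -
      have "(\<Sum>l<?N. \<gamma>'' l * enn2real (c j (\<beta>'' l))) = (\<Sum>l<?N. \<gamma>' l * enn2real (c j (\<beta>' l)))"
        by (intro sum.cong) (auto simp: q)
      also have "\<dots> = (\<Sum>l<J + 1 + 2. \<delta> l * enn2real (c j (\<eta> l)))"
        using gb(4)[of j] that unfolding N_eq by simp
      finally show ?thesis
        using sum_split[of "\<lambda>b. enn2real (c j b)"] by (simp add: y_def)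
    qed
    have "F (\<gamma>, \<beta>) \<le> F (\<gamma>'', \<beta>'')"
      using p(2)[OF q(1)] p_eq by simp
    then have "(\<Sum>j\<le>J. (max 0 (y j - d j))\<^sup>2) \<le> (\<Sum>j\<le>J. (max 0 ((\<Sum>l<?N. \<gamma>'' l * enn2real (c j (\<beta>'' l))) - d j))\<^sup>2)"
      unfolding F_real[OF tw] F_real[OF tw''] y_def[symmetric]
      by (subst (asm) ennreal_le_iff) (auto intro: sum_nonneg)
    also have "\<dots> = (\<Sum>j\<le>J. (max 0 ((1 - t) * y j + t * enn2real (c j \<beta>1) - d j))\<^sup>2)"
      by (intro sum.cong refl) (simp add: avg'' del: sum.lessThan_Suc add_2_eq_Suc')
    finally show "(\<Sum>j\<le>J. (max 0 (y j - d j))\<^sup>2) \<le> (\<Sum>j\<le>J. (max 0 ((1 - t) * y j + t * enn2real (c j \<beta>1) - d j))\<^sup>2)" .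
  qed
  then show ?thesis
    using tw unfolding fin_def y_def by blast
qed

lemma reciprocal_strictly_convex:
  fixes a b \<rho> :: real
  assumes "0 \<le> a" "0 \<le> b" "0 < \<rho>" "\<rho> < 1"
  shows "1 / (1 + ((1 - \<rho>) * a + \<rho> * b)) \<le> (1 - \<rho>) / (1 + a) + \<rho> / (1 + b)"
    and "a \<noteq> b \<Longrightarrow> 1 / (1 + ((1 - \<rho>) * a + \<rho> * b)) < (1 - \<rho>) / (1 + a) + \<rho> / (1 + b)"
proof -
  define p where "p = 1 + a"
  define q where "q = 1 + b"
  have pq: "0 < p" "0 < q"
    using assms by (auto simp: p_def q_def)
  define m where "m = (1 - \<rho>) * p + \<rho> * q"
  have m: "0 < m"
    unfolding m_def using pq assms by (intro add_pos_pos mult_pos_pos) auto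
  have m_eq: "1 + ((1 - \<rho>) * a + \<rho> * b) = m"
    by (simp add: m_def p_def q_def algebra_simps)
  have "(1 - \<rho>) / p + \<rho> / q - 1 / m = (((1 - \<rho>) * q + \<rho> * p) * m - p * q) / (p * q * m)"
    using pq m by (simp add: field_simps)
  also have "((1 - \<rho>) * q + \<rho> * p) * m - p * q = \<rho> * (1 - \<rho>) * (p - q)\<^sup>2"
    by (simp add: m_def power2_eq_square algebra_simps)
  finally have *: "(1 - \<rho>) / p + \<rho> / q - 1 / m = \<rho> * (1 - \<rho>) * (p - q)\<^sup>2 / (p * q * m)" .
  have "0 \<le> \<rho> * (1 - \<rho>) * (p - q)\<^sup>2 / (p * q * m)"
    using assms pq m by (intro divide_nonneg_pos mult_nonneg_nonneg mult_pos_pos) auto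
  with * show "1 / (1 + ((1 - \<rho>) * a + \<rho> * b)) \<le> (1 - \<rho>) / (1 + a) + \<rho> / (1 + b)"
    unfolding m_eq p_def[symmetric] q_def[symmetric] by linarith
  assume "a \<noteq> b"
  then have "0 < (p - q)\<^sup>2"
    by (simp add: p_def q_def)
  then have "0 < \<rho> * (1 - \<rho>) * (p - q)\<^sup>2 / (p * q * m)"
    using assms pq m by (intro divide_pos_pos mult_pos_pos) auto
  with * show "1 / (1 + ((1 - \<rho>) * a + \<rho> * b)) < (1 - \<rho>) / (1 + a) + \<rho> / (1 + b)"
    unfolding m_eq p_def[symmetric] q_def[symmetric] by linarith
qed

text \<open>A bounded function of the costs that is increasing and strictly concave. Increasing, because it has
to be lower semicontinuous in the point; strictly concave, because splitting an atom that is not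
extreme has to decrease its average.\<close>

definition saturation :: "nat \<Rightarrow> (nat \<Rightarrow> 'b \<Rightarrow> ennreal) \<Rightarrow> 'b \<Rightarrow> ennreal" where
  "saturation J c \<beta> = (\<Sum>j\<le>J. 1 - inverse (1 + c j \<beta>))"

lemma saturation_finite: "saturation J c \<beta> < \<infinity>"
  unfolding saturation_def
  by (auto simp: less_top[symmetric])

lemma inverse_antimono_ennreal:
  fixes x y :: ennreal
  assumes "x \<le> y"
  shows "inverse y \<le> inverse x"
proof (cases "x = 0 \<or> y = top")
  case False
  then obtain a b where "x = ennreal a" "y = ennreal b" "0 < a" "0 \<le> b"
    using assms by (cases x; cases y) (auto simp: order_le_less top_unique)
  moreover from this assms have "a \<le> b"
    by simp
  ultimately show ?thesis
    by (simp add: inverse_ennreal)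
qed auto

lemma seq_lsc_saturation:
  assumes "\<And>j. j \<le> J \<Longrightarrow> seq_lsc S (c j)"
  shows "seq_lsc S (saturation J c)"
proof -
  have "seq_lsc S (\<lambda>\<beta>. \<Sum>j\<le>J. 1 - inverse (1 + c j \<beta>))"
  proof (intro seq_lsc_sum finite_atMost)
    fix j assume "j \<in> {..J}"
    show "seq_lsc S (\<lambda>\<beta>. 1 - inverse (1 + c j \<beta>))"
    proof (rule seq_lsc_mono_compose[where h = "\<lambda>x. 1 - inverse (1 + x)"])
      show "seq_lsc S (c j)"
        using assms \<open>j \<in> {..J}\<close> by simp
      show "continuous_on UNIV (\<lambda>x :: ennreal. 1 - inverse (1 + x))"
        by (intro continuous_on_diff_ennreal continuous_on_inverse_ennreal continuous_on_add_ennreal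
              continuous_on_const continuous_on_id) auto
      show "mono (\<lambda>x :: ennreal. 1 - inverse (1 + x))"
        by (intro monoI ennreal_minus_mono inverse_antimono_ennreal add_left_mono order_refl)
    qed
  qed
  then show ?thesis
    by (simp add: saturation_def[abs_def])
qed

lemma saturation_real:
  assumes "\<forall>j\<le>J. c j \<beta> < \<infinity>"
  shows "enn2real (saturation J c \<beta>) = (\<Sum>j\<le>J. 1 - 1 / (1 + enn2real (c j \<beta>)))"
proof -
  have "saturation J c \<beta> = (\<Sum>j\<le>J. ennreal (1 - 1 / (1 + enn2real (c j \<beta>))))"
    unfolding saturation_def
  proof (intro sum.cong refl)
    fix j assume "j \<in> {..J}"
    then obtain r where r: "0 \<le> r" "c j \<beta> = ennreal r"
      using assms by (cases "c j \<beta>") auto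
    have "1 + c j \<beta> = ennreal (1 + r)"
      using r by simp
    then have "inverse (1 + c j \<beta>) = ennreal (1 / (1 + r))"
      using r(1) by (simp only: inverse_ennreal inverse_eq_divide)
    then have "1 - inverse (1 + c j \<beta>) = ennreal 1 - ennreal (1 / (1 + r))"
      by simp
    also have "\<dots> = ennreal (1 - 1 / (1 + r))"
      using r(1) by (intro ennreal_minus) simp
    finally show "1 - inverse (1 + c j \<beta>) = ennreal (1 - 1 / (1 + enn2real (c j \<beta>)))"
      using r by simp
  qed
  also have "\<dots> = ennreal (\<Sum>j\<le>J. 1 - 1 / (1 + enn2real (c j \<beta>)))"
    by (intro sum_ennreal) (simp add: divide_le_eq_1 add_pos_nonneg)
  finally show ?thesis
    by (simp add: sum_nonneg divide_le_eq_1 add_pos_nonneg)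
qed

lemma saturation_strictly_concave:
  assumes fin: "\<forall>j\<le>J. c j \<beta> < \<infinity>" "\<forall>j\<le>J. c j \<beta>1 < \<infinity>" "\<forall>j\<le>J. c j \<beta>2 < \<infinity>"
    and \<rho>: "0 < \<rho>" "\<rho> < (1::real)"
    and eq: "\<forall>j\<le>J. enn2real (c j \<beta>) = (1 - \<rho>) * enn2real (c j \<beta>1) + \<rho> * enn2real (c j \<beta>2)"
    and j: "j \<le> J" "c j \<beta>1 \<noteq> c j \<beta>"
  shows "(1 - \<rho>) * enn2real (saturation J c \<beta>1) + \<rho> * enn2real (saturation J c \<beta>2)
    < enn2real (saturation J c \<beta>)"
proof -
  let ?r = "\<lambda>j b. enn2real (c j b)"
  have "(1 - \<rho>) * enn2real (saturation J c \<beta>1) + \<rho> * enn2real (saturation J c \<beta>2)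
      = (\<Sum>j\<le>J. 1 - ((1 - \<rho>) / (1 + ?r j \<beta>1) + \<rho> / (1 + ?r j \<beta>2)))"
    unfolding saturation_real[of J c, OF fin(2)] saturation_real[of J c, OF fin(3)] sum_distrib_left sum.distrib[symmetric]
    by (intro sum.cong) (auto simp: algebra_simps)
  also have "\<dots> < (\<Sum>j\<le>J. 1 - 1 / (1 + ?r j \<beta>))"
  proof (rule sum_strict_mono_ex1)
    show "\<forall>j\<in>{..J}. 1 - ((1 - \<rho>) / (1 + ?r j \<beta>1) + \<rho> / (1 + ?r j \<beta>2)) \<le> 1 - 1 / (1 + ?r j \<beta>)"
    proof
      fix j assume "j \<in> {..J}"
      then have *: "?r j \<beta> = (1 - \<rho>) * ?r j \<beta>1 + \<rho> * ?r j \<beta>2"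
        using eq by simp
      show "1 - ((1 - \<rho>) / (1 + ?r j \<beta>1) + \<rho> / (1 + ?r j \<beta>2)) \<le> 1 - 1 / (1 + ?r j \<beta>)"
        unfolding * by (intro diff_left_mono reciprocal_strictly_convex(1) \<rho> enn2real_nonneg)
    qed
    have "?r j \<beta>1 \<noteq> ?r j \<beta>2"
    proof
      assume "?r j \<beta>1 = ?r j \<beta>2"
      then have "?r j \<beta> = ?r j \<beta>1"
      proof -
        have "?r j \<beta> = (1 - \<rho>) * ?r j \<beta>1 + \<rho> * ?r j \<beta>2"
          using eq j(1) by simp
        also have "\<dots> = ?r j \<beta>1"
          unfolding \<open>?r j \<beta>1 = ?r j \<beta>2\<close> by (simp add: algebra_simps)
        finally show ?thesis .
      qed
      then have "c j \<beta> = c j \<beta>1"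
        using fin j(1) by (metis ennreal_enn2real infinity_ennreal_def)
      with j(2) show False by simp
    qed
    have *: "?r j \<beta> = (1 - \<rho>) * ?r j \<beta>1 + \<rho> * ?r j \<beta>2"
      using eq j(1) by simp
    have "1 - ((1 - \<rho>) / (1 + ?r j \<beta>1) + \<rho> / (1 + ?r j \<beta>2)) < 1 - 1 / (1 + ?r j \<beta>)"
      unfolding * by (intro diff_strict_left_mono reciprocal_strictly_convex(2) \<rho> enn2real_nonneg) fact
    then show "\<exists>j\<in>{..J}. 1 - ((1 - \<rho>) / (1 + ?r j \<beta>1) + \<rho> / (1 + ?r j \<beta>2)) < 1 - 1 / (1 + ?r j \<beta>)"
      using j(1) by blast
  qed simp
  also have "\<dots> = enn2real (saturation J c \<beta>)"
    by (rule saturation_real[of J c, OF fin(1), symmetric])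
  finally show ?thesis .
qed

text \<open>This is extremality of the cost vector of \<open>\<beta>\<close> among those that occur in \<open>S\<close>. No closure or convex
hull is involved, because a plan will be split into two explicitly given ones.\<close>

definition extreme_costs :: "nat \<Rightarrow> (nat \<Rightarrow> 'b \<Rightarrow> ennreal) \<Rightarrow> 'b set \<Rightarrow> 'b \<Rightarrow> bool" where
  "extreme_costs J c S \<beta> \<longleftrightarrow>
     (\<forall>\<beta>1\<in>S. \<forall>\<beta>2\<in>S. \<forall>\<rho>. 0 < \<rho> \<longrightarrow> \<rho> < 1 \<longrightarrow> (\<forall>j\<le>J. c j \<beta>1 < \<infinity>) \<longrightarrow> (\<forall>j\<le>J. c j \<beta>2 < \<infinity>) \<longrightarrow>
       (\<forall>j\<le>J. enn2real (c j \<beta>) = (1 - \<rho>) * enn2real (c j \<beta>1) + \<rho> * enn2real (c j \<beta>2)) \<longrightarrow>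
       (\<forall>j\<le>J. c j \<beta>1 = c j \<beta>))"

lemma extreme_costsD:
  assumes "extreme_costs J c S \<beta>" "\<beta>1 \<in> S" "\<beta>2 \<in> S" "0 < \<rho>" "\<rho> < 1"
    "\<forall>j\<le>J. c j \<beta>1 < \<infinity>" "\<forall>j\<le>J. c j \<beta>2 < \<infinity>"
    "\<forall>j\<le>J. enn2real (c j \<beta>) = (1 - \<rho>) * enn2real (c j \<beta>1) + \<rho> * enn2real (c j \<beta>2)"
  shows "\<forall>j\<le>J. c j \<beta>1 = c j \<beta>"
  by (rule assms(1)[unfolded extreme_costs_def, THEN bspec, OF assms(2), THEN bspec, OF assms(3), THEN spec,
        THEN mp, OF assms(4), THEN mp, OF assms(5), THEN mp, OF assms(6), THEN mp, OF assms(7), THEN mp, OF assms(8)])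

text \<open>The multipliers \<open>g\<close> make every point satisfy the Lagrangian inequality with value
\<open>d 0 + \<Sum> g j * d j\<close>, so that a mixture with averages below \<open>d\<close> has it with equality at every atom of
positive weight. Then cost \<open>0\<close> is an affine function of the others on the atoms, and the reduction
works in dimension \<open>J\<close>, with \<open>J + 1\<close> atoms. Minimising the average of \<open>saturation\<close> over such mixtures
makes the atoms extreme: splitting an atom that is not extreme, followed by a reduction to \<open>J + 1\<close>
atoms, would lead to a smaller value.\<close>

theorem extreme_mixture:
  fixes S :: "'b :: first_countable_topology set" and c :: "nat \<Rightarrow> 'b \<Rightarrow> ennreal" and d g :: "nat \<Rightarrow> real"
  assumes S: "compact S"
    and lsc: "\<And>j. j \<le> J \<Longrightarrow> seq_lsc S (c j)"
    and d: "\<And>j. j \<le> J \<Longrightarrow> 0 \<le> d j"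
    and H: "\<And>v. (\<And>j. j \<le> J \<Longrightarrow> 0 \<le> v j) \<Longrightarrow> \<exists>\<beta>\<in>S. (\<forall>j\<le>J. c j \<beta> < \<infinity>) \<and>
        (\<Sum>j\<le>J. v j * enn2real (c j \<beta>)) \<le> (\<Sum>j\<le>J. v j * d j)"
    and g: "\<And>j. j \<in> {1..J} \<Longrightarrow> 0 \<le> g j"
    and w: "\<And>\<beta>. \<beta> \<in> S \<Longrightarrow> \<forall>j\<le>J. c j \<beta> < \<infinity> \<Longrightarrow>
        d 0 + (\<Sum>j=1..J. g j * d j) \<le> enn2real (c 0 \<beta>) + (\<Sum>j=1..J. g j * enn2real (c j \<beta>))"
  shows "\<exists>\<gamma> \<beta>. finite_mixture (J + 1) S (\<lambda>\<beta>. \<forall>j\<le>J. c j \<beta> < \<infinity>) \<gamma> \<beta> \<and>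
    (\<forall>j\<le>J. (\<Sum>l<J + 1. \<gamma> l * enn2real (c j (\<beta> l))) \<le> d j) \<and>
    (\<forall>l<J + 1. 0 < \<gamma> l \<longrightarrow>
       enn2real (c 0 (\<beta> l)) + (\<Sum>j=1..J. g j * enn2real (c j (\<beta> l))) = d 0 + (\<Sum>j=1..J. g j * d j) \<and>
       extreme_costs J c S (\<beta> l))"
proof -
  let ?N = "J + 1"
  define fin where "fin \<beta> \<longleftrightarrow> (\<forall>j\<le>J. c j \<beta> < \<infinity>)" for \<beta>
  define r where "r j \<beta> = enn2real (c j \<beta>)" for j \<beta>
  define lag where "lag \<beta> = r 0 \<beta> + (\<Sum>j=1..J. g j * r j \<beta>)" for \<beta>
  define w0 where "w0 = d 0 + (\<Sum>j=1..J. g j * d j)"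
  define \<phi> where "\<phi> \<beta> = enn2real (saturation J c \<beta>)" for \<beta>
  define feas where "feas N \<gamma> \<beta> \<longleftrightarrow> finite_mixture N S fin \<gamma> \<beta> \<and> (\<forall>j\<le>J. (\<Sum>l<N. \<gamma> l * r j (\<beta> l)) \<le> d j)"
    for N \<gamma> \<beta>
  have sum_lag: "(\<Sum>l<N. \<gamma> l * lag (\<beta> l)) = (\<Sum>l<N. \<gamma> l * r 0 (\<beta> l)) + (\<Sum>j=1..J. g j * (\<Sum>l<N. \<gamma> l * r j (\<beta> l)))"
    for N \<gamma> \<beta>
  proof -
    have "(\<Sum>l<N. \<gamma> l * lag (\<beta> l)) = (\<Sum>l<N. \<gamma> l * r 0 (\<beta> l)) + (\<Sum>l<N. \<Sum>j=1..J. g j * (\<gamma> l * r j (\<beta> l)))"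
      by (simp add: lag_def distrib_left sum.distrib sum_distrib_left mult.left_commute)
    also have "(\<Sum>l<N. \<Sum>j=1..J. g j * (\<gamma> l * r j (\<beta> l))) = (\<Sum>j=1..J. \<Sum>l<N. g j * (\<gamma> l * r j (\<beta> l)))"
      by (rule sum.swap)
    finally show ?thesis
      by (simp add: sum_distrib_left)
  qed
  have tight: "lag (\<beta> l) = w0" if f: "feas N \<gamma> \<beta>" and l: "l < N" "0 < \<gamma> l" for N \<gamma> \<beta> l
  proof -
    have ge: "0 \<le> \<gamma> i * (lag (\<beta> i) - w0)" if "i \<in> {..<N}" for i
    proof (cases "\<gamma> i = 0")
      case False
      then have "fin (\<beta> i)" "\<beta> i \<in> S" "0 \<le> \<gamma> i"
        using f that by (auto simp: feas_def finite_mixture_def less_le)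
      then show ?thesis
        using w[of "\<beta> i"] by (simp add: fin_def lag_def r_def w0_def)
    qed simp
    have "(\<Sum>i<N. \<gamma> i * (lag (\<beta> i) - w0)) = (\<Sum>i<N. \<gamma> i * lag (\<beta> i)) - (\<Sum>i<N. \<gamma> i) * w0"
      by (simp add: algebra_simps sum_subtractf sum_distrib_left)
    also have "(\<Sum>i<N. \<gamma> i) = 1"
      using f by (simp add: feas_def finite_mixture_def)
    also have "(\<Sum>i<N. \<gamma> i * lag (\<beta> i)) \<le> w0"
      unfolding sum_lag w0_def using f g
      by (intro add_mono sum_mono mult_left_mono) (auto simp: feas_def)
    finally have "(\<Sum>i<N. \<gamma> i * (lag (\<beta> i) - w0)) \<le> 0"
      by simp
    then have "(\<Sum>i\<in>{..<N}. \<gamma> i * (lag (\<beta> i) - w0)) = 0"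
      using sum_nonneg[of "{..<N}" "\<lambda>i. \<gamma> i * (lag (\<beta> i) - w0)", OF ge] by simp
    from sum_nonneg_eq_0_iff[THEN iffD1, OF _ ge this] have "\<gamma> l * (lag (\<beta> l) - w0) = 0"
      using l(1) by simp
    then show ?thesis
      using l(2) by simp
  qed
  have average_cost0: "(\<Sum>l<N. \<gamma> l * r 0 (\<beta> l)) = w0 - (\<Sum>j=1..J. g j * (\<Sum>l<N. \<gamma> l * r j (\<beta> l)))"
    if "(\<Sum>l<N. \<gamma> l) = 1" "\<And>l. l < N \<Longrightarrow> \<gamma> l \<noteq> 0 \<Longrightarrow> lag (\<beta> l) = w0" for N \<gamma> \<beta>
  proof -
    have "(\<Sum>l<N. \<gamma> l * lag (\<beta> l)) = (\<Sum>l<N. \<gamma> l * w0)"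
    proof (intro sum.cong refl)
      show "\<gamma> l * lag (\<beta> l) = \<gamma> l * w0" if "l \<in> {..<N}" for l
        using that \<open>\<And>l. l < N \<Longrightarrow> \<gamma> l \<noteq> 0 \<Longrightarrow> lag (\<beta> l) = w0\<close>[of l] by (cases "\<gamma> l = 0") auto
    qed
    also have "\<dots> = w0"
      using that(1) by (simp add: sum_distrib_right[symmetric])
    finally show ?thesis
      unfolding sum_lag by simp
  qed
  have reduce: "\<exists>\<gamma>' \<beta>'. feas (J + 1) \<gamma>' \<beta>' \<and> (\<Sum>l<J + 1. \<gamma>' l * \<phi> (\<beta>' l)) \<le> (\<Sum>l<J + 2. \<gamma> l * \<phi> (\<beta> l))"
    if f: "feas (J + 2) \<gamma> \<beta>" for \<gamma> \<beta>
  proof -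
    have \<gamma>0: "0 \<le> \<gamma> l" if "l < J + 2" for l
      using f that by (auto simp: feas_def finite_mixture_def)
    obtain \<gamma>' \<beta>' where gb: "\<And>l. l < J + 1 \<Longrightarrow> 0 \<le> \<gamma>' l"
      "\<And>l. l < J + 1 \<Longrightarrow> \<exists>i<J + 2. \<beta>' l = \<beta> i \<and> (0 < \<gamma>' l \<longrightarrow> 0 < \<gamma> i)"
      "(\<Sum>l<J + 1. \<gamma>' l) = (\<Sum>l<J + 2. \<gamma> l)"
      "\<And>k. k < J \<Longrightarrow> (\<Sum>l<J + 1. \<gamma>' l * r (Suc k) (\<beta>' l)) = (\<Sum>l<J + 2. \<gamma> l * r (Suc k) (\<beta> l))"
      "(\<Sum>l<J + 1. \<gamma>' l * \<phi> (\<beta>' l)) \<le> (\<Sum>l<J + 2. \<gamma> l * \<phi> (\<beta> l))"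
      using drop_atom[of J \<gamma> \<beta> "\<lambda>k. r (Suc k)" \<phi>, OF \<gamma>0] by blast
    have sum_\<gamma>: "(\<Sum>l<J + 2. \<gamma> l) = 1"
      using f by (simp add: feas_def finite_mixture_def)
    have fm: "finite_mixture (J + 1) S fin \<gamma>' \<beta>'"
      unfolding finite_mixture_def
    proof (intro conjI allI impI)
      show "(\<Sum>l<J + 1. \<gamma>' l) = 1"
        using gb(3) sum_\<gamma> by simp
      fix l assume l: "l < J + 1"
      show "0 \<le> \<gamma>' l"
        using gb(1)[OF l] .
      obtain i where i: "i < J + 2" "\<beta>' l = \<beta> i" "0 < \<gamma>' l \<longrightarrow> 0 < \<gamma> i"
        using gb(2)[OF l] by blast
      have "\<beta> i \<in> S \<and> (0 < \<gamma> i \<longrightarrow> fin (\<beta> i))"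
        using f i(1) by (simp add: feas_def finite_mixture_def)
      then show "\<beta>' l \<in> S" "0 < \<gamma>' l \<Longrightarrow> fin (\<beta>' l)"
        using i by auto
    qed
    have eq: "(\<Sum>l<J + 1. \<gamma>' l * r j (\<beta>' l)) = (\<Sum>l<J + 2. \<gamma> l * r j (\<beta> l))" if "j \<in> {1..J}" for j
    proof -
      obtain k where "j = Suc k" "k < J"
        using \<open>j \<in> {1..J}\<close> by (cases j) auto
      then show ?thesis
        using gb(4)[of k] by (simp only:)
    qed
    have eq0: "(\<Sum>l<J + 1. \<gamma>' l * r 0 (\<beta>' l)) = (\<Sum>l<J + 2. \<gamma> l * r 0 (\<beta> l))"
    proof -
      have "lag (\<beta> l) = w0" if "l < J + 2" "\<gamma> l \<noteq> 0" for l
        using tight[OF f that(1)] \<gamma>0[OF that(1)] that(2) by simp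
      then have 1: "(\<Sum>l<J + 2. \<gamma> l * r 0 (\<beta> l)) = w0 - (\<Sum>j=1..J. g j * (\<Sum>l<J + 2. \<gamma> l * r j (\<beta> l)))"
        by (intro average_cost0 sum_\<gamma>)
      have "lag (\<beta>' l) = w0" if l: "l < J + 1" "\<gamma>' l \<noteq> 0" for l
      proof -
        obtain i where i: "i < J + 2" "\<beta>' l = \<beta> i" "0 < \<gamma>' l \<longrightarrow> 0 < \<gamma> i"
          using gb(2)[OF l(1)] by blast
        then show ?thesis
          using tight[OF f i(1)] gb(1)[OF l(1)] l(2) by simp
      qed
      then have 2: "(\<Sum>l<J + 1. \<gamma>' l * r 0 (\<beta>' l)) = w0 - (\<Sum>j=1..J. g j * (\<Sum>l<J + 1. \<gamma>' l * r j (\<beta>' l)))"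
        by (intro average_cost0 gb(3)[unfolded sum_\<gamma>])
      have "(\<Sum>j=1..J. g j * (\<Sum>l<J + 1. \<gamma>' l * r j (\<beta>' l))) = (\<Sum>j=1..J. g j * (\<Sum>l<J + 2. \<gamma> l * r j (\<beta> l)))"
        by (rule sum.cong[OF refl]) (simp only: eq)
      with 1 2 show ?thesis
        by (simp only:)
    qed
    have "feas (J + 1) \<gamma>' \<beta>'"
      unfolding feas_def
    proof (intro conjI allI impI fm)
      fix j assume j: "j \<le> J"
      have "(\<Sum>l<J + 1. \<gamma>' l * r j (\<beta>' l)) = (\<Sum>l<J + 2. \<gamma> l * r j (\<beta> l))"
        using eq[of j] eq0 j by (cases "j = 0") (simp_all only: atLeastAtMost_iff One_nat_def Suc_le_eq neq0_conv)
      also have "\<dots> \<le> d j"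
        using f j by (simp add: feas_def)
      finally show "(\<Sum>l<J + 1. \<gamma>' l * r j (\<beta>' l)) \<le> d j" .
    qed
    with gb(5) show ?thesis by blast
  qed
  \<comment> \<open>The factor \<open>\<infinity>\<close> turns the constraints into a penalty: \<open>G\<close> is finite exactly at feasible mixtures.\<close>
  define G where "G p = (\<Sum>l<?N. ennreal (fst p l) * saturation J c (snd p l)) +
      top * (\<Sum>j\<le>J. (\<Sum>l<?N. ennreal (fst p l) * c j (snd p l)) - ennreal (d j))" for p
  have G_lsc: "seq_lsc (mixtures ?N S) G"
    unfolding G_def
    by (intro seq_lsc_add seq_lsc_sum seq_lsc_mult seq_lsc_const seq_lsc_diff_const seq_lsc_average lsc
        seq_lsc_saturation) auto
  have avg_real: "(\<Sum>l<?N. ennreal (\<gamma> l) * c j (\<beta> l)) = ennreal (\<Sum>l<?N. \<gamma> l * r j (\<beta> l))"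
    if "finite_mixture ?N S fin \<gamma> \<beta>" "j \<le> J" for \<gamma> \<beta> j
    unfolding r_def
    using that by (intro average_eq_real) (auto simp: finite_mixture_def fin_def)
  have G_feas: "G (\<gamma>, \<beta>) = ennreal (\<Sum>l<?N. \<gamma> l * \<phi> (\<beta> l))" if f: "feas ?N \<gamma> \<beta>" for \<gamma> \<beta>
  proof -
    have fm: "finite_mixture ?N S fin \<gamma> \<beta>"
      using f by (simp add: feas_def)
    have "(\<Sum>l<?N. ennreal (\<gamma> l) * c j (\<beta> l)) - ennreal (d j) = 0" if "j \<le> J" for j
      unfolding avg_real[OF fm that] using f that
      unfolding feas_def by (intro diff_eq_0_ennreal ennreal_leI) auto
    moreover have "(\<Sum>l<?N. ennreal (\<gamma> l) * saturation J c (\<beta> l)) = ennreal (\<Sum>l<?N. \<gamma> l * \<phi> (\<beta> l))"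
      unfolding \<phi>_def using fm
      by (intro average_eq_real) (auto simp: finite_mixture_def saturation_finite[unfolded infinity_ennreal_def])
    ultimately show ?thesis
      by (simp add: G_def del: sum.lessThan_Suc add_Suc_right)
  qed
  obtain \<gamma>A \<beta>A where "feas (J + 2) \<gamma>A \<beta>A"
    using dominated_mixture[of S J c d, OF S lsc d H] unfolding feas_def fin_def[abs_def] r_def by blast
  from reduce[OF this] obtain \<gamma>B \<beta>B where fB: "feas ?N \<gamma>B \<beta>B"
    by blast
  have extend: "\<exists>q\<in>mixtures ?N S. G q = ennreal (\<Sum>l<?N. \<gamma> l * \<phi> (\<beta> l))" if f: "feas ?N \<gamma> \<beta>" for \<gamma> \<beta>
  proof -
    have fm: "finite_mixture ?N S fin \<gamma> \<beta>"
      using f by (simp add: feas_def)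
    from finite_mixture_extend[OF this]
    obtain \<gamma>' \<beta>' where q: "(\<gamma>', \<beta>') \<in> mixtures ?N S" "\<And>l. l < ?N \<Longrightarrow> \<gamma>' l = \<gamma> l" "\<And>l. l < ?N \<Longrightarrow> \<beta>' l = \<beta> l"
      by blast
    have sums: "(\<Sum>l<?N. \<gamma>' l * h (\<beta>' l)) = (\<Sum>l<?N. \<gamma> l * h (\<beta> l))" for h :: "'b \<Rightarrow> real"
      by (intro sum.cong) (auto simp: q)
    have "finite_mixture ?N S fin \<gamma>' \<beta>'"
      using q(1) by (rule finite_mixture_if_mixtures) (use fm q(2,3) in \<open>auto simp: finite_mixture_def\<close>)
    then have "feas ?N \<gamma>' \<beta>'"
      using f unfolding feas_def sums by blast
    from G_feas[OF this] q(1) show ?thesis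
      unfolding sums by blast
  qed
  have "mixtures ?N S \<noteq> {}"
    using extend[OF fB] by blast
  with seq_lsc_attains_min[OF seq_compact_mixtures[OF S] _ G_lsc]
  obtain p where p: "p \<in> mixtures ?N S" "\<And>q. q \<in> mixtures ?N S \<Longrightarrow> G p \<le> G q"
    by blast
  obtain \<gamma> \<beta> where p_eq: "p = (\<gamma>, \<beta>)"
    by (cases p)
  have "G p < \<infinity>"
    using extend[OF fB] p(2) by (metis ennreal_less_top infinity_ennreal_def le_less_trans)
  have nonneg: "0 \<le> \<gamma> l" for l
    using p(1) p_eq by (auto simp: mixtures_def)
  have avg_le: "(\<Sum>l<?N. ennreal (\<gamma> l) * c j (\<beta> l)) \<le> ennreal (d j)" if "j \<le> J" for j
  proof -
    have "top * (\<Sum>j\<le>J. (\<Sum>l<?N. ennreal (\<gamma> l) * c j (\<beta> l)) - ennreal (d j)) \<noteq> top"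
      using \<open>G p < \<infinity>\<close> by (auto simp: G_def p_eq)
    then have "(\<Sum>j\<le>J. (\<Sum>l<?N. ennreal (\<gamma> l) * c j (\<beta> l)) - ennreal (d j)) = 0"
      by (simp only: ennreal_mult_eq_top_iff) auto
    then have "(\<Sum>l<?N. ennreal (\<gamma> l) * c j (\<beta> l)) - ennreal (d j) = 0"
      using that by (simp del: sum.lessThan_Suc add_Suc_right)
    then show ?thesis
      by (simp only: ennreal_minus_eq_0)
  qed
  have fm: "finite_mixture ?N S fin \<gamma> \<beta>"
  proof (rule finite_mixture_if_mixtures)
    show "(\<gamma>, \<beta>) \<in> mixtures ?N S"
      using p(1) p_eq by simp
    fix l assume l: "l < ?N" "0 < \<gamma> l"
    have "c j (\<beta> l) < \<infinity>" if j: "j \<le> J" for j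
    proof -
      have "(\<Sum>l<?N. ennreal (\<gamma> l) * c j (\<beta> l)) < \<infinity>"
        using avg_le[OF j] by (rule le_less_trans) simp
      then show ?thesis
        using average_finite[of ?N \<gamma> "c j" \<beta>] nonneg l by blast
    qed
    then show "fin (\<beta> l)"
      by (simp add: fin_def)
  qed
  have feas: "feas ?N \<gamma> \<beta>"
    unfolding feas_def
  proof (intro conjI allI impI fm)
    fix j assume j: "j \<le> J"
    show "(\<Sum>l<?N. \<gamma> l * r j (\<beta> l)) \<le> d j"
      using avg_le[OF j] d[OF j] unfolding avg_real[OF fm j] by (simp only: ennreal_le_iff)
  qed
  have min: "(\<Sum>l<?N. \<gamma> l * \<phi> (\<beta> l)) \<le> (\<Sum>l<?N. \<gamma>' l * \<phi> (\<beta>' l))" if f: "feas ?N \<gamma>' \<beta>'" for \<gamma>' \<beta>'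
  proof -
    obtain q where "q \<in> mixtures ?N S" "G q = ennreal (\<Sum>l<?N. \<gamma>' l * \<phi> (\<beta>' l))"
      using extend[OF f] by blast
    with p(2) p_eq G_feas[OF feas]
    have "ennreal (\<Sum>l<?N. \<gamma> l * \<phi> (\<beta> l)) \<le> ennreal (\<Sum>l<?N. \<gamma>' l * \<phi> (\<beta>' l))"
      by metis
    moreover have "0 \<le> (\<Sum>l<?N. \<gamma>' l * \<phi> (\<beta>' l))"
      using f by (intro sum_nonneg mult_nonneg_nonneg) (auto simp: feas_def finite_mixture_def \<phi>_def)
    ultimately show ?thesis
      by (simp only: ennreal_le_iff)
  qed
  have extreme: "c j \<beta>1 = c j (\<beta> l)"
    if l: "l < ?N" "0 < \<gamma> l" and b: "\<beta>1 \<in> S" "\<beta>2 \<in> S" "fin \<beta>1" "fin \<beta>2" and \<rho>: "0 < \<rho>" "\<rho> < 1"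
      and eq: "\<forall>j\<le>J. r j (\<beta> l) = (1 - \<rho>) * r j \<beta>1 + \<rho> * r j \<beta>2" and j: "j \<le> J" for l \<beta>1 \<beta>2 \<rho> j
  proof (rule ccontr)
    assume neq: "c j \<beta>1 \<noteq> c j (\<beta> l)"
    have fl: "fin (\<beta> l)"
      using fm l by (simp add: finite_mixture_def)
    have less: "(1 - \<rho>) * \<phi> \<beta>1 + \<rho> * \<phi> \<beta>2 < \<phi> (\<beta> l)"
      unfolding \<phi>_def
      by (rule saturation_strictly_concave[of J c "\<beta> l" \<beta>1 \<beta>2 \<rho> j]) (use \<rho> j neq fl b eq in \<open>auto simp: fin_def r_def\<close>)
    define \<delta> where "\<delta> i = (if i = l then (1 - \<rho>) * \<gamma> l else if i < ?N then \<gamma> i else \<rho> * \<gamma> l)" for i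
    define \<eta> where "\<eta> i = (if i = l then \<beta>1 else if i < ?N then \<beta> i else \<beta>2)" for i
    have split: "(\<Sum>i<J + 2. \<delta> i * h (\<eta> i)) = (\<Sum>i<?N. \<gamma> i * h (\<beta> i)) + \<gamma> l * ((1 - \<rho>) * h \<beta>1 + \<rho> * h \<beta>2 - h (\<beta> l))"
      for h :: "'b \<Rightarrow> real"
    proof -
      have "(\<Sum>i<J + 2. \<delta> i * h (\<eta> i)) = (\<Sum>i<?N. \<delta> i * h (\<eta> i)) + \<delta> ?N * h (\<eta> ?N)"
        by (simp add: numeral_2_eq_2)
      also have "(\<Sum>i<?N. \<delta> i * h (\<eta> i)) = \<delta> l * h (\<eta> l) + (\<Sum>i\<in>{..<?N} - {l}. \<delta> i * h (\<eta> i))"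
        using l(1) by (intro sum.remove) auto
      also have "(\<Sum>i\<in>{..<?N} - {l}. \<delta> i * h (\<eta> i)) = (\<Sum>i\<in>{..<?N} - {l}. \<gamma> i * h (\<beta> i))"
        by (intro sum.cong) (auto simp: \<delta>_def \<eta>_def)
      also have "\<dots> = (\<Sum>i<?N. \<gamma> i * h (\<beta> i)) - \<gamma> l * h (\<beta> l)"
        using l(1) by (subst sum.remove[of "{..<?N}" l]) auto
      finally show ?thesis
        using l(1) by (simp add: \<delta>_def \<eta>_def algebra_simps del: sum.lessThan_Suc add_Suc_right)
    qed
    have "feas (J + 2) \<delta> \<eta>"
      unfolding feas_def finite_mixture_def
    proof (intro conjI allI impI)
      show "(\<Sum>i<J + 2. \<delta> i) = 1"
        using split[of "\<lambda>_. 1"] fm by (simp add: finite_mixture_def del: sum.lessThan_Suc add_Suc_right add_2_eq_Suc')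
      fix i assume i: "i < J + 2"
      show "0 \<le> \<delta> i"
        using \<rho> nonneg by (simp add: \<delta>_def)
      show "\<eta> i \<in> S"
        using b fm by (simp add: \<eta>_def finite_mixture_def)
      show "fin (\<eta> i)" if "0 < \<delta> i"
        using b fm that by (auto simp: \<eta>_def \<delta>_def finite_mixture_def split: if_splits)
    next
      fix j assume j: "j \<le> J"
      have "(\<Sum>i<J + 2. \<delta> i * r j (\<eta> i)) = (\<Sum>i<?N. \<gamma> i * r j (\<beta> i))"
        unfolding split using eq j by simp
      also have "\<dots> \<le> d j"
        using feas j by (simp add: feas_def)
      finally show "(\<Sum>i<J + 2. \<delta> i * r j (\<eta> i)) \<le> d j" .
    qed
    from reduce[OF this] obtain \<gamma>' \<beta>' where f': "feas ?N \<gamma>' \<beta>'"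
      "(\<Sum>l<?N. \<gamma>' l * \<phi> (\<beta>' l)) \<le> (\<Sum>l<J + 2. \<delta> l * \<phi> (\<eta> l))"
      by blast
    have "(\<Sum>l<J + 2. \<delta> l * \<phi> (\<eta> l)) < (\<Sum>l<?N. \<gamma> l * \<phi> (\<beta> l))"
      unfolding split using less l(2) by (simp add: mult_less_0_iff del: sum.lessThan_Suc add_Suc_right)
    with f'(2) min[OF f'(1)] show False
      by linarith
  qed
  show ?thesis
  proof (intro exI[of _ \<gamma>] exI[of _ \<beta>] conjI allI impI)
    show "finite_mixture ?N S (\<lambda>\<beta>. \<forall>j\<le>J. c j \<beta> < \<infinity>) \<gamma> \<beta>"
      using fm by (simp add: fin_def[abs_def])
    show "(\<Sum>l<?N. \<gamma> l * enn2real (c j (\<beta> l))) \<le> d j" if "j \<le> J" for j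
      using feas that by (simp add: feas_def r_def)
    show "enn2real (c 0 (\<beta> l)) + (\<Sum>j=1..J. g j * enn2real (c j (\<beta> l))) = d 0 + (\<Sum>j=1..J. g j * d j)"
      if "l < ?N" "0 < \<gamma> l" for l
      using tight[OF feas that] by (simp add: lag_def r_def w0_def)
    show "extreme_costs J c S (\<beta> l)" if "l < ?N" "0 < \<gamma> l" for l
      unfolding extreme_costs_def
    proof (intro ballI allI impI)
      fix \<beta>1 \<beta>2 \<rho> j
      assume "\<beta>1 \<in> S" "\<beta>2 \<in> S" "0 < \<rho>" "\<rho> < 1" "\<forall>j\<le>J. c j \<beta>1 < \<infinity>" "\<forall>j\<le>J. c j \<beta>2 < \<infinity>"
        "\<forall>j\<le>J. enn2real (c j (\<beta> l)) = (1 - \<rho>) * enn2real (c j \<beta>1) + \<rho> * enn2real (c j \<beta>2)" "j \<le> J"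
      then show "c j \<beta>1 = c j (\<beta> l)"
        using extreme[OF that, of \<beta>1 \<beta>2 \<rho> j] by (simp add: fin_def r_def)
    qed
  qed
qed

section \<open>Plans and their costs\<close>

text \<open>Transition kernels, occupation measures and marginals of balanced measures are all given by their
values on sets, as sums of simpler measures; this passes from sets to functions.\<close>

lemma nn_integral_countable_mixture:
  assumes sets: "\<And>i. sets (N i) = sets M"
    and em: "\<And>A. A \<in> sets M \<Longrightarrow> emeasure M A = (\<Sum>i. a i * emeasure (N i) A)"
    and v: "v \<in> borel_measurable M"
  shows "(\<integral>\<^sup>+x. v x \<partial>M) = (\<Sum>i. a i * (\<integral>\<^sup>+x. v x \<partial>N i) :: ennreal)"
  using v
proof (induction rule: borel_measurable_induct)
  case (cong f g)
  have "(\<integral>\<^sup>+x. g x \<partial>N i) = (\<integral>\<^sup>+x. f x \<partial>N i)" for i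
    using cong(3) sets_eq_imp_space_eq[OF sets] by (intro nn_integral_cong) simp
  moreover have "(\<integral>\<^sup>+x. g x \<partial>M) = (\<integral>\<^sup>+x. f x \<partial>M)"
    using cong(3) by (intro nn_integral_cong) simp
  ultimately show ?case
    using cong(4) by simp
next
  case (set A)
  then show ?case
    using em[OF set] sets by simp
next
  case (mult u c)
  have "u \<in> borel_measurable (N i)" for i
    using mult(2) by (simp add: measurable_cong_sets[OF sets refl])
  with mult show ?case
    by (simp add: nn_integral_cmult mult.left_commute ennreal_suminf_cmult)
next
  case (add u w)
  have "u \<in> borel_measurable M" "w \<in> borel_measurable M"
    using add.hyps by auto
  then have "u \<in> borel_measurable (N i)" "w \<in> borel_measurable (N i)" for i
    by (simp_all add: measurable_cong_sets[OF sets refl])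
  with add show ?case
    by (simp add: nn_integral_add distrib_left suminf_add)
next
  case (seq U)
  have U: "U k \<in> borel_measurable (N i)" for i k
    using seq(1) by (simp add: measurable_cong_sets[OF sets refl])
  have inc: "incseq U"
    by (rule seq.hyps)
  have SUP: "(\<integral>\<^sup>+x. (SUP k. U k) x \<partial>L) = (SUP k. \<integral>\<^sup>+x. U k x \<partial>L)"
    if "\<And>k. U k \<in> borel_measurable L" for L
    unfolding SUP_apply using inc that by (intro nn_integral_monotone_convergence_SUP) auto
  have "(\<integral>\<^sup>+x. (SUP k. U k) x \<partial>M) = (SUP k. \<integral>\<^sup>+x. U k x \<partial>M)"
    by (rule SUP) (rule seq(1))
  also have "\<dots> = (SUP k. \<Sum>i. a i * (\<integral>\<^sup>+x. U k x \<partial>N i))"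
    by (intro SUP_cong refl seq.IH)
  also have "\<dots> = (\<Sum>i. SUP k. a i * (\<integral>\<^sup>+x. U k x \<partial>N i))"
    using inc
    by (intro ennreal_suminf_SUP_eq[symmetric])
       (auto simp: incseq_def le_fun_def intro!: mult_left_mono nn_integral_mono)
  also have "\<dots> = (\<Sum>i. a i * (\<integral>\<^sup>+x. (SUP k. U k) x \<partial>N i))"
    by (simp only: SUP[OF U] SUP_mult_left_ennreal)
  finally show ?case .
qed

text \<open>The probability of not being killed before the impulse of action \<open>b\<close>.\<close>

definition survival :: "('x, 'a) impulse_model \<Rightarrow> ennreal \<times> 'a \<Rightarrow> ennreal" where
  "survival m b = (if fst b = \<infinity> then 0 else ennreal (exp (- disc m * enn2real (fst b))))"

text \<open>At \<open>\<theta> = \<infinity>\<close> this is a default value inside the state space, which saves case distinctions because it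
only ever occurs with the weight \<open>0\<close>.\<close>

definition next_state :: "('x, 'a) impulse_model \<Rightarrow> 'x \<Rightarrow> ennreal \<times> 'a \<Rightarrow> 'x" where
  "next_state m x b = jump m (flow m x (enn2real (fst b))) (snd b)"

primrec plan_state :: "('x, 'a) impulse_model \<Rightarrow> 'x \<Rightarrow> (nat \<Rightarrow> ennreal \<times> 'a) \<Rightarrow> nat \<Rightarrow> 'x" where
  "plan_state m x \<beta> 0 = x"
| "plan_state m x \<beta> (Suc k) = next_state m (plan_state m x \<beta> k) (\<beta> k)"

text \<open>The probability of being alive after the first \<open>k\<close> impulses of a plan.\<close>

primrec weight :: "('x, 'a) impulse_model \<Rightarrow> (nat \<Rightarrow> ennreal \<times> 'a) \<Rightarrow> nat \<Rightarrow> ennreal" where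
  "weight m \<beta> 0 = 1"
| "weight m \<beta> (Suc k) = weight m \<beta> k * survival m (\<beta> k)"

definition plan_cost :: "('x, 'a) impulse_model \<Rightarrow> ('x option \<times> (ennreal \<times> 'a) \<Rightarrow> ennreal) \<Rightarrow>
    'x \<Rightarrow> (nat \<Rightarrow> ennreal \<times> 'a) \<Rightarrow> ennreal" where
  "plan_cost m C x \<beta> = (\<Sum>k. weight m \<beta> k * C (Some (plan_state m x \<beta> k), \<beta> k))"

definition plans :: "('x, 'a) impulse_model \<Rightarrow> (nat \<Rightarrow> ennreal \<times> 'a) set" where
  "plans m = {\<beta>. \<forall>k. \<beta> k \<in> BA m}"

lemma plan_state_add: "plan_state m x \<beta> (n + k) = plan_state m (plan_state m x \<beta> n) (\<lambda>i. \<beta> (n + i)) k"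
  by (induction k) auto

lemma weight_add: "weight m \<beta> (n + k) = weight m \<beta> n * weight m (\<lambda>i. \<beta> (n + i)) k"
  by (induction k) (auto simp: mult.assoc)

lemma plan_cost_split:
  "plan_cost m C x \<beta> = (\<Sum>i<n. weight m \<beta> i * C (Some (plan_state m x \<beta> i), \<beta> i)) +
     weight m \<beta> n * plan_cost m C (plan_state m x \<beta> n) (\<lambda>i. \<beta> (n + i))"
proof -
  let ?f = "\<lambda>k. weight m \<beta> k * C (Some (plan_state m x \<beta> k), \<beta> k)"
  have "plan_cost m C x \<beta> = (\<Sum>k. ?f (k + n)) + (\<Sum>i<n. ?f i)"
    unfolding plan_cost_def by (intro suminf_offset summableI)
  also have "(\<Sum>k. ?f (k + n)) = weight m \<beta> n * plan_cost m C (plan_state m x \<beta> n) (\<lambda>i. \<beta> (n + i))"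
    unfolding plan_cost_def ennreal_suminf_cmult[symmetric]
    by (intro suminf_cong) (simp only: add.commute[of _ n] plan_state_add weight_add mult.assoc)
  finally show ?thesis
    by (simp only: add.commute)
qed

lemma survival_le_1: "0 < disc m \<Longrightarrow> survival m b \<le> 1"
  by (auto simp: survival_def ennreal_le_1)

lemma survival_pos_iff: "0 < survival m b \<longleftrightarrow> fst b \<noteq> \<infinity>"
  by (auto simp: survival_def)

lemma weight_le_1: "0 < disc m \<Longrightarrow> weight m \<beta> k \<le> 1"
proof (induction k)
  case (Suc k)
  then show ?case
    using mult_mono[of "weight m \<beta> k" 1 "survival m (\<beta> k)" 1] survival_le_1[of m "\<beta> k"] by simp
qed simp

text \<open>At \<open>\<theta> = \<infinity>\<close> continuity is the statement that \<open>e\<^sup>-\<^sup>\<alpha>\<^sup>\<theta>\<close> vanishes at infinity, which is why the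
compactification of the time axis is harmless.\<close>

lemma tendsto_survival:
  assumes disc: "0 < disc m" and b: "(b \<longlongrightarrow> b') F"
  shows "((\<lambda>n. survival m (b n)) \<longlongrightarrow> survival m b') F"
proof (cases "fst b' = \<infinity>")
  case False
  then obtain t where t: "0 \<le> t" "fst b' = ennreal t"
    by (cases "fst b'") auto
  have lim: "((\<lambda>n. fst (b n)) \<longlongrightarrow> ennreal t) F"
    using tendsto_fst[OF b] t(2) by simp
  have "((\<lambda>n. ennreal (exp (- disc m * enn2real (fst (b n))))) \<longlongrightarrow> ennreal (exp (- disc m * t))) F"
    using t(1) by (intro tendsto_ennrealI tendsto_exp tendsto_mult tendsto_const tendsto_enn2real lim)
  moreover have "eventually (\<lambda>n. fst (b n) < \<infinity>) F"
    using lim by (rule order_tendstoD(2)) simp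
  then have "eventually (\<lambda>n. ennreal (exp (- disc m * enn2real (fst (b n)))) = survival m (b n)) F"
    by eventually_elim (simp add: survival_def)
  ultimately have "((\<lambda>n. survival m (b n)) \<longlongrightarrow> ennreal (exp (- disc m * t))) F"
    by (rule Lim_transform_eventually)
  then show ?thesis
    using t by (simp add: survival_def)
next
  case True
  show ?thesis
  proof (rule order_tendstoI)
    fix r assume "r < survival m b'"
    then show "eventually (\<lambda>n. r < survival m (b n)) F"
      using True by (simp add: survival_def)
  next
    fix r assume "survival m b' < r"
    then have r: "0 < r"
      using True by (simp add: survival_def)
    have "((\<lambda>t. exp (- disc m * t)) \<longlongrightarrow> 0) at_top"
      using disc by real_asymp
    then have "((\<lambda>t. ennreal (exp (- disc m * t))) \<longlongrightarrow> ennreal 0) at_top"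
      by (rule tendsto_ennrealI)
    then have "eventually (\<lambda>t. ennreal (exp (- disc m * t)) < r) at_top"
      using r by (intro order_tendstoD(2)) auto
    then obtain T where T: "\<And>t. T \<le> t \<Longrightarrow> ennreal (exp (- disc m * t)) < r"
      by (auto simp: eventually_at_top_linorder)
    have "eventually (\<lambda>n. ennreal (max 0 T) < fst (b n)) F"
      using tendsto_fst[OF b] by (rule order_tendstoD(1)) (simp add: True)
    then show "eventually (\<lambda>n. survival m (b n) < r) F"
    proof eventually_elim
      case (elim n)
      show ?case
      proof (cases "fst (b n)")
        case (real t)
        with elim have "max 0 T < t"
          using ennreal_less_iff[of "max 0 T" t] by (simp only: max.cobounded1)
        then have "T \<le> t"
          by simp
        with T real show ?thesis
          by (simp add: survival_def)
      qed (use r in \<open>simp add: survival_def\<close>)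
    qed
  qed
qed

text \<open>The constant \<open>K\<close> bounds all costs of the model, and \<open>\<delta>\<close> is the least price of an impulse.\<close>

locale bounded_impulse_model =
  fixes m :: "('x :: polish_space, 'a :: polish_space) impulse_model" and \<delta> K :: real
  assumes model: "impulse_control_model m"
    and semicont: "semicontinuous_mdp m"
    and \<delta>: "0 < \<delta>" "\<And>x a. x \<in> states m \<Longrightarrow> a \<in> acts m \<Longrightarrow> ennreal \<delta> \<le> icost m 0 x a"
    and K: "0 \<le> K" "\<And>j x. j \<le> ncons m \<Longrightarrow> x \<in> states m \<Longrightarrow> gcost m j x \<le> ennreal K"
      "\<And>j x a. j \<le> ncons m \<Longrightarrow> x \<in> states m \<Longrightarrow> a \<in> acts m \<Longrightarrow> icost m j x a \<le> ennreal K"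
begin

lemma disc_pos: "0 < disc m"
  using model by (simp add: impulse_control_model_def)

lemma acts_nonempty: "acts m \<noteq> {}"
  using model by (simp add: impulse_control_model_def)

lemma flow_in_states:
  assumes "x \<in> states m" "0 \<le> t"
  shows "flow m x t \<in> states m"
proof -
  have "(\<lambda>(x, t). flow m x t) \<in>
       restrict_space borel (states m) \<Otimes>\<^sub>M restrict_space borel {0..} \<rightarrow>\<^sub>M restrict_space borel (states m)"
    using model by (simp add: impulse_control_model_def)
  from measurable_space[OF this, of "(x, t)"] assms show ?thesis
    by (simp add: space_pair_measure space_restrict_space)
qed

lemma jump_in_states:
  assumes "x \<in> states m" "a \<in> acts m"
  shows "jump m x a \<in> states m"
proof -
  have "(\<lambda>(x, a). jump m x a) \<in>
       restrict_space borel (states m) \<Otimes>\<^sub>M restrict_space borel (acts m) \<rightarrow>\<^sub>M restrict_space borel (states m)"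
    using model by (simp add: impulse_control_model_def)
  from measurable_space[OF this, of "(x, a)"] assms show ?thesis
    by (simp add: space_pair_measure space_restrict_space)
qed

lemma next_state_in_states: "x \<in> states m \<Longrightarrow> b \<in> BA m \<Longrightarrow> next_state m x b \<in> states m"
  unfolding next_state_def by (intro jump_in_states flow_in_states) (auto simp: BA_def)

lemma plan_state_in_states: "x \<in> states m \<Longrightarrow> \<beta> \<in> plans m \<Longrightarrow> plan_state m x \<beta> k \<in> states m"
  by (induction k) (auto simp: plans_def intro: next_state_in_states)

lemma Some_in_XD [simp]: "Some x \<in> XD m \<longleftrightarrow> x \<in> states m"
  by (auto simp: XD_def)

lemma Cbar_None [simp]: "Cbar m j (None, b) = 0"
  by (cases b) simp

lemma nn_integral_Qtr:
  assumes x: "x \<in> states m" and b: "b \<in> BA m" and v: "v \<in> borel_measurable (SM m)"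
  shows "(\<integral>\<^sup>+y. v y \<partial>Qtr m (Some x, b)) =
    survival m b * v (Some (next_state m x b)) + (1 - survival m b) * v None"
proof (cases "fst b = \<infinity>")
  case True
  then have "Qtr m (Some x, b) = return (SM m) None"
    by (cases b) simp
  then show ?thesis
    using v True by (simp add: nn_integral_return survival_def)
next
  case False
  define p where "p = exp (- disc m * enn2real (fst b))"
  have p: "0 \<le> p" "p \<le> 1"
    using disc_pos by (auto simp: p_def)
  have s: "survival m b = ennreal p"
    using False by (simp add: survival_def p_def)
  have s': "1 - survival m b = ennreal (1 - p)"
    unfolding s using p by (simp add: ennreal_minus[symmetric])
  define a where "a i = (if i = 0 then ennreal p else if i = 1 then ennreal (1 - p) else 0)" for i :: nat
  define N where "N i = (if i = 0 then return (SM m) (Some (next_state m x b)) else return (SM m) None)" for i :: nat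
  have two: "(\<Sum>i. a i * h i) = ennreal p * h 0 + ennreal (1 - p) * h 1" for h :: "nat \<Rightarrow> ennreal"
  proof -
    have "(\<Sum>i. a i * h i) = (\<Sum>i\<in>{0, 1}. a i * h i)"
      by (rule suminf_finite) (auto simp: a_def)
    then show ?thesis
      by (simp add: a_def)
  qed
  have "(\<integral>\<^sup>+y. v y \<partial>Qtr m (Some x, b)) = (\<Sum>i. a i * (\<integral>\<^sup>+y. v y \<partial>N i))"
  proof (rule nn_integral_countable_mixture)
    show "sets (N i) = sets (Qtr m (Some x, b))" for i
      by (simp add: N_def)
    show "v \<in> borel_measurable (Qtr m (Some x, b))"
      using v by (simp add: measurable_cong_sets[OF sets_Qtr refl])
    fix A assume "A \<in> sets (Qtr m (Some x, b))"
    then have "A \<in> sets (SM m)" by simp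
    then have "emeasure (Qtr m (Some x, b)) A = ennreal p * indicator A (Some (next_state m x b)) + ennreal (1 - p) * indicator A None"
      using emeasure_Qtr[of "fst b" A m x "snd b"] False by (simp add: p_def next_state_def)
    then show "emeasure (Qtr m (Some x, b)) A = (\<Sum>i. a i * emeasure (N i) A)"
      unfolding two using \<open>A \<in> sets (SM m)\<close> by (simp add: N_def)
  qed
  also have "\<dots> = survival m b * v (Some (next_state m x b)) + (1 - survival m b) * v None"
    unfolding two s' unfolding s using v next_state_in_states[OF x b] by (simp add: N_def nn_integral_return)
  finally show ?thesis .
qed

lemma Qtr_None: "Qtr m (None, b) = return (SM m) None"
  by (cases b) simp

lemma Cbar_le:
  assumes "j \<le> ncons m" "x \<in> states m" "b \<in> BA m"
  shows "Cbar m j (Some x, b) \<le> ennreal (K / disc m + K)"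
proof -
  obtain \<theta> a where b: "b = (\<theta>, a)" "a \<in> acts m"
    using assms(3) by (cases b) (auto simp: BA_def)
  have "(\<integral>\<^sup>+t\<in>{t. 0 \<le> t \<and> ennreal t \<le> \<theta>}. ennreal (exp (- disc m * t)) * gcost m j (flow m x t) \<partial>lborel)
      \<le> (\<integral>\<^sup>+t. ennreal (exponential_density (disc m) t) * ennreal (K / disc m) \<partial>lborel)"
  proof (rule nn_integral_mono)
    fix t :: real
    show "ennreal (exp (- disc m * t)) * gcost m j (flow m x t) * indicator {t. 0 \<le> t \<and> ennreal t \<le> \<theta>} t
        \<le> ennreal (exponential_density (disc m) t) * ennreal (K / disc m)"
    proof (cases "0 \<le> t")
      case True
      have "ennreal (exp (- disc m * t)) * gcost m j (flow m x t) \<le> ennreal (exp (- disc m * t)) * ennreal K"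
        using K(2)[OF assms(1) flow_in_states[OF assms(2) True]] by (rule mult_left_mono) simp
      also have "\<dots> = ennreal (exponential_density (disc m) t) * ennreal (K / disc m)"
        using disc_pos K(1) True by (simp add: exponential_density_def ennreal_mult[symmetric] mult.commute)
      finally show ?thesis
        by (auto simp: indicator_def)
    qed simp
  qed
  also have "\<dots> = (\<integral>\<^sup>+t. ennreal (exponential_density (disc m) t) \<partial>lborel) * ennreal (K / disc m)"
    by (rule nn_integral_multc) simp
  also have "(\<integral>\<^sup>+t. ennreal (exponential_density (disc m) t) \<partial>lborel) = 1"
    using prob_space.emeasure_space_1[OF prob_space_exponential_density[OF disc_pos]]
    by (simp add: emeasure_density)
  finally have 1: "(\<integral>\<^sup>+t\<in>{t. 0 \<le> t \<and> ennreal t \<le> \<theta>}. ennreal (exp (- disc m * t)) * gcost m j (flow m x t) \<partial>lborel) \<le> ennreal (K / disc m)"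
    by simp
  have 2: "(if \<theta> = \<infinity> then 0 else ennreal (exp (- disc m * enn2real \<theta>)) * icost m j (flow m x (enn2real \<theta>)) a) \<le> ennreal K"
  proof -
    have "ennreal (exp (- disc m * enn2real \<theta>)) * icost m j (flow m x (enn2real \<theta>)) a \<le> 1 * ennreal K"
      using disc_pos by (intro mult_mono K(3) flow_in_states assms b) (auto simp: ennreal_le_1)
    then show ?thesis by simp
  qed
  show ?thesis
    using add_mono[OF 1 2] K(1) disc_pos by (simp add: b(1))
qed

text \<open>Surviving an action means that an impulse is made and paid for. This is what makes the number of
impulses integrable.\<close>

lemma Cbar0_ge:
  assumes "x \<in> states m" "b \<in> BA m"
  shows "ennreal \<delta> * survival m b \<le> Cbar m 0 (Some x, b)"
proof -
  obtain \<theta> a where b: "b = (\<theta>, a)" "a \<in> acts m"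
    using assms(2) by (cases b) (auto simp: BA_def)
  show ?thesis
  proof (cases "\<theta> = \<infinity>")
    case False
    have "ennreal \<delta> * survival m b = ennreal (exp (- disc m * enn2real \<theta>)) * ennreal \<delta>"
      using False by (simp add: survival_def b mult.commute)
    also have "\<dots> \<le> ennreal (exp (- disc m * enn2real \<theta>)) * icost m 0 (flow m x (enn2real \<theta>)) a"
      by (intro mult_left_mono \<delta>(2) flow_in_states assms b) auto
    finally show ?thesis
      using False by (simp add: b add_increasing)
  qed (simp add: survival_def b)
qed

lemma Cbar_seq_lsc: "j \<le> ncons m \<Longrightarrow> seq_lsc (XD m \<times> BA m) (Cbar m j)"
  using semicont by (intro lsc_on_imp_seq_lsc) (simp add: semicontinuous_mdp_def)

lemma measurable_SBM_if_seq_lsc: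
  assumes "seq_lsc (XD m \<times> BA m) C"
  shows "C \<in> borel_measurable (SBM m)"
  using seq_lsc_measurable[OF assms] by (simp add: measurable_cong_sets[OF sets_SBM_eq_borel refl])

lemma compact_BA: "compact (BA m)"
  using semicont by (simp add: semicontinuous_mdp_def)

lemma BA_nonempty: "BA m \<noteq> {}"
  using acts_nonempty by (auto simp: BA_def)

lemma compact_plans: "compact (plans m)"
  unfolding plans_def by (rule compact_functions) (rule compact_BA)

lemma plans_nonempty: "plans m \<noteq> {}"
proof -
  obtain b where "b \<in> BA m"
    using BA_nonempty by blast
  then have "(\<lambda>_. b) \<in> plans m"
    by (simp add: plans_def)
  then show ?thesis by blast
qed

text \<open>Weak continuity of the kernel is tested on the bounded continuous function \<open>min 1 (dist y)\<close>, where
\<open>y\<close> is the limit and \<open>\<Delta>\<close> gets the value \<open>0\<close>. Its integral is the survival probability times the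
truncated distance of the next state from \<open>y\<close>, and the survival probability stays away from \<open>0\<close>.\<close>

lemma tendsto_next_state:
  assumes x: "\<And>n. x n \<in> states m" "x' \<in> states m" "x \<longlonglongrightarrow> x'"
    and b: "\<And>n. b n \<in> BA m" "b' \<in> BA m" "b \<longlonglongrightarrow> b'" and fin: "fst b' \<noteq> \<infinity>"
  shows "(\<lambda>n. next_state m (x n) (b n)) \<longlonglongrightarrow> next_state m x' b'"
proof -
  define y where "y = next_state m x' b'"
  define u where "u z = (case z of None \<Rightarrow> 0 | Some z \<Rightarrow> min 1 (dist z y))" for z
  have u_cont: "continuous_on (XD m) u"
  proof (rule continuous_on_subset[OF _ subset_UNIV])
    have "continuous_on UNIV (\<lambda>z. min 1 (dist z y))"
      by (intro continuous_intros)
    then have "open ((\<lambda>z. min 1 (dist z y)) -` B)" if "open B" for B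
      using that by (simp add: continuous_on_open_vimage)
    then show "continuous_on UNIV u"
      by (simp add: continuous_on_open_vimage open_option_def u_def vimage_def)
  qed
  have u_None: "u None = 0"
    by (simp add: u_def)
  have u_bounds: "0 \<le> u z" "u z \<le> 1" for z
    by (auto simp: u_def split: option.split)
  then have "bounded (u ` XD m)"
    by (auto simp: bounded_iff intro!: exI[of _ 1])
  with u_cont semicont have cont: "continuous_on (XD m \<times> BA m) (\<lambda>z. \<integral>y. u y \<partial>Qtr m z)"
    by (simp add: semicontinuous_mdp_def)
  have u_meas: "u \<in> borel_measurable (SM m)"
    unfolding SM_def by (intro borel_measurable_continuous_on_restrict u_cont)
  have int_u: "(\<integral>y. u y \<partial>Qtr m (Some x, b)) = enn2real (survival m b) * min 1 (dist (next_state m x b) y)"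
    if "x \<in> states m" "b \<in> BA m" for x b
  proof -
    have "(\<integral>y. u y \<partial>Qtr m (Some x, b)) = enn2real (\<integral>\<^sup>+y. ennreal (u y) \<partial>Qtr m (Some x, b))"
      using u_meas by (intro integral_eq_nn_integral) (auto simp: measurable_cong_sets[OF sets_Qtr refl] u_bounds)
    also have "(\<integral>\<^sup>+y. ennreal (u y) \<partial>Qtr m (Some x, b)) = survival m b * ennreal (u (Some (next_state m x b)))"
      using nn_integral_Qtr[OF that, of "\<lambda>y. ennreal (u y)"] measurable_compose[OF u_meas measurable_ennreal]
      by (simp add: u_None)
    finally show ?thesis
      by (simp add: enn2real_mult u_def)
  qed
  have "(\<lambda>n. (Some (x n), b n)) \<longlonglongrightarrow> (Some x', b')"
    using continuous_on_tendsto_compose[OF continuous_on_Some[of UNIV] x(3)] b(3) by (intro tendsto_Pair) auto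
  then have "(\<lambda>n. \<integral>y. u y \<partial>Qtr m (Some (x n), b n)) \<longlonglongrightarrow> (\<integral>y. u y \<partial>Qtr m (Some x', b'))"
    using x b by (intro continuous_on_tendsto_compose[OF cont]) auto
  then have lim: "(\<lambda>n. enn2real (survival m (b n)) * min 1 (dist (next_state m (x n) (b n)) y)) \<longlonglongrightarrow> 0"
    using int_u x b by (simp add: y_def)
  have surv: "(\<lambda>n. enn2real (survival m (b n))) \<longlonglongrightarrow> enn2real (survival m b')"
  proof (rule tendsto_enn2real)
    have "survival m b' = ennreal (enn2real (survival m b'))"
      using fin by (simp add: survival_def)
    then show "(\<lambda>n. survival m (b n)) \<longlonglongrightarrow> ennreal (enn2real (survival m b'))"
      using tendsto_survival[OF disc_pos b(3)] by simp
  qed simp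
  have pos: "0 < enn2real (survival m b')"
    using fin by (simp add: survival_def)
  have "(\<lambda>n. enn2real (survival m (b n)) * min 1 (dist (next_state m (x n) (b n)) y) / enn2real (survival m (b n))) \<longlonglongrightarrow> 0 / enn2real (survival m b')"
    using pos by (intro tendsto_divide lim surv) auto
  moreover have "eventually (\<lambda>n. 0 < enn2real (survival m (b n))) sequentially"
    using surv pos by (rule order_tendstoD(1))
  then have "eventually (\<lambda>n. enn2real (survival m (b n)) * min 1 (dist (next_state m (x n) (b n)) y) / enn2real (survival m (b n)) = min 1 (dist (next_state m (x n) (b n)) y)) sequentially"
    by eventually_elim simp
  ultimately have min_lim: "(\<lambda>n. min 1 (dist (next_state m (x n) (b n)) y)) \<longlonglongrightarrow> 0"
    by (simp add: tendsto_cong)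
  show ?thesis
    unfolding y_def[symmetric]
  proof (rule tendstoI)
    fix e :: real assume "0 < e"
    then have "eventually (\<lambda>n. min 1 (dist (next_state m (x n) (b n)) y) < min 1 e) sequentially"
      using min_lim by (intro order_tendstoD(2)) auto
    then show "eventually (\<lambda>n. dist (next_state m (x n) (b n)) y < e) sequentially"
      by eventually_elim (auto simp: min_def split: if_splits)
  qed
qed

text \<open>After an action with \<open>\<theta> = \<infinity>\<close> the states of a plan need not depend continuously on it; but then the
weight is \<open>0\<close>.\<close>

lemma tendsto_plan_state_weight:
  assumes x: "\<And>n. x n \<in> states m" "x' \<in> states m" "x \<longlonglongrightarrow> x'"
    and b: "\<And>n. \<beta> n \<in> plans m" "\<beta>' \<in> plans m" "\<beta> \<longlonglongrightarrow> \<beta>'"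
  shows "(\<lambda>n. weight m (\<beta> n) k) \<longlonglongrightarrow> weight m \<beta>' k \<and>
    (0 < weight m \<beta>' k \<longrightarrow> (\<lambda>n. plan_state m (x n) (\<beta> n) k) \<longlonglongrightarrow> plan_state m x' \<beta>' k)"
proof (induction k)
  case 0
  then show ?case using x by simp
next
  case (Suc k)
  have b_k: "(\<lambda>n. \<beta> n k) \<longlonglongrightarrow> \<beta>' k"
    using continuous_on_tendsto_compose[OF continuous_on_product_then_coordinatewise[OF continuous_on_id] b(3), of UNIV] by simp
  have s: "(\<lambda>n. survival m (\<beta> n k)) \<longlonglongrightarrow> survival m (\<beta>' k)"
    by (rule tendsto_survival[OF disc_pos b_k])
  have fin: "weight m \<beta>' k < top" "survival m (\<beta>' k) < top"
    using weight_le_1[OF disc_pos] survival_le_1[OF disc_pos] by (metis ennreal_one_less_top le_less_trans)+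
  have w: "(\<lambda>n. weight m (\<beta> n) (Suc k)) \<longlonglongrightarrow> weight m \<beta>' (Suc k)"
    using Suc s fin by (auto intro!: tendsto_mult_ennreal)
  show ?case
  proof (intro conjI impI w)
    assume "0 < weight m \<beta>' (Suc k)"
    then have "0 < weight m \<beta>' k" "fst (\<beta>' k) \<noteq> \<infinity>"
      using survival_pos_iff[of m "\<beta>' k"] by (auto simp: zero_less_iff_neq_zero)
    then show "(\<lambda>n. plan_state m (x n) (\<beta> n) (Suc k)) \<longlonglongrightarrow> plan_state m x' \<beta>' (Suc k)"
      unfolding plan_state.simps using Suc x b b_k
      by (intro tendsto_next_state plan_state_in_states) (auto simp: plans_def)
  qed
qed

lemma plan_cost_seq_lsc:
  assumes C: "seq_lsc (XD m \<times> BA m) C"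
  shows "seq_lsc (states m \<times> plans m) (\<lambda>p. plan_cost m C (fst p) (snd p))"
  unfolding plan_cost_def
proof (intro seq_lsc_suminf seq_lscI)
  fix k s p assume s: "\<And>n. s n \<in> states m \<times> plans m" "p \<in> states m \<times> plans m" "s \<longlonglongrightarrow> p"
  let ?w = "\<lambda>p. weight m (snd p) k" and ?z = "\<lambda>p. (Some (plan_state m (fst p) (snd p) k), snd p k)"
  have lim: "(\<lambda>n. ?w (s n)) \<longlonglongrightarrow> ?w p" "0 < ?w p \<Longrightarrow> (\<lambda>n. plan_state m (fst (s n)) (snd (s n)) k) \<longlonglongrightarrow> plan_state m (fst p) (snd p) k"
    using tendsto_plan_state_weight[of "\<lambda>n. fst (s n)" "fst p" "\<lambda>n. snd (s n)" "snd p" k] s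
    by (auto simp: tendsto_fst tendsto_snd mem_Times_iff)
  show "?w p * C (?z p) \<le> liminf (\<lambda>n. ?w (s n) * C (?z (s n)))"
  proof (cases "?w p = 0")
    case False
    have "(\<lambda>n. Some (plan_state m (fst (s n)) (snd (s n)) k)) \<longlonglongrightarrow> Some (plan_state m (fst p) (snd p) k)"
      using False by (intro continuous_on_tendsto_compose[OF continuous_on_Some[of UNIV]] lim(2))
        (auto simp: zero_less_iff_neq_zero)
    moreover have "(\<lambda>n. snd (s n) k) \<longlonglongrightarrow> snd p k"
      using continuous_on_tendsto_compose[OF continuous_on_product_then_coordinatewise[OF continuous_on_id] tendsto_snd[OF s(3)], of UNIV] by simp
    ultimately have "(\<lambda>n. ?z (s n)) \<longlonglongrightarrow> ?z p"
      by (rule tendsto_Pair)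
    moreover have "?z q \<in> XD m \<times> BA m" if "q \<in> states m \<times> plans m" for q
      using that plan_state_in_states[of "fst q" "snd q" k] by (auto simp: plans_def)
    ultimately have "C (?z p) \<le> liminf (\<lambda>n. C (?z (s n)))"
      using s by (intro seq_lscD[OF C]) auto
    moreover have "?w p \<le> liminf (\<lambda>n. ?w (s n))"
      using lim_imp_Liminf[OF _ lim(1)] by simp
    ultimately have "?w p * C (?z p) \<le> liminf (\<lambda>n. ?w (s n)) * liminf (\<lambda>n. C (?z (s n)))"
      by (intro mult_mono) auto
    also have "\<dots> \<le> liminf (\<lambda>n. ?w (s n) * C (?z (s n)))"
      by (rule liminf_mult_ennreal)
    finally show ?thesis .
  qed simp
qed

end

section \<open>Measurable selection\<close>

text \<open>Let \<open>C\<^sub>0, C\<^sub>1, \<dots>\<close> be the complements of a countable base. Starting with \<open>A x\<close>, intersect successively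
with each \<open>C\<^sub>n\<close> that meets what has been left so far. By compactness something remains, and any
remaining point \<open>f x\<close> lies in \<open>C\<^sub>n\<close> if and only if \<open>C\<^sub>n\<close> was used. The latter is a measurable
condition on \<open>x\<close>, since it depends on finitely many earlier choices, each of which amounts to
\<open>A x\<close> meeting a closed set.\<close>

lemma measurable_selection:
  fixes A :: "'s \<Rightarrow> 'b :: second_countable_topology set"
  assumes compact: "\<And>x. x \<in> space M \<Longrightarrow> compact (A x)"
    and nonempty: "\<And>x. x \<in> space M \<Longrightarrow> A x \<noteq> {}"
    and hit: "\<And>C. closed C \<Longrightarrow> {x \<in> space M. A x \<inter> C \<noteq> {}} \<in> sets M"
  shows "\<exists>f. f \<in> borel_measurable M \<and> (\<forall>x\<in>space M. f x \<in> A x)"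
proof -
  obtain B :: "'b set set" where B: "countable B" "topological_basis B"
    using ex_countable_basis by blast
  have "B \<noteq> {}"
  proof
    assume "B = {}"
    then have "\<Union>B' \<noteq> (UNIV :: 'b set)" if "B' \<subseteq> B" for B'
      using that by auto
    moreover have "\<exists>B'\<subseteq>B. \<Union>B' = (UNIV :: 'b set)"
      using B(2) open_UNIV unfolding topological_basis_def by blast
    ultimately show False by blast
  qed
  define U where "U = from_nat_into B"
  have U_range: "range U = B"
    unfolding U_def using B(1) \<open>B \<noteq> {}\<close> by (rule range_from_nat_into[rotated])
  have U_open: "open (U n)" for n
    using topological_basis_open[OF B(2)] U_range by blast
  define C where "C n = - U n" for n
  have C_closed: "closed (C n)" for n
    unfolding C_def by (rule closed_Compl) (rule U_open)
  \<comment> \<open>The indices used among the first \<open>n\<close>.\<close>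
  define s where "s x = rec_nat {} (\<lambda>n S. if A x \<inter> (\<Inter>j\<in>insert n S. C j) \<noteq> {} then insert n S else S)" for x
  define P where "P n x \<longleftrightarrow> A x \<inter> (\<Inter>j\<in>insert n (s x n). C j) \<noteq> {}" for n x
  have s_0: "s x 0 = {}" and s_Suc: "s x (Suc n) = (if P n x then insert n (s x n) else s x n)" for x n
    by (simp_all add: s_def P_def)
  have s_eq: "s x n = {j. j < n \<and> P j x}" for x n
    by (induction n) (auto simp: s_0 s_Suc less_Suc_eq)
  define K where "K n x = (\<Inter>j\<in>s x n. C j)" for n x
  have K_nonempty: "A x \<inter> K n x \<noteq> {}" if "x \<in> space M" for x n
  proof (induction n)
    case 0
    then show ?case using nonempty[OF that] by (simp add: K_def s_0)
  next
    case (Suc n)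
    then show ?case by (auto simp: K_def s_Suc P_def)
  qed
  have K_mono: "K n x \<subseteq> K k x" if "k \<le> n" for x n k
    using that by (auto simp: K_def s_eq)
  have "A x \<inter> (\<Inter>n\<in>UNIV. K n x) \<noteq> {}" if x: "x \<in> space M" for x
  proof (rule compact_imp_fip_image[OF compact[OF x]])
    show "closed (K n x)" for n
      unfolding K_def by (intro closed_INT ballI C_closed)
    fix I :: "nat set" assume I: "finite I"
    have "K (Max (insert 0 I)) x \<subseteq> (\<Inter>n\<in>I. K n x)"
      using I by (intro INT_greatest K_mono) auto
    then show "A x \<inter> (\<Inter>n\<in>I. K n x) \<noteq> {}"
      using K_nonempty[OF x, of "Max (insert 0 I)"] by blast
  qed
  then have "\<forall>x\<in>space M. \<exists>y. y \<in> A x \<and> (\<forall>n. y \<in> K n x)"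
    by blast
  then obtain f where f: "\<And>x. x \<in> space M \<Longrightarrow> f x \<in> A x" "\<And>x n. x \<in> space M \<Longrightarrow> f x \<in> K n x"
    by metis
  have f_C: "f x \<in> C n \<longleftrightarrow> P n x" if x: "x \<in> space M" for x n
  proof
    assume "f x \<in> C n"
    then show "P n x"
      using f(1)[OF x] f(2)[OF x, of n] by (auto simp: P_def K_def)
  next
    assume "P n x"
    then show "f x \<in> C n"
      using f(2)[OF x, of "Suc n"] by (auto simp: K_def s_Suc)
  qed
  have P_sets: "{x \<in> space M. P n x} \<in> sets M" for n
  proof (induction n rule: less_induct)
    case (less n)
    have "{x \<in> space M. P n x} = (\<Union>S\<in>Pow {..<n}.
        {x \<in> space M. \<forall>j\<in>{..<n}. j \<in> S \<longleftrightarrow> P j x} \<inter> {x \<in> space M. A x \<inter> (\<Inter>j\<in>insert n S. C j) \<noteq> {}})"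
    proof (intro set_eqI iffI)
      fix x assume "x \<in> {x \<in> space M. P n x}"
      then show "x \<in> (\<Union>S\<in>Pow {..<n}.
        {x \<in> space M. \<forall>j\<in>{..<n}. j \<in> S \<longleftrightarrow> P j x} \<inter> {x \<in> space M. A x \<inter> (\<Inter>j\<in>insert n S. C j) \<noteq> {}})"
        by (intro UN_I[of "s x n"]) (auto simp: P_def[of n] s_eq)
    next
      fix x assume "x \<in> (\<Union>S\<in>Pow {..<n}.
        {x \<in> space M. \<forall>j\<in>{..<n}. j \<in> S \<longleftrightarrow> P j x} \<inter> {x \<in> space M. A x \<inter> (\<Inter>j\<in>insert n S. C j) \<noteq> {}})"
      then obtain S where S: "S \<subseteq> {..<n}" "x \<in> space M" "\<forall>j\<in>{..<n}. j \<in> S \<longleftrightarrow> P j x"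
        "A x \<inter> (\<Inter>j\<in>insert n S. C j) \<noteq> {}"
        by blast
      then have "s x n = S"
        by (auto simp: s_eq)
      with S show "x \<in> {x \<in> space M. P n x}"
        by (simp add: P_def)
    qed
    also have "\<dots> \<in> sets M"
    proof (intro sets.finite_UN sets.Int)
      fix S assume "S \<in> Pow {..<n}"
      have "{x \<in> space M. j \<in> S \<longleftrightarrow> P j x} \<in> sets M" if "j \<in> {..<n}" for j
      proof (cases "j \<in> S")
        case True
        then show ?thesis using less that by simp
      next
        case False
        then have "{x \<in> space M. j \<in> S \<longleftrightarrow> P j x} = space M - {x \<in> space M. P j x}"
          by auto
        then show ?thesis using less that by simp
      qed
      then show "{x \<in> space M. \<forall>j\<in>{..<n}. j \<in> S \<longleftrightarrow> P j x} \<in> sets M"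
        by (intro sets.sets_Collect_finite_All) auto
      show "{x \<in> space M. A x \<inter> (\<Inter>j\<in>insert n S. C j) \<noteq> {}} \<in> sets M"
        by (intro hit closed_INT ballI C_closed)
    qed simp
    finally show ?case .
  qed
  have "f \<in> measurable M (sigma UNIV B)"
  proof (rule measurable_measure_of)
    fix V assume "V \<in> B"
    then obtain n where n: "V = U n"
      using U_range by blast
    have "f -` V \<inter> space M = space M - {x \<in> space M. P n x}"
      using f_C by (auto simp: n C_def)
    then show "f -` V \<inter> space M \<in> sets M"
      using P_sets by simp
  qed auto
  then have "f \<in> borel_measurable M"
    by (simp add: borel_eq_countable_basis[OF B])
  with f(1) show ?thesis by blast
qed

section \<open>The Bellman equation for plans\<close>

lemma plan_Cons: "b \<in> BA m \<Longrightarrow> \<beta> \<in> plans m \<Longrightarrow> case_nat b \<beta> \<in> plans m"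
  by (auto simp: plans_def split: nat.split)

lemma plan_shift: "\<beta> \<in> plans m \<Longrightarrow> (\<lambda>i. \<beta> (n + i)) \<in> plans m"
  by (auto simp: plans_def)

lemma plan_cost_Suc:
  "plan_cost m C x \<beta> = C (Some x, \<beta> 0) + survival m (\<beta> 0) * plan_cost m C (next_state m x (\<beta> 0)) (\<lambda>i. \<beta> (Suc i))"
  using plan_cost_split[of m C x \<beta> 1] by simp

definition plan_value :: "('x, 'a) impulse_model \<Rightarrow> ('x option \<times> (ennreal \<times> 'a) \<Rightarrow> ennreal) \<Rightarrow> 'x \<Rightarrow> ennreal" where
  "plan_value m C x = (INF \<beta>\<in>plans m. plan_cost m C x \<beta>)"

definition action_value :: "('x, 'a) impulse_model \<Rightarrow> ('x option \<times> (ennreal \<times> 'a) \<Rightarrow> ennreal) \<Rightarrow>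
    'x \<Rightarrow> ennreal \<times> 'a \<Rightarrow> ennreal" where
  "action_value m C x b = C (Some x, b) + survival m b * plan_value m C (next_state m x b)"

lemma plan_value_le: "\<beta> \<in> plans m \<Longrightarrow> plan_value m C x \<le> plan_cost m C x \<beta>"
  unfolding plan_value_def by (rule INF_lower)

context bounded_impulse_model
begin

lemma plan_value_attained:
  assumes C: "seq_lsc (XD m \<times> BA m) C" and x: "x \<in> states m"
  shows "\<exists>\<beta>\<in>plans m. plan_cost m C x \<beta> = plan_value m C x"
proof -
  have "seq_lsc (plans m) (\<lambda>\<beta>. plan_cost m C (fst (x, \<beta>)) (snd (x, \<beta>)))"
    using x by (intro seq_lsc_compose[OF plan_cost_seq_lsc[OF C]]) (auto intro!: continuous_intros)
  from seq_lsc_attains_min[OF compact_imp_seq_compact[OF compact_plans] plans_nonempty this]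
  obtain \<beta> where "\<beta> \<in> plans m" "\<forall>\<beta>'\<in>plans m. plan_cost m C x \<beta> \<le> plan_cost m C x \<beta>'"
    by auto
  then show ?thesis
    unfolding plan_value_def by (intro bexI[of _ \<beta>] antisym INF_greatest INF_lower) auto
qed

lemma plan_value_seq_lsc:
  assumes C: "seq_lsc (XD m \<times> BA m) C"
  shows "seq_lsc (states m) (plan_value m C)"
  using seq_lsc_INF_compact[OF compact_plans plans_nonempty plan_cost_seq_lsc[OF C]]
  by (simp add: plan_value_def[abs_def])

text \<open>Prepend the action to an optimal plan for the next state.\<close>

lemma plan_value_le_action_value:
  assumes C: "seq_lsc (XD m \<times> BA m) C" and x: "x \<in> states m" and b: "b \<in> BA m"
  shows "plan_value m C x \<le> action_value m C x b"
proof -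
  obtain \<beta> where \<beta>: "\<beta> \<in> plans m" "plan_cost m C (next_state m x b) \<beta> = plan_value m C (next_state m x b)"
    using plan_value_attained[OF C next_state_in_states[OF x b]] by blast
  have "plan_value m C x \<le> plan_cost m C x (case_nat b \<beta>)"
    by (intro plan_value_le plan_Cons b \<beta>)
  also have "\<dots> = action_value m C x b"
    using \<beta>(2) by (subst plan_cost_Suc) (simp add: action_value_def)
  finally show ?thesis .
qed

lemma action_value_le_plan_cost:
  assumes "\<beta> \<in> plans m"
  shows "action_value m C x (\<beta> 0) \<le> plan_cost m C x \<beta>"
  unfolding action_value_def plan_cost_Suc[of m C x \<beta>]
  using plan_shift[OF assms, of 1] by (intro add_left_mono mult_left_mono plan_value_le) auto

lemma action_value_attained:
  assumes C: "seq_lsc (XD m \<times> BA m) C" and x: "x \<in> states m"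
  shows "\<exists>b\<in>BA m. action_value m C x b = plan_value m C x"
proof -
  obtain \<beta> where \<beta>: "\<beta> \<in> plans m" "plan_cost m C x \<beta> = plan_value m C x"
    using plan_value_attained[OF C x] by blast
  then have "\<beta> 0 \<in> BA m"
    by (simp add: plans_def)
  then show ?thesis
    using action_value_le_plan_cost[OF \<beta>(1), of C x] plan_value_le_action_value[OF C x] \<beta>(2)
    by (intro bexI[of _ "\<beta> 0"] antisym) auto
qed

text \<open>The next state is continuous only where the survival probability is positive; elsewhere the second
summand vanishes.\<close>

lemma action_value_seq_lsc:
  assumes C: "seq_lsc (XD m \<times> BA m) C"
  shows "seq_lsc (states m \<times> BA m) (\<lambda>(x, b). action_value m C x b)"
  unfolding action_value_def case_prod_unfold
proof (rule seq_lsc_add)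
  show "seq_lsc (states m \<times> BA m) (\<lambda>p. C (Some (fst p), snd p))"
    by (rule seq_lsc_compose[OF C])
       (auto intro!: continuous_on_Pair continuous_on_snd continuous_on_id continuous_on_compose2[OF continuous_on_Some[of UNIV]]
          continuous_on_fst)
  show "seq_lsc (states m \<times> BA m) (\<lambda>p. survival m (snd p) * plan_value m C (next_state m (fst p) (snd p)))"
  proof (rule seq_lscI)
    fix s p assume s: "\<And>n. s n \<in> states m \<times> BA m" "p \<in> states m \<times> BA m" "s \<longlonglongrightarrow> p"
    let ?w = "\<lambda>p. survival m (snd p)" and ?y = "\<lambda>p. next_state m (fst p) (snd p)"
    have in_space: "fst (s n) \<in> states m" "snd (s n) \<in> BA m" "fst p \<in> states m" "snd p \<in> BA m" for n
      using s(1)[of n] s(2) by (auto simp: mem_Times_iff)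
    show "?w p * plan_value m C (?y p) \<le> liminf (\<lambda>n. ?w (s n) * plan_value m C (?y (s n)))"
    proof (cases "?w p = 0")
      case False
      then have "fst (snd p) \<noteq> \<infinity>"
        using survival_pos_iff[of m "snd p"] by (auto simp: zero_less_iff_neq_zero)
      then have "(\<lambda>n. ?y (s n)) \<longlonglongrightarrow> ?y p"
        by (intro tendsto_next_state in_space tendsto_fst tendsto_snd s(3))
      then have "plan_value m C (?y p) \<le> liminf (\<lambda>n. plan_value m C (?y (s n)))"
        by (intro seq_lscD[OF plan_value_seq_lsc[OF C]] next_state_in_states in_space)
      moreover have "?w p \<le> liminf (\<lambda>n. ?w (s n))"
        using lim_imp_Liminf[OF _ tendsto_survival[OF disc_pos tendsto_snd[OF s(3)]]] by simp
      ultimately have "?w p * plan_value m C (?y p) \<le> liminf (\<lambda>n. ?w (s n)) * liminf (\<lambda>n. plan_value m C (?y (s n)))"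
        by (intro mult_mono) auto
      also have "\<dots> \<le> liminf (\<lambda>n. ?w (s n) * plan_value m C (?y (s n)))"
        by (rule liminf_mult_ennreal)
      finally show ?thesis .
    qed simp
  qed
qed

text \<open>The sets of optimal actions are compact, and whether such a set meets a closed set can be read off
from the minimum of the action value on the closed set, which is lower semicontinuous in the
state.\<close>

lemma optimal_action_selector:
  assumes C: "seq_lsc (XD m \<times> BA m) C"
  shows "\<exists>f \<in> borel_measurable (restrict_space borel (states m)).
    \<forall>x\<in>states m. f x \<in> BA m \<and> action_value m C x (f x) = plan_value m C x"
proof -
  let ?M = "restrict_space borel (states m)"
  define A where "A x = {b \<in> BA m. action_value m C x b \<le> plan_value m C x}" for x
  have space: "space ?M = states m"
    by (simp add: space_restrict_space)
  have lsc_x: "seq_lsc (BA m) (\<lambda>b. action_value m C x b)" if "x \<in> states m" for x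
  proof -
    have "continuous_on (BA m) (\<lambda>b. (x, b))"
      by (intro continuous_on_Pair continuous_on_const continuous_on_id)
    from seq_lsc_compose[OF action_value_seq_lsc[OF C] this] that show ?thesis
      by auto
  qed
  have "\<exists>f. f \<in> borel_measurable ?M \<and> (\<forall>x\<in>space ?M. f x \<in> A x)"
  proof (rule measurable_selection)
    fix x assume "x \<in> space ?M"
    then have x: "x \<in> states m" by (simp add: space)
    show "A x \<noteq> {}"
      using action_value_attained[OF C x] by (force simp: A_def)
    have "A x = BA m \<inter> closure (A x)"
      unfolding A_def by (rule seq_lsc_sublevel[OF lsc_x[OF x]])
    then show "compact (A x)"
      using compact_Int_closed[OF compact_BA closed_closure[of "A x"]] by simp
  next
    fix D :: "(ennreal \<times> 'a) set" assume D: "closed D"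
    show "{x \<in> space ?M. A x \<inter> D \<noteq> {}} \<in> sets ?M"
    proof (cases "BA m \<inter> D = {}")
      case True
      then have "{x \<in> space ?M. A x \<inter> D \<noteq> {}} = {}"
        by (auto simp: A_def)
      then show ?thesis by (simp only: sets.empty_sets)
    next
      case False
      have cpt: "compact (BA m \<inter> D)"
        using compact_BA D by (rule compact_Int_closed)
      have "seq_lsc (states m \<times> (BA m \<inter> D)) (\<lambda>(x, b). action_value m C x b)"
        by (rule seq_lsc_subset[OF action_value_seq_lsc[OF C]]) auto
      from seq_lsc_INF_compact[OF cpt False this]
      have "seq_lsc (states m) (\<lambda>x. INF b\<in>BA m \<inter> D. action_value m C x b)"
        by simp
      then have [measurable]: "(\<lambda>x. INF b\<in>BA m \<inter> D. action_value m C x b) \<in> borel_measurable ?M"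
        by (rule seq_lsc_measurable)
      have [measurable]: "plan_value m C \<in> borel_measurable ?M"
        by (rule seq_lsc_measurable[OF plan_value_seq_lsc[OF C]])
      have hits: "A x \<inter> D \<noteq> {} \<longleftrightarrow> (INF b\<in>BA m \<inter> D. action_value m C x b) \<le> plan_value m C x" if x: "x \<in> space ?M" for x
      proof
        assume "A x \<inter> D \<noteq> {}"
        then obtain b where b: "b \<in> BA m \<inter> D" "action_value m C x b \<le> plan_value m C x"
          by (auto simp: A_def)
        then show "(INF b\<in>BA m \<inter> D. action_value m C x b) \<le> plan_value m C x"
          by (rule INF_lower2)
      next
        assume le: "(INF b\<in>BA m \<inter> D. action_value m C x b) \<le> plan_value m C x"
        have "seq_lsc (BA m \<inter> D) (\<lambda>b. action_value m C x b)"
          by (rule seq_lsc_subset[OF lsc_x]) (use x in \<open>auto simp: space\<close>)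
        from seq_lsc_attains_min[OF compact_imp_seq_compact[OF cpt] False this]
        obtain b where b: "b \<in> BA m \<inter> D" "\<And>b'. b' \<in> BA m \<inter> D \<Longrightarrow> action_value m C x b \<le> action_value m C x b'"
          by blast
        from b(2) have "action_value m C x b \<le> (INF b\<in>BA m \<inter> D. action_value m C x b)"
          by (rule INF_greatest)
        with le b(1) show "A x \<inter> D \<noteq> {}"
          by (auto simp: A_def intro: order_trans)
      qed
      have "{x \<in> space ?M. A x \<inter> D \<noteq> {}} =
          {x \<in> space ?M. (INF b\<in>BA m \<inter> D. action_value m C x b) \<le> plan_value m C x}"
        by (intro Collect_cong conj_cong refl hits)
      also have "\<dots> \<in> sets ?M"
        by measurable
      finally show ?thesis .
    qed
  qed
  then obtain f where f: "f \<in> borel_measurable ?M" "\<And>x. x \<in> states m \<Longrightarrow> f x \<in> A x"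
    by (auto simp: space)
  then show ?thesis
    using plan_value_le_action_value[OF C]
    by (intro bexI[of _ f] ballI conjI antisym) (simp_all add: A_def)
qed

end

section \<open>Laws of trajectories\<close>

lemma (in Ionescu_Tulcea) CI_initial_segment: "CI {0..<k} = C 0 k (\<lambda>_. undefined)"
proof (rule measure_eqI)
  have undef: "(\<lambda>_. undefined) \<in> space (PiM {0..<0} M)"
    by (simp add: space_PiM)
  show "sets (CI {0..<k}) = sets (C 0 k (\<lambda>_. undefined))"
    using sets_C[OF undef, of k] by (simp add: CI_def)
  fix X assume "X \<in> sets (CI {0..<k})"
  then have X: "X \<in> sets (PiM {0..<k} M)"
    by (simp add: CI_def)
  then have "PF.emb {0..<k} {0..<k} X = X"
    using sets.sets_into_space[OF X] by (intro prod_emb_id) (simp add: space_PiM)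
  then show "emeasure (CI {0..<k}) X = emeasure (C 0 k (\<lambda>_. undefined)) X"
    using emeasure_CI[of "{0..<k}" k X] X by simp
qed

lemma (in Ionescu_Tulcea) nn_integral_lim_restrict:
  assumes h: "h \<in> borel_measurable (PiM {0..<k} M)"
  shows "(\<integral>\<^sup>+\<omega>. h (restrict \<omega> {0..<k}) \<partial>PF.lim) = (\<integral>\<^sup>+\<omega>. h \<omega> \<partial>C 0 k (\<lambda>_. undefined))"
proof -
  have "(\<lambda>\<omega>. restrict \<omega> {0..<k}) \<in> PF.lim \<rightarrow>\<^sub>M PiM {0..<k} M"
    unfolding measurable_cong_sets[OF PF.sets_lim refl] by (rule measurable_restrict_subset) simp
  moreover have "h \<in> borel_measurable (distr PF.lim (PiM {0..<k} M) (\<lambda>\<omega>. restrict \<omega> {0..<k}))"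
    using h by simp
  ultimately have "(\<integral>\<^sup>+\<omega>. h \<omega> \<partial>distr PF.lim (PiM {0..<k} M) (\<lambda>\<omega>. restrict \<omega> {0..<k})) =
      (\<integral>\<^sup>+\<omega>. h (restrict \<omega> {0..<k}) \<partial>PF.lim)"
    by (rule nn_integral_distr)
  then show ?thesis
    using distr_lim[of "{0..<k}"] by (simp add: CI_initial_segment)
qed

lemma (in Ionescu_Tulcea) nn_integral_lim_coordinate:
  assumes u: "u \<in> borel_measurable (M n)"
  shows "(\<integral>\<^sup>+\<omega>. u (\<omega> n) \<partial>PF.lim) = (\<integral>\<^sup>+\<omega>. (\<integral>\<^sup>+z. u z \<partial>P n (restrict \<omega> {0..<n})) \<partial>PF.lim)"
proof -
  let ?u = "\<lambda>\<omega>. u (\<omega> n)"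
  have undef: "(\<lambda>_. undefined) \<in> space (PiM {0..<0} M)"
    by (simp add: space_PiM)
  have u': "?u \<in> borel_measurable (PiM {0..<Suc n} M)"
    by (rule measurable_compose[OF measurable_component_singleton[of n "{0..<Suc n}" M] u]) simp
  have "(\<integral>\<^sup>+\<omega>. u (\<omega> n) \<partial>PF.lim) = (\<integral>\<^sup>+\<omega>. ?u (restrict \<omega> {0..<Suc n}) \<partial>PF.lim)"
    by simp
  also have "\<dots> = (\<integral>\<^sup>+\<omega>. ?u \<omega> \<partial>C 0 (Suc n) (\<lambda>_. undefined))"
    by (rule nn_integral_lim_restrict[OF u'])
  also have "\<dots> = (\<integral>\<^sup>+\<omega>. (\<integral>\<^sup>+\<omega>'. ?u \<omega>' \<partial>eP n \<omega>) \<partial>C 0 n (\<lambda>_. undefined))"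
  proof -
    have "eP n \<in> C 0 n (\<lambda>_. undefined) \<rightarrow>\<^sub>M subprob_algebra (PiM {0..<Suc n} M)"
      by (subst measurable_cong_sets[OF sets_C[OF undef] refl]) (use measurable_eP[of n] in simp)
    from nn_integral_bind[OF u' this] show ?thesis
      by simp
  qed
  also have "\<dots> = (\<integral>\<^sup>+\<omega>. (\<integral>\<^sup>+z. u z \<partial>P n \<omega>) \<partial>C 0 n (\<lambda>_. undefined))"
    using space_C[OF undef, of n] by (intro nn_integral_cong) (simp add: nn_integral_eP[OF _ u'])
  also have "\<dots> = (\<integral>\<^sup>+\<omega>. (\<integral>\<^sup>+z. u z \<partial>P n (restrict \<omega> {0..<n})) \<partial>PF.lim)"
    by (rule nn_integral_lim_restrict[symmetric])
       (rule measurable_compose[OF P nn_integral_measurable_subprob_algebra[OF u]])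
  finally show ?thesis .
qed

lemma sets_law [simp]:
  assumes "impulse_control_model m" "\<pi> \<in> strategies m" "x \<in> XD m"
  shows "sets (law m \<pi> x) = sets (\<Pi>\<^sub>M i\<in>UNIV. SBM m)"
proof -
  interpret Ionescu_Tulcea "step m \<pi> x" "\<lambda>_. SBM m"
    by (rule Ionescu_Tulcea_step) fact+
  show ?thesis unfolding law_def by simp
qed

lemma nn_integral_step:
  assumes m: "impulse_control_model m" and \<pi>: "\<pi> \<in> strategies m" and x: "x \<in> XD m"
    and \<omega>: "\<omega> \<in> space (\<Pi>\<^sub>M i\<in>{0..<n}. SBM m)" and u: "u \<in> borel_measurable (SBM m)"
  shows "(\<integral>\<^sup>+z. u z \<partial>step m \<pi> x n \<omega>) =
    (\<integral>\<^sup>+y. (\<integral>\<^sup>+b. u (y, b) \<partial>\<pi> n (\<omega>, y)) \<partial>(if n = 0 then return (SM m) x else Qtr m (\<omega> (n - 1))))"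
proof -
  let ?F = "if n = 0 then return (SM m) x else Qtr m (\<omega> (n - 1))"
  have pi: "\<pi> n \<in> (\<Pi>\<^sub>M i\<in>{0..<n}. SBM m) \<Otimes>\<^sub>M SM m \<rightarrow>\<^sub>M prob_algebra (BM m)"
    using \<pi> by (simp add: strategies_def HM_def)
  have pi': "(\<lambda>y. \<pi> n (\<omega>, y)) \<in> SM m \<rightarrow>\<^sub>M prob_algebra (BM m)"
    using \<omega> by (intro measurable_compose[OF measurable_Pair1' pi])
  have ret: "(\<lambda>(y, b). return (SBM m) (y, b)) \<in> SM m \<Otimes>\<^sub>M BM m \<rightarrow>\<^sub>M prob_algebra (SBM m)"
    unfolding SBM_def by simp
  have kernel: "(\<lambda>y. \<pi> n (\<omega>, y) \<bind> (\<lambda>b. return (SBM m) (y, b))) \<in> SM m \<rightarrow>\<^sub>M prob_algebra (SBM m)"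
    by (rule measurable_bind_prob_space2[OF pi' ret])
  have sets_F: "sets ?F = sets (SM m)"
    by simp
  have "(\<integral>\<^sup>+z. u z \<partial>step m \<pi> x n \<omega>) = (\<integral>\<^sup>+y. (\<integral>\<^sup>+z. u z \<partial>(\<pi> n (\<omega>, y) \<bind> (\<lambda>b. return (SBM m) (y, b)))) \<partial>?F)"
    unfolding step_def
    by (rule nn_integral_bind[OF u]) (use measurable_prob_algebraD[OF kernel] in \<open>simp add: measurable_cong_sets[OF sets_F refl]\<close>)
  also have "\<dots> = (\<integral>\<^sup>+y. (\<integral>\<^sup>+b. u (y, b) \<partial>\<pi> n (\<omega>, y)) \<partial>?F)"
  proof (rule nn_integral_cong)
    fix y assume "y \<in> space ?F"
    then have y: "y \<in> XD m"
      using sets_eq_imp_space_eq[OF sets_F] by simp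
    then have "\<pi> n (\<omega>, y) \<in> space (prob_algebra (BM m))"
      using measurable_space[OF pi'] by simp
    then have sets_pi: "sets (\<pi> n (\<omega>, y)) = sets (BM m)"
      by (simp add: space_prob_algebra)
    have "(\<lambda>b. (y, b)) \<in> BM m \<rightarrow>\<^sub>M SBM m"
      unfolding SBM_def using y by (intro measurable_Pair1') simp
    then have "(\<lambda>b. return (SBM m) (y, b)) \<in> BM m \<rightarrow>\<^sub>M subprob_algebra (SBM m)"
      by (rule measurable_compose[OF _ return_measurable])
    then have "(\<integral>\<^sup>+z. u z \<partial>(\<pi> n (\<omega>, y) \<bind> (\<lambda>b. return (SBM m) (y, b)))) = (\<integral>\<^sup>+b. (\<integral>\<^sup>+z. u z \<partial>return (SBM m) (y, b)) \<partial>\<pi> n (\<omega>, y))"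
      by (intro nn_integral_bind[OF u]) (simp add: measurable_cong_sets[OF sets_pi refl])
    also have "\<dots> = (\<integral>\<^sup>+b. u (y, b) \<partial>\<pi> n (\<omega>, y))"
      using y sets_eq_imp_space_eq[OF sets_pi] u by (intro nn_integral_cong nn_integral_return) auto
    finally show "(\<integral>\<^sup>+z. u z \<partial>(\<pi> n (\<omega>, y) \<bind> (\<lambda>b. return (SBM m) (y, b)))) = (\<integral>\<^sup>+b. u (y, b) \<partial>\<pi> n (\<omega>, y))" .
  qed
  finally show ?thesis .
qed

text \<open>The conditional law of the \<open>n\<close>-th coordinate, written with the kernel and the strategy. Together with
linearity, all that is used about laws of strategies follows from it.\<close>

lemma nn_integral_law:
  assumes m: "impulse_control_model m" and \<pi>: "\<pi> \<in> strategies m" and x: "x \<in> XD m"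
    and u: "u \<in> borel_measurable (SBM m)"
  shows "(\<integral>\<^sup>+\<omega>. u (\<omega> n) \<partial>law m \<pi> x) =
    (\<integral>\<^sup>+\<omega>. (\<integral>\<^sup>+y. (\<integral>\<^sup>+b. u (y, b) \<partial>\<pi> n (restrict \<omega> {0..<n}, y))
      \<partial>(if n = 0 then return (SM m) x else Qtr m (\<omega> (n - 1)))) \<partial>law m \<pi> x)"
proof -
  interpret Ionescu_Tulcea "step m \<pi> x" "\<lambda>_. SBM m"
    by (rule Ionescu_Tulcea_step) fact+
  have "(\<integral>\<^sup>+\<omega>. u (\<omega> n) \<partial>law m \<pi> x) = (\<integral>\<^sup>+\<omega>. (\<integral>\<^sup>+z. u z \<partial>step m \<pi> x n (restrict \<omega> {0..<n})) \<partial>law m \<pi> x)"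
    unfolding law_def by (rule nn_integral_lim_coordinate[OF u])
  also have "\<dots> = (\<integral>\<^sup>+\<omega>. (\<integral>\<^sup>+y. (\<integral>\<^sup>+b. u (y, b) \<partial>\<pi> n (restrict \<omega> {0..<n}, y))
      \<partial>(if n = 0 then return (SM m) x else Qtr m (\<omega> (n - 1)))) \<partial>law m \<pi> x)"
  proof (rule nn_integral_cong)
    fix \<omega> assume "\<omega> \<in> space (law m \<pi> x)"
    then have "\<omega> \<in> space (\<Pi>\<^sub>M i\<in>UNIV. SBM m)"
      using sets_eq_imp_space_eq[OF sets_law[OF m \<pi> x]] by simp
    then have "restrict \<omega> {0..<n} \<in> space (\<Pi>\<^sub>M i\<in>{0..<n}. SBM m)"
      by (auto simp: space_PiM)
    from nn_integral_step[OF m \<pi> x this u] show "(\<integral>\<^sup>+z. u z \<partial>step m \<pi> x n (restrict \<omega> {0..<n})) =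
        (\<integral>\<^sup>+y. (\<integral>\<^sup>+b. u (y, b) \<partial>\<pi> n (restrict \<omega> {0..<n}, y)) \<partial>(if n = 0 then return (SM m) x else Qtr m (\<omega> (n - 1))))"
      by (cases n) simp_all
  qed
  finally show ?thesis .
qed

lemma law_coordinate_in_space:
  assumes m: "impulse_control_model m" and \<pi>: "\<pi> \<in> strategies m" and x: "x \<in> XD m"
    and "\<omega> \<in> space (law m \<pi> x)"
  shows "\<omega> n \<in> XD m \<times> BA m"
  using assms(4) unfolding sets_eq_imp_space_eq[OF sets_law[OF m \<pi> x]] by (auto simp: space_PiM)

lemma measurable_law_coordinate:
  assumes m: "impulse_control_model m" and \<pi>: "\<pi> \<in> strategies m" and x: "x \<in> XD m"
  shows "(\<lambda>\<omega>. \<omega> n) \<in> law m \<pi> x \<rightarrow>\<^sub>M SBM m"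
  unfolding measurable_cong_sets[OF sets_law[OF m \<pi> x] refl] by (rule measurable_component_singleton) simp

lemma prob_strategy:
  assumes \<pi>: "\<pi> \<in> strategies m" and "\<omega> \<in> space (\<Pi>\<^sub>M i\<in>{0..<n}. SBM m)" "y \<in> XD m"
  shows "emeasure (\<pi> n (\<omega>, y)) (space (\<pi> n (\<omega>, y))) = 1" "sets (\<pi> n (\<omega>, y)) = sets (BM m)"
proof -
  have "\<pi> n \<in> HM m n \<rightarrow>\<^sub>M prob_algebra (BM m)"
    using \<pi> by (simp add: strategies_def)
  from measurable_space[OF this, of "(\<omega>, y)"] assms
  have "\<pi> n (\<omega>, y) \<in> space (prob_algebra (BM m))"
    by (simp add: HM_def space_pair_measure)
  then show "emeasure (\<pi> n (\<omega>, y)) (space (\<pi> n (\<omega>, y))) = 1" "sets (\<pi> n (\<omega>, y)) = sets (BM m)"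
    by (auto simp: space_prob_algebra prob_space.emeasure_space_1)
qed

lemma restrict_history_in_space:
  assumes m: "impulse_control_model m" and \<pi>: "\<pi> \<in> strategies m" and x: "x \<in> XD m"
    and "\<omega> \<in> space (law m \<pi> x)"
  shows "restrict \<omega> {0..<n} \<in> space (\<Pi>\<^sub>M i\<in>{0..<n}. SBM m)"
  using law_coordinate_in_space[OF assms] by (auto simp: space_PiM)

lemma nn_integral_law_state:
  assumes m: "impulse_control_model m" and \<pi>: "\<pi> \<in> strategies m" and x: "x \<in> XD m"
    and v: "v \<in> borel_measurable (SM m)"
  shows "(\<integral>\<^sup>+\<omega>. v (fst (\<omega> n)) \<partial>law m \<pi> x) =
    (\<integral>\<^sup>+\<omega>. (\<integral>\<^sup>+y. v y \<partial>(if n = 0 then return (SM m) x else Qtr m (\<omega> (n - 1)))) \<partial>law m \<pi> x)"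
proof -
  have "(\<lambda>z. v (fst z)) \<in> borel_measurable (SBM m)"
    unfolding SBM_def by (rule measurable_compose[OF measurable_fst v])
  from nn_integral_law[OF m \<pi> x this, of n]
  have "(\<integral>\<^sup>+\<omega>. v (fst (\<omega> n)) \<partial>law m \<pi> x) =
    (\<integral>\<^sup>+\<omega>. (\<integral>\<^sup>+y. (\<integral>\<^sup>+b. v y \<partial>\<pi> n (restrict \<omega> {0..<n}, y))
      \<partial>(if n = 0 then return (SM m) x else Qtr m (\<omega> (n - 1)))) \<partial>law m \<pi> x)"
    by simp
  also have "\<dots> = (\<integral>\<^sup>+\<omega>. (\<integral>\<^sup>+y. v y \<partial>(if n = 0 then return (SM m) x else Qtr m (\<omega> (n - 1)))) \<partial>law m \<pi> x)"
  proof (intro nn_integral_cong)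
    fix \<omega> y assume \<omega>: "\<omega> \<in> space (law m \<pi> x)"
      and "y \<in> space (if n = 0 then return (SM m) x else Qtr m (\<omega> (n - 1)))"
    then have "y \<in> XD m"
      by (simp split: if_splits)
    from prob_strategy(1)[OF \<pi> restrict_history_in_space[OF m \<pi> x \<omega>] this]
    show "(\<integral>\<^sup>+b. v y \<partial>\<pi> n (restrict \<omega> {0..<n}, y)) = v y"
      by simp
  qed
  finally show ?thesis .
qed

lemma prob_space_law:
  assumes m: "impulse_control_model m" and \<pi>: "\<pi> \<in> strategies m" and x: "x \<in> XD m"
  shows "prob_space (law m \<pi> x)"
proof -
  interpret Ionescu_Tulcea "step m \<pi> x" "\<lambda>_. SBM m"
    by (rule Ionescu_Tulcea_step) fact+
  interpret CI: prob_space "CI {}"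
    by (rule PF.prob_space_P) auto
  have "(\<lambda>\<omega>. restrict \<omega> {}) \<in> PF.lim \<rightarrow>\<^sub>M PiM {} (\<lambda>_. SBM m)"
    unfolding measurable_cong_sets[OF PF.sets_lim refl] by (rule measurable_restrict_subset) simp
  moreover have "prob_space (distr PF.lim (PiM {} (\<lambda>_. SBM m)) (\<lambda>\<omega>. restrict \<omega> {}))"
    using distr_lim[of "{}"] CI.prob_space_axioms by simp
  ultimately show ?thesis
    unfolding law_def by (rule prob_space_distrD)
qed

lemma nn_integral_law_initial:
  assumes m: "impulse_control_model m" and \<pi>: "\<pi> \<in> strategies m" and x: "x \<in> XD m"
    and v: "v \<in> borel_measurable (SM m)"
  shows "(\<integral>\<^sup>+\<omega>. v (fst (\<omega> 0)) \<partial>law m \<pi> x) = v x"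
  unfolding nn_integral_law_state[OF assms]
  using x v prob_space.emeasure_space_1[OF prob_space_law[OF m \<pi> x]] by (simp add: nn_integral_return)

lemma nn_integral_law_Suc:
  assumes m: "impulse_control_model m" and \<pi>: "\<pi> \<in> strategies m" and x: "x \<in> XD m"
    and v: "v \<in> borel_measurable (SM m)"
  shows "(\<integral>\<^sup>+\<omega>. v (fst (\<omega> (Suc n))) \<partial>law m \<pi> x) = (\<integral>\<^sup>+\<omega>. (\<integral>\<^sup>+y. v y \<partial>Qtr m (\<omega> n)) \<partial>law m \<pi> x)"
  unfolding nn_integral_law_state[OF assms] by simp

text \<open>If a strategy only looks at the present state, integrating out the action leaves a function of the
state, whose integral is determined by the same conditional law.\<close>

lemma nn_integral_law_Markov:
  assumes m: "impulse_control_model m" and \<pi>: "\<pi> \<in> strategies m" and x: "x \<in> XD m"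
    and \<kappa>: "\<kappa> \<in> SM m \<rightarrow>\<^sub>M prob_algebra (BM m)" and \<pi>_eq: "\<And>\<omega> y. \<pi> n (\<omega>, y) = \<kappa> y"
    and u: "u \<in> borel_measurable (SBM m)"
  shows "(\<integral>\<^sup>+\<omega>. u (\<omega> n) \<partial>law m \<pi> x) = (\<integral>\<^sup>+\<omega>. (\<integral>\<^sup>+b. u (fst (\<omega> n), b) \<partial>\<kappa> (fst (\<omega> n))) \<partial>law m \<pi> x)"
proof -
  have "(\<lambda>(y, b). u (y, b)) \<in> borel_measurable (SM m \<Otimes>\<^sub>M BM m)"
    using u by (simp add: SBM_def)
  from nn_integral_measurable_subprob_algebra2[OF this measurable_prob_algebraD[OF \<kappa>]]
  have "(\<lambda>y. \<integral>\<^sup>+b. u (y, b) \<partial>\<kappa> y) \<in> borel_measurable (SM m)" .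
  from nn_integral_law_state[OF m \<pi> x this, of n] nn_integral_law[OF m \<pi> x u, of n] show ?thesis
    by (simp add: \<pi>_eq)
qed

lemma nn_integral_law_stationary:
  assumes m: "impulse_control_model m" and f: "f \<in> det_stationary m" and x: "x \<in> XD m"
    and u: "u \<in> borel_measurable (SBM m)"
  shows "(\<integral>\<^sup>+\<omega>. u (\<omega> n) \<partial>law m (stat m f) x) = (\<integral>\<^sup>+\<omega>. u (fst (\<omega> n), f (fst (\<omega> n))) \<partial>law m (stat m f) x)"
proof -
  have f': "f \<in> SM m \<rightarrow>\<^sub>M BM m"
    using f by (simp add: det_stationary_def)
  then have \<kappa>: "(\<lambda>y. return (BM m) (f y)) \<in> SM m \<rightarrow>\<^sub>M prob_algebra (BM m)"
    by (rule measurable_compose[OF _ measurable_return_prob_space])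
  have "(\<integral>\<^sup>+\<omega>. u (\<omega> n) \<partial>law m (stat m f) x) =
      (\<integral>\<^sup>+\<omega>. (\<integral>\<^sup>+b. u (fst (\<omega> n), b) \<partial>return (BM m) (f (fst (\<omega> n)))) \<partial>law m (stat m f) x)"
    by (rule nn_integral_law_Markov[OF m stat_in_strategies[OF f] x \<kappa> _ u]) (simp add: stat_def)
  also have "\<dots> = (\<integral>\<^sup>+\<omega>. u (fst (\<omega> n), f (fst (\<omega> n))) \<partial>law m (stat m f) x)"
  proof (intro nn_integral_cong)
    fix \<omega> assume "\<omega> \<in> space (law m (stat m f) x)"
    then have y: "fst (\<omega> n) \<in> XD m"
      using law_coordinate_in_space[OF m stat_in_strategies[OF f] x, of \<omega> n] by (auto simp: mem_Times_iff)
    have "(\<lambda>b. u (fst (\<omega> n), b)) \<in> borel_measurable (BM m)"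
      using y by (intro measurable_compose[OF measurable_Pair1' u[unfolded SBM_def]]) simp
    then show "(\<integral>\<^sup>+b. u (fst (\<omega> n), b) \<partial>return (BM m) (f (fst (\<omega> n)))) = u (fst (\<omega> n), f (fst (\<omega> n)))"
      using measurable_space[OF f'] y by (intro nn_integral_return) auto
  qed
  finally show ?thesis .
qed

lemma sets_occ: "sets (occ m x \<pi>) = sets (SBM m)"
  using sets.sigma_sets_eq[of "SBM m"] sets.space_closed[of "SBM m"] by (simp add: occ_def)

lemma nn_integral_occ:
  assumes m: "impulse_control_model m" and \<pi>: "\<pi> \<in> strategies m" and x: "x \<in> XD m"
    and u: "u \<in> borel_measurable (SBM m)"
  shows "(\<integral>\<^sup>+z. u z \<partial>occ m x \<pi>) = (\<Sum>n. \<integral>\<^sup>+\<omega>. u (\<omega> n) \<partial>law m \<pi> x)"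
proof -
  note [measurable] = measurable_law_coordinate[OF m \<pi> x]
  have "(\<integral>\<^sup>+z. u z \<partial>occ m x \<pi>) = (\<Sum>n. 1 * (\<integral>\<^sup>+z. u z \<partial>distr (law m \<pi> x) (SBM m) (\<lambda>\<omega>. \<omega> n)))"
  proof (rule nn_integral_countable_mixture)
    show "sets (distr (law m \<pi> x) (SBM m) (\<lambda>\<omega>. \<omega> n)) = sets (occ m x \<pi>)" for n
      by (simp add: sets_occ)
    show "u \<in> borel_measurable (occ m x \<pi>)"
      using u by (simp add: measurable_cong_sets[OF sets_occ refl])
    fix A assume "A \<in> sets (occ m x \<pi>)"
    then have A[measurable]: "A \<in> sets (SBM m)"
      by (simp add: sets_occ)
    have "emeasure (occ m x \<pi>) A = (\<Sum>n. \<integral>\<^sup>+\<omega>. indicator A (\<omega> n) \<partial>law m \<pi> x)"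
      unfolding emeasure_occ[OF m \<pi> x A] by (rule nn_integral_suminf) measurable
    also have "\<dots> = (\<Sum>n. emeasure (distr (law m \<pi> x) (SBM m) (\<lambda>\<omega>. \<omega> n)) A)"
    proof (intro suminf_cong)
      fix n
      have "emeasure (distr (law m \<pi> x) (SBM m) (\<lambda>\<omega>. \<omega> n)) A = (\<integral>\<^sup>+z. indicator A z \<partial>distr (law m \<pi> x) (SBM m) (\<lambda>\<omega>. \<omega> n))"
        by (rule nn_integral_indicator[symmetric]) simp
      also have "\<dots> = (\<integral>\<^sup>+\<omega>. indicator A (\<omega> n) \<partial>law m \<pi> x)"
        by (rule nn_integral_distr[OF measurable_law_coordinate[OF m \<pi> x]]) simp
      finally show "(\<integral>\<^sup>+\<omega>. indicator A (\<omega> n) \<partial>law m \<pi> x) = emeasure (distr (law m \<pi> x) (SBM m) (\<lambda>\<omega>. \<omega> n)) A"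
        by simp
    qed
    finally show "emeasure (occ m x \<pi>) A = (\<Sum>n. 1 * emeasure (distr (law m \<pi> x) (SBM m) (\<lambda>\<omega>. \<omega> n)) A)"
      by simp
  qed
  also have "\<dots> = (\<Sum>n. \<integral>\<^sup>+\<omega>. u (\<omega> n) \<partial>law m \<pi> x)"
    using u by (simp add: nn_integral_distr)
  finally show ?thesis .
qed

lemma val_eq_sum:
  assumes m: "impulse_control_model m" and \<pi>: "\<pi> \<in> strategies m" and x: "x \<in> XD m"
    and C: "C \<in> borel_measurable (SBM m)"
  shows "val m x \<pi> C = (\<Sum>n. \<integral>\<^sup>+\<omega>. C (\<omega> n) \<partial>law m \<pi> x)"
  unfolding val_def
  by (intro nn_integral_suminf measurable_compose[OF measurable_law_coordinate[OF m \<pi> x] C])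

lemma val_eq_occ:
  assumes m: "impulse_control_model m" and \<pi>: "\<pi> \<in> strategies m" and x: "x \<in> XD m"
    and C: "C \<in> borel_measurable (SBM m)"
  shows "val m x \<pi> C = (\<integral>\<^sup>+z. C z \<partial>occ m x \<pi>)"
  unfolding val_eq_sum[OF assms] nn_integral_occ[OF assms] ..

section \<open>Stationary strategies follow plans\<close>

text \<open>Under a stationary strategy the process follows one fixed plan until it is killed.\<close>

primrec closed_loop_state :: "('x, 'a) impulse_model \<Rightarrow> ('x option \<Rightarrow> ennreal \<times> 'a) \<Rightarrow> 'x \<Rightarrow> nat \<Rightarrow> 'x" where
  "closed_loop_state m f x 0 = x"
| "closed_loop_state m f x (Suc k) = next_state m (closed_loop_state m f x k) (f (Some (closed_loop_state m f x k)))"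

definition closed_loop :: "('x, 'a) impulse_model \<Rightarrow> ('x option \<Rightarrow> ennreal \<times> 'a) \<Rightarrow> 'x \<Rightarrow> nat \<Rightarrow> ennreal \<times> 'a" where
  "closed_loop m f x k = f (Some (closed_loop_state m f x k))"

lemma plan_state_closed_loop: "plan_state m x (closed_loop m f x) k = closed_loop_state m f x k"
  by (induction k) (auto simp: closed_loop_def)

definition weighted_cost :: "('x, 'a) impulse_model \<Rightarrow> (nat \<Rightarrow> real) \<Rightarrow> 'x option \<times> (ennreal \<times> 'a) \<Rightarrow> ennreal" where
  "weighted_cost m g z = Cbar m 0 z + (\<Sum>j=1..ncons m. ennreal (g j) * Cbar m j z)"

lemma sets_VBM_eq: "sets (occV m x \<pi>) = sets (VBM m)"
  unfolding occV_def VBM_def by (rule sets_restrict_space_cong) (rule sets_occ)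

context bounded_impulse_model
begin

lemma det_stationary_in_BA: "f \<in> det_stationary m \<Longrightarrow> y \<in> XD m \<Longrightarrow> f y \<in> BA m"
  using measurable_space[of f "SM m" "BM m" y] by (simp add: det_stationary_def)

lemma closed_loop_state_in_states:
  "f \<in> det_stationary m \<Longrightarrow> x \<in> states m \<Longrightarrow> closed_loop_state m f x k \<in> states m"
  by (induction k) (auto intro!: next_state_in_states det_stationary_in_BA)

lemma closed_loop_in_plans: "f \<in> det_stationary m \<Longrightarrow> x \<in> states m \<Longrightarrow> closed_loop m f x \<in> plans m"
  by (auto simp: plans_def closed_loop_def intro!: det_stationary_in_BA closed_loop_state_in_states)

lemma nn_integral_Qtr_measurable:
  assumes "v \<in> borel_measurable (SM m)"
  shows "(\<lambda>z. \<integral>\<^sup>+y. v y \<partial>Qtr m z) \<in> borel_measurable (SBM m)"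
  by (rule measurable_compose[OF measurable_prob_algebraD[OF measurable_Qtr[OF model]]
        nn_integral_measurable_subprob_algebra[OF assms]])

lemma nn_integral_Qtr_None:
  assumes "v \<in> borel_measurable (SM m)"
  shows "(\<integral>\<^sup>+y. v y \<partial>Qtr m (None, b)) = v None"
  using assms by (simp add: Qtr_None nn_integral_return)

lemma stationary_pair_measurable:
  assumes f: "f \<in> det_stationary m" and u: "u \<in> borel_measurable (SBM m)"
  shows "(\<lambda>y. u (y, f y)) \<in> borel_measurable (SM m)"
proof -
  have "(\<lambda>y. (y, f y)) \<in> SM m \<rightarrow>\<^sub>M SBM m"
    using f unfolding SBM_def det_stationary_def by (intro measurable_Pair measurable_ident_sets) auto
  from measurable_compose[OF this u] show ?thesis .
qed

text \<open>Functions that vanish at \<open>\<Delta>\<close> only see the path of the surviving process, so that the law of the state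
reduces to one atom.\<close>

lemma law_stationary_state:
  assumes f: "f \<in> det_stationary m" and x: "x \<in> states m"
  shows "v \<in> borel_measurable (SM m) \<Longrightarrow> v None = 0 \<Longrightarrow>
    (\<integral>\<^sup>+\<omega>. v (fst (\<omega> n)) \<partial>law m (stat m f) (Some x)) =
      weight m (closed_loop m f x) n * v (Some (closed_loop_state m f x n))"
proof (induction n arbitrary: v)
  case 0
  then show ?case
    using nn_integral_law_initial[OF model stat_in_strategies[OF f], of "Some x" v] x by simp
next
  case (Suc n)
  let ?u = "\<lambda>z. \<integral>\<^sup>+y. v y \<partial>Qtr m z"
  have u: "?u \<in> borel_measurable (SBM m)"
    by (rule nn_integral_Qtr_measurable[OF Suc(2)])
  have xD: "Some x \<in> XD m"
    using x by simp
  let ?y = "closed_loop_state m f x n"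
  have y: "?y \<in> states m" "f (Some ?y) \<in> BA m"
    using closed_loop_state_in_states[OF f x] det_stationary_in_BA[OF f] by auto
  have "(\<integral>\<^sup>+\<omega>. v (fst (\<omega> (Suc n))) \<partial>law m (stat m f) (Some x)) = (\<integral>\<^sup>+\<omega>. ?u (\<omega> n) \<partial>law m (stat m f) (Some x))"
    by (rule nn_integral_law_Suc[OF model stat_in_strategies[OF f] xD Suc(2)])
  also have "\<dots> = (\<integral>\<^sup>+\<omega>. ?u (fst (\<omega> n), f (fst (\<omega> n))) \<partial>law m (stat m f) (Some x))"
    by (rule nn_integral_law_stationary[OF model f xD u])
  also have "\<dots> = weight m (closed_loop m f x) n * ?u (Some ?y, f (Some ?y))"
    by (rule Suc.IH[OF stationary_pair_measurable[OF f u]]) (simp add: nn_integral_Qtr_None[OF Suc(2)] Suc(3))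
  also have "?u (Some ?y, f (Some ?y)) = survival m (f (Some ?y)) * v (Some (next_state m ?y (f (Some ?y))))"
    using nn_integral_Qtr[OF y Suc(2)] Suc(3) by simp
  finally show ?case
    by (simp add: closed_loop_def mult.assoc)
qed

lemma law_stationary:
  assumes f: "f \<in> det_stationary m" and x: "x \<in> states m"
    and u: "u \<in> borel_measurable (SBM m)" "\<And>b. u (None, b) = 0"
  shows "(\<integral>\<^sup>+\<omega>. u (\<omega> n) \<partial>law m (stat m f) (Some x)) =
      weight m (closed_loop m f x) n * u (Some (closed_loop_state m f x n), f (Some (closed_loop_state m f x n)))"
proof -
  have "(\<integral>\<^sup>+\<omega>. u (\<omega> n) \<partial>law m (stat m f) (Some x)) = (\<integral>\<^sup>+\<omega>. u (fst (\<omega> n), f (fst (\<omega> n))) \<partial>law m (stat m f) (Some x))"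
    using x by (intro nn_integral_law_stationary[OF model f _ u(1)]) simp
  also have "\<dots> = weight m (closed_loop m f x) n * u (Some (closed_loop_state m f x n), f (Some (closed_loop_state m f x n)))"
    by (rule law_stationary_state[OF f x stationary_pair_measurable[OF f u(1)]]) (rule u(2))
  finally show ?thesis .
qed

lemma val_stationary:
  assumes f: "f \<in> det_stationary m" and x: "x \<in> states m"
    and C: "C \<in> borel_measurable (SBM m)" "\<And>b. C (None, b) = 0"
  shows "val m (Some x) (stat m f) C = plan_cost m C x (closed_loop m f x)"
proof -
  have "val m (Some x) (stat m f) C = (\<Sum>n. \<integral>\<^sup>+\<omega>. C (\<omega> n) \<partial>law m (stat m f) (Some x))"
    using x by (intro val_eq_sum[OF model stat_in_strategies[OF f] _ C(1)]) simp
  then show ?thesis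
    unfolding plan_cost_def law_stationary[OF f x C] by (simp add: plan_state_closed_loop closed_loop_def)
qed

text \<open>The point \<open>\<Delta>\<close> is isolated, so functions on the two parts of the state space can be combined.\<close>

lemma case_option_measurable:
  assumes w: "w \<in> restrict_space borel (states m) \<rightarrow>\<^sub>M N" and c: "c \<in> space N"
  shows "case_option c w \<in> SM m \<rightarrow>\<^sub>M N"
proof -
  have None: "{z \<in> space (SM m). z \<in> {None}} \<in> sets (SM m)"
    using sets_borel_None[where 'a = 'x] unfolding SM_def sets_restrict_space
    by (auto simp: space_restrict_space intro!: image_eqI[of _ _ "{None}"])
  have "(\<lambda>z. if z \<in> {None} then c else w (the z)) \<in> SM m \<rightarrow>\<^sub>M N"
  proof (subst measurable_If_restrict_space_iff[OF None], intro conjI)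
    let ?X = "restrict_space (SM m) {z. z \<notin> {None}}"
    have "the \<in> ?X \<rightarrow>\<^sub>M restrict_space borel (states m)"
    proof (rule measurable_restrict_space2)
      show "the \<in> space ?X \<rightarrow> states m"
        by (auto simp: space_restrict_space XD_def)
      show "the \<in> borel_measurable ?X"
        unfolding SM_def by (intro measurable_restrict_space1 borel_measurable_the)
    qed
    from measurable_compose[OF this w] show "(\<lambda>z. w (the z)) \<in> ?X \<rightarrow>\<^sub>M N" .
  qed (use c in simp)
  moreover have "(\<lambda>z. if z \<in> {None} then c else w (the z)) = case_option c w"
    by (auto split: option.split)
  ultimately show ?thesis
    by simp
qed

lemma extend_selector:
  assumes s: "s \<in> borel_measurable (restrict_space borel (states m))" "\<And>x. x \<in> states m \<Longrightarrow> s x \<in> BA m"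
    and b0: "b0 \<in> BA m"
  shows "case_option b0 s \<in> det_stationary m"
  unfolding det_stationary_def BM_def
proof (rule measurable_restrict_space2)
  show "case_option b0 s \<in> space (SM m) \<rightarrow> BA m"
    using s(2) b0 by (auto split: option.split simp: XD_def)
  show "case_option b0 s \<in> borel_measurable (SM m)"
    by (rule case_option_measurable[OF s(1)]) simp
qed

text \<open>Unrolling the Bellman equality \<open>n\<close> times exhibits the first \<open>n\<close> costs as a part of the value. Costs
being nonnegative, nothing has to be known about the remainder.\<close>

lemma conserving_optimal:
  assumes f: "f \<in> det_stationary m" and x: "x \<in> states m"
    and eq: "\<And>y. y \<in> states m \<Longrightarrow> action_value m C y (f (Some y)) = plan_value m C y"
  shows "plan_cost m C x (closed_loop m f x) = plan_value m C x"
proof (rule antisym)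
  let ?\<beta> = "closed_loop m f x"
  let ?y = "closed_loop_state m f x"
  have y: "?y k \<in> states m" for k
    by (rule closed_loop_state_in_states[OF f x])
  have unroll: "plan_value m C x = (\<Sum>i<n. weight m ?\<beta> i * C (Some (plan_state m x ?\<beta> i), ?\<beta> i)) + weight m ?\<beta> n * plan_value m C (?y n)" for n
  proof (induction n)
    case (Suc n)
    have "plan_value m C (?y n) = C (Some (?y n), ?\<beta> n) + survival m (?\<beta> n) * plan_value m C (?y (Suc n))"
      using eq[OF y[of n]] by (simp add: action_value_def closed_loop_def)
    with Suc show ?case
      by (simp add: plan_state_closed_loop distrib_left mult.assoc add.assoc)
  qed simp
  have "(\<Sum>i<n. weight m ?\<beta> i * C (Some (plan_state m x ?\<beta> i), ?\<beta> i)) \<le> plan_value m C x" for n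
    unfolding unroll[of n] by (rule add_increasing2) simp_all
  then show "plan_cost m C x ?\<beta> \<le> plan_value m C x"
    unfolding plan_cost_def suminf_eq_SUP by (intro SUP_least)
  show "plan_value m C x \<le> plan_cost m C x ?\<beta>"
    by (intro plan_value_le closed_loop_in_plans f x)
qed

lemma weighted_cost_None [simp]: "weighted_cost m g (None, b) = 0"
  by (simp add: weighted_cost_def)

lemma weighted_cost_seq_lsc: "seq_lsc (XD m \<times> BA m) (weighted_cost m g)"
  unfolding weighted_cost_def[abs_def]
  by (intro seq_lsc_add seq_lsc_sum seq_lsc_mult seq_lsc_const Cbar_seq_lsc) auto

lemma weighted_cost_measurable: "weighted_cost m g \<in> borel_measurable (SBM m)"
  by (rule measurable_SBM_if_seq_lsc[OF weighted_cost_seq_lsc])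

lemma Cbar_measurable: "j \<le> ncons m \<Longrightarrow> Cbar m j \<in> borel_measurable (SBM m)"
  by (rule measurable_SBM_if_seq_lsc[OF Cbar_seq_lsc])

lemma weighted_cost_bounded:
  "\<exists>B::real. \<forall>x\<in>states m. \<forall>b\<in>BA m. weighted_cost m g (Some x, b) \<le> ennreal B"
proof -
  define c where "c = ennreal (K / disc m + K) + (\<Sum>j=1..ncons m. ennreal (g j) * ennreal (K / disc m + K))"
  have "c < \<infinity>"
    unfolding c_def by (auto simp: ennreal_mult_less_top less_top[symmetric] ennreal_mult_eq_top_iff)
  then have c: "c = ennreal (enn2real c)"
    by simp
  have "weighted_cost m g (Some x, b) \<le> c" if "x \<in> states m" "b \<in> BA m" for x b
    unfolding weighted_cost_def c_def using that by (intro add_mono sum_mono mult_left_mono Cbar_le) auto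
  then show ?thesis
    using c by (intro exI[of _ "enn2real c"]) auto
qed

text \<open>Wait for ever and pay only the running cost of the first and only action.\<close>

lemma plan_value_bounded:
  assumes "\<And>x b. x \<in> states m \<Longrightarrow> b \<in> BA m \<Longrightarrow> C (Some x, b) \<le> c" and x: "x \<in> states m"
  shows "plan_value m C x \<le> c"
proof -
  obtain a where a: "a \<in> acts m"
    using acts_nonempty by blast
  have "plan_value m C x \<le> plan_cost m C x (\<lambda>_. (\<infinity>, a))"
    using a by (intro plan_value_le) (simp add: plans_def BA_def)
  also have "\<dots> = C (Some x, (\<infinity>, a))"
    by (subst plan_cost_Suc) (simp add: survival_def)
  also have "\<dots> \<le> c"
    using a x by (intro assms) (simp_all add: BA_def)
  finally show ?thesis .
qed

lemma optimal_stationary: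
  assumes b0: "b0 \<in> BA m"
  shows "\<exists>f\<in>det_stationary m. f None = b0 \<and>
    (\<forall>y\<in>states m. action_value m (weighted_cost m g) y (f (Some y)) = plan_value m (weighted_cost m g) y)"
proof -
  obtain s where s: "s \<in> borel_measurable (restrict_space borel (states m))"
    "\<And>x. x \<in> states m \<Longrightarrow> s x \<in> BA m \<and> action_value m (weighted_cost m g) x (s x) = plan_value m (weighted_cost m g) x"
    using optimal_action_selector[OF weighted_cost_seq_lsc[of g]] by blast
  then show ?thesis
    using b0 by (intro bexI[of _ "case_option b0 s"]) (auto intro!: extend_selector)
qed

end

section \<open>Occupation measures and duality\<close>

locale full_impulse_model = bounded_impulse_model m \<delta> K
  for m :: "('x :: polish_space, 'a :: polish_space) impulse_model" and \<delta> K +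
  assumes V_eq: "VV m = Some ` states m"
begin

lemma V_measurable: "VV m \<in> sets (SM m)"
proof -
  have "VV m = space (SM m) - {None}"
    by (auto simp: V_eq XD_def)
  moreover have "{None} \<in> sets (SM m)"
    using sets_borel_None[where 'a = 'x] unfolding SM_def sets_restrict_space
    by (auto intro!: image_eqI[of _ _ "{None}"])
  ultimately show ?thesis
    by (metis sets.compl_sets)
qed

lemma V_subset: "VV m \<subseteq> XD m"
  by (auto simp: V_eq)

lemma space_VBM: "space (VBM m) = VV m \<times> BA m"
  using V_subset by (auto simp: VBM_def space_restrict_space)

lemma VB_measurable: "VV m \<times> BA m \<in> sets (SBM m)"
  using V_measurable sets.top[of "BM m"] by (auto simp: SBM_def)

lemma measurable_VBM: "u \<in> borel_measurable (SBM m) \<Longrightarrow> u \<in> borel_measurable (VBM m)"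
  unfolding VBM_def by (rule measurable_restrict_space1)

lemma sets_VBM_imp:
  assumes "\<Gamma> \<in> sets (VBM m)"
  shows "\<Gamma> \<in> sets (SBM m)" "\<Gamma> \<subseteq> VV m \<times> BA m"
proof -
  show "\<Gamma> \<subseteq> VV m \<times> BA m"
    using sets.sets_into_space[OF assms] by (simp add: space_VBM)
  have "(VV m \<times> BA m) \<inter> space (SBM m) \<in> sets (SBM m)"
    by (rule sets.Int[OF VB_measurable sets.top])
  from sets_restrict_space_iff[OF this] assms show "\<Gamma> \<in> sets (SBM m)"
    by (simp add: VBM_def)
qed

lemma V_set_imp:
  assumes "\<Gamma> \<in> sets (restrict_space (SM m) (VV m))"
  shows "\<Gamma> \<in> sets (SM m)" "\<Gamma> \<subseteq> VV m"
proof -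
  have "VV m \<inter> space (SM m) \<in> sets (SM m)"
    by (rule sets.Int[OF V_measurable sets.top])
  from sets_restrict_space_iff[OF this] assms show "\<Gamma> \<in> sets (SM m)" "\<Gamma> \<subseteq> VV m"
    by auto
qed

lemma V_set_in: "VV m \<in> sets (restrict_space (SM m) (VV m))"
  unfolding sets_restrict_space using V_measurable by (intro image_eqI[of _ _ "VV m"]) auto

lemma nn_integral_occV:
  assumes \<pi>: "\<pi> \<in> strategies m" and x: "x \<in> XD m"
    and u: "u \<in> borel_measurable (SBM m)" "\<And>b. u (None, b) = 0"
  shows "(\<integral>\<^sup>+z. u z \<partial>occV m x \<pi>) = (\<integral>\<^sup>+z. u z \<partial>occ m x \<pi>)"
proof -
  have sp: "space (occ m x \<pi>) = XD m \<times> BA m"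
    using sets_eq_imp_space_eq[OF sets_occ] by simp
  have "(\<integral>\<^sup>+z. u z \<partial>occV m x \<pi>) = (\<integral>\<^sup>+z. u z * indicator (VV m \<times> BA m) z \<partial>occ m x \<pi>)"
    unfolding occV_def using VB_measurable by (intro nn_integral_restrict_space) (simp add: sets_occ sp Int_absorb2 V_subset Sigma_mono)
  also have "\<dots> = (\<integral>\<^sup>+z. u z \<partial>occ m x \<pi>)"
  proof (rule nn_integral_cong)
    fix z assume "z \<in> space (occ m x \<pi>)"
    then have z: "z \<in> XD m \<times> BA m" by (simp add: sp)
    show "u z * indicator (VV m \<times> BA m) z = u z"
    proof (cases "fst z")
      case None
      then show ?thesis using u(2)[of "snd z"] by (cases z) simp
    next
      case (Some y)
      with z have "z \<in> VV m \<times> BA m"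
        by (cases z) (auto simp: V_eq)
      then show ?thesis by simp
    qed
  qed
  finally show ?thesis .
qed

lemma val_eq_occV:
  assumes \<pi>: "\<pi> \<in> strategies m" and x: "x \<in> XD m"
    and C: "C \<in> borel_measurable (SBM m)" "\<And>b. C (None, b) = 0"
  shows "val m x \<pi> C = (\<integral>\<^sup>+z. C z \<partial>occV m x \<pi>)"
  unfolding nn_integral_occV[OF assms] by (rule val_eq_occ[OF model \<pi> x C(1)])

lemma emeasure_occV:
  assumes \<pi>: "\<pi> \<in> strategies m" and x: "x \<in> XD m" and \<Gamma>: "\<Gamma> \<in> sets (VBM m)"
  shows "emeasure (occV m x \<pi>) \<Gamma> = (\<Sum>n. \<integral>\<^sup>+\<omega>. indicator \<Gamma> (\<omega> n) \<partial>law m \<pi> x)"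
proof -
  have "emeasure (occV m x \<pi>) \<Gamma> = (\<integral>\<^sup>+z. indicator \<Gamma> z \<partial>occV m x \<pi>)"
    using \<Gamma> by (simp add: sets_VBM_eq)
  also have "\<dots> = (\<integral>\<^sup>+z. indicator \<Gamma> z \<partial>occ m x \<pi>)"
    using sets_VBM_imp[OF \<Gamma>] by (intro nn_integral_occV[OF \<pi> x]) (auto simp: V_eq indicator_def)
  also have "\<dots> = (\<Sum>n. \<integral>\<^sup>+\<omega>. indicator \<Gamma> (\<omega> n) \<partial>law m \<pi> x)"
    using sets_VBM_imp[OF \<Gamma>] by (intro nn_integral_occ[OF model \<pi> x]) simp
  finally show ?thesis .
qed

text \<open>The first visit contributes the initial distribution, and every later visit is a transition from the
preceding state.\<close>

lemma balance_occV:
  assumes \<pi>: "\<pi> \<in> strategies m" and x: "x \<in> XD m"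
  shows "balance m x (occV m x \<pi>)"
  unfolding balance_def
proof
  fix \<Gamma> assume "\<Gamma> \<in> sets (restrict_space (SM m) (VV m))"
  note \<Gamma> = V_set_imp[OF this]
  have i: "indicator \<Gamma> \<in> borel_measurable (SM m)"
    using \<Gamma> by simp
  have \<Gamma>B: "\<Gamma> \<times> BA m \<in> sets (VBM m)"
  proof -
    have "\<Gamma> \<times> BA m \<in> sets (SBM m)"
      using \<Gamma>(1) sets.top[of "BM m"] by (auto simp: SBM_def)
    then have "(VV m \<times> BA m) \<inter> (\<Gamma> \<times> BA m) \<in> sets (VBM m)"
      unfolding VBM_def sets_restrict_space by (rule imageI)
    moreover have "(VV m \<times> BA m) \<inter> (\<Gamma> \<times> BA m) = \<Gamma> \<times> BA m"
      using \<Gamma>(2) by auto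
    ultimately show ?thesis by simp
  qed
  have em: "emeasure (Qtr m z) \<Gamma> = (\<integral>\<^sup>+y. indicator \<Gamma> y \<partial>Qtr m z)" for z
    using \<Gamma>(1) by simp
  have Q: "(\<lambda>z. emeasure (Qtr m z) \<Gamma>) \<in> borel_measurable (SBM m)"
    unfolding em by (rule nn_integral_Qtr_measurable[OF i])
  have "emeasure (occV m x \<pi>) (\<Gamma> \<times> BA m) = (\<Sum>n. \<integral>\<^sup>+\<omega>. indicator (\<Gamma> \<times> BA m) (\<omega> n) \<partial>law m \<pi> x)"
    by (rule emeasure_occV[OF \<pi> x \<Gamma>B])
  also have "\<dots> = (\<Sum>n. \<integral>\<^sup>+\<omega>. indicator \<Gamma> (fst (\<omega> n)) \<partial>law m \<pi> x)"
  proof (intro suminf_cong nn_integral_cong)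
    fix n \<omega> assume "\<omega> \<in> space (law m \<pi> x)"
    from law_coordinate_in_space[OF model \<pi> x this, of n]
    show "indicator (\<Gamma> \<times> BA m) (\<omega> n) = (indicator \<Gamma> (fst (\<omega> n)) :: ennreal)"
      by (cases "\<omega> n") (auto simp: indicator_def)
  qed
  also have "\<dots> = (\<Sum>n. \<integral>\<^sup>+\<omega>. indicator \<Gamma> (fst (\<omega> (Suc n))) \<partial>law m \<pi> x) + (\<integral>\<^sup>+\<omega>. indicator \<Gamma> (fst (\<omega> 0)) \<partial>law m \<pi> x)"
    by (subst suminf_offset[where i = 1]) auto
  also have "(\<integral>\<^sup>+\<omega>. indicator \<Gamma> (fst (\<omega> 0)) \<partial>law m \<pi> x) = indicator \<Gamma> x"
    by (rule nn_integral_law_initial[OF model \<pi> x i])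
  also have "(\<Sum>n. \<integral>\<^sup>+\<omega>. indicator \<Gamma> (fst (\<omega> (Suc n))) \<partial>law m \<pi> x) = (\<Sum>n. \<integral>\<^sup>+\<omega>. emeasure (Qtr m (\<omega> n)) \<Gamma> \<partial>law m \<pi> x)"
    unfolding em by (intro suminf_cong nn_integral_law_Suc[OF model \<pi> x i])
  also have "\<dots> = (\<integral>\<^sup>+z. emeasure (Qtr m z) \<Gamma> \<partial>occ m x \<pi>)"
    by (rule nn_integral_occ[OF model \<pi> x Q, symmetric])
  also have "\<dots> = (\<integral>\<^sup>+z. emeasure (Qtr m z) \<Gamma> \<partial>occV m x \<pi>)"
  proof (rule nn_integral_occV[OF \<pi> x Q, symmetric])
    show "emeasure (Qtr m (None, b)) \<Gamma> = 0" for b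
      unfolding em nn_integral_Qtr_None[OF i] using \<Gamma>(2) by (auto simp: V_eq indicator_def)
  qed
  finally show "emeasure (occV m x \<pi>) (\<Gamma> \<times> BA m) = indicator \<Gamma> x + (\<integral>\<^sup>+z. emeasure (Qtr m z) \<Gamma> \<partial>occV m x \<pi>)"
    by (simp add: add.commute)
qed

text \<open>By balance, the total mass exceeds the expected number of survived transitions by at most \<open>1\<close>, and each
survived transition costs at least \<open>\<delta>\<close>.\<close>

lemma finite_if_finite_cost:
  assumes sets: "sets \<mu> = sets (VBM m)" and bal: "balance m x \<mu>"
    and cost: "(\<integral>\<^sup>+z. Cbar m 0 z \<partial>\<mu>) < \<infinity>"
  shows "emeasure \<mu> (space \<mu>) < \<infinity>"
proof -
  have sp: "space \<mu> = VV m \<times> BA m"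
    using sets_eq_imp_space_eq[OF sets] by (simp add: space_VBM)
  have C: "Cbar m 0 \<in> borel_measurable \<mu>"
    using measurable_VBM[OF Cbar_measurable[of 0]] by (simp add: measurable_cong_sets[OF sets refl])
  have "emeasure \<mu> (space \<mu>) = indicator (VV m) x + (\<integral>\<^sup>+z. emeasure (Qtr m z) (VV m) \<partial>\<mu>)"
    using bal V_set_in unfolding balance_def sp by blast
  also have "\<dots> \<le> 1 + (\<integral>\<^sup>+z. ennreal (1 / \<delta>) * Cbar m 0 z \<partial>\<mu>)"
  proof (intro add_mono nn_integral_mono)
    show "indicator (VV m) x \<le> (1 :: ennreal)"
      by (auto simp: indicator_def)
    fix z assume "z \<in> space \<mu>"
    then obtain y b where z: "z = (Some y, b)" "y \<in> states m" "b \<in> BA m"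
      by (auto simp: sp V_eq)
    have "emeasure (Qtr m z) (VV m) = (\<integral>\<^sup>+y. indicator (VV m) y \<partial>Qtr m z)"
      using V_measurable by simp
    also have "\<dots> = survival m b"
      using nn_integral_Qtr[OF z(2,3), of "indicator (VV m)"] V_measurable next_state_in_states[OF z(2,3)]
      by (simp add: z(1)) (auto simp: V_eq indicator_def)
    also have "\<dots> = ennreal (1 / \<delta>) * (ennreal \<delta> * survival m b)"
      using \<delta>(1) by (simp add: mult.assoc[symmetric] ennreal_mult[symmetric])
    also have "\<dots> \<le> ennreal (1 / \<delta>) * Cbar m 0 z"
      unfolding z(1) by (intro mult_left_mono Cbar0_ge z) simp
    finally show "emeasure (Qtr m z) (VV m) \<le> ennreal (1 / \<delta>) * Cbar m 0 z" .
  qed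
  also have "\<dots> = 1 + ennreal (1 / \<delta>) * (\<integral>\<^sup>+z. Cbar m 0 z \<partial>\<mu>)"
    using C by (simp add: nn_integral_cmult)
  also have "\<dots> < \<infinity>"
    using cost by (auto simp: ennreal_mult_less_top)
  finally show ?thesis .
qed

lemma cost_finite_if_finite:
  assumes sets: "sets \<mu> = sets (VBM m)" and fin: "emeasure \<mu> (space \<mu>) < \<infinity>"
    and bound: "\<And>x b. x \<in> states m \<Longrightarrow> b \<in> BA m \<Longrightarrow> C (Some x, b) \<le> ennreal B"
  shows "(\<integral>\<^sup>+z. C z \<partial>\<mu>) < \<infinity>"
proof -
  have sp: "space \<mu> = VV m \<times> BA m"
    using sets_eq_imp_space_eq[OF sets] by (simp add: space_VBM)
  have "(\<integral>\<^sup>+z. C z \<partial>\<mu>) \<le> (\<integral>\<^sup>+z. ennreal B \<partial>\<mu>)"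
    by (intro nn_integral_mono) (auto simp: sp V_eq intro: bound)
  also have "\<dots> = ennreal B * emeasure \<mu> (space \<mu>)"
    by simp
  also have "\<dots> < \<infinity>"
    using fin by (auto simp: ennreal_mult_less_top)
  finally show ?thesis .
qed

text \<open>Finite measures have \<open>\<sigma>\<close>-finite marginals, and they integrate the bounded costs; only the cost with
index \<open>0\<close> has to be checked.\<close>

lemma in_DD_iff:
  "\<mu> \<in> DD m x \<longleftrightarrow> sets \<mu> = sets (VBM m) \<and> balance m x \<mu> \<and> (\<integral>\<^sup>+z. Cbar m 0 z \<partial>\<mu>) < \<infinity>"
proof
  assume \<mu>: "\<mu> \<in> DD m x"
  have "(\<integral>\<^sup>+z. Cbar m 0 z \<partial>\<mu>) \<le> (\<integral>\<^sup>+z. Ctot m z \<partial>\<mu>)"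
    unfolding Ctot_def by (intro nn_integral_mono member_le_sum) auto
  with \<mu> show "sets \<mu> = sets (VBM m) \<and> balance m x \<mu> \<and> (\<integral>\<^sup>+z. Cbar m 0 z \<partial>\<mu>) < \<infinity>"
    by (auto simp: DD_def intro: le_less_trans)
next
  assume \<mu>: "sets \<mu> = sets (VBM m) \<and> balance m x \<mu> \<and> (\<integral>\<^sup>+z. Cbar m 0 z \<partial>\<mu>) < \<infinity>"
  then have sets: "sets \<mu> = sets (VBM m)" and fin: "emeasure \<mu> (space \<mu>) < \<infinity>"
    using finite_if_finite_cost by auto
  have fst: "fst \<in> \<mu> \<rightarrow>\<^sub>M restrict_space (SM m) (VV m)"
    unfolding measurable_cong_sets[OF sets refl]
  proof (rule measurable_restrict_space2)
    show "fst \<in> space (VBM m) \<rightarrow> VV m"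
      by (auto simp: space_VBM)
    show "fst \<in> VBM m \<rightarrow>\<^sub>M SM m"
      unfolding VBM_def SBM_def by (intro measurable_restrict_space1 measurable_fst)
  qed
  interpret \<mu>: finite_measure \<mu>
    using fin by (intro finite_measureI) simp
  interpret d: finite_measure "distr \<mu> (restrict_space (SM m) (VV m)) fst"
    by (rule \<mu>.finite_measure_distr[OF fst])
  have "sigma_finite_marginal m \<mu>"
    unfolding sigma_finite_marginal_def by (rule d.sigma_finite_measure_axioms)
  moreover have "(\<integral>\<^sup>+z. Ctot m z \<partial>\<mu>) < \<infinity>"
  proof (rule cost_finite_if_finite[OF sets fin])
    fix x b assume xb: "x \<in> states m" "b \<in> BA m"
    have "Ctot m (Some x, b) \<le> (\<Sum>j\<le>ncons m. ennreal (K / disc m + K))"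
      unfolding Ctot_def using xb by (intro sum_mono Cbar_le) auto
    also have "\<dots> = ennreal (\<Sum>j\<le>ncons m. K / disc m + K)"
      using K(1) disc_pos by (intro sum_ennreal) simp
    finally show "Ctot m (Some x, b) \<le> ennreal (\<Sum>j\<le>ncons m. K / disc m + K)" .
  qed
  ultimately show "\<mu> \<in> DD m x"
    using \<mu> by (simp add: DD_def)
qed

lemma DD_finite:
  assumes "\<mu> \<in> DD m x"
  shows "emeasure \<mu> (space \<mu>) < \<infinity>"
  using assms finite_if_finite_cost unfolding in_DD_iff by blast

text \<open>Balance says that the marginal of \<open>\<mu>\<close> on the states is the sum of a point mass and of the image of \<open>\<mu>\<close>
under the kernel, restricted to the states other than \<open>\<Delta>\<close>.\<close>

lemma balance_integral:
  assumes sets: "sets \<mu> = sets (VBM m)" and bal: "balance m (Some x) \<mu>" and x: "x \<in> states m"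
    and v: "v \<in> borel_measurable (SM m)" "v None = 0"
  shows "(\<integral>\<^sup>+z. v (fst z) \<partial>\<mu>) = v (Some x) + (\<integral>\<^sup>+z. (\<integral>\<^sup>+y. v y \<partial>Qtr m z) \<partial>\<mu>)"
proof -
  let ?R = "restrict_space (SM m) (VV m)"
  have sp: "space \<mu> = VV m \<times> BA m"
    using sets_eq_imp_space_eq[OF sets] by (simp add: space_VBM)
  have sp_R: "space ?R = VV m"
    using V_subset by (auto simp: space_restrict_space)
  have ne: "space \<mu> \<noteq> {}"
    using x BA_nonempty by (auto simp: sp V_eq)
  have fst: "fst \<in> \<mu> \<rightarrow>\<^sub>M ?R"
    unfolding measurable_cong_sets[OF sets refl]
  proof (rule measurable_restrict_space2)
    show "fst \<in> space (VBM m) \<rightarrow> VV m"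
      by (auto simp: space_VBM)
    show "fst \<in> VBM m \<rightarrow>\<^sub>M SM m"
      unfolding VBM_def SBM_def by (intro measurable_restrict_space1 measurable_fst)
  qed
  have Q: "Qtr m \<in> \<mu> \<rightarrow>\<^sub>M subprob_algebra (SM m)"
    unfolding measurable_cong_sets[OF sets refl] VBM_def
    by (intro measurable_restrict_space1 measurable_prob_algebraD[OF measurable_Qtr[OF model]])
  define L where "L = \<mu> \<bind> Qtr m"
  have sets_L: "sets L = sets (SM m)"
    unfolding L_def by (rule sets_bind[OF _ ne]) simp
  have sp_L: "space L = XD m"
    using sets_eq_imp_space_eq[OF sets_L] by simp
  have V_L: "VV m \<inter> space L \<in> sets L"
    using V_measurable V_subset by (simp add: sets_L sp_L Int_absorb2)
  define N where "N i = (if i = 0 then return ?R (Some x) else restrict_space L (VV m))" for i :: nat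
  define a where "a i = (if i \<le> 1 then 1 else 0 :: ennreal)" for i :: nat
  have two: "(\<Sum>i. a i * h i) = h 0 + h 1" for h :: "nat \<Rightarrow> ennreal"
  proof -
    have "(\<Sum>i. a i * h i) = (\<Sum>i\<in>{0, 1}. a i * h i)"
      by (rule suminf_finite) (auto simp: a_def)
    then show ?thesis
      by (simp add: a_def)
  qed
  have sets_rL: "sets (restrict_space L (VV m)) = sets ?R"
    by (rule sets_restrict_space_cong[OF sets_L])
  have v_R: "v \<in> borel_measurable ?R"
    using v(1) by (rule measurable_restrict_space1)
  have "(\<integral>\<^sup>+y. v y \<partial>distr \<mu> ?R fst) = (\<Sum>i. a i * (\<integral>\<^sup>+y. v y \<partial>N i))"
  proof (rule nn_integral_countable_mixture)
    show "sets (N i) = sets (distr \<mu> ?R fst)" for i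
      by (simp add: N_def sets_rL)
    show "v \<in> borel_measurable (distr \<mu> ?R fst)"
      using v_R by simp
    fix A assume "A \<in> sets (distr \<mu> ?R fst)"
    then have A: "A \<in> sets ?R" by simp
    note A' = V_set_imp[OF A]
    have "fst -` A \<inter> space \<mu> = A \<times> BA m"
      using A'(2) by (auto simp: sp)
    then have "emeasure (distr \<mu> ?R fst) A = emeasure \<mu> (A \<times> BA m)"
      using emeasure_distr[OF fst A] by simp
    also have "\<dots> = indicator A (Some x) + (\<integral>\<^sup>+z. emeasure (Qtr m z) A \<partial>\<mu>)"
      using bal A unfolding balance_def by blast
    also have "(\<integral>\<^sup>+z. emeasure (Qtr m z) A \<partial>\<mu>) = emeasure L A"
      unfolding L_def by (rule emeasure_bind[OF ne Q A'(1), symmetric])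
    also have "\<dots> = emeasure (restrict_space L (VV m)) A"
      using emeasure_restrict_space[OF V_L A'(2)] by simp
    finally show "emeasure (distr \<mu> ?R fst) A = (\<Sum>i. a i * emeasure (N i) A)"
      unfolding two using A by (simp add: N_def)
  qed
  also have "\<dots> = v (Some x) + (\<integral>\<^sup>+y. v y \<partial>restrict_space L (VV m))"
  proof -
    have "(\<integral>\<^sup>+y. v y \<partial>return ?R (Some x)) = v (Some x)"
      by (rule nn_integral_return[OF _ v_R]) (use x in \<open>simp add: sp_R, simp add: V_eq\<close>)
    then show ?thesis
      unfolding two by (simp add: N_def)
  qed
  also have "(\<integral>\<^sup>+y. v y \<partial>restrict_space L (VV m)) = (\<integral>\<^sup>+y. v y * indicator (VV m) y \<partial>L)"
    by (rule nn_integral_restrict_space[OF V_L])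
  also have "\<dots> = (\<integral>\<^sup>+y. v y \<partial>L)"
    using v(2) by (intro nn_integral_cong) (auto simp: sp_L V_eq XD_def indicator_def)
  also have "\<dots> = (\<integral>\<^sup>+z. (\<integral>\<^sup>+y. v y \<partial>Qtr m z) \<partial>\<mu>)"
    unfolding L_def by (rule nn_integral_bind[OF v(1) Q])
  also have "(\<integral>\<^sup>+y. v y \<partial>distr \<mu> ?R fst) = (\<integral>\<^sup>+z. v (fst z) \<partial>\<mu>)"
    using v_R by (intro nn_integral_distr[OF fst]) simp
  finally show ?thesis .
qed

text \<open>Integrate the Bellman inequality \<open>v \<le> C + Q v\<close> for the value \<open>v\<close> of plans. By balance the integral of
\<open>v\<close> is \<open>v x\<close> plus the integral of \<open>Q v\<close>, and the latter cancels, being finite because \<open>v\<close> is bounded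
and \<open>\<mu>\<close> is finite. Measures that are not occupation measures of any strategy are covered as well.\<close>

lemma plan_value_le_integral:
  assumes \<mu>: "\<mu> \<in> DD m (Some x)" and x: "x \<in> states m"
    and C: "seq_lsc (XD m \<times> BA m) C"
    and bound: "\<And>x b. x \<in> states m \<Longrightarrow> b \<in> BA m \<Longrightarrow> C (Some x, b) \<le> ennreal B"
  shows "plan_value m C x \<le> (\<integral>\<^sup>+z. C z \<partial>\<mu>)"
proof -
  have sets: "sets \<mu> = sets (VBM m)" and bal: "balance m (Some x) \<mu>"
    using \<mu> unfolding in_DD_iff by auto
  have sp: "space \<mu> = VV m \<times> BA m"
    using sets_eq_imp_space_eq[OF sets] by (simp add: space_VBM)
  define v where "v = case_option 0 (plan_value m C)"
  have v: "v \<in> borel_measurable (SM m)" "v None = 0"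
    unfolding v_def by (auto intro!: case_option_measurable seq_lsc_measurable plan_value_seq_lsc C)
  have v_le: "v (Some y) \<le> ennreal B" if "y \<in> states m" for y
    using plan_value_bounded[of C "ennreal B", OF bound that] by (simp add: v_def)
  have Qv: "(\<integral>\<^sup>+y. v y \<partial>Qtr m (Some y, b)) = survival m b * plan_value m C (next_state m y b)" if "y \<in> states m" "b \<in> BA m" for y b
    using nn_integral_Qtr[OF that v(1)] by (simp add: v_def)
  let ?T = "\<integral>\<^sup>+z. (\<integral>\<^sup>+y. v y \<partial>Qtr m z) \<partial>\<mu>"
  have C_meas: "C \<in> borel_measurable \<mu>"
    using measurable_VBM[OF measurable_SBM_if_seq_lsc[OF C]] by (simp add: measurable_cong_sets[OF sets refl])
  have Qv_meas: "(\<lambda>z. \<integral>\<^sup>+y. v y \<partial>Qtr m z) \<in> borel_measurable \<mu>"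
    using measurable_VBM[OF nn_integral_Qtr_measurable[OF v(1)]] by (simp add: measurable_cong_sets[OF sets refl])
  have "?T < \<infinity>"
  proof (rule cost_finite_if_finite[OF sets DD_finite[OF \<mu>]])
    fix y b assume yb: "y \<in> states m" "b \<in> BA m"
    have "survival m b * plan_value m C (next_state m y b) \<le> 1 * ennreal B"
      using v_le[OF next_state_in_states[OF yb]] by (intro mult_mono survival_le_1 disc_pos) (auto simp: v_def)
    then show "(\<integral>\<^sup>+y. v y \<partial>Qtr m (Some y, b)) \<le> ennreal B"
      unfolding Qv[OF yb] by simp
  qed
  have "v (Some x) + ?T = (\<integral>\<^sup>+z. v (fst z) \<partial>\<mu>)"
    by (rule balance_integral[OF sets bal x v, symmetric])
  also have "\<dots> \<le> (\<integral>\<^sup>+z. C z + (\<integral>\<^sup>+y. v y \<partial>Qtr m z) \<partial>\<mu>)"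
  proof (rule nn_integral_mono)
    fix z assume "z \<in> space \<mu>"
    then obtain y b where z: "z = (Some y, b)" "y \<in> states m" "b \<in> BA m"
      by (auto simp: sp V_eq)
    show "v (fst z) \<le> C z + (\<integral>\<^sup>+y. v y \<partial>Qtr m z)"
      unfolding z(1) Qv[OF z(2,3)] using plan_value_le_action_value[OF C z(2,3)] by (simp add: v_def action_value_def)
  qed
  also have "\<dots> = (\<integral>\<^sup>+z. C z \<partial>\<mu>) + ?T"
    by (rule nn_integral_add[OF C_meas Qv_meas])
  finally have "?T + v (Some x) \<le> ?T + (\<integral>\<^sup>+z. C z \<partial>\<mu>)"
    by (simp add: add.commute)
  with \<open>?T < \<infinity>\<close> have "v (Some x) \<le> (\<integral>\<^sup>+z. C z \<partial>\<mu>)"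
    by (auto simp: ennreal_add_left_cancel_le)
  then show ?thesis
    by (simp add: v_def)
qed

lemma nn_integral_weighted_cost:
  assumes "sets \<mu> = sets (VBM m)"
  shows "(\<integral>\<^sup>+z. weighted_cost m g z \<partial>\<mu>) =
    (\<integral>\<^sup>+z. Cbar m 0 z \<partial>\<mu>) + (\<Sum>j=1..ncons m. ennreal (g j) * (\<integral>\<^sup>+z. Cbar m j z \<partial>\<mu>))"
proof -
  have C: "Cbar m j \<in> borel_measurable \<mu>" if "j \<le> ncons m" for j
    using measurable_VBM[OF Cbar_measurable[OF that]] by (simp add: measurable_cong_sets[OF assms refl])
  have "(\<integral>\<^sup>+z. weighted_cost m g z \<partial>\<mu>) =
      (\<integral>\<^sup>+z. Cbar m 0 z \<partial>\<mu>) + (\<integral>\<^sup>+z. (\<Sum>j=1..ncons m. ennreal (g j) * Cbar m j z) \<partial>\<mu>)"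
    unfolding weighted_cost_def using C by (intro nn_integral_add) auto
  also have "(\<integral>\<^sup>+z. (\<Sum>j=1..ncons m. ennreal (g j) * Cbar m j z) \<partial>\<mu>) = (\<Sum>j=1..ncons m. ennreal (g j) * (\<integral>\<^sup>+z. Cbar m j z \<partial>\<mu>))"
    using C by (subst nn_integral_sum) (auto simp: nn_integral_cmult)
  finally show ?thesis .
qed

lemma val_weighted_cost:
  assumes \<pi>: "\<pi> \<in> strategies m" and x: "x \<in> XD m"
  shows "val m x \<pi> (Cbar m 0) + (\<Sum>j=1..ncons m. ennreal (g j) * val m x \<pi> (Cbar m j)) = val m x \<pi> (weighted_cost m g)"
proof -
  have "val m x \<pi> (Cbar m j) = (\<integral>\<^sup>+z. Cbar m j z \<partial>occV m x \<pi>)" if "j \<le> ncons m" for j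
    using that by (intro val_eq_occV[OF \<pi> x] Cbar_measurable) auto
  moreover have "val m x \<pi> (weighted_cost m g) = (\<integral>\<^sup>+z. weighted_cost m g z \<partial>occV m x \<pi>)"
    by (intro val_eq_occV[OF \<pi> x] weighted_cost_measurable) auto
  ultimately show ?thesis
    by (simp add: nn_integral_weighted_cost[OF sets_VBM_eq])
qed

lemma occV_in_DD:
  assumes \<pi>: "\<pi> \<in> strategies m" and x: "x \<in> XD m" and fin: "val m x \<pi> (Cbar m 0) < \<infinity>"
  shows "occV m x \<pi> \<in> DD m x"
  unfolding in_DD_iff
  using fin balance_occV[OF \<pi> x] val_eq_occV[OF \<pi> x, of "Cbar m 0"] Cbar_measurable[of 0]
  by (simp add: sets_VBM_eq)

text \<open>A conserving stationary strategy attains the value of plans. Conversely the occupation measure of a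
strategy with finite cost is a measure to which the lower bound applies.\<close>

lemma Wg_eq:
  assumes x: "x \<in> states m"
  shows "Wg m g (Some x) = plan_value m (weighted_cost m g) x"
proof (rule antisym)
  have xD: "Some x \<in> XD m"
    using x by simp
  obtain b0 where "b0 \<in> BA m"
    using BA_nonempty by blast
  from optimal_stationary[OF this] obtain f where f: "f \<in> det_stationary m"
    "\<And>y. y \<in> states m \<Longrightarrow> action_value m (weighted_cost m g) y (f (Some y)) = plan_value m (weighted_cost m g) y"
    by blast
  have "Wg m g (Some x) \<le> val m (Some x) (stat m f) (weighted_cost m g)"
    unfolding Wg_def val_weighted_cost[OF stat_in_strategies[OF f(1)] xD, symmetric]
    by (rule INF_lower[OF stat_in_strategies[OF f(1)]])
  also have "\<dots> = plan_value m (weighted_cost m g) x"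
    using conserving_optimal[OF f(1) x, of "weighted_cost m g"] f(2)
    by (simp add: val_stationary[OF f(1) x weighted_cost_measurable])
  finally show "Wg m g (Some x) \<le> plan_value m (weighted_cost m g) x" .
  show "plan_value m (weighted_cost m g) x \<le> Wg m g (Some x)"
    unfolding Wg_def
  proof (rule INF_greatest)
    fix \<pi> assume \<pi>: "\<pi> \<in> strategies m"
    show "plan_value m (weighted_cost m g) x \<le>
        val m (Some x) \<pi> (Cbar m 0) + (\<Sum>j=1..ncons m. ennreal (g j) * val m (Some x) \<pi> (Cbar m j))"
    proof (cases "val m (Some x) \<pi> (Cbar m 0) < \<infinity>")
      case True
      obtain B where B: "\<And>x b. x \<in> states m \<Longrightarrow> b \<in> BA m \<Longrightarrow> weighted_cost m g (Some x, b) \<le> ennreal B"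
        using weighted_cost_bounded[of g] by blast
      have "plan_value m (weighted_cost m g) x \<le> (\<integral>\<^sup>+z. weighted_cost m g z \<partial>occV m (Some x) \<pi>)"
        by (rule plan_value_le_integral[OF occV_in_DD[OF \<pi> xD True] x weighted_cost_seq_lsc B])
      also have "\<dots> = val m (Some x) \<pi> (weighted_cost m g)"
        by (rule val_eq_occV[OF \<pi> xD weighted_cost_measurable, symmetric]) simp
      finally show ?thesis
        unfolding val_weighted_cost[OF \<pi> xD] .
    next
      case False
      then have "val m (Some x) \<pi> (Cbar m 0) = top"
        by (simp add: less_top[symmetric])
      then show ?thesis by simp
    qed
  qed
qed

lemma bellman_rhs_eq:
  assumes x: "x \<in> states m" and b: "b \<in> BA m"
  shows "bellman_rhs m g (Some x) b = action_value m (weighted_cost m g) x b"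
proof -
  let ?v = "case_option 0 (plan_value m (weighted_cost m g))"
  have v: "?v \<in> borel_measurable (SM m)"
    by (intro case_option_measurable seq_lsc_measurable plan_value_seq_lsc weighted_cost_seq_lsc) simp
  have "(\<integral>\<^sup>+y\<in>VV m. Wg m g y \<partial>Qtr m (Some x, b)) = (\<integral>\<^sup>+y. ?v y \<partial>Qtr m (Some x, b))"
    by (intro nn_integral_cong) (auto simp: V_eq XD_def Wg_eq indicator_def split: option.split)
  also have "\<dots> = survival m b * plan_value m (weighted_cost m g) (next_state m x b)"
    using nn_integral_Qtr[OF x b v] by simp
  finally show ?thesis
    by (simp add: bellman_rhs_def action_value_def weighted_cost_def)
qed

lemma in_FF_iff:
  assumes "f \<in> det_stationary m"
  shows "f \<in> FF m fs g \<longleftrightarrow> f None = fs None \<and>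
    (\<forall>x\<in>states m. action_value m (weighted_cost m g) x (f (Some x)) = plan_value m (weighted_cost m g) x)"
proof -
  have "plan_value m (weighted_cost m g) x = (INF b\<in>BA m. bellman_rhs m g (Some x) b)" if x: "x \<in> states m" for x
  proof -
    have "(INF b\<in>BA m. bellman_rhs m g (Some x) b) = (INF b\<in>BA m. action_value m (weighted_cost m g) x b)"
      using bellman_rhs_eq[OF x] by (intro INF_cong) auto
    also have "\<dots> = plan_value m (weighted_cost m g) x"
    proof (rule antisym)
      obtain b where "b \<in> BA m" "action_value m (weighted_cost m g) x b = plan_value m (weighted_cost m g) x"
        using action_value_attained[OF weighted_cost_seq_lsc x] by blast
      then show "(INF b\<in>BA m. action_value m (weighted_cost m g) x b) \<le> plan_value m (weighted_cost m g) x"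
        by (intro INF_lower2[of b]) auto
      show "plan_value m (weighted_cost m g) x \<le> (INF b\<in>BA m. action_value m (weighted_cost m g) x b)"
        by (intro INF_greatest plan_value_le_action_value weighted_cost_seq_lsc x)
    qed
    finally show ?thesis by simp
  qed
  moreover have "bellman_rhs m g (Some x) (f (Some x)) = action_value m (weighted_cost m g) x (f (Some x))" if "x \<in> states m" for x
    using that by (intro bellman_rhs_eq det_stationary_in_BA[OF assms]) auto
  moreover have "XD m - VV m = {None}"
    by (auto simp: V_eq XD_def)
  ultimately show ?thesis
    using assms by (auto simp: FF_def V_eq Wg_eq)
qed

end

section \<open>Extreme optimal plans are stationary\<close>

lemma closed_loop_state_add:
  "closed_loop_state m f x (n + k) = closed_loop_state m f (closed_loop_state m f x n) k"
  by (induction k) auto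

lemma closed_loop_shift: "(\<lambda>i. closed_loop m f x (n + i)) = closed_loop m f (closed_loop_state m f x n)"
  by (rule ext) (simp add: closed_loop_def closed_loop_state_add)

lemma plan_state_cong: "(\<And>i. i < k \<Longrightarrow> \<beta> i = \<beta>' i) \<Longrightarrow> plan_state m x \<beta> k = plan_state m x \<beta>' k"
  by (induction k) auto

lemma weight_cong: "(\<And>i. i < k \<Longrightarrow> \<beta> i = \<beta>' i) \<Longrightarrow> weight m \<beta> k = weight m \<beta>' k"
  by (induction k) auto

lemma plan_cost_weighted:
  "plan_cost m (weighted_cost m g) x \<beta> =
    plan_cost m (Cbar m 0) x \<beta> + (\<Sum>j=1..ncons m. ennreal (g j) * plan_cost m (Cbar m j) x \<beta>)"
proof -
  let ?w = "weight m \<beta>" and ?z = "\<lambda>k. (Some (plan_state m x \<beta> k), \<beta> k)"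
  have "plan_cost m (weighted_cost m g) x \<beta> =
      (\<Sum>k. ?w k * Cbar m 0 (?z k) + (\<Sum>j=1..ncons m. ennreal (g j) * (?w k * Cbar m j (?z k))))"
    unfolding plan_cost_def weighted_cost_def
    by (intro suminf_cong) (simp add: distrib_left sum_distrib_left mult.left_commute)
  also have "\<dots> = (\<Sum>k. ?w k * Cbar m 0 (?z k)) + (\<Sum>k. \<Sum>j=1..ncons m. ennreal (g j) * (?w k * Cbar m j (?z k)))"
    by (rule suminf_add[symmetric]) auto
  also have "(\<Sum>k. \<Sum>j=1..ncons m. ennreal (g j) * (?w k * Cbar m j (?z k))) =
      (\<Sum>j=1..ncons m. \<Sum>k. ennreal (g j) * (?w k * Cbar m j (?z k)))"
    by (rule suminf_sum) auto
  finally show ?thesis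
    unfolding plan_cost_def by (simp add: ennreal_suminf_cmult)
qed

context bounded_impulse_model
begin

lemma plan_cost_seq_lsc_in_plan:
  assumes C: "seq_lsc (XD m \<times> BA m) C" and x: "x \<in> states m"
  shows "seq_lsc (plans m) (plan_cost m C x)"
proof -
  have "continuous_on (plans m) (\<lambda>\<beta>. (x, \<beta>))"
    by (intro continuous_on_Pair continuous_on_const continuous_on_id)
  from seq_lsc_compose[OF plan_cost_seq_lsc[OF C] this] x show ?thesis
    by auto
qed

text \<open>The weights are summable as soon as the cost with index \<open>0\<close> is finite, since each weight except the
first is at most a multiple of the cost of the preceding action.\<close>

lemma plan_cost_finite:
  assumes x: "x \<in> states m" and \<beta>: "\<beta> \<in> plans m" and fin: "plan_cost m (Cbar m 0) x \<beta> < \<infinity>"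
    and j: "j \<le> ncons m"
  shows "plan_cost m (Cbar m j) x \<beta> < \<infinity>"
proof -
  let ?w = "weight m \<beta>" and ?z = "\<lambda>k. (Some (plan_state m x \<beta> k), \<beta> k)"
  have z: "plan_state m x \<beta> k \<in> states m" "\<beta> k \<in> BA m" for k
    using plan_state_in_states[OF x \<beta>] \<beta> by (auto simp: plans_def)
  have "plan_cost m (Cbar m j) x \<beta> \<le> (\<Sum>k. ?w k * ennreal (K / disc m + K))"
    unfolding plan_cost_def by (intro suminf_le mult_left_mono Cbar_le j z) auto
  also have "\<dots> = (\<Sum>k. ?w k) * ennreal (K / disc m + K)"
    by (rule ennreal_suminf_multc)
  also have "(\<Sum>k. ?w k) = (\<Sum>k. ?w (k + 1)) + (\<Sum>k<1. ?w k)"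
    by (rule suminf_offset) simp
  also have "(\<Sum>k. ?w (k + 1)) \<le> (\<Sum>k. ennreal (1 / \<delta>) * (?w k * Cbar m 0 (?z k)))"
  proof (intro suminf_le)
    fix k
    have "?w (k + 1) = ennreal (1 / \<delta>) * (?w k * (ennreal \<delta> * survival m (\<beta> k)))"
    proof -
      have "ennreal (1 / \<delta>) * ennreal \<delta> = 1"
        using \<delta>(1) by (simp add: ennreal_mult[symmetric])
      then have "?w k * survival m (\<beta> k) = (ennreal (1 / \<delta>) * ennreal \<delta>) * (?w k * survival m (\<beta> k))"
        by simp
      then show ?thesis
        by (simp add: ac_simps)
    qed
    also have "\<dots> \<le> ennreal (1 / \<delta>) * (?w k * Cbar m 0 (?z k))"
      by (intro mult_left_mono Cbar0_ge z) auto
    finally show "?w (k + 1) \<le> ennreal (1 / \<delta>) * (?w k * Cbar m 0 (?z k))" .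
  qed auto
  also have "(\<Sum>k. ennreal (1 / \<delta>) * (?w k * Cbar m 0 (?z k))) = ennreal (1 / \<delta>) * plan_cost m (Cbar m 0) x \<beta>"
    unfolding plan_cost_def by (rule ennreal_suminf_cmult)
  finally have "plan_cost m (Cbar m j) x \<beta> \<le>
      (ennreal (1 / \<delta>) * plan_cost m (Cbar m 0) x \<beta> + 1) * ennreal (K / disc m + K)"
    by (simp add: add_right_mono mult_right_mono)
  also have "\<dots> < \<infinity>"
    using fin by (auto simp: ennreal_mult_less_top)
  finally show ?thesis .
qed

lemma plan_value_weighted_finite:
  assumes "x \<in> states m"
  shows "plan_value m (weighted_cost m g) x < \<infinity>"
proof -
  obtain B where B: "\<And>x b. x \<in> states m \<Longrightarrow> b \<in> BA m \<Longrightarrow> weighted_cost m g (Some x, b) \<le> ennreal B"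
    using weighted_cost_bounded[of g] by blast
  have "plan_value m (weighted_cost m g) x \<le> ennreal B"
    by (rule plan_value_bounded[of "weighted_cost m g" "ennreal B", OF B assms])
  then show ?thesis
    by (rule le_less_trans) simp
qed

lemma costs_finite_if_weighted_finite:
  assumes x: "x \<in> states m" and \<beta>: "\<beta> \<in> plans m" and fin: "plan_cost m (weighted_cost m g) x \<beta> < \<infinity>"
    and j: "j \<le> ncons m"
  shows "plan_cost m (Cbar m j) x \<beta> < \<infinity>"
proof (rule plan_cost_finite[OF x \<beta> _ j])
  show "plan_cost m (Cbar m 0) x \<beta> < \<infinity>"
    using fin unfolding plan_cost_weighted by simp
qed

lemma weighted_cost_real:
  assumes g: "g \<in> nonneg_orthant m" and fin: "\<And>j. j \<le> ncons m \<Longrightarrow> plan_cost m (Cbar m j) x \<beta> < \<infinity>"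
  shows "plan_cost m (weighted_cost m g) x \<beta> =
    ennreal (enn2real (plan_cost m (Cbar m 0) x \<beta>) + (\<Sum>j=1..ncons m. g j * enn2real (plan_cost m (Cbar m j) x \<beta>)))"
proof -
  have "(\<Sum>j=1..ncons m. ennreal (g j) * plan_cost m (Cbar m j) x \<beta>) =
      (\<Sum>j=1..ncons m. ennreal (g j * enn2real (plan_cost m (Cbar m j) x \<beta>)))"
  proof (intro sum.cong refl)
    fix j assume j: "j \<in> {1..ncons m}"
    then have "plan_cost m (Cbar m j) x \<beta> = ennreal (enn2real (plan_cost m (Cbar m j) x \<beta>))" "0 \<le> g j"
      using fin[of j] g by (auto simp: nonneg_orthant_def)
    then show "ennreal (g j) * plan_cost m (Cbar m j) x \<beta> = ennreal (g j * enn2real (plan_cost m (Cbar m j) x \<beta>))"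
      by (metis ennreal_mult enn2real_nonneg)
  qed
  also have "\<dots> = ennreal (\<Sum>j=1..ncons m. g j * enn2real (plan_cost m (Cbar m j) x \<beta>))"
    using g by (intro sum_ennreal) (auto simp: nonneg_orthant_def)
  finally have "plan_cost m (weighted_cost m g) x \<beta> = ennreal (enn2real (plan_cost m (Cbar m 0) x \<beta>)) +
      ennreal (\<Sum>j=1..ncons m. g j * enn2real (plan_cost m (Cbar m j) x \<beta>))"
    unfolding plan_cost_weighted using fin[of 0] by simp
  also have "\<dots> = ennreal (enn2real (plan_cost m (Cbar m 0) x \<beta>) + (\<Sum>j=1..ncons m. g j * enn2real (plan_cost m (Cbar m j) x \<beta>)))"
    using g by (intro ennreal_plus[symmetric] sum_nonneg) (auto simp: nonneg_orthant_def)
  finally show ?thesis .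
qed

text \<open>The principle of optimality: replacing the tail of an optimal plan by an optimal plan for the state
reached cannot lower the cost, so that the tail is optimal. The cancellations require finite costs
and a positive weight.\<close>

lemma optimal_plan_conserving:
  assumes C: "seq_lsc (XD m \<times> BA m) C" and x: "x \<in> states m" and \<beta>: "\<beta> \<in> plans m"
    and opt: "plan_cost m C x \<beta> = plan_value m C x" and fin: "plan_value m C x < \<infinity>"
    and w: "0 < weight m \<beta> k"
  shows "plan_cost m C (plan_state m x \<beta> k) (\<lambda>i. \<beta> (k + i)) = plan_value m C (plan_state m x \<beta> k)"
    and "action_value m C (plan_state m x \<beta> k) (\<beta> k) = plan_value m C (plan_state m x \<beta> k)"
proof -
  let ?S = "\<lambda>n. \<Sum>i<n. weight m \<beta> i * C (Some (plan_state m x \<beta> i), \<beta> i)"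
  let ?y = "plan_state m x \<beta>"
  let ?tail = "plan_cost m C (?y k) (\<lambda>i. \<beta> (k + i))"
  have y: "?y n \<in> states m" "\<beta> n \<in> BA m" for n
    using plan_state_in_states[OF x \<beta>] \<beta> by (auto simp: plans_def)
  have upper: "plan_value m C x \<le> ?S n + weight m \<beta> n * plan_value m C (?y n)" for n
  proof (induction n)
    case (Suc n)
    have "weight m \<beta> n * plan_value m C (?y n) \<le> weight m \<beta> n * action_value m C (?y n) (\<beta> n)"
      by (intro mult_left_mono plan_value_le_action_value C y) simp
    then have "?S n + weight m \<beta> n * plan_value m C (?y n) \<le> ?S n + weight m \<beta> n * action_value m C (?y n) (\<beta> n)"
      by (rule add_left_mono)
    with Suc have "plan_value m C x \<le> ?S n + weight m \<beta> n * action_value m C (?y n) (\<beta> n)"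
      by (rule order_trans)
    then show ?case
      by (simp add: action_value_def distrib_left mult.assoc add.assoc)
  qed simp
  have split: "plan_value m C x = ?S k + weight m \<beta> k * ?tail"
    using plan_cost_split[of m C x \<beta> k] opt by simp
  have "?S k \<le> ?S k + weight m \<beta> k * ?tail"
    by simp
  then have "?S k \<le> plan_value m C x"
    unfolding split[symmetric] .
  then have "?S k < \<infinity>"
    using fin by (rule le_less_trans)
  then have "?S k \<noteq> top"
    unfolding infinity_ennreal_def by (rule less_imp_neq)
  have "?S k + weight m \<beta> k * ?tail \<le> ?S k + weight m \<beta> k * plan_value m C (?y k)"
    using upper[of k] split by simp
  with \<open>?S k \<noteq> top\<close> have le: "weight m \<beta> k * ?tail \<le> weight m \<beta> k * plan_value m C (?y k)"
    by (simp add: ennreal_add_left_cancel_le)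
  have "weight m \<beta> k \<noteq> top"
    using weight_le_1[OF disc_pos, of \<beta> k] by (auto simp: top_unique)
  with le w have "?tail \<le> plan_value m C (?y k)"
    by (simp add: ennreal_mult_le_mult_iff zero_less_iff_neq_zero)
  then show tail: "?tail = plan_value m C (?y k)"
    using plan_value_le[OF plan_shift[OF \<beta>, of k], of C "?y k"] by (rule antisym)
  show "action_value m C (?y k) (\<beta> k) = plan_value m C (?y k)"
    using action_value_le_plan_cost[OF plan_shift[OF \<beta>, of k], of C "?y k"] tail
      plan_value_le_action_value[OF C y(1)[of k] y(2)[of k]] by (intro antisym) simp_all
qed

lemma Some_singleton_measurable: "y \<in> states m \<Longrightarrow> {Some y} \<in> sets (SM m)"
proof -
  assume y: "y \<in> states m"
  have "closed {Some y}"
    unfolding closed_def open_option_def by (auto simp: vimage_def intro!: open_Collect_neq continuous_intros)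
  then have "{Some y} \<in> sets borel"
    by (rule borel_closed)
  then show ?thesis
    using y unfolding SM_def sets_restrict_space by (auto intro!: image_eqI[of _ _ "{Some y}"])
qed

text \<open>A measurable function remains measurable if it is changed at countably many points. On the path the
new strategy copies the plan, which makes sense because the states concerned are distinct.\<close>

lemma override_along_path:
  assumes h: "h \<in> det_stationary m" and x: "x \<in> states m" and \<beta>: "\<beta> \<in> plans m"
    and inj: "inj_on (plan_state m x \<beta>) I"
  obtains f where "f \<in> det_stationary m" "f None = h None" "\<And>k. k \<in> I \<Longrightarrow> f (Some (plan_state m x \<beta> k)) = \<beta> k"
    "\<And>y. y \<notin> plan_state m x \<beta> ` I \<Longrightarrow> f (Some y) = h (Some y)"
proof
  define f where "f z = (case z of None \<Rightarrow> h None | Some y \<Rightarrow>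
      if y \<in> plan_state m x \<beta> ` I then \<beta> (the_inv_into I (plan_state m x \<beta>) y) else h z)" for z
  show "f None = h None" "\<And>y. y \<notin> plan_state m x \<beta> ` I \<Longrightarrow> f (Some y) = h (Some y)"
    by (simp_all add: f_def)
  show f_on_path: "f (Some (plan_state m x \<beta> k)) = \<beta> k" if "k \<in> I" for k
    using that by (simp add: f_def the_inv_into_f_f[OF inj])
  have h': "h \<in> SM m \<rightarrow>\<^sub>M BM m"
    using h by (simp add: det_stationary_def)
  show "f \<in> det_stationary m"
    unfolding det_stationary_def
  proof (rule measurable_discrete_difference[OF h', where X = "Some ` plan_state m x \<beta> ` I"])
    show "countable (Some ` plan_state m x \<beta> ` I)"
      by (intro countable_image countableI_type)
    fix z assume "z \<in> Some ` plan_state m x \<beta> ` I"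
    then obtain k where k: "k \<in> I" "z = Some (plan_state m x \<beta> k)"
      by blast
    show "{z} \<in> sets (SM m)"
      unfolding k(2) by (rule Some_singleton_measurable[OF plan_state_in_states[OF x \<beta>]])
    show "f z \<in> space (BM m)"
      using f_on_path[OF k(1)] k(2) \<beta> by (simp add: plans_def)
  next
    show "h z = f z" if "z \<notin> Some ` plan_state m x \<beta> ` I" for z
      using that by (auto simp: f_def split: option.split)
  qed
qed

lemma closed_loop_follows:
  assumes f: "\<And>k. k < n \<Longrightarrow> 0 < weight m \<beta> k \<Longrightarrow> f (Some (plan_state m x \<beta> k)) = \<beta> k"
  shows "k \<le> n \<Longrightarrow> weight m (closed_loop m f x) k = weight m \<beta> k \<and>
    (0 < weight m \<beta> k \<longrightarrow> closed_loop_state m f x k = plan_state m x \<beta> k)"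
proof (induction k)
  case (Suc k)
  show ?case
  proof (cases "0 < weight m \<beta> k")
    case True
    then have "closed_loop_state m f x k = plan_state m x \<beta> k" "closed_loop m f x k = \<beta> k"
      using Suc f[of k] by (auto simp: closed_loop_def)
    with Suc show ?thesis
      by (simp add: closed_loop_def)
  next
    case False
    then have "weight m \<beta> k = 0"
      by (simp add: zero_less_iff_neq_zero)
    with Suc show ?thesis
      by simp
  qed
qed simp

text \<open>If the states reached with positive weight are distinct, a stationary strategy can copy the plan.
Otherwise let \<open>q\<close> be the first time at which a state is reached again, say the state of time \<open>n < q\<close>.
Let \<open>S\<close> be the cost up to time \<open>n\<close>, \<open>w\<close> the weight at time \<open>n\<close>, \<open>L\<close> and \<open>r\<close> the cost and the survival
probability of the loop, and \<open>G\<close> the cost after the loop. The plan costs \<open>S + w (L + r G)\<close>. Repeating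
the loop for ever costs \<open>S + w A\<close> with \<open>A = L + r A\<close>, and skipping it costs \<open>S + w G\<close>. The first is the
convex combination of the other two with coefficients \<open>1 - r\<close> and \<open>r\<close>. Here \<open>r < 1\<close>, because a
loop without risk of being killed only adds the price of at least one impulse to an optimal cost. So the
costs of an extreme plan equal those of the plan that repeats the loop, whose states before the first
return are distinct. Off the path the strategy is an arbitrary conserving one.\<close>

lemma stationary_of_extreme_plan:
  assumes x: "x \<in> states m" and \<beta>: "\<beta> \<in> plans m" and b0: "b0 \<in> BA m"
    and opt: "plan_cost m (weighted_cost m g) x \<beta> = plan_value m (weighted_cost m g) x"
    and extreme: "extreme_costs (ncons m) (\<lambda>j. plan_cost m (Cbar m j) x) (plans m) \<beta>"
  shows "\<exists>f\<in>det_stationary m. f None = b0 \<and>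
    (\<forall>y\<in>states m. action_value m (weighted_cost m g) y (f (Some y)) = plan_value m (weighted_cost m g) y) \<and>
    (\<forall>j\<le>ncons m. plan_cost m (Cbar m j) x (closed_loop m f x) = plan_cost m (Cbar m j) x \<beta>)"
proof -
  let ?C = "weighted_cost m g" and ?y = "plan_state m x \<beta>" and ?w = "weight m \<beta>"
  have pv_fin: "plan_value m ?C y < \<infinity>" if "y \<in> states m" for y
    by (rule plan_value_weighted_finite[OF that])
  have y: "?y k \<in> states m" "\<beta> k \<in> BA m" for k
    using plan_state_in_states[OF x \<beta>] \<beta> by (auto simp: plans_def)
  note cons = optimal_plan_conserving[OF weighted_cost_seq_lsc x \<beta> opt pv_fin[OF x]]
  have w_mono: "0 < ?w k" if "0 < ?w (k + i)" for k i
    using that by (auto simp: weight_add zero_less_iff_neq_zero)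
  obtain h where h: "h \<in> det_stationary m" "h None = b0"
    "\<And>y. y \<in> states m \<Longrightarrow> action_value m ?C y (h (Some y)) = plan_value m ?C y"
    using optimal_stationary[OF b0, of g] by blast
  have conserving: "action_value m ?C z (f (Some z)) = plan_value m ?C z"
    if f: "\<And>k. k \<in> I \<Longrightarrow> f (Some (?y k)) = \<beta> k" "\<And>y. y \<notin> ?y ` I \<Longrightarrow> f (Some y) = h (Some y)"
      and I: "\<And>k. k \<in> I \<Longrightarrow> 0 < ?w k" and z: "z \<in> states m" for f I z
  proof (cases "z \<in> ?y ` I")
    case True
    then show ?thesis
      using f(1) cons(2)[OF I] by auto
  next
    case False
    then show ?thesis
      using f(2) h(3)[OF z] by simp
  qed
  show ?thesis
  proof (cases "inj_on ?y {k. 0 < ?w k}")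
    case True
    obtain f where f: "f \<in> det_stationary m" "f None = h None" "\<And>k. k \<in> {k. 0 < ?w k} \<Longrightarrow> f (Some (?y k)) = \<beta> k"
      "\<And>y. y \<notin> ?y ` {k. 0 < ?w k} \<Longrightarrow> f (Some y) = h (Some y)"
      by (rule override_along_path[OF h(1) x \<beta> True]) blast
    have "plan_cost m D x (closed_loop m f x) = plan_cost m D x \<beta>" for D
      unfolding plan_cost_def
    proof (intro suminf_cong)
      fix k
      have follow: "weight m (closed_loop m f x) k = ?w k" "0 < ?w k \<Longrightarrow> closed_loop_state m f x k = ?y k"
        using closed_loop_follows[of k \<beta> f x k] f(3) by auto
      show "weight m (closed_loop m f x) k * D (Some (plan_state m x (closed_loop m f x) k), closed_loop m f x k) =
          ?w k * D (Some (?y k), \<beta> k)"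
      proof (cases "0 < ?w k")
        case True
        with follow f(3)[of k] show ?thesis
          by (simp add: plan_state_closed_loop closed_loop_def)
      next
        case False
        with follow show ?thesis
          by (simp add: zero_less_iff_neq_zero)
      qed
    qed
    moreover have "action_value m ?C z (f (Some z)) = plan_value m ?C z" if "z \<in> states m" for z
      by (rule conserving[OF f(3,4) _ that]) auto
    ultimately show ?thesis
      using f(1,2) h(2) by (intro bexI[of _ f]) auto
  next
    case False
    \<comment> \<open>\<open>rep q\<close>: time \<open>q\<close> is reached alive, in a state that was visited before.\<close>
    define rep where "rep q \<longleftrightarrow> 0 < ?w q \<and> (\<exists>n<q. ?y n = ?y q)" for q
    have "\<exists>q. rep q"
    proof -
      obtain a b where ab: "0 < ?w a" "0 < ?w b" "?y a = ?y b" "a \<noteq> b"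
        using False by (auto simp: inj_on_def)
      show ?thesis
      proof (cases "a < b")
        case True
        then show ?thesis
          using ab by (auto simp: rep_def)
      next
        case False
        then have "b < a"
          using ab(4) by simp
        then show ?thesis
          using ab by (metis rep_def)
      qed
    qed
    define q where "q = (LEAST q. rep q)"
    have q: "rep q" and q_min: "\<And>k. k < q \<Longrightarrow> \<not> rep k"
      unfolding q_def using \<open>\<exists>q. rep q\<close> by (auto intro: LeastI_ex dest: not_less_Least)
    obtain n where n: "n < q" "?y n = ?y q" and wq: "0 < ?w q"
      using q by (auto simp: rep_def)
    have w_pos: "0 < ?w k" if "k \<le> q" for k
      using w_mono[of k "q - k"] wq that by simp
    have inj: "inj_on ?y {..<q}"
    proof (rule linorder_inj_onI)
      fix i k assume "i < k" "i \<in> {..<q}" "k \<in> {..<q}"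
      then show "?y i \<noteq> ?y k"
        using q_min[of k] w_pos[of k] by (auto simp: rep_def)
    qed (rule nat_le_linear)
    obtain f where f: "f \<in> det_stationary m" "f None = h None" "\<And>k. k \<in> {..<q} \<Longrightarrow> f (Some (?y k)) = \<beta> k"
      "\<And>y. y \<notin> ?y ` {..<q} \<Longrightarrow> f (Some y) = h (Some y)"
      by (rule override_along_path[OF h(1) x \<beta> inj]) blast
    have f_cons: "action_value m ?C z (f (Some z)) = plan_value m ?C z" if "z \<in> states m" for z
      by (rule conserving[OF f(3,4) _ that]) (use w_pos in auto)
    let ?\<beta>1 = "closed_loop m f x"
    have clp: "closed_loop_state m f x k = ?y k" if "k \<le> q" for k
      using closed_loop_follows[of q \<beta> f x k] f(3) w_pos[OF that] that by auto
    have cl: "?\<beta>1 k = \<beta> k" if "k < q" for k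
      using f(3)[of k] clp[of k] that by (simp add: closed_loop_def)
    define p where "p = q - n"
    have p: "0 < p" "n + p = q"
      using n(1) by (auto simp: p_def)
    let ?x' = "?y n" and ?\<alpha> = "\<lambda>i. \<beta> (n + i)"
    have x': "?x' \<in> states m"
      by (rule y)
    define \<beta>2 where "\<beta>2 k = (if k < n then \<beta> k else \<beta> (k + p))" for k
    have \<beta>1_plan: "?\<beta>1 \<in> plans m"
      by (rule closed_loop_in_plans[OF f(1) x])
    have \<beta>2_plan: "\<beta>2 \<in> plans m"
      using \<beta> by (auto simp: plans_def \<beta>2_def)
    define S where "S D = (\<Sum>i<n. ?w i * D (Some (?y i), \<beta> i))" for D
    define L where "L D = (\<Sum>i<p. weight m ?\<alpha> i * D (Some (plan_state m ?x' ?\<alpha> i), ?\<alpha> i))" for D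
    define r where "r = weight m ?\<alpha> p"
    define G where "G D = plan_cost m D (?y q) (\<lambda>i. \<beta> (q + i))" for D
    define A where "A D = plan_cost m D ?x' (closed_loop m f ?x')" for D
    have wn_r: "?w n * r = ?w q"
      unfolding r_def using weight_add[of m \<beta> n p] p(2) by simp
    have cost_tail: "plan_cost m D ?x' ?\<alpha> = L D + r * G D" for D
    proof -
      have "plan_state m ?x' ?\<alpha> p = ?y q"
        using plan_state_add[of m x \<beta> n p] p(2) by simp
      moreover have "(\<lambda>i. \<beta> (n + (p + i))) = (\<lambda>i. \<beta> (q + i))"
        using p(2) by (simp add: add.assoc[symmetric])
      ultimately show ?thesis
        unfolding L_def r_def G_def by (subst plan_cost_split[of m D ?x' ?\<alpha> p]) simp
    qed
    have cost_\<beta>: "plan_cost m D x \<beta> = S D + ?w n * (L D + r * G D)" for D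
      unfolding S_def cost_tail[symmetric] by (rule plan_cost_split)
    have cost_\<beta>1: "plan_cost m D x ?\<beta>1 = S D + ?w n * A D" for D
    proof -
      have "plan_cost m D x ?\<beta>1 = (\<Sum>i<n. weight m ?\<beta>1 i * D (Some (plan_state m x ?\<beta>1 i), ?\<beta>1 i)) +
          weight m ?\<beta>1 n * plan_cost m D (plan_state m x ?\<beta>1 n) (\<lambda>i. ?\<beta>1 (n + i))"
        by (rule plan_cost_split)
      also have "(\<Sum>i<n. weight m ?\<beta>1 i * D (Some (plan_state m x ?\<beta>1 i), ?\<beta>1 i)) = S D"
        unfolding S_def
      proof (intro sum.cong refl)
        fix i assume "i \<in> {..<n}"
        then have "i < q" using n(1) by simp
        then show "weight m ?\<beta>1 i * D (Some (plan_state m x ?\<beta>1 i), ?\<beta>1 i) = ?w i * D (Some (?y i), \<beta> i)"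
          using cl clp[of i] weight_cong[of i ?\<beta>1 \<beta> m] by (simp add: plan_state_closed_loop)
      qed
      also have "weight m ?\<beta>1 n = ?w n"
        using cl n(1) by (intro weight_cong) simp
      also have "plan_state m x ?\<beta>1 n = ?x'"
        using clp[of n] n(1) by (simp add: plan_state_closed_loop)
      also have "(\<lambda>i. ?\<beta>1 (n + i)) = closed_loop m f ?x'"
        unfolding closed_loop_shift using clp[of n] n(1) by simp
      finally show ?thesis
        by (simp add: A_def)
    qed
    have A_rec: "A D = L D + r * A D" for D
    proof -
      let ?\<eta> = "closed_loop m f ?x'"
      have \<eta>: "?\<eta> i = ?\<beta>1 (n + i)" for i
        using fun_cong[OF closed_loop_shift[of m f x n], of i] clp[of n] n(1) by simp
      have \<eta>': "?\<eta> i = ?\<alpha> i" if "i < p" for i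
        unfolding \<eta> using cl[of "n + i"] that p(2) by simp
      have "A D = (\<Sum>i<p. weight m ?\<eta> i * D (Some (plan_state m ?x' ?\<eta> i), ?\<eta> i)) +
          weight m ?\<eta> p * plan_cost m D (plan_state m ?x' ?\<eta> p) (\<lambda>i. ?\<eta> (p + i))"
        unfolding A_def by (rule plan_cost_split)
      also have "(\<Sum>i<p. weight m ?\<eta> i * D (Some (plan_state m ?x' ?\<eta> i), ?\<eta> i)) = L D"
        unfolding L_def
      proof (intro sum.cong refl)
        fix i assume "i \<in> {..<p}"
        then show "weight m ?\<eta> i * D (Some (plan_state m ?x' ?\<eta> i), ?\<eta> i) = weight m ?\<alpha> i * D (Some (plan_state m ?x' ?\<alpha> i), ?\<alpha> i)"
          using \<eta>' weight_cong[of i ?\<eta> ?\<alpha> m] plan_state_cong[of i ?\<eta> ?\<alpha> m ?x'] by simp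
      qed
      also have "weight m ?\<eta> p = r"
        unfolding r_def using \<eta>' by (rule weight_cong)
      also have "plan_state m ?x' ?\<eta> p = ?x'"
        using plan_state_cong[of p ?\<eta> ?\<alpha> m ?x'] \<eta>' plan_state_add[of m x \<beta> n p] p(2) n(2) by simp
      also have "(\<lambda>i. ?\<eta> (p + i)) = ?\<eta>"
      proof -
        have "closed_loop_state m f ?x' p = ?x'"
          using closed_loop_state_add[of m f x n p] clp[of n] clp[of q] n p(2) by simp
        then show ?thesis
          unfolding closed_loop_shift by simp
      qed
      finally show ?thesis
        unfolding A_def[symmetric] .
    qed
    have cost_\<beta>2: "plan_cost m D x \<beta>2 = S D + ?w n * G D" for D
    proof -
      have pre: "\<beta>2 i = \<beta> i" if "i < n" for i
        using that by (simp add: \<beta>2_def)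
      have "plan_cost m D x \<beta>2 = (\<Sum>i<n. weight m \<beta>2 i * D (Some (plan_state m x \<beta>2 i), \<beta>2 i)) +
          weight m \<beta>2 n * plan_cost m D (plan_state m x \<beta>2 n) (\<lambda>i. \<beta>2 (n + i))"
        by (rule plan_cost_split)
      also have "(\<Sum>i<n. weight m \<beta>2 i * D (Some (plan_state m x \<beta>2 i), \<beta>2 i)) = S D"
        unfolding S_def
      proof (intro sum.cong refl)
        fix i assume "i \<in> {..<n}"
        then show "weight m \<beta>2 i * D (Some (plan_state m x \<beta>2 i), \<beta>2 i) = ?w i * D (Some (?y i), \<beta> i)"
          using pre weight_cong[of i \<beta>2 \<beta> m] plan_state_cong[of i \<beta>2 \<beta> m x] by simp
      qed
      also have "weight m \<beta>2 n = ?w n"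
        using pre by (rule weight_cong)
      also have "plan_state m x \<beta>2 n = ?y q"
        using plan_state_cong[of n \<beta>2 \<beta> m x] pre n(2) by simp
      also have "(\<lambda>i. \<beta>2 (n + i)) = (\<lambda>i. \<beta> (q + i))"
        using p(2) by (auto simp: \<beta>2_def add_ac)
      finally show ?thesis
        by (simp add: G_def)
    qed
    have r_pos: "0 < r"
      using wq wn_r by (auto simp: zero_less_iff_neq_zero)
    have r_le: "r \<le> 1"
      unfolding r_def by (rule weight_le_1[OF disc_pos])
    \<comment> \<open>With \<open>r = 1\<close> the optimal value at the repeated state would exceed itself by the cost \<open>L\<close> of the loop.\<close>
    have "r \<noteq> 1"
    proof
      assume r1: "r = 1"
      have tail_n: "plan_value m ?C ?x' = L ?C + r * G ?C"
        using cons(1)[OF w_pos[of n]] n(1) cost_tail by simp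
      have "G ?C = plan_value m ?C ?x'"
        unfolding G_def using cons(1)[OF wq] n(2) by simp
      then have "plan_value m ?C ?x' = L ?C + plan_value m ?C ?x'"
        using tail_n r1 by simp
      then have "plan_value m ?C ?x' + L ?C \<le> plan_value m ?C ?x' + 0"
        by (simp add: add.commute)
      then have "L ?C = 0"
        using pv_fin[OF x'] by (subst (asm) ennreal_add_left_cancel_le) auto
      moreover have "weight m ?\<alpha> 0 * ?C (Some (plan_state m ?x' ?\<alpha> 0), ?\<alpha> 0) \<le> L ?C"
        unfolding L_def using p(1) by (intro member_le_sum) auto
      ultimately have "?C (Some ?x', \<beta> n) = 0"
        by simp
      then have "Cbar m 0 (Some ?x', \<beta> n) = 0"
        by (simp add: weighted_cost_def)
      then have "ennreal \<delta> * survival m (\<beta> n) = 0"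
        using Cbar0_ge[OF y(1)[of n] y(2)[of n]] by simp
      then have "survival m (\<beta> n) = 0"
        using \<delta>(1) by simp
      then have "?w (Suc n) = 0"
        by simp
      moreover have "0 < ?w (Suc n)"
        using n(1) by (intro w_pos) simp
      ultimately show False
        by (simp only: less_irrefl)
    qed
    then have r_less: "r < 1"
      using r_le by simp
    have fin_\<beta>: "plan_cost m (Cbar m j) x \<beta> < \<infinity>" if "j \<le> ncons m" for j
      by (rule costs_finite_if_weighted_finite[where g = g, OF x \<beta> _ that]) (use opt pv_fin[OF x] in simp)
    have fin_\<beta>1: "plan_cost m (Cbar m j) x ?\<beta>1 < \<infinity>" if "j \<le> ncons m" for j
      by (rule costs_finite_if_weighted_finite[where g = g, OF x \<beta>1_plan _ that])
         (use conserving_optimal[OF f(1) x f_cons] pv_fin[OF x] in simp)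
    have wn: "?w n \<noteq> 0" "?w n \<noteq> top"
      using w_pos[of n] n(1) weight_le_1[OF disc_pos, of \<beta> n] by (auto simp: top_unique)
    have finite_parts: "S (Cbar m j) < top" "L (Cbar m j) < top" "G (Cbar m j) < top" "A (Cbar m j) < top"
      if j: "j \<le> ncons m" for j
      using fin_\<beta>[OF j] fin_\<beta>1[OF j] wn r_pos unfolding cost_\<beta> cost_\<beta>1
      by (auto simp: ennreal_mult_less_top zero_less_iff_neq_zero)
    have fin_\<beta>2: "plan_cost m (Cbar m j) x \<beta>2 < \<infinity>" if "j \<le> ncons m" for j
      unfolding cost_\<beta>2 using finite_parts[OF that] wn by (auto simp: ennreal_mult_less_top less_top)
    have "\<forall>j\<le>ncons m. plan_cost m (Cbar m j) x ?\<beta>1 = plan_cost m (Cbar m j) x \<beta>"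
    proof (rule extreme_costsD[OF extreme \<beta>1_plan \<beta>2_plan, of "enn2real r"])
      show "0 < enn2real r" "enn2real r < 1"
        using r_pos r_less by (auto simp: enn2real_positive_iff less_trans enn2real_less_iff)
      show "\<forall>j\<le>ncons m. plan_cost m (Cbar m j) x ?\<beta>1 < \<infinity>" "\<forall>j\<le>ncons m. plan_cost m (Cbar m j) x \<beta>2 < \<infinity>"
        using fin_\<beta>1 fin_\<beta>2 by auto
      show "\<forall>j\<le>ncons m. enn2real (plan_cost m (Cbar m j) x \<beta>) =
          (1 - enn2real r) * enn2real (plan_cost m (Cbar m j) x ?\<beta>1) + enn2real r * enn2real (plan_cost m (Cbar m j) x \<beta>2)"
      proof (intro allI impI)
        fix j assume "j \<le> ncons m"
        note fp = finite_parts[OF this]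
        obtain s l g' a w' r' where reals: "S (Cbar m j) = ennreal s" "0 \<le> s" "L (Cbar m j) = ennreal l" "0 \<le> l"
          "G (Cbar m j) = ennreal g'" "0 \<le> g'" "A (Cbar m j) = ennreal a" "0 \<le> a"
          "?w n = ennreal w'" "0 \<le> w'" "r = ennreal r'" "0 \<le> r'"
          using fp wn(2) r_le
          by (cases "S (Cbar m j)"; cases "L (Cbar m j)"; cases "G (Cbar m j)"; cases "A (Cbar m j)"; cases "?w n"; cases r)
             (auto simp: top_unique)
        have "ennreal (l + r' * a) = ennreal l + ennreal r' * ennreal a"
          using reals by (simp add: ennreal_mult)
        then have "ennreal a = ennreal (l + r' * a)"
          using A_rec[of "Cbar m j"] unfolding reals by (simp only:)
        moreover have "0 \<le> l + r' * a"
          using reals by simp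
        ultimately have a: "a = l + r' * a"
          using reals(8) by (simp only: ennreal_inj)
        have "enn2real (plan_cost m (Cbar m j) x \<beta>) = s + w' * (l + r' * g')"
          "enn2real (plan_cost m (Cbar m j) x ?\<beta>1) = s + w' * a"
          "enn2real (plan_cost m (Cbar m j) x \<beta>2) = s + w' * g'"
          unfolding cost_\<beta> cost_\<beta>1 cost_\<beta>2 using reals
          by (simp_all add: ennreal_mult[symmetric] ennreal_plus[symmetric] del: ennreal_plus)
        moreover have "s + w' * (l + r' * g') = (1 - r') * (s + w' * a) + r' * (s + w' * g')"
        proof -
          have "(1 - r') * (s + w' * a) + r' * (s + w' * g') = s + w' * ((a - r' * a) + r' * g')"
            by (simp add: algebra_simps)
          also have "a - r' * a = l"
            using a by simp
          finally show ?thesis by simp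
        qed
        ultimately show "enn2real (plan_cost m (Cbar m j) x \<beta>) =
          (1 - enn2real r) * enn2real (plan_cost m (Cbar m j) x ?\<beta>1) + enn2real r * enn2real (plan_cost m (Cbar m j) x \<beta>2)"
          using reals by simp
      qed
    qed
    then show ?thesis
      using f(1,2) h(2) f_cons by (intro bexI[of _ f]) auto
  qed
qed

end

context bounded_impulse_model
begin

section \<open>Markov strategies that realise mixtures\<close>

text \<open>If \<open>l\<close> is drawn with probability \<open>\<gamma> l\<close> and \<open>f l\<close> is used from then on, the process at time \<open>n\<close> is either
dead or in one of the finitely many states \<open>y l n\<close>. The Markov strategy \<open>\<kappa> n\<close> draws \<open>l\<close> anew at every
step, with its conditional probability \<open>p n z l\<close> given the present state \<open>z\<close>. It has the same joint
law of state and action at every time, and only these laws matter for costs and occupation measures.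
The strategy is a modification of \<open>f 0\<close> at finitely many states, whence measurability.\<close>

lemma exists_mixing_strategy:
  fixes f :: "nat \<Rightarrow> 'x option \<Rightarrow> ennreal \<times> 'a" and \<gamma> :: "nat \<Rightarrow> real"
  assumes f: "\<And>l. l < N \<Longrightarrow> f l \<in> det_stationary m" and N: "0 < N"
    and \<gamma>: "\<And>l. l < N \<Longrightarrow> 0 \<le> \<gamma> l" "(\<Sum>l<N. \<gamma> l) = 1" and x: "x \<in> states m"
  shows "\<exists>\<pi>\<in>strategies m. (\<forall>n \<omega>. \<pi> n (\<omega>, None) = return (BM m) (f 0 None)) \<and>
    (\<forall>n. \<forall>u\<in>borel_measurable (SBM m). (\<forall>b. u (None, b) = 0) \<longrightarrow>
      (\<integral>\<^sup>+\<omega>. u (\<omega> n) \<partial>law m \<pi> (Some x)) = (\<Sum>l<N. ennreal (\<gamma> l) * (\<integral>\<^sup>+\<omega>. u (\<omega> n) \<partial>law m (stat m (f l)) (Some x))))"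
proof -
  define y where "y l n = closed_loop_state m (f l) x n" for l n
  define a where "a l n = ennreal (\<gamma> l) * weight m (closed_loop m (f l) x) n" for l n
  \<comment> \<open>\<open>D n z\<close> is the probability of being in state \<open>z\<close> at time \<open>n\<close>, and \<open>a l n\<close> the part of it due to \<open>l\<close>.\<close>
  define D where "D n z = (\<Sum>l<N. if z = Some (y l n) then a l n else 0)" for n z
  define p where "p n z l = (if z = Some (y l n) then a l n / D n z else 0)" for n z l
  define \<kappa> where "\<kappa> n z = (if D n z = 0 then return (BM m) (f 0 z)
      else distr (point_measure {..<N} (p n z)) (BM m) (\<lambda>l. f l z))" for n z
  define \<pi> :: "('x, 'a) strategy" where "\<pi> n h = \<kappa> n (snd h)" for n h
  have y: "y l n \<in> states m" if "l < N" for l n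
    unfolding y_def by (rule closed_loop_state_in_states[OF f[OF that] x])
  have a_fin: "a l n < top" for l n
    using weight_le_1[OF disc_pos, of "closed_loop m (f l) x" n]
    unfolding a_def by (auto simp: ennreal_mult_less_top intro: le_less_trans)
  have D_fin: "D n z < top" for n z
    unfolding D_def using a_fin by auto
  have D_None: "D n None = 0" for n
    by (simp add: D_def)
  have f_BA: "f l z \<in> BA m" if "l < N" "z \<in> XD m" for l z
    by (rule det_stationary_in_BA[OF f[OF that(1)] that(2)])
  have sum_p: "(\<Sum>l<N. p n z l) = 1" if "D n z \<noteq> 0" for n z
  proof -
    have "(\<Sum>l<N. p n z l) = (\<Sum>l<N. (if z = Some (y l n) then a l n else 0) / D n z)"
      by (intro sum.cong) (auto simp: p_def)
    also have "\<dots> = D n z / D n z"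
      unfolding D_def by (simp add: divide_ennreal_def sum_distrib_right)
    also have "\<dots> = 1"
      using that D_fin[of n z] by (intro ennreal_divide_self) auto
    finally show ?thesis .
  qed
  have f_meas: "(\<lambda>l. f l z) \<in> point_measure {..<N} (p n z) \<rightarrow>\<^sub>M BM m" if "z \<in> XD m" for n z
    using f_BA[OF _ that] by (auto simp: measurable_def space_point_measure sets_point_measure)
  have \<kappa>_prob: "\<kappa> n z \<in> space (prob_algebra (BM m))" if z: "z \<in> XD m" for n z
  proof (cases "D n z = 0")
    case True
    then show ?thesis
      using f_BA[OF N z] by (auto simp: \<kappa>_def space_prob_algebra intro!: prob_space_return)
  next
    case False
    have "emeasure (point_measure {..<N} (p n z)) {..<N} = (\<Sum>l<N. p n z l)"
      by (rule emeasure_point_measure_finite2) auto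
    then have "prob_space (point_measure {..<N} (p n z))"
      using sum_p[OF False] by (intro prob_spaceI) (simp add: space_point_measure)
    then have "prob_space (distr (point_measure {..<N} (p n z)) (BM m) (\<lambda>l. f l z))"
      by (rule prob_space.prob_space_distr[OF _ f_meas[OF z]])
    then show ?thesis
      using False by (simp add: \<kappa>_def space_prob_algebra)
  qed
  have \<kappa>_meas: "\<kappa> n \<in> SM m \<rightarrow>\<^sub>M prob_algebra (BM m)" for n
  proof (rule measurable_discrete_difference[where X = "(\<lambda>l. Some (y l n)) ` {..<N}"])
    have "f 0 \<in> SM m \<rightarrow>\<^sub>M BM m"
      using f[OF N] by (simp add: det_stationary_def)
    then show "(\<lambda>z. return (BM m) (f 0 z)) \<in> SM m \<rightarrow>\<^sub>M prob_algebra (BM m)"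
      by (rule measurable_compose[OF _ measurable_return_prob_space])
    show "countable ((\<lambda>l. Some (y l n)) ` {..<N})"
      by (intro countable_finite finite_imageI finite_lessThan)
    show "{z} \<in> sets (SM m)" "\<kappa> n z \<in> space (prob_algebra (BM m))" if "z \<in> (\<lambda>l. Some (y l n)) ` {..<N}" for z
      using that y by (auto intro!: Some_singleton_measurable \<kappa>_prob)
    show "return (BM m) (f 0 z) = \<kappa> n z" if "z \<notin> (\<lambda>l. Some (y l n)) ` {..<N}" for z
    proof -
      have "D n z = 0"
        unfolding D_def using that by (intro sum.neutral) auto
      then show ?thesis
        by (simp add: \<kappa>_def)
    qed
  qed
  have \<pi>: "\<pi> \<in> strategies m"
    unfolding strategies_def HM_def
  proof (intro CollectI allI)
    fix n
    have "(\<lambda>h. \<kappa> n (snd h)) \<in> (\<Pi>\<^sub>M i\<in>{0..<n}. SBM m) \<Otimes>\<^sub>M SM m \<rightarrow>\<^sub>M prob_algebra (BM m)"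
      by (rule measurable_compose[OF measurable_snd \<kappa>_meas])
    then show "\<pi> n \<in> (\<Pi>\<^sub>M i\<in>{0..<n}. SBM m) \<Otimes>\<^sub>M SM m \<rightarrow>\<^sub>M prob_algebra (BM m)"
      by (simp add: \<pi>_def[abs_def])
  qed
  have xD: "Some x \<in> XD m"
    using x by simp
  have \<kappa>_int: "(\<integral>\<^sup>+b. u (z, b) \<partial>\<kappa> n z) = (\<Sum>l<N. p n z l * u (z, f l z))"
    if u: "u \<in> borel_measurable (SBM m)" and z: "z \<in> XD m" and D: "D n z \<noteq> 0" for u n z
  proof -
    have u': "(\<lambda>b. u (z, b)) \<in> borel_measurable (BM m)"
      using z by (intro measurable_compose[OF measurable_Pair1' u[unfolded SBM_def]]) simp
    have "(\<integral>\<^sup>+b. u (z, b) \<partial>\<kappa> n z) = (\<integral>\<^sup>+l. u (z, f l z) \<partial>point_measure {..<N} (p n z))"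
      unfolding \<kappa>_def using D u' by (simp add: nn_integral_distr[OF f_meas[OF z]])
    then show ?thesis
      by (simp add: nn_integral_point_measure_finite)
  qed
  have pair: "(\<integral>\<^sup>+\<omega>. u (\<omega> n) \<partial>law m \<pi> (Some x)) = (\<Sum>l<N. a l n * u (Some (y l n), f l (Some (y l n))))"
    if state: "\<And>v. v \<in> borel_measurable (SM m) \<Longrightarrow> v None = 0 \<Longrightarrow>
        (\<integral>\<^sup>+\<omega>. v (fst (\<omega> n)) \<partial>law m \<pi> (Some x)) = (\<Sum>l<N. a l n * v (Some (y l n)))"
      and u: "u \<in> borel_measurable (SBM m)" "\<And>b. u (None, b) = 0" for u n
  proof -
    define U where "U z = (\<integral>\<^sup>+b. u (z, b) \<partial>\<kappa> n z)" for z
    have "(\<lambda>(z, b). u (z, b)) \<in> borel_measurable (SM m \<Otimes>\<^sub>M BM m)"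
      using u(1) by (simp add: SBM_def)
    from nn_integral_measurable_subprob_algebra2[OF this measurable_prob_algebraD[OF \<kappa>_meas]]
    have U_meas: "U \<in> borel_measurable (SM m)"
      by (simp add: U_def[abs_def])
    have U_None: "U None = 0"
      by (simp add: U_def u(2))
    have "(\<integral>\<^sup>+\<omega>. u (\<omega> n) \<partial>law m \<pi> (Some x)) = (\<integral>\<^sup>+\<omega>. U (fst (\<omega> n)) \<partial>law m \<pi> (Some x))"
      unfolding U_def by (rule nn_integral_law_Markov[OF model \<pi> xD \<kappa>_meas _ u(1)]) (simp add: \<pi>_def)
    also have "\<dots> = (\<Sum>l<N. a l n * U (Some (y l n)))"
      by (rule state[OF U_meas U_None])
    also have "\<dots> = (\<Sum>l<N. \<Sum>k<N. a l n * (p n (Some (y l n)) k * u (Some (y k n), f k (Some (y k n)))))"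
    proof (intro sum.cong refl)
      fix l assume l: "l \<in> {..<N}"
      show "a l n * U (Some (y l n)) = (\<Sum>k<N. a l n * (p n (Some (y l n)) k * u (Some (y k n), f k (Some (y k n)))))"
      proof (cases "a l n = 0")
        case False
        have "a l n \<le> D n (Some (y l n))"
        proof -
          have "(if Some (y l n) = Some (y l n) then a l n else 0) \<le> D n (Some (y l n))"
            unfolding D_def using l by (intro member_le_sum[where f = "\<lambda>k. if Some (y l n) = Some (y k n) then a k n else 0"]) auto
          then show ?thesis by simp
        qed
        with False have "D n (Some (y l n)) \<noteq> 0"
          by auto
        from \<kappa>_int[OF u(1) _ this] y l
        have "U (Some (y l n)) = (\<Sum>k<N. p n (Some (y l n)) k * u (Some (y l n), f k (Some (y l n))))"
          by (simp add: U_def)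
        also have "\<dots> = (\<Sum>k<N. p n (Some (y l n)) k * u (Some (y k n), f k (Some (y k n))))"
          by (intro sum.cong refl) (simp add: p_def)
        finally show ?thesis
          by (simp add: sum_distrib_left)
      qed simp
    qed
    also have "\<dots> = (\<Sum>k<N. \<Sum>l<N. a l n * (p n (Some (y l n)) k * u (Some (y k n), f k (Some (y k n)))))"
      by (rule sum.swap)
    also have "\<dots> = (\<Sum>k<N. a k n * u (Some (y k n), f k (Some (y k n))))"
    proof (intro sum.cong refl)
      fix k assume k: "k \<in> {..<N}"
      let ?uk = "u (Some (y k n), f k (Some (y k n)))" and ?D = "D n (Some (y k n))"
      show "(\<Sum>l<N. a l n * (p n (Some (y l n)) k * ?uk)) = a k n * ?uk"
      proof (cases "a k n = 0")
        case True
        then show ?thesis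
          by (simp add: p_def)
      next
        case False
        have "(if Some (y k n) = Some (y k n) then a k n else 0) \<le> ?D"
          unfolding D_def using k by (intro member_le_sum[where f = "\<lambda>l. if Some (y k n) = Some (y l n) then a l n else 0"]) auto
        with False have D: "?D \<noteq> 0" "?D \<noteq> top"
          using D_fin[of n "Some (y k n)"] by auto
        have "(\<Sum>l<N. a l n * (p n (Some (y l n)) k * ?uk)) =
            (\<Sum>l<N. (if Some (y k n) = Some (y l n) then a l n else 0) * (a k n / ?D * ?uk))"
          by (intro sum.cong refl) (auto simp: p_def)
        also have "\<dots> = ?D * (a k n / ?D * ?uk)"
          unfolding D_def by (rule sum_distrib_right[symmetric])
        also have "\<dots> = (?D / ?D) * (a k n * ?uk)"
          by (simp add: divide_ennreal_def ac_simps)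
        also have "\<dots> = a k n * ?uk"
          using D by (simp add: ennreal_divide_self less_top)
        finally show ?thesis .
      qed
    qed
    finally show ?thesis .
  qed
  have state: "v \<in> borel_measurable (SM m) \<Longrightarrow> v None = 0 \<Longrightarrow>
      (\<integral>\<^sup>+\<omega>. v (fst (\<omega> n)) \<partial>law m \<pi> (Some x)) = (\<Sum>l<N. a l n * v (Some (y l n)))" for n v
  proof (induction n arbitrary: v)
    case 0
    have "(\<Sum>l<N. a l 0 * v (Some (y l 0))) = (\<Sum>l<N. ennreal (\<gamma> l)) * v (Some x)"
      by (simp add: a_def y_def sum_distrib_right)
    also have "(\<Sum>l<N. ennreal (\<gamma> l)) = ennreal (\<Sum>l<N. \<gamma> l)"
      by (rule sum_ennreal) (simp add: \<gamma>(1))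
    finally have "(\<Sum>l<N. a l 0 * v (Some (y l 0))) = v (Some x)"
      by (simp add: \<gamma>(2))
    then show ?case
      using nn_integral_law_initial[OF model \<pi> xD 0(1)] by simp
  next
    case (Suc n)
    let ?u = "\<lambda>z. \<integral>\<^sup>+y. v y \<partial>Qtr m z"
    have u_None: "?u (None, b) = 0" for b
      using nn_integral_Qtr_None[OF Suc(2)] Suc(3) by simp
    have "(\<integral>\<^sup>+\<omega>. v (fst (\<omega> (Suc n))) \<partial>law m \<pi> (Some x)) = (\<integral>\<^sup>+\<omega>. ?u (\<omega> n) \<partial>law m \<pi> (Some x))"
      by (rule nn_integral_law_Suc[OF model \<pi> xD Suc(2)])
    also have "\<dots> = (\<Sum>l<N. a l n * ?u (Some (y l n), f l (Some (y l n))))"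
      by (rule pair[OF Suc.IH nn_integral_Qtr_measurable[OF Suc(2)] u_None])
    also have "\<dots> = (\<Sum>l<N. a l (Suc n) * v (Some (y l (Suc n))))"
    proof (intro sum.cong refl)
      fix l assume "l \<in> {..<N}"
      then have l: "y l n \<in> states m" "f l (Some (y l n)) \<in> BA m"
        using y f_BA by auto
      have "a l (Suc n) = a l n * survival m (f l (Some (y l n)))"
        by (simp add: a_def closed_loop_def y_def mult.assoc)
      then show "a l n * ?u (Some (y l n), f l (Some (y l n))) = a l (Suc n) * v (Some (y l (Suc n)))"
        using nn_integral_Qtr[OF l Suc(2)] Suc(3) by (simp add: y_def mult.assoc)
    qed
    finally show ?case .
  qed
  show ?thesis
  proof (intro bexI[of _ \<pi>] conjI allI ballI impI \<pi>)
    show "\<pi> n (\<omega>, None) = return (BM m) (f 0 None)" for n \<omega>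
      by (simp add: \<pi>_def \<kappa>_def D_None)
    fix n and u :: "'x option \<times> (ennreal \<times> 'a) \<Rightarrow> ennreal"
    assume u: "u \<in> borel_measurable (SBM m)" "\<forall>b. u (None, b) = 0"
    then have u_None: "u (None, b) = 0" for b
      by blast
    have "(\<integral>\<^sup>+\<omega>. u (\<omega> n) \<partial>law m \<pi> (Some x)) = (\<Sum>l<N. a l n * u (Some (y l n), f l (Some (y l n))))"
      by (rule pair[OF state u(1) u_None])
    also have "\<dots> = (\<Sum>l<N. ennreal (\<gamma> l) * (\<integral>\<^sup>+\<omega>. u (\<omega> n) \<partial>law m (stat m (f l)) (Some x)))"
      by (intro sum.cong refl) (simp add: law_stationary[OF f x u(1) u_None] a_def y_def mult.assoc)
    finally show "(\<integral>\<^sup>+\<omega>. u (\<omega> n) \<partial>law m \<pi> (Some x)) = (\<Sum>l<N. ennreal (\<gamma> l) * (\<integral>\<^sup>+\<omega>. u (\<omega> n) \<partial>law m (stat m (f l)) (Some x)))" .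
  qed
qed

end

section \<open>The dual functional\<close>

lemma sum_shift_index:
  fixes h :: "nat \<Rightarrow> 'c :: comm_monoid_add"
  shows "(\<Sum>l=1..N. h (l - 1)) = (\<Sum>l<N. h l)"
  by (simp add: sum.atLeast1_atMost_eq)

text \<open>Atoms of weight \<open>0\<close> are replaced by copies of an atom \<open>p\<close> of positive weight, whose weight is shared
equally among the copies.\<close>

lemma positive_coefficients:
  fixes \<gamma> :: "nat \<Rightarrow> real"
  assumes \<gamma>: "\<And>l. l < N \<Longrightarrow> 0 \<le> \<gamma> l" "(\<Sum>l<N. \<gamma> l) = 1"
  obtains \<gamma>' \<sigma> where "\<And>l. l < N \<Longrightarrow> 0 < \<gamma>' l" "\<And>l. l < N \<Longrightarrow> \<sigma> l < N \<and> 0 < \<gamma> (\<sigma> l)"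
    "\<And>h :: nat \<Rightarrow> real. (\<Sum>l<N. \<gamma>' l * h (\<sigma> l)) = (\<Sum>l<N. \<gamma> l * h l)"
proof -
  define P where "P = {l. l < N \<and> 0 < \<gamma> l}"
  have "P \<noteq> {}"
  proof
    assume "P = {}"
    have "(\<Sum>l<N. \<gamma> l) \<le> 0"
    proof (intro sum_nonpos)
      fix l assume "l \<in> {..<N}"
      with \<open>P = {}\<close> have "\<not> 0 < \<gamma> l"
        by (auto simp: P_def)
      then show "\<gamma> l \<le> 0" by simp
    qed
    with \<gamma>(2) show False by simp
  qed
  then obtain p where p: "p < N" "0 < \<gamma> p"
    by (auto simp: P_def)
  define Z where "Z = insert p ({..<N} - P)"
  have Z: "finite Z" "p \<in> Z" "Z \<subseteq> {..<N}"
    using p by (auto simp: Z_def)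
  then have "0 < card Z"
    by (auto simp: card_gt_0_iff)
  define \<sigma> where "\<sigma> l = (if l \<in> Z then p else l)" for l
  define \<gamma>' where "\<gamma>' l = (if l \<in> Z then \<gamma> p / card Z else \<gamma> l)" for l
  show ?thesis
  proof
    show "0 < \<gamma>' l" if "l < N" for l
      using that p \<open>0 < card Z\<close> by (auto simp: \<gamma>'_def Z_def P_def)
    show "\<sigma> l < N \<and> 0 < \<gamma> (\<sigma> l)" if "l < N" for l
      using that p by (auto simp: \<sigma>_def Z_def P_def)
    show "(\<Sum>l<N. \<gamma>' l * h (\<sigma> l)) = (\<Sum>l<N. \<gamma> l * h l)" for h :: "nat \<Rightarrow> real"
    proof -
      have "(\<Sum>l<N. \<gamma>' l * h (\<sigma> l)) = (\<Sum>l\<in>{..<N} - Z. \<gamma>' l * h (\<sigma> l)) + (\<Sum>l\<in>Z. \<gamma>' l * h (\<sigma> l))"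
        using Z by (intro sum.subset_diff) auto
      also have "(\<Sum>l\<in>Z. \<gamma>' l * h (\<sigma> l)) = (\<Sum>l\<in>Z. \<gamma> p / card Z * h p)"
        by (intro sum.cong) (auto simp: \<gamma>'_def \<sigma>_def)
      also have "\<dots> = \<gamma> p * h p"
        using \<open>0 < card Z\<close> by simp
      also have "(\<Sum>l\<in>{..<N} - Z. \<gamma>' l * h (\<sigma> l)) = (\<Sum>l\<in>{..<N} - Z. \<gamma> l * h l)"
        by (intro sum.cong) (auto simp: \<gamma>'_def \<sigma>_def)
      also have "\<gamma> p * h p = (\<Sum>l\<in>Z. \<gamma> l * h l)"
      proof -
        have "(\<Sum>l\<in>Z. \<gamma> l * h l) = \<gamma> p * h p + (\<Sum>l\<in>Z - {p}. \<gamma> l * h l)"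
          using Z by (intro sum.remove) auto
        moreover have "(\<Sum>l\<in>Z - {p}. \<gamma> l * h l) = 0"
        proof (intro sum.neutral ballI)
          fix l assume "l \<in> Z - {p}"
          then have "l < N" "\<not> 0 < \<gamma> l"
            by (auto simp: Z_def P_def)
          then show "\<gamma> l * h l = 0"
            using \<gamma>(1)[of l] by simp
        qed
        ultimately show ?thesis by simp
      qed
      also have "(\<Sum>l\<in>{..<N} - Z. \<gamma> l * h l) + (\<Sum>l\<in>Z. \<gamma> l * h l) = (\<Sum>l<N. \<gamma> l * h l)"
        using Z by (intro sum.subset_diff[symmetric]) auto
      finally show ?thesis .
    qed
  qed
qed

context full_impulse_model
begin

lemma DD_cost_finite:
  assumes "\<mu> \<in> DD m x" "j \<le> ncons m"
  shows "(\<integral>\<^sup>+z. Cbar m j z \<partial>\<mu>) < \<infinity>"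
proof (rule cost_finite_if_finite[OF _ DD_finite[OF assms(1)]])
  show "sets \<mu> = sets (VBM m)"
    using assms(1) by (simp add: in_DD_iff)
qed (rule Cbar_le[OF assms(2)])

lemma L1_eq:
  assumes \<mu>: "\<mu> \<in> DD m x" and g: "g \<in> nonneg_orthant m"
  shows "L1 m \<mu> g = ereal (enn2real (\<integral>\<^sup>+z. weighted_cost m g z \<partial>\<mu>) - (\<Sum>j=1..ncons m. g j * bound m j))"
    and "(\<integral>\<^sup>+z. weighted_cost m g z \<partial>\<mu>) < \<infinity>"
proof -
  define c where "c j = enn2real (\<integral>\<^sup>+z. Cbar m j z \<partial>\<mu>)" for j
  have c: "(\<integral>\<^sup>+z. Cbar m j z \<partial>\<mu>) = ennreal (c j)" "0 \<le> c j" if "j \<le> ncons m" for j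
    using DD_cost_finite[OF \<mu> that] by (auto simp: c_def)
  have "(\<integral>\<^sup>+z. weighted_cost m g z \<partial>\<mu>) = ennreal (c 0) + (\<Sum>j=1..ncons m. ennreal (g j * c j))"
  proof -
    have "(\<integral>\<^sup>+z. weighted_cost m g z \<partial>\<mu>) =
        (\<integral>\<^sup>+z. Cbar m 0 z \<partial>\<mu>) + (\<Sum>j=1..ncons m. ennreal (g j) * (\<integral>\<^sup>+z. Cbar m j z \<partial>\<mu>))"
      using \<mu> by (intro nn_integral_weighted_cost) (simp add: in_DD_iff)
    also have "(\<Sum>j=1..ncons m. ennreal (g j) * (\<integral>\<^sup>+z. Cbar m j z \<partial>\<mu>)) = (\<Sum>j=1..ncons m. ennreal (g j * c j))"
      using g by (intro sum.cong refl) (auto simp: c nonneg_orthant_def ennreal_mult)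
    finally show ?thesis
      by (simp add: c)
  qed
  also have "(\<Sum>j=1..ncons m. ennreal (g j * c j)) = ennreal (\<Sum>j=1..ncons m. g j * c j)"
    using g c by (intro sum_ennreal) (auto simp: nonneg_orthant_def)
  also have "ennreal (c 0) + ennreal (\<Sum>j=1..ncons m. g j * c j) = ennreal (c 0 + (\<Sum>j=1..ncons m. g j * c j))"
    using g c by (intro ennreal_plus[symmetric] sum_nonneg) (auto simp: nonneg_orthant_def)
  finally have w: "(\<integral>\<^sup>+z. weighted_cost m g z \<partial>\<mu>) = ennreal (c 0 + (\<Sum>j=1..ncons m. g j * c j))" .
  then show "(\<integral>\<^sup>+z. weighted_cost m g z \<partial>\<mu>) < \<infinity>"
    by simp
  have "0 \<le> c 0 + (\<Sum>j=1..ncons m. g j * c j)"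
    using g c by (intro add_nonneg_nonneg sum_nonneg mult_nonneg_nonneg) (auto simp: nonneg_orthant_def)
  then have w_real: "enn2real (\<integral>\<^sup>+z. weighted_cost m g z \<partial>\<mu>) = c 0 + (\<Sum>j=1..ncons m. g j * c j)"
    unfolding w by simp
  have "L1 m \<mu> g = ereal (c 0) + (\<Sum>j=1..ncons m. ereal (g j * (c j - bound m j)))"
    unfolding L1_def using c by (intro arg_cong2[where f = "(+)"] sum.cong) (auto simp: enn2ereal_ennreal)
  also have "\<dots> = ereal (c 0 + (\<Sum>j=1..ncons m. g j * (c j - bound m j)))"
    by simp
  also have "c 0 + (\<Sum>j=1..ncons m. g j * (c j - bound m j)) = enn2real (\<integral>\<^sup>+z. weighted_cost m g z \<partial>\<mu>) - (\<Sum>j=1..ncons m. g j * bound m j)"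
    unfolding w_real by (simp add: algebra_simps sum_subtractf)
  finally show "L1 m \<mu> g = ereal (enn2real (\<integral>\<^sup>+z. weighted_cost m g z \<partial>\<mu>) - (\<Sum>j=1..ncons m. g j * bound m j))" .
qed

text \<open>The lower bound for balanced measures is attained by the occupation measure of a conserving
stationary strategy.\<close>

lemma hdual_eq:
  assumes g: "g \<in> nonneg_orthant m" and x: "x \<in> states m"
  shows "hdual m (Some x) g = ereal (enn2real (plan_value m (weighted_cost m g) x) - (\<Sum>j=1..ncons m. g j * bound m j))"
  unfolding hdual_def
proof (rule antisym)
  have xD: "Some x \<in> XD m"
    using x by simp
  show "ereal (enn2real (plan_value m (weighted_cost m g) x) - (\<Sum>j=1..ncons m. g j * bound m j)) \<le> (INF \<mu>\<in>DD m (Some x). L1 m \<mu> g)"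
  proof (rule INF_greatest)
    fix \<mu> assume \<mu>: "\<mu> \<in> DD m (Some x)"
    obtain B where B: "\<And>x b. x \<in> states m \<Longrightarrow> b \<in> BA m \<Longrightarrow> weighted_cost m g (Some x, b) \<le> ennreal B"
      using weighted_cost_bounded[of g] by blast
    have "plan_value m (weighted_cost m g) x \<le> (\<integral>\<^sup>+z. weighted_cost m g z \<partial>\<mu>)"
      by (rule plan_value_le_integral[OF \<mu> x weighted_cost_seq_lsc B])
    then have "enn2real (plan_value m (weighted_cost m g) x) \<le> enn2real (\<integral>\<^sup>+z. weighted_cost m g z \<partial>\<mu>)"
      using L1_eq(2)[OF \<mu> g] by (intro enn2real_mono) auto
    then show "ereal (enn2real (plan_value m (weighted_cost m g) x) - (\<Sum>j=1..ncons m. g j * bound m j)) \<le> L1 m \<mu> g"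
      unfolding L1_eq(1)[OF \<mu> g] by simp
  qed
  obtain b0 where "b0 \<in> BA m"
    using BA_nonempty by blast
  from optimal_stationary[OF this, of g] obtain f where f: "f \<in> det_stationary m"
    "\<And>y. y \<in> states m \<Longrightarrow> action_value m (weighted_cost m g) y (f (Some y)) = plan_value m (weighted_cost m g) y"
    by blast
  note \<pi> = stat_in_strategies[OF f(1)]
  have cost: "plan_cost m (weighted_cost m g) x (closed_loop m f x) = plan_value m (weighted_cost m g) x"
    by (rule conserving_optimal[OF f(1) x f(2)])
  have "val m (Some x) (stat m f) (Cbar m 0) < \<infinity>"
    unfolding val_stationary[OF f(1) x Cbar_measurable[of 0] Cbar_None, simplified]
    by (rule costs_finite_if_weighted_finite[OF x closed_loop_in_plans[OF f(1) x], of g])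
       (simp_all add: cost plan_value_weighted_finite[OF x, unfolded infinity_ennreal_def])
  from occV_in_DD[OF \<pi> xD this] have \<mu>: "occV m (Some x) (stat m f) \<in> DD m (Some x)" .
  have "(\<integral>\<^sup>+z. weighted_cost m g z \<partial>occV m (Some x) (stat m f)) = val m (Some x) (stat m f) (weighted_cost m g)"
    by (rule val_eq_occV[OF \<pi> xD weighted_cost_measurable weighted_cost_None, symmetric])
  also have "\<dots> = plan_value m (weighted_cost m g) x"
    unfolding val_stationary[OF f(1) x weighted_cost_measurable weighted_cost_None] by (rule cost)
  finally show "(INF \<mu>\<in>DD m (Some x). L1 m \<mu> g) \<le> ereal (enn2real (plan_value m (weighted_cost m g) x) - (\<Sum>j=1..ncons m. g j * bound m j))"
    using L1_eq(1)[OF \<mu> g] by (intro INF_lower2[OF \<mu>]) simp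
qed

section \<open>Optimal mixtures of stationary strategies\<close>

lemma dual_value_le_cost:
  fixes I :: "nat \<Rightarrow> ennreal"
  assumes w: "ennreal w \<le> I 0 + (\<Sum>j=1..ncons m. ennreal (g j) * I j)"
    and g: "g \<in> nonneg_orthant m" and bound: "\<And>j. j \<in> {1..ncons m} \<Longrightarrow> I j \<le> ennreal (bound m j)"
  shows "ennreal (w - (\<Sum>j=1..ncons m. g j * bound m j)) \<le> I 0"
proof -
  have nonneg: "0 \<le> g j" "0 \<le> bound m j" if "j \<in> {1..ncons m}" for j
    using g model that by (auto simp: nonneg_orthant_def impulse_control_model_def)
  have "(\<Sum>j=1..ncons m. ennreal (g j) * I j) \<le> (\<Sum>j=1..ncons m. ennreal (g j * bound m j))"
  proof (rule sum_mono)
    fix j assume j: "j \<in> {1..ncons m}"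
    have "ennreal (g j) * I j \<le> ennreal (g j) * ennreal (bound m j)"
      by (intro mult_left_mono bound j) simp
    then show "ennreal (g j) * I j \<le> ennreal (g j * bound m j)"
      using nonneg[OF j] by (simp add: ennreal_mult)
  qed
  also have "\<dots> = ennreal (\<Sum>j=1..ncons m. g j * bound m j)"
    using nonneg by (intro sum_ennreal) simp
  finally have "ennreal w \<le> I 0 + ennreal (\<Sum>j=1..ncons m. g j * bound m j)"
    using w by (meson add_left_mono order_trans)
  moreover have "0 \<le> (\<Sum>j=1..ncons m. g j * bound m j)"
    using nonneg by (intro sum_nonneg) simp
  ultimately show ?thesis
    by (simp add: ennreal_minus[symmetric] ennreal_minus_le_iff add.commute)
qed

text \<open>Weak duality for the relaxed problem; if the cost is infinite there is nothing to prove, and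
otherwise the measure belongs to the domain of the dual functional.\<close>

lemma cost_ge_dual_value:
  assumes sets: "sets \<nu> = sets (VBM m)" and bal: "balance m (Some x) \<nu>" and x: "x \<in> states m"
    and g: "g \<in> nonneg_orthant m"
    and bound: "\<And>j. j \<in> {1..ncons m} \<Longrightarrow> (\<integral>\<^sup>+z. Cbar m j z \<partial>\<nu>) \<le> ennreal (bound m j)"
  shows "ennreal (enn2real (plan_value m (weighted_cost m g) x) - (\<Sum>j=1..ncons m. g j * bound m j)) \<le> (\<integral>\<^sup>+z. Cbar m 0 z \<partial>\<nu>)"
proof (cases "(\<integral>\<^sup>+z. Cbar m 0 z \<partial>\<nu>) < \<infinity>")
  case True
  then have \<nu>: "\<nu> \<in> DD m (Some x)"
    using sets bal by (simp add: in_DD_iff)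
  obtain B where B: "\<And>x b. x \<in> states m \<Longrightarrow> b \<in> BA m \<Longrightarrow> weighted_cost m g (Some x, b) \<le> ennreal B"
    using weighted_cost_bounded[of g] by blast
  have "plan_value m (weighted_cost m g) x \<le> (\<integral>\<^sup>+z. weighted_cost m g z \<partial>\<nu>)"
    by (rule plan_value_le_integral[OF \<nu> x weighted_cost_seq_lsc B])
  then have "ennreal (enn2real (plan_value m (weighted_cost m g) x)) \<le> (\<integral>\<^sup>+z. weighted_cost m g z \<partial>\<nu>)"
    using plan_value_weighted_finite[OF x] by simp
  then show ?thesis
    unfolding nn_integral_weighted_cost[OF sets] by (rule dual_value_le_cost[OF _ g bound])
next
  case False
  then have "(\<integral>\<^sup>+z. Cbar m 0 z \<partial>\<nu>) = top"
    by (simp add: less_top[symmetric])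
  then show ?thesis by simp
qed

lemma exists_optimal_plan:
  assumes x: "x \<in> states m" and g: "g \<in> nonneg_orthant m"
  shows "\<exists>\<beta>\<in>plans m. (\<forall>j\<le>ncons m. plan_cost m (Cbar m j) x \<beta> < \<infinity>) \<and>
    enn2real (plan_cost m (Cbar m 0) x \<beta>) + (\<Sum>j=1..ncons m. g j * enn2real (plan_cost m (Cbar m j) x \<beta>)) =
      enn2real (plan_value m (weighted_cost m g) x)"
proof -
  obtain \<beta> where \<beta>: "\<beta> \<in> plans m" "plan_cost m (weighted_cost m g) x \<beta> = plan_value m (weighted_cost m g) x"
    using plan_value_attained[OF weighted_cost_seq_lsc x] by blast
  have fin: "plan_cost m (Cbar m j) x \<beta> < \<infinity>" if "j \<le> ncons m" for j
    by (rule costs_finite_if_weighted_finite[where g = g, OF x \<beta>(1) _ that])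
       (use \<beta>(2) plan_value_weighted_finite[OF x] in simp)
  have "0 \<le> enn2real (plan_cost m (Cbar m 0) x \<beta>) + (\<Sum>j=1..ncons m. g j * enn2real (plan_cost m (Cbar m j) x \<beta>))"
    using g by (intro add_nonneg_nonneg sum_nonneg mult_nonneg_nonneg) (auto simp: nonneg_orthant_def)
  moreover have "plan_cost m (weighted_cost m g) x \<beta> =
      ennreal (enn2real (plan_cost m (Cbar m 0) x \<beta>) + (\<Sum>j=1..ncons m. g j * enn2real (plan_cost m (Cbar m j) x \<beta>)))"
    by (rule weighted_cost_real[OF g fin])
  ultimately have "enn2real (plan_cost m (weighted_cost m g) x \<beta>) =
      enn2real (plan_cost m (Cbar m 0) x \<beta>) + (\<Sum>j=1..ncons m. g j * enn2real (plan_cost m (Cbar m j) x \<beta>))"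
    by (simp only: enn2real_ennreal)
  then show ?thesis
    using \<beta> fin by (intro bexI[of _ \<beta>]) auto
qed

lemma weighted_cost_plan_ge:
  assumes x: "x \<in> states m" and g: "g \<in> nonneg_orthant m" and \<beta>: "\<beta> \<in> plans m"
    and fin: "\<forall>j\<le>ncons m. plan_cost m (Cbar m j) x \<beta> < \<infinity>"
  shows "enn2real (plan_value m (weighted_cost m g) x) \<le>
    enn2real (plan_cost m (Cbar m 0) x \<beta>) + (\<Sum>j=1..ncons m. g j * enn2real (plan_cost m (Cbar m j) x \<beta>))"
proof -
  have nonneg: "0 \<le> enn2real (plan_cost m (Cbar m 0) x \<beta>) + (\<Sum>j=1..ncons m. g j * enn2real (plan_cost m (Cbar m j) x \<beta>))"
    using g by (intro add_nonneg_nonneg sum_nonneg mult_nonneg_nonneg) (auto simp: nonneg_orthant_def)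
  have eq: "plan_cost m (weighted_cost m g) x \<beta> =
      ennreal (enn2real (plan_cost m (Cbar m 0) x \<beta>) + (\<Sum>j=1..ncons m. g j * enn2real (plan_cost m (Cbar m j) x \<beta>)))"
    by (rule weighted_cost_real[OF g]) (use fin in blast)
  have "plan_value m (weighted_cost m g) x \<le> plan_cost m (weighted_cost m g) x \<beta>"
    by (rule plan_value_le[OF \<beta>])
  then have "enn2real (plan_value m (weighted_cost m g) x) \<le> enn2real (plan_cost m (weighted_cost m g) x \<beta>)"
    by (rule enn2real_mono) (simp add: eq)
  also have "\<dots> = enn2real (plan_cost m (Cbar m 0) x \<beta>) + (\<Sum>j=1..ncons m. g j * enn2real (plan_cost m (Cbar m j) x \<beta>))"
    unfolding eq using nonneg by simp
  finally show ?thesis .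
qed

text \<open>For \<open>v 0 > 0\<close> the plan is optimal for the multipliers \<open>v j / v 0\<close>, and the inequality expresses that
their dual value is at most \<open>d 0\<close>. For \<open>v 0 = 0\<close> it is optimal for \<open>g + v\<close>; its weighted cost for \<open>g\<close>
is at least the minimal one, so that a positive product of \<open>v\<close> with the excess costs would make the
dual value at \<open>g + v\<close> larger than at \<open>g\<close>.\<close>

lemma dual_maximizer_imp_no_separation:
  assumes x: "x \<in> states m" and g: "dual_maximizer m (Some x) g"
    and v: "\<And>j. j \<le> ncons m \<Longrightarrow> 0 \<le> v j"
  defines "d \<equiv> \<lambda>j. if j = 0 then enn2real (plan_value m (weighted_cost m g) x) - (\<Sum>j=1..ncons m. g j * bound m j) else bound m j"
  shows "\<exists>\<beta>\<in>plans m. (\<forall>j\<le>ncons m. plan_cost m (Cbar m j) x \<beta> < \<infinity>) \<and>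
    (\<Sum>j\<le>ncons m. v j * enn2real (plan_cost m (Cbar m j) x \<beta>)) \<le> (\<Sum>j\<le>ncons m. v j * d j)"
proof -
  let ?J = "ncons m"
  have g_in: "g \<in> nonneg_orthant m"
    using g by (simp add: dual_maximizer_def)
  have max: "enn2real (plan_value m (weighted_cost m g') x) - (\<Sum>j=1..?J. g' j * bound m j) \<le> d 0"
    if "g' \<in> nonneg_orthant m" for g'
  proof -
    have "hdual m (Some x) g' \<le> hdual m (Some x) g"
      using g that by (simp add: dual_maximizer_def)
    then show ?thesis
      unfolding hdual_eq[OF that x] hdual_eq[OF g_in x] by (simp add: d_def)
  qed
  have split: "(\<Sum>j\<le>?J. h j) = h 0 + (\<Sum>j=1..?J. h j)" for h :: "nat \<Rightarrow> real"
    by (simp add: atMost_atLeast0 sum.atLeast_Suc_atMost)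
  have d_pos: "(\<Sum>j=1..?J. v j * d j) = (\<Sum>j=1..?J. v j * bound m j)"
    by (intro sum.cong) (auto simp: d_def)
  show ?thesis
  proof (cases "v 0 = 0")
    case False
    then have v0: "0 < v 0"
      using v[of 0] by simp
    \<comment> \<open>Normalise the direction to a vector of multipliers.\<close>
    define g' where "g' j = v j / v 0" for j
    have g': "g' \<in> nonneg_orthant m"
      using v v0 by (auto simp: nonneg_orthant_def g'_def)
    obtain \<beta> where \<beta>: "\<beta> \<in> plans m" "\<forall>j\<le>?J. plan_cost m (Cbar m j) x \<beta> < \<infinity>"
      "enn2real (plan_cost m (Cbar m 0) x \<beta>) + (\<Sum>j=1..?J. g' j * enn2real (plan_cost m (Cbar m j) x \<beta>)) =
        enn2real (plan_value m (weighted_cost m g') x)"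
      using exists_optimal_plan[OF x g'] by blast
    have "enn2real (plan_cost m (Cbar m 0) x \<beta>) + (\<Sum>j=1..?J. g' j * enn2real (plan_cost m (Cbar m j) x \<beta>)) \<le>
        d 0 + (\<Sum>j=1..?J. g' j * bound m j)"
      using max[OF g'] \<beta>(3) by simp
    from mult_left_mono[OF this, of "v 0"] v0
    have "(\<Sum>j\<le>?J. v j * enn2real (plan_cost m (Cbar m j) x \<beta>)) \<le> (\<Sum>j\<le>?J. v j * d j)"
      unfolding split d_pos by (simp add: g'_def distrib_left sum_distrib_left)
    with \<beta>(1,2) show ?thesis by blast
  next
    case True
    define g' where "g' j = g j + v j" for j
    have g': "g' \<in> nonneg_orthant m"
      using v g_in by (auto simp: nonneg_orthant_def g'_def)
    obtain \<beta> where \<beta>: "\<beta> \<in> plans m" "\<forall>j\<le>?J. plan_cost m (Cbar m j) x \<beta> < \<infinity>"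
      "enn2real (plan_cost m (Cbar m 0) x \<beta>) + (\<Sum>j=1..?J. g' j * enn2real (plan_cost m (Cbar m j) x \<beta>)) =
        enn2real (plan_value m (weighted_cost m g') x)"
      using exists_optimal_plan[OF x g'] by blast
    have "(\<Sum>j=1..?J. v j * enn2real (plan_cost m (Cbar m j) x \<beta>)) \<le> (\<Sum>j=1..?J. v j * bound m j)"
      using max[OF g'] \<beta>(3) weighted_cost_plan_ge[OF x g_in \<beta>(1,2)]
      by (simp add: g'_def d_def distrib_right sum.distrib)
    then have "(\<Sum>j\<le>?J. v j * enn2real (plan_cost m (Cbar m j) x \<beta>)) \<le> (\<Sum>j\<le>?J. v j * d j)"
      unfolding split d_pos using True by simp
    with \<beta>(1,2) show ?thesis by blast
  qed
qed

text \<open>The bound \<open>d0\<close> is the maximum of the dual functional. It is nonnegative, as it is at least the dual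
value of the multipliers \<open>0\<close>.\<close>

lemma optimal_mixture_of_stationary:
  assumes x: "x \<in> states m" and g: "dual_maximizer m (Some x) g" and b0: "b0 \<in> BA m"
  defines "d0 \<equiv> enn2real (plan_value m (weighted_cost m g) x) - (\<Sum>j=1..ncons m. g j * bound m j)"
  shows "\<exists>f \<gamma>. (\<forall>l<ncons m + 1. f l \<in> det_stationary m \<and> f l None = b0 \<and>
      (\<forall>y\<in>states m. action_value m (weighted_cost m g) y (f l (Some y)) = plan_value m (weighted_cost m g) y) \<and>
      (\<forall>j\<le>ncons m. plan_cost m (Cbar m j) x (closed_loop m (f l) x) < \<infinity>) \<and> 0 < \<gamma> l) \<and>
    (\<Sum>l<ncons m + 1. \<gamma> l) = 1 \<and>
    (\<Sum>l<ncons m + 1. \<gamma> l * enn2real (plan_cost m (Cbar m 0) x (closed_loop m (f l) x))) \<le> d0 \<and>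
    (\<forall>j\<in>{1..ncons m}. (\<Sum>l<ncons m + 1. \<gamma> l * enn2real (plan_cost m (Cbar m j) x (closed_loop m (f l) x))) \<le> bound m j)"
proof -
  let ?J = "ncons m" and ?C = "weighted_cost m g"
  let ?c = "\<lambda>j. plan_cost m (Cbar m j) x"
  define d where "d j = (if j = 0 then d0 else bound m j)" for j
  have g_in: "g \<in> nonneg_orthant m"
    using g by (simp add: dual_maximizer_def)
  have d_nonneg: "0 \<le> d j" if "j \<le> ?J" for j
  proof (cases "j = 0")
    case True
    have "(\<lambda>_. 0) \<in> nonneg_orthant m"
      by (simp add: nonneg_orthant_def)
    then have "hdual m (Some x) (\<lambda>_. 0) \<le> hdual m (Some x) g"
      using g by (simp add: dual_maximizer_def)
    then have "enn2real (plan_value m (weighted_cost m (\<lambda>_. 0)) x) \<le> d0"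
      unfolding hdual_eq[OF \<open>(\<lambda>_. 0) \<in> nonneg_orthant m\<close> x] hdual_eq[OF g_in x] d0_def by simp
    then show ?thesis
      using True enn2real_nonneg[of "plan_value m (weighted_cost m (\<lambda>_. 0)) x"] by (simp add: d_def del: enn2real_nonneg)
  next
    case False
    then show ?thesis
      using model that by (auto simp: d_def impulse_control_model_def)
  qed
  have w_eq: "d 0 + (\<Sum>j=1..?J. g j * d j) = enn2real (plan_value m ?C x)"
  proof -
    have "(\<Sum>j=1..?J. g j * d j) = (\<Sum>j=1..?J. g j * bound m j)"
      by (intro sum.cong) (auto simp: d_def)
    then show ?thesis
      by (simp add: d_def d0_def)
  qed
  have "\<exists>\<gamma> \<beta>. finite_mixture (?J + 1) (plans m) (\<lambda>\<beta>. \<forall>j\<le>?J. ?c j \<beta> < \<infinity>) \<gamma> \<beta> \<and>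
    (\<forall>j\<le>?J. (\<Sum>l<?J + 1. \<gamma> l * enn2real (?c j (\<beta> l))) \<le> d j) \<and>
    (\<forall>l<?J + 1. 0 < \<gamma> l \<longrightarrow>
       enn2real (?c 0 (\<beta> l)) + (\<Sum>j=1..?J. g j * enn2real (?c j (\<beta> l))) = d 0 + (\<Sum>j=1..?J. g j * d j) \<and>
       extreme_costs ?J ?c (plans m) (\<beta> l))"
  proof (rule extreme_mixture[OF compact_plans _ d_nonneg])
    show "seq_lsc (plans m) (?c j)" if "j \<le> ?J" for j
      by (rule plan_cost_seq_lsc_in_plan[OF Cbar_seq_lsc[OF that] x])
    show "\<exists>\<beta>\<in>plans m. (\<forall>j\<le>?J. ?c j \<beta> < \<infinity>) \<and> (\<Sum>j\<le>?J. v j * enn2real (?c j \<beta>)) \<le> (\<Sum>j\<le>?J. v j * d j)"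
      if "\<And>j. j \<le> ?J \<Longrightarrow> 0 \<le> v j" for v
      using dual_maximizer_imp_no_separation[OF x g that] unfolding d_def d0_def .
    show "0 \<le> g j" if "j \<in> {1..?J}" for j
      using g_in that by (simp add: nonneg_orthant_def)
    show "d 0 + (\<Sum>j=1..?J. g j * d j) \<le> enn2real (?c 0 \<beta>) + (\<Sum>j=1..?J. g j * enn2real (?c j \<beta>))"
      if "\<beta> \<in> plans m" "\<forall>j\<le>?J. ?c j \<beta> < \<infinity>" for \<beta>
      unfolding w_eq by (rule weighted_cost_plan_ge[OF x g_in that])
  qed
  then obtain \<gamma> \<beta> where mix: "finite_mixture (?J + 1) (plans m) (\<lambda>\<beta>. \<forall>j\<le>?J. ?c j \<beta> < \<infinity>) \<gamma> \<beta>"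
    and feas_all: "\<forall>j\<le>?J. (\<Sum>l<?J + 1. \<gamma> l * enn2real (?c j (\<beta> l))) \<le> d j"
    and atoms: "\<forall>l<?J + 1. 0 < \<gamma> l \<longrightarrow>
       enn2real (?c 0 (\<beta> l)) + (\<Sum>j=1..?J. g j * enn2real (?c j (\<beta> l))) = d 0 + (\<Sum>j=1..?J. g j * d j) \<and>
       extreme_costs ?J ?c (plans m) (\<beta> l)"
    by (elim exE conjE)
  have feas: "(\<Sum>l<?J + 1. \<gamma> l * enn2real (?c j (\<beta> l))) \<le> d j" if "j \<le> ?J" for j
    using feas_all that by simp
  have tight: "enn2real (?c 0 (\<beta> l)) + (\<Sum>j=1..?J. g j * enn2real (?c j (\<beta> l))) = d 0 + (\<Sum>j=1..?J. g j * d j)"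
    and extreme: "extreme_costs ?J ?c (plans m) (\<beta> l)" if "l < ?J + 1" "0 < \<gamma> l" for l
    using atoms that by blast+
  have stationary: "\<exists>f\<in>det_stationary m. f None = b0 \<and>
      (\<forall>y\<in>states m. action_value m ?C y (f (Some y)) = plan_value m ?C y) \<and>
      (\<forall>j\<le>?J. ?c j (closed_loop m f x) = ?c j (\<beta> l))" if l: "l < ?J + 1" "0 < \<gamma> l" for l
  proof (rule stationary_of_extreme_plan[OF x _ b0])
    show "\<beta> l \<in> plans m"
      using mix l by (simp add: finite_mixture_def)
    have fin: "?c j (\<beta> l) < \<infinity>" if "j \<le> ?J" for j
      using mix l that by (simp add: finite_mixture_def)
    have "plan_cost m ?C x (\<beta> l) =
        ennreal (enn2real (?c 0 (\<beta> l)) + (\<Sum>j=1..?J. g j * enn2real (?c j (\<beta> l))))"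
      by (rule weighted_cost_real[OF g_in fin])
    then have "plan_cost m ?C x (\<beta> l) = ennreal (enn2real (plan_value m ?C x))"
      unfolding tight[OF l] w_eq .
    then show "plan_cost m ?C x (\<beta> l) = plan_value m ?C x"
      using plan_value_weighted_finite[OF x] by simp
  qed (rule extreme[OF l])
  have \<gamma>: "0 \<le> \<gamma> l" if "l < ?J + 1" for l
    using mix that by (simp add: finite_mixture_def)
  have \<gamma>_sum: "(\<Sum>l<?J + 1. \<gamma> l) = 1"
    using mix by (simp only: finite_mixture_def)
  from positive_coefficients[OF \<gamma> \<gamma>_sum]
  obtain \<gamma>' \<sigma> where \<gamma>': "\<And>l. l < ?J + 1 \<Longrightarrow> 0 < \<gamma>' l" "\<And>l. l < ?J + 1 \<Longrightarrow> \<sigma> l < ?J + 1 \<and> 0 < \<gamma> (\<sigma> l)"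
    "\<And>h :: nat \<Rightarrow> real. (\<Sum>l<?J + 1. \<gamma>' l * h (\<sigma> l)) = (\<Sum>l<?J + 1. \<gamma> l * h l)"
    by blast
  have "\<forall>l. \<exists>f. l < ?J + 1 \<longrightarrow> f \<in> det_stationary m \<and> f None = b0 \<and>
      (\<forall>y\<in>states m. action_value m ?C y (f (Some y)) = plan_value m ?C y) \<and>
      (\<forall>j\<le>?J. ?c j (closed_loop m f x) = ?c j (\<beta> (\<sigma> l)))"
    using stationary \<gamma>'(2) by blast
  then obtain f where f: "\<And>l. l < ?J + 1 \<Longrightarrow> f l \<in> det_stationary m \<and> f l None = b0 \<and>
      (\<forall>y\<in>states m. action_value m ?C y (f l (Some y)) = plan_value m ?C y) \<and>
      (\<forall>j\<le>?J. ?c j (closed_loop m (f l) x) = ?c j (\<beta> (\<sigma> l)))"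
    by metis
  have avg: "(\<Sum>l<?J + 1. \<gamma>' l * enn2real (?c j (closed_loop m (f l) x))) \<le> d j" if "j \<le> ?J" for j
  proof -
    have "(\<Sum>l<?J + 1. \<gamma>' l * enn2real (?c j (closed_loop m (f l) x))) = (\<Sum>l<?J + 1. \<gamma>' l * enn2real (?c j (\<beta> (\<sigma> l))))"
    proof (intro sum.cong refl)
      fix l assume "l \<in> {..<?J + 1}"
      then show "\<gamma>' l * enn2real (?c j (closed_loop m (f l) x)) = \<gamma>' l * enn2real (?c j (\<beta> (\<sigma> l)))"
        using f[of l] that by simp
    qed
    also have "\<dots> = (\<Sum>l<?J + 1. \<gamma> l * enn2real (?c j (\<beta> l)))"
      by (rule \<gamma>'(3))
    finally show ?thesis
      using feas[OF that] by simp
  qed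
  show ?thesis
  proof (intro exI[of _ f] exI[of _ \<gamma>'] conjI allI impI ballI)
    fix l assume l: "l < ?J + 1"
    show "0 < \<gamma>' l"
      by (rule \<gamma>'(1)[OF l])
    show "f l \<in> det_stationary m" "f l None = b0"
      using f[OF l] by blast+
    show "action_value m ?C y (f l (Some y)) = plan_value m ?C y" if "y \<in> states m" for y
      using f[OF l] that by blast
    show "?c j (closed_loop m (f l) x) < \<infinity>" if "j \<le> ?J" for j
    proof -
      have "?c j (closed_loop m (f l) x) = ?c j (\<beta> (\<sigma> l))"
        using f[OF l] that by blast
      moreover have "?c j (\<beta> (\<sigma> l)) < \<infinity>"
        using mix \<gamma>'(2)[OF l] that by (simp add: finite_mixture_def)
      ultimately show ?thesis by simp
    qed
  next
    show "(\<Sum>l<?J + 1. \<gamma>' l) = 1"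
      using \<gamma>'(3)[of "\<lambda>_. 1"] \<gamma>_sum by simp
    show "(\<Sum>l<?J + 1. \<gamma>' l * enn2real (?c 0 (closed_loop m (f l) x))) \<le> d0"
      using avg[of 0] by (simp add: d_def)
    show "(\<Sum>l<?J + 1. \<gamma>' l * enn2real (?c j (closed_loop m (f l) x))) \<le> bound m j" if "j \<in> {1..?J}" for j
      using avg[of j] that by (simp add: d_def)
  qed
qed

text \<open>The mixture has cost at most the dual value \<open>d0\<close> and satisfies the constraints, whereas by weak
duality no competitor in any of the three problems has a cost below \<open>d0\<close>.\<close>

lemma optimal_mixed_strategy:
  assumes x: "x \<in> states m" and g: "dual_maximizer m (Some x) g" and fs: "fs \<in> det_stationary m"
  shows "\<exists>\<pi> f \<gamma>. \<pi> \<in> PiF m (Some x) fs \<and>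
    (\<forall>l\<in>{1..ncons m + 1}. f l \<in> FF m fs g) \<and>
    mixture_of m (Some x) \<pi> f \<gamma> \<and>
    optimal m (Some x) \<pi> \<and>
    solves_C m (Some x) (occV m (Some x) \<pi>) \<and>
    solves_R m (Some x) (occV m (Some x) \<pi>)"
proof -
  let ?J = "ncons m" and ?N = "ncons m + 1"
  have xD: "Some x \<in> XD m"
    using x by simp
  have g_in: "g \<in> nonneg_orthant m"
    using g by (simp add: dual_maximizer_def)
  have b0: "fs None \<in> BA m"
    by (rule det_stationary_in_BA[OF fs]) simp
  define d0 where "d0 = enn2real (plan_value m (weighted_cost m g) x) - (\<Sum>j=1..?J. g j * bound m j)"
  obtain f \<gamma> where f: "\<And>l. l < ?N \<Longrightarrow> f l \<in> det_stationary m" "\<And>l. l < ?N \<Longrightarrow> f l None = fs None"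
    "\<And>l y. l < ?N \<Longrightarrow> y \<in> states m \<Longrightarrow> action_value m (weighted_cost m g) y (f l (Some y)) = plan_value m (weighted_cost m g) y"
    and fin: "\<And>l j. l < ?N \<Longrightarrow> j \<le> ?J \<Longrightarrow> plan_cost m (Cbar m j) x (closed_loop m (f l) x) < \<infinity>"
    and \<gamma>: "\<And>l. l < ?N \<Longrightarrow> 0 < \<gamma> l" "(\<Sum>l<?N. \<gamma> l) = 1"
    and cost0: "(\<Sum>l<?N. \<gamma> l * enn2real (plan_cost m (Cbar m 0) x (closed_loop m (f l) x))) \<le> d0"
    and costs: "\<And>j. j \<in> {1..?J} \<Longrightarrow> (\<Sum>l<?N. \<gamma> l * enn2real (plan_cost m (Cbar m j) x (closed_loop m (f l) x))) \<le> bound m j"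
    using optimal_mixture_of_stationary[OF x g b0] unfolding d0_def by blast
  have \<gamma>_nonneg: "0 \<le> \<gamma> l" if "l < ?N" for l
    using \<gamma>(1)[OF that] by simp
  have "0 < ?N" by simp
  from exists_mixing_strategy[of ?N f \<gamma>, OF f(1) this \<gamma>_nonneg \<gamma>(2) x]
  obtain \<pi> where \<pi>: "\<pi> \<in> strategies m" and \<pi>_None: "\<And>n \<omega>. \<pi> n (\<omega>, None) = return (BM m) (f 0 None)"
    and mix: "\<And>n u. u \<in> borel_measurable (SBM m) \<Longrightarrow> (\<And>b. u (None, b) = 0) \<Longrightarrow>
      (\<integral>\<^sup>+\<omega>. u (\<omega> n) \<partial>law m \<pi> (Some x)) = (\<Sum>l<?N. ennreal (\<gamma> l) * (\<integral>\<^sup>+\<omega>. u (\<omega> n) \<partial>law m (stat m (f l)) (Some x)))"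
    by blast
  have mix_sum: "(\<Sum>n. \<integral>\<^sup>+\<omega>. u (\<omega> n) \<partial>law m \<pi> (Some x)) =
      (\<Sum>l<?N. ennreal (\<gamma> l) * (\<Sum>n. \<integral>\<^sup>+\<omega>. u (\<omega> n) \<partial>law m (stat m (f l)) (Some x)))"
    if "u \<in> borel_measurable (SBM m)" "\<And>b. u (None, b) = 0" for u
    unfolding mix[OF that] by (subst suminf_sum) (simp_all add: ennreal_suminf_cmult)
  have val_\<pi>: "val m (Some x) \<pi> (Cbar m j) =
      ennreal (\<Sum>l<?N. \<gamma> l * enn2real (plan_cost m (Cbar m j) x (closed_loop m (f l) x)))" if j: "j \<le> ?J" for j
  proof -
    have "val m (Some x) \<pi> (Cbar m j) = (\<Sum>l<?N. ennreal (\<gamma> l) * val m (Some x) (stat m (f l)) (Cbar m j))"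
      unfolding val_eq_sum[OF model \<pi> xD Cbar_measurable[OF j]] mix_sum[OF Cbar_measurable[OF j] Cbar_None]
      by (intro sum.cong refl arg_cong2[where f = "(*)"] val_eq_sum[symmetric, OF model _ xD Cbar_measurable[OF j]]
          stat_in_strategies f(1)) simp
    also have "\<dots> = (\<Sum>l<?N. ennreal (\<gamma> l) * plan_cost m (Cbar m j) x (closed_loop m (f l) x))"
      by (intro sum.cong refl arg_cong2[where f = "(*)"] val_stationary f(1) x Cbar_measurable j Cbar_None) simp
    also have "\<dots> = ennreal (\<Sum>l<?N. \<gamma> l * enn2real (plan_cost m (Cbar m j) x (closed_loop m (f l) x)))"
      by (rule average_eq_real[where c = "plan_cost m (Cbar m j) x" and \<beta> = "\<lambda>l. closed_loop m (f l) x"])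
         (use \<gamma>_nonneg fin j in auto)
    finally show ?thesis .
  qed
  have val0: "val m (Some x) \<pi> (Cbar m 0) \<le> ennreal d0"
    unfolding val_\<pi>[of 0, simplified] using cost0 by (intro ennreal_leI) simp
  have val_j: "val m (Some x) \<pi> (Cbar m j) \<le> ennreal (bound m j)" if "j \<in> {1..?J}" for j
    using costs[OF that] that by (simp add: val_\<pi> ennreal_leI)
  have val0_fin: "val m (Some x) \<pi> (Cbar m 0) < \<infinity>"
    using val0 by (rule le_less_trans) simp
  define \<mu> where "\<mu> = occV m (Some x) \<pi>"
  have \<mu>_D: "\<mu> \<in> DD m (Some x)"
    unfolding \<mu>_def by (rule occV_in_DD[OF \<pi> xD val0_fin])
  have \<mu>_val: "(\<integral>\<^sup>+z. Cbar m j z \<partial>\<mu>) = val m (Some x) \<pi> (Cbar m j)" if "j \<le> ?J" for j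
    unfolding \<mu>_def using that by (intro val_eq_occV[symmetric] \<pi> xD Cbar_measurable Cbar_None)
  have lower: "ennreal d0 \<le> (\<integral>\<^sup>+z. Cbar m 0 z \<partial>\<nu>)"
    if "sets \<nu> = sets (VBM m)" "balance m (Some x) \<nu>" "\<And>j. j \<in> {1..?J} \<Longrightarrow> (\<integral>\<^sup>+z. Cbar m j z \<partial>\<nu>) \<le> ennreal (bound m j)" for \<nu>
    unfolding d0_def by (rule cost_ge_dual_value[OF that(1,2) x g_in that(3)])
  have \<pi>_feasible: "\<pi> \<in> feasible m (Some x)"
    using \<pi> val_j by (simp add: feasible_def)
  have C_iff: "enn2ereal I - ereal r \<le> 0 \<longleftrightarrow> I \<le> ennreal r" if "0 \<le> r" for I r
    using that by (cases I) (auto simp: enn2ereal_ennreal ereal_minus_le_iff top_unique)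
  have bound_nonneg: "0 \<le> bound m j" if "j \<in> {1..?J}" for j
    using model that by (simp add: impulse_control_model_def)
  have \<mu>_C: "\<mu> \<in> feasible_C m (Some x)"
    unfolding feasible_C_def using \<mu>_D val_j bound_nonneg by (simp add: C_iff \<mu>_val)
  have \<mu>_R: "\<mu> \<in> feasible_R m (Some x)"
    unfolding feasible_R_def using \<mu>_D val_j by (simp add: DD_def \<mu>_val)
  show ?thesis
  proof (intro exI[of _ \<pi>] exI[of _ "\<lambda>l. f (l - 1)"] exI[of _ "\<lambda>l. \<gamma> (l - 1)"] conjI)
    show "\<pi> \<in> PiF m (Some x) fs"
      unfolding PiF_def
    proof (intro CollectI conjI allI \<pi>_feasible val0_fin)
      fix n
      show "\<forall>(\<omega>, y)\<in>space (HM m n). y \<notin> VV m \<longrightarrow> \<pi> n (\<omega>, y) = return (BM m) (fs y)"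
        using \<pi>_None f(2)[of 0] by (auto simp: HM_def space_pair_measure V_eq XD_def)
    qed
    show "\<forall>l\<in>{1..?N}. f (l - 1) \<in> FF m fs g"
    proof
      fix l assume "l \<in> {1..?N}"
      then have l: "l - 1 < ?N" by auto
      show "f (l - 1) \<in> FF m fs g"
        using f[OF l] by (simp add: in_FF_iff)
    qed
    show "mixture_of m (Some x) \<pi> (\<lambda>l. f (l - 1)) (\<lambda>l. \<gamma> (l - 1))"
      unfolding mixture_of_def
    proof (intro conjI ballI \<pi>)
      fix l assume "l \<in> {1..?N}"
      then have l: "l - 1 < ?N" by auto
      show "f (l - 1) \<in> det_stationary m" "0 < \<gamma> (l - 1)"
        using f(1)[OF l] \<gamma>(1)[OF l] by auto
      have "\<gamma> (l - 1) \<le> (\<Sum>l<?N. \<gamma> l)"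
        using l \<gamma>_nonneg by (intro member_le_sum) auto
      then show "\<gamma> (l - 1) \<le> 1"
        by (simp only: \<gamma>(2))
    next
      show "(\<Sum>l=1..?N. \<gamma> (l - 1)) = 1"
        unfolding sum_shift_index by (rule \<gamma>(2))
      fix \<Gamma> assume \<Gamma>: "\<Gamma> \<in> sets (VBM m)"
      note \<Gamma>' = sets_VBM_imp[OF \<Gamma>]
      have i: "indicator \<Gamma> \<in> borel_measurable (SBM m)" "indicator \<Gamma> (None, b) = (0 :: ennreal)" for b
        using \<Gamma>' by (auto simp: V_eq indicator_def)
      have "emeasure (occV m (Some x) \<pi>) \<Gamma> = (\<Sum>l<?N. ennreal (\<gamma> l) * emeasure (occV m (Some x) (stat m (f l))) \<Gamma>)"
        unfolding emeasure_occV[OF \<pi> xD \<Gamma>] mix_sum[OF i]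
        by (intro sum.cong refl arg_cong2[where f = "(*)"] emeasure_occV[symmetric] stat_in_strategies f(1) xD \<Gamma>) simp
      also have "\<dots> = (\<Sum>l=1..?N. ennreal (\<gamma> (l - 1)) * emeasure (occV m (Some x) (stat m (f (l - 1)))) \<Gamma>)"
        by (rule sum_shift_index[symmetric])
      finally show "emeasure (occV m (Some x) \<pi>) \<Gamma> =
          (\<Sum>l=1..?N. ennreal (\<gamma> (l - 1)) * emeasure (occV m (Some x) (stat m (f (l - 1)))) \<Gamma>)" .
    qed
    show "optimal m (Some x) \<pi>"
      unfolding optimal_def
    proof (intro conjI \<pi>_feasible antisym INF_greatest INF_lower)
      fix \<sigma> assume \<sigma>: "\<sigma> \<in> feasible m (Some x)"
      then have \<sigma>_strat: "\<sigma> \<in> strategies m"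
        by (simp add: feasible_def)
      have eq: "val m (Some x) \<sigma> (Cbar m j) = (\<integral>\<^sup>+z. Cbar m j z \<partial>occV m (Some x) \<sigma>)" if "j \<le> ?J" for j
        using that by (intro val_eq_occV \<sigma>_strat xD Cbar_measurable Cbar_None)
      have "ennreal d0 \<le> (\<integral>\<^sup>+z. Cbar m 0 z \<partial>occV m (Some x) \<sigma>)"
        using \<sigma> by (intro lower sets_VBM_eq balance_occV \<sigma>_strat xD) (simp add: feasible_def eq[symmetric])
      with val0 show "val m (Some x) \<pi> (Cbar m 0) \<le> val m (Some x) \<sigma> (Cbar m 0)"
        unfolding eq[of 0, simplified] by (rule order_trans)
    qed
    show "solves_C m (Some x) (occV m (Some x) \<pi>)"
      unfolding solves_C_def \<mu>_def[symmetric]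
    proof (intro conjI \<mu>_C antisym INF_greatest INF_lower)
      fix \<nu> assume "\<nu> \<in> feasible_C m (Some x)"
      then have "ennreal d0 \<le> (\<integral>\<^sup>+z. Cbar m 0 z \<partial>\<nu>)"
        using bound_nonneg by (intro lower) (auto simp: feasible_C_def DD_def C_iff)
      with val0 show "(\<integral>\<^sup>+z. Cbar m 0 z \<partial>\<mu>) \<le> (\<integral>\<^sup>+z. Cbar m 0 z \<partial>\<nu>)"
        unfolding \<mu>_val[of 0, simplified] by (rule order_trans)
    qed
    show "solves_R m (Some x) (occV m (Some x) \<pi>)"
      unfolding solves_R_def \<mu>_def[symmetric]
    proof (intro conjI \<mu>_R antisym INF_greatest INF_lower)
      fix \<nu> assume "\<nu> \<in> feasible_R m (Some x)"
      then have "ennreal d0 \<le> (\<integral>\<^sup>+z. Cbar m 0 z \<partial>\<nu>)"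
        by (intro lower) (auto simp: feasible_R_def)
      with val0 show "(\<integral>\<^sup>+z. Cbar m 0 z \<partial>\<mu>) \<le> (\<integral>\<^sup>+z. Cbar m 0 z \<partial>\<nu>)"
        unfolding \<mu>_val[of 0, simplified] by (rule order_trans)
    qed
  qed
qed

end

theorem theorem4:
  fixes m :: "('x :: polish_space, 'a :: polish_space) impulse_model"
    and x0 :: "'x option"
    and fs :: "'x option \<Rightarrow> ennreal \<times> 'a"
    and g :: "nat \<Rightarrow> real"
  assumes model: "impulse_control_model m"
    and x0: "x0 \<in> VV m"
    and semicont: "semicontinuous_mdp m"
    and fs: "uniformly_optimal_total m fs"
    and V_eq: "VV m = Some ` states m"
    and slater: "\<exists>\<mu>\<in>DD m x0. \<forall>j\<in>{1..ncons m}. (\<integral>\<^sup>+z. Cbar m j z \<partial>\<mu>) < ennreal (bound m j)"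
    and cost_lower: "\<exists>\<delta>::real. 0 < \<delta> \<and> (\<forall>x\<in>states m. \<forall>a\<in>acts m. ennreal \<delta> \<le> icost m 0 x a)"
    and cost_upper: "(MAX j\<in>{0..ncons m}. SUP x\<in>states m. gcost m j x) +
      (MAX j\<in>{0..ncons m}. SUP (x, a)\<in>states m \<times> acts m. icost m j x a) < \<infinity>"
    and g: "dual_maximizer m x0 g"
  shows "\<exists>\<pi> f \<gamma>. \<pi> \<in> PiF m x0 fs \<and>
    (\<forall>l\<in>{1..ncons m + 1}. f l \<in> FF m fs g) \<and>
    mixture_of m x0 \<pi> f \<gamma> \<and>
    optimal m x0 \<pi> \<and>
    solves_C m x0 (occV m x0 \<pi>) \<and>
    solves_R m x0 (occV m x0 \<pi>)"
proof -
  obtain \<delta> where \<delta>: "0 < \<delta>" "\<And>x a. x \<in> states m \<Longrightarrow> a \<in> acts m \<Longrightarrow> ennreal \<delta> \<le> icost m 0 x a"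
    using cost_lower by blast
  let ?G = "MAX j\<in>{0..ncons m}. SUP x\<in>states m. gcost m j x"
  let ?I = "MAX j\<in>{0..ncons m}. SUP (x, a)\<in>states m \<times> acts m. icost m j x a"
  define K where "K = enn2real (?G + ?I)"
  have K: "ennreal K = ?G + ?I"
    using cost_upper by (simp add: K_def)
  have gcost_le: "gcost m j x \<le> ennreal K" if "j \<le> ncons m" "x \<in> states m" for j x
  proof -
    have "gcost m j x \<le> (SUP x\<in>states m. gcost m j x)"
      using that(2) by (rule SUP_upper)
    also have "\<dots> \<le> ?G"
      using that(1) by (intro Max_ge) auto
    also have "\<dots> \<le> ?G + ?I"
      by (rule add_increasing2[OF zero_le order_refl])
    finally show ?thesis
      unfolding K .
  qed
  have icost_le: "icost m j x a \<le> ennreal K" if "j \<le> ncons m" "x \<in> states m" "a \<in> acts m" for j x a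
  proof -
    have "icost m j x a \<le> (SUP (x, a)\<in>states m \<times> acts m. icost m j x a)"
      using that(2,3) by (intro SUP_upper2[of "(x, a)"]) auto
    also have "\<dots> \<le> ?I"
      using that(1) by (intro Max_ge) auto
    also have "\<dots> \<le> ?G + ?I"
      by (rule add_increasing[OF zero_le order_refl])
    finally show ?thesis
      unfolding K .
  qed
  interpret full_impulse_model m \<delta> K
    by unfold_locales (use model semicont \<delta> gcost_le icost_le V_eq in \<open>auto simp: K_def\<close>)
  obtain x where x: "x0 = Some x" "x \<in> states m"
    using x0 V_eq by auto
  have "fs \<in> det_stationary m"
    using fs by (simp add: uniformly_optimal_total_def)
  from optimal_mixed_strategy[OF x(2) g[unfolded x(1)] this] show ?thesis
    unfolding x(1) .
qed

end
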